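(* Let $\alpha=1/2$ and let $L$ be a slowly varying function of logarithmic type with exponent $\mathsf b\in(-\infty,1/2)$, that is, $L(x)\sim \mathsf a\,(\log x)^{\mathsf b}$ as $x\to\infty$ for some $\mathsf a>0$. Consider the disordered pinning model with inter-arrival law $K(n)=L(n)/n^{3/2}$ and critical point $h_c(\beta)$. Then $h_c(\beta)>h_c(0)$ for every $\beta>0$, and for every $b>2/(1-2\mathsf b)$ there exists $c>0$ such that, for all $\beta>0$ sufficiently small, $$h_c(\beta)-h_c(0)\;\ge\;\exp\left(-c\,\beta^{-b}\right).$$
   Context: Slowly varying: $L:(0,\infty)\to(0,\infty)$ is measurable with $\lim_{x\to\infty}L(cx)/L(x)=1$ for every $c>0$. Standing assumption (no loss of generality): $L$ is smooth. Renewal process: $\tau=\{\tau_n\}_{n\ge0}$ has law $\mathbf P$ (expectation $\mathbf E$), $\tau_0=0$, and the increments $\tau_{j+1}-\tau_j$ are i.i.d. with values in $\mathbb N=\{1,2,\dots\}$ and law $K(n)=\mathbf P(\tau_1=n)=L(n)/n^{1+\alpha}$, with $\alpha\ge 0$ and $\sum_{n\ge1}K(n)=1$. View $\tau$ as a random subset of $\{0\}\cup\mathbb N$ and put $\delta_n:=\mathbf 1_{\{n\in\tau\}}$. Disorder: $\omega=\{\omega_n\}_{n\ge1}$ is an i.i.d. sequence with law $\mathbb P$ (expectation $\mathbb E$), $\mathbb E[\omega_1]=0$, $\mathrm{var}(\omega_1)=1$, and $M(t):=\mathbb E[\exp(t\omega_1)]<\infty$ for every $t\in\mathbb R$. Model: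 for $\beta\ge0$, $h\in\mathbb R$, $$Z_{N,\omega}:=\mathbf E\Big[\exp\Big(\sum_{n=1}^N(\beta\omega_n+h-\log M(\beta))\delta_n\Big)\delta_N\Big].$$ The free energy is $F(\beta,h):=\lim_{N\to\infty}\frac1N\mathbb E\log Z_{N,\omega}$ (the limit exists, is nonnegative, and is non-decreasing in $h$), and the critical point is $h_c(\beta):=\sup\{h: F(\beta,h)=0\}$. *)

theory Defs
  imports "HOL-Probability.Probability" "HOL-Library.Landau_Symbols"
begin

text \<open>Functions on \<open>(0, \<infinity>)\<close> are total functions on the reals of which only the values at
  positive arguments are constrained.\<close>

definition smooth_on_pos :: "(real \<Rightarrow> real) \<Rightarrow> bool" where
  "smooth_on_pos L \<longleftrightarrow> (\<forall>k::nat. (deriv ^^ k) L differentiable_on {0<..})"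

definition slowly_varying :: "(real \<Rightarrow> real) \<Rightarrow> bool" where
  "slowly_varying L \<longleftrightarrow>
     (\<forall>x>0. L x > 0) \<and>
     L \<in> borel_measurable (restrict_space borel {0<..}) \<and>
     (\<forall>c>0. ((\<lambda>x. L (c * x) / L x) \<longlongrightarrow> 1) at_top)"

definition logarithmic_type :: "(real \<Rightarrow> real) \<Rightarrow> real \<Rightarrow> bool" where
  "logarithmic_type L b \<longleftrightarrow> (\<exists>a>0. L \<sim>[at_top] (\<lambda>x. a * (ln x) powr b))"

definition inter_arrival_law :: "(real \<Rightarrow> real) \<Rightarrow> real \<Rightarrow> nat \<Rightarrow> real" where
  "inter_arrival_law L \<alpha> n = L (real n) / real n powr (1 + \<alpha>)"

locale renewal_process = prob_space P for P :: "'r measure" +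
  fixes \<tau> :: "nat \<Rightarrow> 'r \<Rightarrow> nat" and K :: "nat \<Rightarrow> real"
  assumes start: "\<And>x. x \<in> space P \<Longrightarrow> \<tau> 0 x = 0"
    and increasing: "\<And>j x. x \<in> space P \<Longrightarrow> \<tau> j x < \<tau> (Suc j) x"
    and indep_increments:
      "indep_vars (\<lambda>_. count_space UNIV) (\<lambda>j x. \<tau> (Suc j) x - \<tau> j x) UNIV"
    and increment_law:
      "\<And>j n. n \<ge> 1 \<Longrightarrow> prob {x \<in> space P. \<tau> (Suc j) x - \<tau> j x = n} = K n"
    and law_sums: "(\<lambda>n. K (Suc n)) sums 1"

text \<open>The disorder variables are indexed from 1; \<open>\<omega> 0\<close> is unconstrained and never used.\<close>

locale disorder = prob_space Q for Q :: "'w measure" +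
  fixes \<omega> :: "nat \<Rightarrow> 'w \<Rightarrow> real"
  assumes indep: "indep_vars (\<lambda>_. borel) \<omega> {1..}"
    and identically_distributed: "\<And>n. n \<ge> 1 \<Longrightarrow> distr Q borel (\<omega> n) = distr Q borel (\<omega> 1)"
    and integrable: "integrable Q (\<omega> 1)"
    and mean_zero: "expectation (\<omega> 1) = 0"
    and unit_variance: "variance (\<omega> 1) = 1"
    and exponential_moments: "\<And>t. integrable Q (\<lambda>v. exp (t * \<omega> 1 v))"

definition mgf :: "'w measure \<Rightarrow> (nat \<Rightarrow> 'w \<Rightarrow> real) \<Rightarrow> real \<Rightarrow> real" where
  "mgf Q \<omega> t = (\<integral>v. exp (t * \<omega> 1 v) \<partial>Q)"

definition \<delta> :: "(nat \<Rightarrow> 'r \<Rightarrow> nat) \<Rightarrow> nat \<Rightarrow> 'r \<Rightarrow> real" where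
  "\<delta> \<tau> n x = indicator (range (\<lambda>j. \<tau> j x)) n"

definition partition_function ::
  "'r measure \<Rightarrow> (nat \<Rightarrow> 'r \<Rightarrow> nat) \<Rightarrow> 'w measure \<Rightarrow> (nat \<Rightarrow> 'w \<Rightarrow> real) \<Rightarrow>
    real \<Rightarrow> real \<Rightarrow> nat \<Rightarrow> 'w \<Rightarrow> real" where
  "partition_function P \<tau> Q \<omega> \<beta> h N v =
     (\<integral>x. exp (\<Sum>n=1..N. (\<beta> * \<omega> n v + h - ln (mgf Q \<omega> \<beta>)) * \<delta> \<tau> n x) * \<delta> \<tau> N x \<partial>P)"

definition free_energy ::
  "'r measure \<Rightarrow> (nat \<Rightarrow> 'r \<Rightarrow> nat) \<Rightarrow> 'w measure \<Rightarrow> (nat \<Rightarrow> 'w \<Rightarrow> real) \<Rightarrow>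
    real \<Rightarrow> real \<Rightarrow> real" where
  "free_energy P \<tau> Q \<omega> \<beta> h =
     lim (\<lambda>N. 1 / real N * (\<integral>v. ln (partition_function P \<tau> Q \<omega> \<beta> h N v) \<partial>Q))"

definition critical_point ::
  "'r measure \<Rightarrow> (nat \<Rightarrow> 'r \<Rightarrow> nat) \<Rightarrow> 'w measure \<Rightarrow> (nat \<Rightarrow> 'w \<Rightarrow> real) \<Rightarrow> real \<Rightarrow> real" where
  "critical_point P \<tau> Q \<omega> \<beta> = Sup {h. free_energy P \<tau> Q \<omega> \<beta> h = 0}"

end

(* Since the annealed critical point is 0, it suffices to show F(beta, 1/k) = 0 for a scale k that
   is at most exp(beta^(-b)).  By Jensen, F <= 0 follows once E[Z^(9/10)] grows at most linearly
   in the system size.  The system is cut into blocks of length k, over which h = 1/k costs only a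
   factor e.  In each block the disorder polynomial X, the sum over sets R of q sites of
   star(R) times the product of omega over R, serves as a test: X has mean zero and a controlled
   variance under the disorder law, but under the law tilted along a typical renewal path its mean
   exceeds many standard deviations, provided that mu^(2q) k v(k)^2 D(k)^(q-1) is large, where
   mu ~ beta is the mean of the tilted disorder and D(k) grows at least like (log k)^(1 - 2 \<b>).  On the unlikely
   event that X is large Hoelder's inequality bounds the fractional moment; off it the contribution
   of a block is small.  Summing over the visited blocks gives the fractional moment bound.  Letting
   q be large brings the admissible exponents b down to 2/(1 - 2 \<b>). *)

theory Submission
  imports Defs
begin

subsection \<open>Sums over the finite subsets of an interval\<close>

text \<open>At \<open>\<alpha> = 1/2\<close> the disorder is only marginally relevant: the overlap
  \<open>D k\<close> of two renewals grows like a power of \<open>ln k\<close>, and blocks must be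
  exponentially long in a power of \<open>1/\<beta>\<close>. With \<open>y = ln k\<close> and
  \<open>s = 1 - 2 \<b>\<close> the squared mean of the test over its variance is of order
  \<open>\<beta>^(2q) y^(s q - 1)\<close>; for \<open>y = \<beta>^(-b)\<close> it diverges iff
  \<open>b > 2q / (s q - 1)\<close>, which tends to \<open>2 / s\<close>. This is why one fixed
  \<open>q\<close> is not enough. No local limit theorem enters. The renewal mass is controlled only
  through sums over intervals, and summation by parts against the decreasing \<open>v\<close>
  replaces pointwise bounds. As \<open>v\<close> is \<open>n^(-1/2)\<close> up to logarithms, the
  power bounds with exponents \<open>3/4\<close> and \<open>1/4\<close> hold;
  \<open>2 - 3/4 = 5/4 > 1\<close> keeps jump sums convergent. A path that enters a block near its
  end has no room to be typical, so the test says nothing about it. The last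
  \<open>\<epsilon>\<close>-fraction of each block is therefore \<open>bad\<close>. Such entries are
  rare but carry a larger weight \<open>\<Lambda>\<close>; the parameters make
  \<open>(1, \<Lambda>)\<close> a supersolution of the two-type block transition matrix, and a
  backward induction over blocks closes.\<close>

lemma sum_Pow_insert:
  fixes f :: "'a set \<Rightarrow> 'b::comm_monoid_add"
  assumes "finite S" "a \<notin> S"
  shows "(\<Sum>B\<in>Pow (insert a S). f B) = (\<Sum>B\<in>Pow S. f B + f (insert a B))"
proof -
  have "inj_on (insert a) (Pow S)"
    using assms(2) by (intro inj_onI) (metis PowD in_mono insert_ident)
  moreover have "Pow S \<inter> insert a ` Pow S = {}" using assms by auto
  ultimately show ?thesis
    using assms by (simp add: Pow_insert sum.union_disjoint sum.reindex sum.distrib)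
qed

lemma sum_Pow_Un:
  fixes f :: "'a set \<Rightarrow> 'b::comm_monoid_add"
  assumes "finite T" "finite S" "S \<inter> T = {}"
  shows "(\<Sum>B\<in>Pow (S \<union> T). f B) = (\<Sum>B\<in>Pow S. \<Sum>C\<in>Pow T. f (B \<union> C))"
  using assms
proof (induction T arbitrary: f rule: finite_induct)
  case empty
  then show ?case by simp
next
  case (insert a T)
  have "(\<Sum>B\<in>Pow (S \<union> insert a T). f B) = (\<Sum>B\<in>Pow (S \<union> T). f B + f (insert a B))"
    using insert by (simp add: sum_Pow_insert)
  also have "\<dots> = (\<Sum>B\<in>Pow S. \<Sum>C\<in>Pow T. f (B \<union> C) + f (insert a (B \<union> C)))"
    using insert by (subst insert.IH) auto
  also have "\<dots> = (\<Sum>B\<in>Pow S. \<Sum>C\<in>Pow (insert a T). f (B \<union> C))"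
    using insert by (simp add: sum_Pow_insert)
  finally show ?case .
qed

text \<open>For sets of renewal points this is the decomposition at the last renewal: the inner sum
  runs over the points before it.\<close>

lemma sum_Pow_by_Max:
  fixes f :: "nat set \<Rightarrow> 'b::comm_monoid_add"
  shows "(\<Sum>B\<in>Pow {d<..n}. f B) = f {} + (\<Sum>t\<in>{d<..n}. \<Sum>B\<in>Pow {d<..<t}. f (insert t B))"
proof (induction n)
  case 0
  then show ?case by simp
next
  case (Suc n)
  show ?case
  proof (cases "d \<le> n")
    case True
    then have e: "{d<..Suc n} = insert (Suc n) {d<..n}" "{d<..<Suc n} = {d<..n}" by auto
    have "(\<Sum>B\<in>Pow {d<..Suc n}. f B) =
        (\<Sum>B\<in>Pow {d<..n}. f B) + (\<Sum>B\<in>Pow {d<..<Suc n}. f (insert (Suc n) B))"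
      unfolding e by (simp add: sum_Pow_insert sum.distrib)
    also have "\<dots> = f {} + (\<Sum>t\<in>{d<..Suc n}. \<Sum>B\<in>Pow {d<..<t}. f (insert t B))"
      unfolding Suc e(1) by (simp add: ac_simps)
    finally show ?thesis .
  qed simp
qed

text \<open>The mirror image, a decomposition at the first renewal; it isolates the first contact
  after a block.\<close>

lemma sum_Pow_by_Min:
  fixes f :: "nat set \<Rightarrow> 'b::comm_monoid_add"
  shows "(\<Sum>B\<in>Pow {d<..n}. f B) = f {} + (\<Sum>t\<in>{d<..n}. \<Sum>B\<in>Pow {t<..n}. f (insert t B))"
proof (induction "n - d" arbitrary: d)
  case 0
  then show ?case by simp
next
  case (Suc m)
  then have e: "{d<..n} = insert (Suc d) {Suc d<..n}" by auto
  have "(\<Sum>B\<in>Pow {d<..n}. f B) =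
      (\<Sum>B\<in>Pow {Suc d<..n}. f B) + (\<Sum>B\<in>Pow {Suc d<..n}. f (insert (Suc d) B))"
    unfolding e by (simp add: sum_Pow_insert sum.distrib)
  also have "\<dots> = f {} + (\<Sum>t\<in>{d<..n}. \<Sum>B\<in>Pow {t<..n}. f (insert t B))"
    using Suc by (subst Suc) (auto simp: e ac_simps)
  finally show ?case .
qed

lemma sum_Pow_shift:
  fixes f :: "nat set \<Rightarrow> 'b::comm_monoid_add"
  shows "(\<Sum>B\<in>Pow {s + d<..s + n}. f B) = (\<Sum>B\<in>Pow {d<..n}. f ((+) s ` B))"
proof -
  have "Pow {s + d<..s + n} = (`) ((+) s) ` Pow {d<..n}"
    by (intro image_Pow_surj[symmetric]) simp
  moreover have "inj_on ((`) ((+) s)) (Pow {d<..n})"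
    by (intro inj_on_subset[OF inj_on_image]) auto
  ultimately show ?thesis by (simp add: sum.reindex)
qed

subsection \<open>Weights of renewal paths\<close>

text \<open>The starting point \<open>d\<close> is inserted so that the empty path has last renewal
  \<open>d\<close> and \<open>Max\<close> is never taken over the empty set.\<close>

definition last_pt :: "nat \<Rightarrow> nat set \<Rightarrow> nat" where
  "last_pt d B = Max (insert d B)"

text \<open>A trajectory started at \<open>d\<close> is coded by its finite set of points, not by
  its increments, so the predecessor of \<open>a\<close> is recovered as the last point below
  \<open>a\<close>. In exchange, rewards and tilts become products over sets.\<close>

definition path_weight :: "(nat \<Rightarrow> real) \<Rightarrow> nat \<Rightarrow> nat set \<Rightarrow> real" where
  "path_weight K d B = (\<Prod>a\<in>B. K (a - last_pt d {b\<in>B. b < a}))"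

text \<open>The probability that one jump exceeds \<open>n\<close>, written as the complement of a
  finite sum so that the combinatorial identities below are purely finite.\<close>

definition tail_mass :: "(nat \<Rightarrow> real) \<Rightarrow> nat \<Rightarrow> real" where
  "tail_mass K n = 1 - (\<Sum>i\<in>{1..n}. K i)"

text \<open>The expectation of \<open>f\<close> of the renewal points in \<open>(d, n]\<close> for
  the process started at \<open>d\<close>; the tail factor is the probability that the jump from the
  last point leaves the window.\<close>

definition path_sum :: "(nat \<Rightarrow> real) \<Rightarrow> nat \<Rightarrow> nat \<Rightarrow> (nat set \<Rightarrow> real) \<Rightarrow> real" where
  "path_sum K d n f = (\<Sum>B\<in>Pow {d<..n}. path_weight K d B * tail_mass K (n - last_pt d B) * f B)"

text \<open>The starting point \<open>d\<close> carries no weight.\<close>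

definition chain_sum :: "(nat \<Rightarrow> real) \<Rightarrow> (nat \<Rightarrow> real) \<Rightarrow> nat \<Rightarrow> nat \<Rightarrow> real" where
  "chain_sum K y d n =
     (\<Sum>B\<in>Pow {d<..n}. if last_pt d B = n then path_weight K d B * (\<Prod>a\<in>B. y a) else 0)"

definition renewal_mass :: "(nat \<Rightarrow> real) \<Rightarrow> nat \<Rightarrow> real" where
  "renewal_mass K t = chain_sum K (\<lambda>_. 1) 0 t"

lemma last_pt_empty [simp]: "last_pt d {} = d"
  by (simp add: last_pt_def)

lemma last_pt_insert:
  assumes "finite B" "\<And>b. b \<in> insert d B \<Longrightarrow> b \<le> x"
  shows "last_pt d (insert x B) = x"
  unfolding last_pt_def using assms by (intro Max_eqI) auto

lemma last_pt_in: "finite B \<Longrightarrow> last_pt d B \<in> insert d B"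
  unfolding last_pt_def by (rule Max_in) auto

lemma last_pt_ge: "finite B \<Longrightarrow> b \<in> insert d B \<Longrightarrow> b \<le> last_pt d B"
  unfolding last_pt_def by (rule Max_ge) auto

lemma last_pt_bounds:
  assumes "B \<subseteq> {d<..n}" "d \<le> n"
  shows "d \<le> last_pt d B" "last_pt d B \<le> n"
proof -
  have "finite B" using assms finite_subset by blast
  then show "d \<le> last_pt d B" "last_pt d B \<le> n"
    using last_pt_ge[of B d d] last_pt_in[of B d] assms by auto
qed

lemma last_pt_Un_insert:
  assumes "B1 \<subseteq> {d<..<t}" "finite B2" "d < t"
  shows "last_pt d (B1 \<union> insert t B2) = last_pt t B2"
proof -
  have f: "finite B1" using assms finite_subset by blast
  have "last_pt d (B1 \<union> insert t B2) = Max (insert d B1 \<union> insert t B2)"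
    unfolding last_pt_def by (rule arg_cong[of _ _ Max]) auto
  also have "\<dots> = max (Max (insert d B1)) (Max (insert t B2))"
    using f assms(2) by (intro Max_Un) auto
  finally have "last_pt d (B1 \<union> insert t B2) = max (Max (insert d B1)) (Max (insert t B2))" .
  moreover have "Max (insert d B1) \<le> t" using assms f by (subst Max_le_iff) auto
  moreover have "t \<le> Max (insert t B2)" using assms(2) by (intro Max_ge) auto
  ultimately show ?thesis unfolding last_pt_def by simp
qed

lemma last_pt_shift:
  assumes "finite B" shows "last_pt (s + d) ((+) s ` B) = s + last_pt d B"
  unfolding last_pt_def using assms
  by (subst mono_Max_commute[of "(+) s"]) (auto simp: mono_def)

lemma path_weight_empty [simp]: "path_weight K d {} = 1"
  by (simp add: path_weight_def)

lemma path_weight_insert: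
  assumes "finite B" "\<And>b. b \<in> B \<Longrightarrow> b < x"
  shows "path_weight K d (insert x B) = path_weight K d B * K (x - last_pt d B)"
proof -
  have x: "x \<notin> B" using assms by auto
  have "{b\<in>insert x B. b < x} = B" using assms(2) by auto
  moreover have "{b\<in>insert x B. b < a} = {b\<in>B. b < a}" if "a \<in> B" for a
    using assms(2)[OF that] by auto
  ultimately show ?thesis
    unfolding path_weight_def using assms(1) x by (simp cong: prod.cong)
qed

text \<open>Regeneration at \<open>t\<close>: every point beyond \<open>t\<close> has its
  predecessor in \<open>insert t B2\<close>, so the factors after \<open>t\<close> do not see
  \<open>B1\<close>.\<close>

lemma path_weight_split:
  assumes "finite B2" "B1 \<subseteq> {d<..<t}" "B2 \<subseteq> {t<..}" "d < t"
  shows "path_weight K d (B1 \<union> insert t B2) = path_weight K d (insert t B1) * path_weight K t B2"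
  using assms
proof (induction B2 rule: finite_linorder_max_induct)
  case empty
  then show ?case by simp
next
  case (insert b A)
  have f: "finite B1" using insert.prems finite_subset by blast
  have "path_weight K d (insert b (B1 \<union> insert t A)) =
      path_weight K d (B1 \<union> insert t A) * K (b - last_pt d (B1 \<union> insert t A))"
    by (rule path_weight_insert) (use insert f in \<open>auto simp: subset_eq intro: less_trans\<close>)
  moreover have "path_weight K t (insert b A) = path_weight K t A * K (b - last_pt t A)"
    by (rule path_weight_insert) (use insert in auto)
  moreover have "last_pt d (B1 \<union> insert t A) = last_pt t A"
    by (rule last_pt_Un_insert) (use insert in auto)
  moreover have "B1 \<union> insert t (insert b A) = insert b (B1 \<union> insert t A)" by auto
  ultimately show ?case using insert by simp
qed

lemma path_weight_shift:
  assumes "finite B"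
  shows "path_weight K (s + d) ((+) s ` B) = path_weight K d B"
  using assms
proof (induction B rule: finite_linorder_max_induct)
  case empty
  then show ?case by simp
next
  case (insert b A)
  have "path_weight K (s + d) (insert (s + b) ((+) s ` A)) =
      path_weight K (s + d) ((+) s ` A) * K (s + b - last_pt (s + d) ((+) s ` A))"
    by (rule path_weight_insert) (use insert in auto)
  moreover have "path_weight K d (insert b A) = path_weight K d A * K (b - last_pt d A)"
    by (rule path_weight_insert) (use insert in auto)
  ultimately show ?case using insert by (simp add: last_pt_shift)
qed

lemma path_weight_nonneg:
  assumes "\<And>n. n \<ge> 1 \<Longrightarrow> K n \<ge> 0" "B \<subseteq> {d<..}" "finite B"
  shows "path_weight K d B \<ge> 0"
  unfolding path_weight_def
proof (rule prod_nonneg)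
  fix a assume a: "a \<in> B"
  have "last_pt d {b\<in>B. b < a} < a"
    using last_pt_in[of "{b\<in>B. b < a}" d] a assms by auto
  then show "0 \<le> K (a - last_pt d {b\<in>B. b < a})" by (intro assms(1)) auto
qed

lemma chain_sum_refl [simp]: "chain_sum K y d d = 1"
  by (simp add: chain_sum_def)

lemma chain_sum_alt:
  assumes "d < n"
  shows "chain_sum K y d n =
    (\<Sum>B\<in>Pow {d<..<n}. path_weight K d (insert n B) * (\<Prod>a\<in>insert n B. y a))"
proof -
  have e: "{d<..n} = insert n {d<..<n}" using assms by auto
  have l: "last_pt d B \<noteq> n" "last_pt d (insert n B) = n" if "B \<subseteq> {d<..<n}" for B
  proof -
    have f: "finite B" using that finite_subset by blast
    show "last_pt d B \<noteq> n" using last_pt_in[OF f, of d] that assms by auto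
    show "last_pt d (insert n B) = n"
      by (rule last_pt_insert[OF f]) (use that assms in auto)
  qed
  show ?thesis
    unfolding chain_sum_def e
    by (subst sum_Pow_insert) (auto simp: l intro!: sum.cong)
qed

lemma chain_sum_nonneg:
  assumes "\<And>n. n \<ge> 1 \<Longrightarrow> K n \<ge> 0" "\<And>a. y a \<ge> 0"
  shows "chain_sum K y d n \<ge> 0"
  unfolding chain_sum_def using assms
  by (intro sum_nonneg) (auto intro!: mult_nonneg_nonneg path_weight_nonneg prod_nonneg finite_subset[of _ "{d<..n}"])

lemma chain_sum_shift:
  "chain_sum K y (s + d) (s + n) = chain_sum K (\<lambda>a. y (s + a)) d n"
proof -
  have "chain_sum K y (s + d) (s + n) = (\<Sum>B\<in>Pow {d<..n}.
      if last_pt (s + d) ((+) s ` B) = s + n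
      then path_weight K (s + d) ((+) s ` B) * (\<Prod>a\<in>(+) s ` B. y a) else 0)"
    unfolding chain_sum_def by (rule sum_Pow_shift)
  also have "\<dots> = chain_sum K (\<lambda>a. y (s + a)) d n"
    unfolding chain_sum_def
  proof (rule sum.cong[OF refl])
    fix B assume "B \<in> Pow {d<..n}"
    then have f: "finite B" using finite_subset by blast
    have "(\<Prod>a\<in>(+) s ` B. y a) = (\<Prod>a\<in>B. y (s + a))"
      by (subst prod.reindex) auto
    then show "(if last_pt (s + d) ((+) s ` B) = s + n
      then path_weight K (s + d) ((+) s ` B) * (\<Prod>a\<in>(+) s ` B. y a) else 0) =
      (if last_pt d B = n then path_weight K d B * (\<Prod>a\<in>B. y (s + a)) else 0)"
      using f by (simp add: last_pt_shift path_weight_shift)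
  qed
  finally show ?thesis .
qed

lemma chain_sum_cong:
  assumes "\<And>a. d < a \<Longrightarrow> a \<le> n \<Longrightarrow> y a = y' a"
  shows "chain_sum K y d n = chain_sum K y' d n"
proof -
  have "(\<Prod>a\<in>B. y a) = (\<Prod>a\<in>B. y' a)" if "B \<in> Pow {d<..n}" for B
    by (rule prod.cong) (use that assms in auto)
  then show ?thesis unfolding chain_sum_def by (intro sum.cong) auto
qed

text \<open>Each path is cut into its points up to \<open>e\<close>, its first point
  \<open>t\<close> after \<open>e\<close>, and a fresh chain from \<open>t\<close>. With
  \<open>d = e\<close> this is the renewal equation; with \<open>e\<close> the end of a block it is
  the basis of the coarse graining.\<close>

lemma chain_sum_block:
  assumes "d \<le> e" "e < n"
  shows "chain_sum K y d n = (\<Sum>B\<in>Pow {d<..e}. path_weight K d B * (\<Prod>a\<in>B. y a) *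
     (\<Sum>t\<in>{e<..n}. K (t - last_pt d B) * y t * chain_sum K y t n))"
proof -
  let ?f = "\<lambda>B. if last_pt d B = n then path_weight K d B * (\<Prod>a\<in>B. y a) else 0"
  have "{d<..n} = {d<..e} \<union> {e<..n}" using assms by auto
  then have "chain_sum K y d n = (\<Sum>B\<in>Pow {d<..e}. \<Sum>C\<in>Pow {e<..n}. ?f (B \<union> C))"
    unfolding chain_sum_def by (simp only:) (rule sum_Pow_Un; auto)
  also have "\<dots> = (\<Sum>B\<in>Pow {d<..e}. path_weight K d B * (\<Prod>a\<in>B. y a) *
     (\<Sum>t\<in>{e<..n}. K (t - last_pt d B) * y t * chain_sum K y t n))"
  proof (rule sum.cong[OF refl])
    fix B assume B: "B \<in> Pow {d<..e}"
    then have f: "finite B" using finite_subset by blast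
    have l: "last_pt d B \<le> e" using last_pt_bounds[of B d e] B assms by auto
    have "(\<Sum>C\<in>Pow {e<..n}. ?f (B \<union> C)) =
        ?f B + (\<Sum>t\<in>{e<..n}. \<Sum>C\<in>Pow {t<..n}. ?f (B \<union> insert t C))"
      by (subst sum_Pow_by_Min) auto
    also have "?f B = 0" using l assms by auto
    also have "(\<Sum>t\<in>{e<..n}. \<Sum>C\<in>Pow {t<..n}. ?f (B \<union> insert t C)) =
      (\<Sum>t\<in>{e<..n}. \<Sum>C\<in>Pow {t<..n}. path_weight K d B * (\<Prod>a\<in>B. y a) *
        (K (t - last_pt d B) * y t * (if last_pt t C = n then path_weight K t C * (\<Prod>a\<in>C. y a) else 0)))"
    proof (intro sum.cong refl)
      fix t C assume t: "t \<in> {e<..n}" and C: "C \<in> Pow {t<..n}"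
      then have fC: "finite C" using finite_subset by blast
      have sub: "B \<subseteq> {d<..<t}" "C \<subseteq> {t<..}" "d < t" using B C t assms by auto
      have "path_weight K d (B \<union> insert t C) = path_weight K d (insert t B) * path_weight K t C"
        by (rule path_weight_split[OF fC sub])
      moreover have "path_weight K d (insert t B) = path_weight K d B * K (t - last_pt d B)"
        by (rule path_weight_insert[OF f]) (use sub in auto)
      moreover have "last_pt d (B \<union> insert t C) = last_pt t C"
        by (rule last_pt_Un_insert[OF sub(1) fC sub(3)])
      moreover have "(\<Prod>a\<in>B \<union> insert t C. y a) = (\<Prod>a\<in>B. y a) * (y t * (\<Prod>a\<in>C. y a))"
      proof -
        have "t \<notin> C" "B \<inter> insert t C = {}" using sub by fastforce+
        then show ?thesis using f fC by (simp add: prod.union_disjoint)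
      qed
      ultimately show "?f (B \<union> insert t C) = path_weight K d B * (\<Prod>a\<in>B. y a) *
        (K (t - last_pt d B) * y t * (if last_pt t C = n then path_weight K t C * (\<Prod>a\<in>C. y a) else 0))"
        by simp
    qed
    finally show "(\<Sum>C\<in>Pow {e<..n}. ?f (B \<union> C)) = path_weight K d B * (\<Prod>a\<in>B. y a) *
     (\<Sum>t\<in>{e<..n}. K (t - last_pt d B) * y t * chain_sum K y t n)"
      unfolding chain_sum_def by (simp add: sum_distrib_left)
  qed
  finally show ?thesis .
qed

text \<open>In the decomposition at \<open>e = t - 1\<close>, keeping only the paths whose first
  point after \<open>e\<close> is \<open>t\<close> gives the left-hand side. This
  supermultiplicativity yields the superadditivity of the expected log partition function.\<close>

lemma chain_sum_super:
  assumes K: "\<And>n. n \<ge> 1 \<Longrightarrow> K n \<ge> 0" and y: "\<And>a. y a \<ge> 0" and "d < t" "t < n"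
  shows "chain_sum K y d t * chain_sum K y t n \<le> chain_sum K y d n"
proof -
  have tn: "t \<in> {t - 1<..n}" using assms by auto
  have "chain_sum K y d t * chain_sum K y t n =
     (\<Sum>B\<in>Pow {d<..t - 1}. path_weight K d B * (\<Prod>a\<in>B. y a) *
     (K (t - last_pt d B) * y t * chain_sum K y t n))"
  proof -
    have e: "{d<..<t} = {d<..t - 1}" using assms by auto
    show ?thesis
      unfolding chain_sum_alt[OF \<open>d < t\<close>] sum_distrib_right e
    proof (rule sum.cong[OF refl])
      fix B assume B: "B \<in> Pow {d<..t - 1}"
      then have f: "finite B" using finite_subset by blast
      have tB: "t \<notin> B" "\<And>b. b \<in> B \<Longrightarrow> b < t" using B assms by fastforce+
      show "path_weight K d (insert t B) * prod y (insert t B) * chain_sum K y t n =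
         path_weight K d B * prod y B * (K (t - last_pt d B) * y t * chain_sum K y t n)"
        using tB f by (simp add: path_weight_insert)
    qed
  qed
  also have "\<dots> \<le> (\<Sum>B\<in>Pow {d<..t - 1}. path_weight K d B * (\<Prod>a\<in>B. y a) *
     (\<Sum>t\<in>{t - 1<..n}. K (t - last_pt d B) * y t * chain_sum K y t n))"
  proof (rule sum_mono)
    fix B assume B: "B \<in> Pow {d<..t - 1}"
    then have f: "finite B" using finite_subset by blast
    have l: "last_pt d B \<le> t - 1" using B assms by (intro last_pt_bounds) auto
    have "K (t - last_pt d B) * y t * chain_sum K y t n \<le>
      (\<Sum>t\<in>{t - 1<..n}. K (t - last_pt d B) * y t * chain_sum K y t n)"
      by (rule member_le_sum[OF tn])
         (use l y K in \<open>auto intro!: mult_nonneg_nonneg chain_sum_nonneg\<close>)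
    moreover have "0 \<le> path_weight K d B * (\<Prod>a\<in>B. y a)"
      using B f by (auto intro!: mult_nonneg_nonneg path_weight_nonneg K y prod_nonneg)
    ultimately show "path_weight K d B * (\<Prod>a\<in>B. y a) * (K (t - last_pt d B) * y t * chain_sum K y t n)
       \<le> path_weight K d B * (\<Prod>a\<in>B. y a) *
         (\<Sum>t\<in>{t - 1<..n}. K (t - last_pt d B) * y t * chain_sum K y t n)"
      by (rule mult_left_mono)
  qed
  also have "\<dots> = chain_sum K y d n"
    using assms by (intro chain_sum_block[symmetric]) auto
  finally show ?thesis .
qed

text \<open>Total probability one, by enlarging the window: the next site is hit or not, and the two
  cases recombine because the tail at \<open>n\<close> is the tail at \<open>n + 1\<close> plus
  \<open>K (n + 1)\<close>.\<close>

lemma path_sum_one: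
  assumes "d \<le> n"
  shows "path_sum K d n (\<lambda>_. 1) = 1"
  using assms
proof (induction n rule: dec_induct)
  case base
  then show ?case by (simp add: path_sum_def tail_mass_def)
next
  case (step n)
  have e: "{d<..Suc n} = insert (Suc n) {d<..n}" using step by auto
  have "path_sum K d (Suc n) (\<lambda>_. 1) = (\<Sum>B\<in>Pow {d<..n}.
      path_weight K d B * tail_mass K (Suc n - last_pt d B) +
      path_weight K d (insert (Suc n) B) * tail_mass K (Suc n - last_pt d (insert (Suc n) B)))"
    unfolding path_sum_def e by (subst sum_Pow_insert) auto
  also have "\<dots> = (\<Sum>B\<in>Pow {d<..n}. path_weight K d B * tail_mass K (n - last_pt d B))"
  proof (rule sum.cong[OF refl])
    fix B assume B: "B \<in> Pow {d<..n}"
    then have f: "finite B" using finite_subset by blast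
    have l: "last_pt d B \<le> n" using B step by (intro last_pt_bounds) auto
    have l2: "last_pt d (insert (Suc n) B) = Suc n"
      by (rule last_pt_insert[OF f]) (use B step in auto)
    have p: "path_weight K d (insert (Suc n) B) = path_weight K d B * K (Suc n - last_pt d B)"
      by (rule path_weight_insert[OF f]) (use B in auto)
    show "path_weight K d B * tail_mass K (Suc n - last_pt d B) +
      path_weight K d (insert (Suc n) B) * tail_mass K (Suc n - last_pt d (insert (Suc n) B)) =
      path_weight K d B * tail_mass K (n - last_pt d B)"
      unfolding p l2 using l by (simp add: tail_mass_def Suc_diff_le algebra_simps)
  qed
  finally show ?case using step by (simp add: path_sum_def)
qed

lemma path_sum_shift:
  "path_sum K (s + d) (s + n) f = path_sum K d n (\<lambda>B. f ((+) s ` B))"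
  unfolding path_sum_def sum_Pow_shift
  by (intro sum.cong refl) (auto simp: last_pt_shift path_weight_shift finite_subset)

lemma chain_sum_one_shift: "d \<le> t \<Longrightarrow> chain_sum K (\<lambda>_. 1) d t = renewal_mass K (t - d)"
  unfolding renewal_mass_def using chain_sum_shift[of K "\<lambda>_. 1" d 0 "t - d"] by simp

text \<open>The Markov property at a renewal point: since \<open>f\<close> sees only the points
  after \<open>t\<close>, the past contributes just the probability of hitting
  \<open>t\<close>.\<close>

lemma path_sum_markov:
  assumes "d < t" "t \<le> n"
  shows "path_sum K d n (\<lambda>B. if t \<in> B then f (B \<inter> {t<..}) else 0) =
    renewal_mass K (t - d) * path_sum K t n f"
proof -
  let ?g = "\<lambda>B. path_weight K d B * tail_mass K (n - last_pt d B) *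
    (if t \<in> B then f (B \<inter> {t<..}) else 0)"
  have "{d<..n} = {d<..<t} \<union> insert t {t<..n}" using assms by auto
  then have "path_sum K d n (\<lambda>B. if t \<in> B then f (B \<inter> {t<..}) else 0) =
      (\<Sum>B\<in>Pow {d<..<t}. \<Sum>C\<in>Pow (insert t {t<..n}). ?g (B \<union> C))"
    unfolding path_sum_def by (simp only:) (rule sum_Pow_Un; auto)
  also have "\<dots> = (\<Sum>B\<in>Pow {d<..<t}. \<Sum>C\<in>Pow {t<..n}. path_weight K d (insert t B) *
      (path_weight K t C * tail_mass K (n - last_pt t C) * f C))"
  proof (rule sum.cong[OF refl])
    fix B assume B: "B \<in> Pow {d<..<t}"
    show "(\<Sum>C\<in>Pow (insert t {t<..n}). ?g (B \<union> C)) =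
      (\<Sum>C\<in>Pow {t<..n}. path_weight K d (insert t B) *
      (path_weight K t C * tail_mass K (n - last_pt t C) * f C))"
    proof (subst sum_Pow_insert, simp, simp, rule sum.cong[OF refl])
      fix C assume C: "C \<in> Pow {t<..n}"
      then have fC: "finite C" using finite_subset by blast
      have sub: "B \<subseteq> {d<..<t}" "C \<subseteq> {t<..}" using B C by auto
      have "t \<notin> B \<union> C" "(B \<union> insert t C) \<inter> {t<..} = C" using sub by fastforce+
      then show "?g (B \<union> C) + ?g (B \<union> insert t C) = path_weight K d (insert t B) *
        (path_weight K t C * tail_mass K (n - last_pt t C) * f C)"
        using path_weight_split[OF fC sub assms(1)] last_pt_Un_insert[OF sub(1) fC assms(1)]
        by simp
    qed
  qed
  also have "\<dots> = chain_sum K (\<lambda>_. 1) d t * path_sum K t n f"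
    unfolding chain_sum_alt[OF assms(1)] path_sum_def by (simp add: sum_product)
  finally show ?thesis using assms by (simp add: chain_sum_one_shift)
qed

text \<open>All paths ending at \<open>g\<close> together weigh the renewal mass of
  \<open>g - d\<close>, so anything that depends only on the last point becomes a sum against that
  mass.\<close>

lemma sum_path_weight_last:
  assumes "d \<le> n"
  shows "(\<Sum>B\<in>Pow {d<..n}. path_weight K d B * \<phi> (last_pt d B)) =
    (\<Sum>g\<in>{d..n}. renewal_mass K (g - d) * \<phi> g)"
proof -
  have "(\<Sum>B\<in>Pow {d<..n}. path_weight K d B * \<phi> (last_pt d B)) =
    \<phi> d + (\<Sum>t\<in>{d<..n}. \<Sum>B\<in>Pow {d<..<t}. path_weight K d (insert t B) * \<phi> (last_pt d (insert t B)))"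
    by (subst sum_Pow_by_Max) simp
  also have "(\<Sum>t\<in>{d<..n}. \<Sum>B\<in>Pow {d<..<t}. path_weight K d (insert t B) * \<phi> (last_pt d (insert t B)))
    = (\<Sum>t\<in>{d<..n}. renewal_mass K (t - d) * \<phi> t)"
  proof (rule sum.cong[OF refl])
    fix t assume t: "t \<in> {d<..n}"
    then have "renewal_mass K (t - d) = (\<Sum>B\<in>Pow {d<..<t}. path_weight K d (insert t B))"
      using chain_sum_one_shift[of d t K] chain_sum_alt[of d t K "\<lambda>_. 1"] by simp
    moreover have "last_pt d (insert t B) = t" if "B \<in> Pow {d<..<t}" for B
      using that t by (intro last_pt_insert finite_subset[of B "{d<..<t}"]) auto
    ultimately show "(\<Sum>B\<in>Pow {d<..<t}. path_weight K d (insert t B) * \<phi> (last_pt d (insert t B)))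
      = renewal_mass K (t - d) * \<phi> t"
      by (simp add: sum_distrib_right)
  qed
  also have "\<phi> d + (\<Sum>t\<in>{d<..n}. renewal_mass K (t - d) * \<phi> t) =
     (\<Sum>g\<in>{d..n}. renewal_mass K (g - d) * \<phi> g)"
  proof -
    have e: "{d..n} = insert d {d<..n}" using assms by auto
    show ?thesis unfolding e by (simp add: renewal_mass_def)
  qed
  finally show ?thesis .
qed

subsection \<open>Kernels of marginal type\<close>

lemma abel_summation:
  fixes f g :: "nat \<Rightarrow> 'a::comm_ring_1"
  shows "(\<Sum>t\<in>{1..n}. f t * g t) =
    (\<Sum>s\<in>{1..n}. (f s - f (Suc s)) * (\<Sum>t\<in>{1..s}. g t)) + f (Suc n) * (\<Sum>t\<in>{1..n}. g t)"
  by (induction n) (simp_all add: algebra_simps)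

text \<open>Summation by parts turns the sum of squares into terms
  \<open>(f s - f (Suc s)) * (f s + f (Suc s)) * s\<close>, and the middle factor lies between
  \<open>f s\<close> and \<open>2 * f s\<close>. It makes \<open>D\<close> interchangeable with the
  weighted sums that arise when only counts \<open>s * v s\<close> on whole intervals are
  known.\<close>

lemma abel_decreasing_bounds:
  fixes f :: "nat \<Rightarrow> real"
  assumes "\<And>m n. m \<le> n \<Longrightarrow> f n \<le> f m" "\<And>n. f n \<ge> 0" "f (Suc n) = 0"
  shows "(\<Sum>s\<in>{1..n}. (f s - f (Suc s)) * (real s * f s)) \<le> (\<Sum>s\<in>{1..n}. (f s)\<^sup>2)"
    and "(\<Sum>s\<in>{1..n}. (f s)\<^sup>2) \<le> 2 * (\<Sum>s\<in>{1..n}. (f s - f (Suc s)) * (real s * f s))"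
proof -
  have e: "(\<Sum>s\<in>{1..n}. (f s)\<^sup>2) = (\<Sum>s\<in>{1..n}. ((f s)\<^sup>2 - (f (Suc s))\<^sup>2) * real s)"
    using abel_summation[of "\<lambda>s. (f s)\<^sup>2" "\<lambda>_. 1" n] assms(3) by simp
  show "(\<Sum>s\<in>{1..n}. (f s - f (Suc s)) * (real s * f s)) \<le> (\<Sum>s\<in>{1..n}. (f s)\<^sup>2)"
    unfolding e
  proof (rule sum_mono)
    fix s
    have "f (Suc s) \<le> f s" "0 \<le> f (Suc s)" using assms by auto
    then have "(f s - f (Suc s)) * f s \<le> (f s - f (Suc s)) * (f s + f (Suc s))"
      by (intro mult_left_mono) auto
    then have "(f s - f (Suc s)) * f s * real s \<le> ((f s - f (Suc s)) * (f s + f (Suc s))) * real s"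
      by (intro mult_right_mono) auto
    then show "(f s - f (Suc s)) * (real s * f s) \<le> ((f s)\<^sup>2 - (f (Suc s))\<^sup>2) * real s"
      by (simp add: power2_eq_square algebra_simps)
  qed
  show "(\<Sum>s\<in>{1..n}. (f s)\<^sup>2) \<le> 2 * (\<Sum>s\<in>{1..n}. (f s - f (Suc s)) * (real s * f s))"
    unfolding e sum_distrib_left
  proof (rule sum_mono)
    fix s
    have "f (Suc s) \<le> f s" "0 \<le> f (Suc s)" using assms by auto
    then have "(f s - f (Suc s)) * (f s + f (Suc s)) \<le> (f s - f (Suc s)) * (2 * f s)"
      by (intro mult_left_mono) auto
    then have "((f s - f (Suc s)) * (f s + f (Suc s))) * real s \<le> (f s - f (Suc s)) * (2 * f s) * real s"
      by (intro mult_right_mono) auto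
    then show "((f s)\<^sup>2 - (f (Suc s))\<^sup>2) * real s \<le> 2 * ((f s - f (Suc s)) * (real s * f s))"
      by (simp add: power2_eq_square algebra_simps)
  qed
qed

text \<open>The mean value theorem, which does the work of comparing a sum of powers with an
  integral in the next two lemmas.\<close>

lemma powr_diff_ge:
  fixes x y p :: real
  assumes "0 < x" "x < y" "p \<le> 1" "p \<noteq> 0"
  shows "p > 0 \<Longrightarrow> y powr (p - 1) \<le> (y powr p - x powr p) / (p * (y - x))"
    and "p < 0 \<Longrightarrow> y powr (p - 1) \<le> (x powr p - y powr p) / (- p * (y - x))"
proof -
  have "\<exists>z. x < z \<and> z < y \<and> y powr p - x powr p = (y - x) * (p * z powr (p - 1))"
    by (rule MVT2) (use assms in \<open>auto intro!: derivative_eq_intros simp: powr_diff\<close>)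
  then obtain z where z: "x < z" "z < y" "y powr p - x powr p = (y - x) * (p * z powr (p - 1))"
    by blast
  have "y powr (p - 1) \<le> z powr (p - 1)"
    using z assms by (intro powr_mono2') auto
  moreover have "z powr (p - 1) = (y powr p - x powr p) / (p * (y - x))"
    using z assms by (simp add: field_simps)
  moreover have "z powr (p - 1) = (x powr p - y powr p) / (- p * (y - x))"
  proof -
    have "x powr p - y powr p = - p * (y - x) * z powr (p - 1)" using z(3) by (simp add: algebra_simps)
    then show ?thesis using assms by simp
  qed
  ultimately show "p > 0 \<Longrightarrow> y powr (p - 1) \<le> (y powr p - x powr p) / (p * (y - x))"
    "p < 0 \<Longrightarrow> y powr (p - 1) \<le> (x powr p - y powr p) / (- p * (y - x))" by auto
qed

lemma sum_powr_54:
  assumes "n \<ge> 1"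
  shows "(\<Sum>i\<in>{n<..m}. real i powr (- 5/4)) \<le> 4 * real n powr (- 1/4)"
proof -
  have "(\<Sum>i\<in>{n<..m}. real i powr (- 5/4)) \<le> 4 * real n powr (- 1/4) - 4 * real (max n m) powr (- 1/4)"
  proof (induction m)
    case (Suc m)
    show ?case
    proof (cases "n \<le> m")
      case True
      have "real (Suc m) powr (- 5/4) \<le> 4 * real m powr (-1/4) - 4 * real (Suc m) powr (-1/4)"
        using powr_diff_ge(2)[of "real m" "real (Suc m)" "-1/4"] True assms by simp
      moreover have "{n<..Suc m} = insert (Suc m) {n<..m}" using True by auto
      ultimately show ?thesis using Suc True by (simp add: max_def)
    next
      case False
      then have "{n<..Suc m} = {}" "max n (Suc m) = n" by auto
      then show ?thesis by simp
    qed
  qed simp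
  then show ?thesis by (smt (verit) powr_ge_zero)
qed

lemma sum_powr_34: "(\<Sum>i\<in>{1..n}. real i powr (- 3/4)) \<le> 4 * real n powr (1/4)"
proof (induction n)
  case (Suc n)
  have "real (Suc n) powr (- 3/4) \<le> 4 * real (Suc n) powr (1/4) - 4 * real n powr (1/4)"
  proof (cases "n = 0")
    case False
    then show ?thesis using powr_diff_ge(1)[of "real n" "real (Suc n)" "1/4"] by simp
  qed simp
  then show ?case using Suc by simp
qed simp

text \<open>\<open>v\<close> has the order of the renewal mass function of \<open>K\<close>, and \<open>D n\<close> that of the expected number
  of intersections up to \<open>n\<close> of two independent copies of the renewal process.\<close>

locale marginal_kernel =
  fixes K v :: "nat \<Rightarrow> real" and c1 c2 :: real
  assumes c1_pos: "c1 > 0"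
    and K_sums: "(\<lambda>n. K (Suc n)) sums 1"
    and v_pos: "\<And>n. v n > 0"
    and v_0: "v 0 = 1"
    and v_decreasing: "\<And>m n. m \<le> n \<Longrightarrow> v n \<le> v m"
    and v_lower: "\<And>m n. 1 \<le> m \<Longrightarrow> m \<le> n \<Longrightarrow> (real m / real n) powr (3/4) * v m \<le> v n"
    and v_upper: "\<And>m n. 1 \<le> m \<Longrightarrow> m \<le> n \<Longrightarrow> (real n / real m) powr (1/4) * v n \<le> v m"
    and K_lower: "\<And>n. n \<ge> 1 \<Longrightarrow> c1 / (real n ^ 2 * v n) \<le> K n"
    and K_upper: "\<And>n. n \<ge> 1 \<Longrightarrow> K n \<le> c2 / (real n ^ 2 * v n)"
begin

definition D :: "nat \<Rightarrow> real" where
  "D n = (\<Sum>t\<in>{1..n}. (v t)\<^sup>2)"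

lemma v_le_1: "v n \<le> 1"
  using v_decreasing[of 0 n] v_0 by simp

lemma K_pos: "n \<ge> 1 \<Longrightarrow> K n > 0"
proof -
  assume n: "n \<ge> 1"
  then have "0 < c1 / (real n ^ 2 * v n)" using c1_pos v_pos[of n] by simp
  then show ?thesis using K_lower[OF n] by linarith
qed

lemma K_nonneg: "n \<ge> 1 \<Longrightarrow> K n \<ge> 0"
  using K_pos[of n] by simp

lemma c2_pos: "c2 > 0"
proof -
  have "0 < c2 / v 1" using K_upper[of 1] K_pos[of 1] by simp
  then show ?thesis using v_pos[of 1] by (simp add: zero_less_divide_iff)
qed

lemma tail_mass_diff: "n \<le> m \<Longrightarrow> tail_mass K n = (\<Sum>i\<in>{n<..m}. K i) + tail_mass K m"
proof -
  assume "n \<le> m"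
  then have "{1..m} = {1..n} \<union> {n<..m}" by auto
  then have "(\<Sum>i\<in>{1..m}. K i) = (\<Sum>i\<in>{1..n}. K i) + (\<Sum>i\<in>{n<..m}. K i)"
    by (simp only:) (rule sum.union_disjoint; auto)
  then show ?thesis by (simp add: tail_mass_def)
qed

lemma tail_mass_eq: "tail_mass K n = 1 - (\<Sum>i<n. K (Suc i))"
proof -
  have "(\<Sum>i\<in>{1..n}. K i) = (\<Sum>i<n. K (Suc i))"
    by (induction n) auto
  then show ?thesis by (simp add: tail_mass_def)
qed

lemma tail_mass_tendsto: "(\<lambda>n. tail_mass K n) \<longlonglongrightarrow> 0"
proof -
  have "(\<lambda>n. 1 - (\<Sum>i<n. K (Suc i))) \<longlonglongrightarrow> 1 - 1"
    using K_sums by (intro tendsto_intros) (simp add: sums_def)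
  then show ?thesis unfolding tail_mass_eq by simp
qed

lemma tail_mass_nonneg: "tail_mass K n \<ge> 0"
proof -
  have "(\<Sum>i<n. K (Suc i)) \<le> (\<Sum>i. K (Suc i))"
    using K_sums K_nonneg by (intro sum_le_suminf) (auto simp: sums_iff)
  then show ?thesis using K_sums unfolding tail_mass_eq by (simp add: sums_iff)
qed

lemma sum_K_le_tail_mass: "(\<Sum>i\<in>{n<..m}. K i) \<le> tail_mass K n"
proof (cases "n \<le> m")
  case True
  then show ?thesis using tail_mass_diff[of n m] tail_mass_nonneg[of m] by simp
qed (use tail_mass_nonneg in auto)

text \<open>Only the \<open>n\<close> jump lengths in \<open>(n, 2n]\<close> are kept; there
  \<open>v i \<le> v n\<close> and \<open>i^2 \<le> 4 n^2\<close>.\<close>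

lemma tail_mass_lower:
  assumes "n \<ge> 1" shows "c1 / (4 * real n * v n) \<le> tail_mass K n"
proof -
  have "(\<Sum>i\<in>{n<..2*n}. c1 / (4 * real n ^ 2 * v n)) \<le> (\<Sum>i\<in>{n<..2*n}. K i)"
  proof (rule sum_mono)
    fix i assume i: "i \<in> {n<..2*n}"
    have "real i ^ 2 \<le> (2 * real n) ^ 2" using i by (intro power_mono) auto
    then have "real i ^ 2 * v i \<le> (4 * real n ^ 2) * v n"
      using v_decreasing[of n i] i v_pos[of i] by (intro mult_mono) (auto simp: power_mult_distrib)
    moreover have "0 < real i ^ 2 * v i" using i v_pos[of i] by auto
    ultimately have "c1 / (4 * real n ^ 2 * v n) \<le> c1 / (real i ^ 2 * v i)"
      using c1_pos v_pos[of n] v_pos[of i] i assms by (intro divide_left_mono mult_pos_pos) auto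
    then show "c1 / (4 * real n ^ 2 * v n) \<le> K i" using K_lower[of i] i assms by simp
  qed
  moreover have "(\<Sum>i\<in>{n<..2*n}. c1 / (4 * real n ^ 2 * v n)) = c1 / (4 * real n * v n)"
    using assms by (simp add: power2_eq_square)
  ultimately show ?thesis using sum_K_le_tail_mass[of "2*n" n] sum_K_le_tail_mass[of n "2*n"] by linarith
qed

text \<open>\<open>v_lower\<close> spends the power \<open>3/4\<close> of the available
  \<open>i^2\<close>, and what remains decays with the summable exponent \<open>5/4\<close>,
  relative to the scale \<open>n\<close>.\<close>

lemma K_le_54:
  assumes "1 \<le> n" "n \<le> i"
  shows "K i \<le> c2 * real n powr (-3/4) / v n * real i powr (-5/4)"
proof -
  have i: "real i > 0" using assms by auto
  have "(real n / real i) powr (3/4) * v n * real i ^ 2 \<le> v i * real i ^ 2"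
    using v_lower[of n i] assms by (intro mult_right_mono) auto
  moreover have "(real n / real i) powr (3/4) * v n * real i ^ 2 = real n powr (3/4) * v n * real i powr (5/4)"
  proof -
    have "real i ^ 2 = real i powr (5/4) * real i powr (3/4)"
      using i by (simp add: powr_add[symmetric] powr_numeral)
    then show ?thesis using i assms by (simp add: powr_divide)
  qed
  ultimately have "real n powr (3/4) * v n * real i powr (5/4) \<le> real i ^ 2 * v i"
    by (metis mult.commute)
  then have "c2 / (real i ^ 2 * v i) \<le> c2 / (real n powr (3/4) * v n * real i powr (5/4))"
    using c2_pos v_pos[of n] v_pos[of i] i assms by (intro divide_left_mono mult_pos_pos) auto
  also have "\<dots> = c2 * real n powr (-3/4) / v n * real i powr (-5/4)"
    using i assms by (simp add: powr_minus field_simps)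
  finally show ?thesis using K_upper[of i] assms by linarith
qed

text \<open>The bound holds for every finite piece of the tail; the remainder beyond
  \<open>m\<close> tends to zero.\<close>

lemma tail_mass_upper:
  assumes "n \<ge> 1" shows "tail_mass K n \<le> 4 * c2 / (real n * v n)"
proof -
  have "(\<Sum>i\<in>{n<..m}. K i) \<le> 4 * c2 / (real n * v n)" for m
  proof -
    have "(\<Sum>i\<in>{n<..m}. K i) \<le> (\<Sum>i\<in>{n<..m}. c2 * real n powr (-3/4) / v n * real i powr (-5/4))"
      using assms by (intro sum_mono K_le_54) auto
    also have "\<dots> \<le> c2 * real n powr (-3/4) / v n * (4 * real n powr (-1/4))"
      unfolding sum_distrib_left[symmetric]
      using sum_powr_54[OF assms, of m] c2_pos v_pos[of n] by (intro mult_left_mono) auto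
    also have "\<dots> = 4 * c2 / v n * (real n powr (-3/4) * real n powr (-1/4))" by simp
    also have "real n powr (-3/4) * real n powr (-1/4) = 1 / real n"
      using assms by (simp add: powr_add[symmetric] powr_minus_divide)
    finally show ?thesis by (simp add: mult.commute)
  qed
  then have "tail_mass K n \<le> 4 * c2 / (real n * v n) + tail_mass K m" if "m \<ge> n" for m
    using tail_mass_diff[OF that] by (metis add_le_cancel_right)
  then have "eventually (\<lambda>m. tail_mass K n \<le> 4 * c2 / (real n * v n) + tail_mass K m) sequentially"
    using eventually_sequentially by blast
  moreover have "(\<lambda>m. 4 * c2 / (real n * v n) + tail_mass K m) \<longlonglongrightarrow> 4 * c2 / (real n * v n) + 0"
    by (intro tendsto_intros tail_mass_tendsto)
  ultimately show ?thesis
    using tendsto_lowerbound[of _ "4 * c2 / (real n * v n) + 0" sequentially "tail_mass K n"] by simp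
qed

text \<open>Here \<open>v_upper\<close> is the right direction: it leaves the exponent
  \<open>3/4\<close>, whose partial sums are of order \<open>n^(1/4)\<close>, so the largest
  admissible jumps dominate. Together with the tail this controls truncated increments.\<close>

lemma truncated_mean:
  assumes "n \<ge> 1" shows "(\<Sum>i\<in>{1..n}. real i * K i) \<le> 4 * c2 / v n"
proof -
  have "(\<Sum>i\<in>{1..n}. real i * K i) \<le> (\<Sum>i\<in>{1..n}. c2 * real n powr (-1/4) / v n * real i powr (-3/4))"
  proof (rule sum_mono)
    fix i assume i: "i \<in> {1..n}"
    have "real i * K i \<le> real i * (c2 / (real i ^ 2 * v i))"
      using K_upper[of i] i by (intro mult_left_mono) auto
    also have "\<dots> = c2 / (real i * v i)" using i by (simp add: power2_eq_square)
    also have "\<dots> \<le> c2 / (real i * ((real n / real i) powr (1/4) * v n))"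
      using v_upper[of i n] i c2_pos v_pos by (intro divide_left_mono mult_left_mono) auto
    also have "\<dots> = c2 / (v n * (real n powr (1/4) * real i powr (3/4)))"
    proof -
      have "real i = real i powr (3/4) * real i powr (1/4)" using i by (simp add: powr_add[symmetric])
      then have "real i * ((real n / real i) powr (1/4) * v n) =
          (real i powr (3/4) * real i powr (1/4)) * (real n powr (1/4) / real i powr (1/4) * v n)"
        using i by (simp add: powr_divide)
      also have "\<dots> = v n * (real n powr (1/4) * real i powr (3/4))" using i by simp
      finally have "real i * ((real n / real i) powr (1/4) * v n) = v n * (real n powr (1/4) * real i powr (3/4))" .
      then show ?thesis by simp
    qed
    also have "\<dots> = c2 * real n powr (-1/4) / v n * real i powr (-3/4)"
      by (simp add: powr_minus field_simps)
    finally show "real i * K i \<le> c2 * real n powr (-1/4) / v n * real i powr (-3/4)" .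
  qed
  also have "\<dots> \<le> c2 * real n powr (-1/4) / v n * (4 * real n powr (1/4))"
    unfolding sum_distrib_left[symmetric]
    using sum_powr_34[of n] c2_pos v_pos[of n] by (intro mult_left_mono) auto
  also have "\<dots> = 4 * c2 / v n * (real n powr (-1/4) * real n powr (1/4))" by simp
  also have "real n powr (-1/4) * real n powr (1/4) = 1"
    using assms by (simp add: powr_add[symmetric])
  finally show ?thesis by simp
qed

lemma renewal_mass_nonneg: "renewal_mass K t \<ge> 0"
  unfolding renewal_mass_def by (intro chain_sum_nonneg K_nonneg) auto

text \<open>Decomposing at the last renewal before \<open>n\<close>.\<close>

lemma green_sum_bound:
  assumes "n \<ge> 1" shows "(\<Sum>t\<in>{0..n}. renewal_mass K t) \<le> 4 / c1 * (real n * v n)"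
proof -
  have "(\<Sum>t\<in>{0..n}. renewal_mass K t) * (c1 / (4 * real n * v n)) \<le>
    (\<Sum>t\<in>{0..n}. renewal_mass K t * tail_mass K (n - t))"
    unfolding sum_distrib_right
  proof (intro sum_mono mult_left_mono renewal_mass_nonneg)
    fix t assume "t \<in> {0..n}"
    have "tail_mass K n \<le> tail_mass K (n - t)"
      using tail_mass_diff[of "n - t" n] K_nonneg sum_nonneg[of "{n - t<..n}" K] by fastforce
    then show "c1 / (4 * real n * v n) \<le> tail_mass K (n - t)"
      using tail_mass_lower[OF assms] by linarith
  qed
  also have "\<dots> = path_sum K 0 n (\<lambda>_. 1)"
    unfolding path_sum_def using sum_path_weight_last[of 0 n K "\<lambda>g. tail_mass K (n - g)"] by simp
  also have "\<dots> = 1" by (rule path_sum_one) simp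
  finally show ?thesis using c1_pos v_pos[of n] assms by (simp add: field_simps)
qed

text \<open>The renewal mass is bounded only in sum, not pointwise. Summation by parts against the
  decreasing weight \<open>v\<close> brings in its partial sums, to which
  \<open>green_sum_bound\<close> applies.\<close>

lemma weighted_green_sum_bound:
  assumes "n \<ge> 1" shows "(\<Sum>t\<in>{1..n}. v t * renewal_mass K t) \<le> 4 / c1 * D n"
proof -
  \<comment> \<open>Setting the weight to zero beyond \<open>n\<close> removes the boundary term of
    the summation by parts.\<close>
  define f where "f t = (if t \<le> n then v t else 0)" for t
  have f: "\<And>m n. m \<le> n \<Longrightarrow> f n \<le> f m" "\<And>n. f n \<ge> 0" "f (Suc n) = 0"
    using v_decreasing v_pos by (auto simp: f_def less_imp_le)
  have "(\<Sum>t\<in>{1..n}. v t * renewal_mass K t) = (\<Sum>t\<in>{1..n}. f t * renewal_mass K t)"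
    by (intro sum.cong) (auto simp: f_def)
  also have "\<dots> = (\<Sum>s\<in>{1..n}. (f s - f (Suc s)) * (\<Sum>t\<in>{1..s}. renewal_mass K t))"
    using abel_summation[of f "renewal_mass K" n] f(3) by simp
  also have "\<dots> \<le> (\<Sum>s\<in>{1..n}. (f s - f (Suc s)) * (4 / c1 * (real s * f s)))"
  proof (intro sum_mono mult_left_mono)
    fix s assume s: "s \<in> {1..n}"
    have "(\<Sum>t\<in>{1..s}. renewal_mass K t) \<le> (\<Sum>t\<in>{0..s}. renewal_mass K t)"
      by (intro sum_mono2 renewal_mass_nonneg) auto
    then show "(\<Sum>t\<in>{1..s}. renewal_mass K t) \<le> 4 / c1 * (real s * f s)"
      using green_sum_bound[of s] s by (simp add: f_def)
  qed (use f(1) in auto)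
  also have "\<dots> = 4 / c1 * (\<Sum>s\<in>{1..n}. (f s - f (Suc s)) * (real s * f s))"
    by (simp add: sum_distrib_left mult_ac)
  also have "\<dots> \<le> 4 / c1 * (\<Sum>s\<in>{1..n}. (f s)\<^sup>2)"
    using abel_decreasing_bounds(1)[of f n, OF f] c1_pos by (intro mult_left_mono) auto
  also have "(\<Sum>s\<in>{1..n}. (f s)\<^sup>2) = D n" unfolding D_def by (intro sum.cong) (auto simp: f_def)
  finally show ?thesis .
qed

lemma D_mono: "m \<le> n \<Longrightarrow> D m \<le> D n"
  unfolding D_def by (intro sum_mono2) auto

lemma D_pos: "n \<ge> 1 \<Longrightarrow> D n > 0"
  unfolding D_def using v_pos by (intro sum_pos) (auto simp: less_imp_neq[symmetric])

text \<open>\<open>D n / n\<close> is the average of a decreasing sequence, hence decreasing. So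
  passing to a fixed fraction of a block costs only a constant factor in \<open>D\<close>.\<close>

lemma D_scale:
  assumes "1 \<le> m" "m \<le> n" shows "real m * D n \<le> real n * D m"
proof -
  have vm: "real m * (v m)\<^sup>2 \<le> D m"
  proof -
    have "(\<Sum>t\<in>{1..m}. (v m)\<^sup>2) \<le> D m" unfolding D_def
      using v_decreasing v_pos by (intro sum_mono power_mono) (auto simp: less_imp_le)
    then show ?thesis by simp
  qed
  have "{1..n} = {1..m} \<union> {m<..n}" using assms by auto
  then have "D n = D m + (\<Sum>t\<in>{m<..n}. (v t)\<^sup>2)"
    unfolding D_def by (simp only:) (rule sum.union_disjoint; auto)
  also have "(\<Sum>t\<in>{m<..n}. (v t)\<^sup>2) \<le> (\<Sum>t\<in>{m<..n}. (v m)\<^sup>2)"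
    using v_decreasing v_pos by (intro sum_mono power_mono) (auto simp: less_imp_le)
  finally have "real m * D n \<le> real m * (D m + real (n - m) * (v m)\<^sup>2)" by (intro mult_left_mono) auto
  also have "\<dots> = real m * D m + real (n - m) * (real m * (v m)\<^sup>2)" by (simp add: algebra_simps)
  also have "\<dots> \<le> real m * D m + real (n - m) * D m" using vm by (intro add_left_mono mult_left_mono) auto
  also have "\<dots> = real n * D m" using assms by (simp add: of_nat_diff algebra_simps)
  finally show ?thesis .
qed

text \<open>The typical number \<open>n * v n\<close> of renewals diverges at an explicit rate,
  which later guarantees that a small multiple of it is at least one.\<close>

lemma nv_lower: "n \<ge> 1 \<Longrightarrow> real n powr (1/4) * v 1 \<le> real n * v n"
proof -
  assume n: "n \<ge> 1"
  have "real n * ((1 / real n) powr (3/4) * v 1) \<le> real n * v n"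
    using v_lower[of 1 n] n by (intro mult_left_mono) auto
  moreover have "real n * (1 / real n) powr (3/4) = real n powr (1/4)"
  proof -
    have "real n * (1 / real n) powr (3/4) = real n powr 1 / real n powr (3/4)"
      using n by (simp add: powr_divide)
    also have "\<dots> = real n powr (1 - 3/4)" by (simp only: powr_diff)
    finally show ?thesis by simp
  qed
  ultimately show ?thesis by (simp add: mult.assoc[symmetric])
qed

lemma path_sum_mono:
  assumes "\<And>B. B \<subseteq> {d<..n} \<Longrightarrow> f B \<le> g B" "d \<le> n"
  shows "path_sum K d n f \<le> path_sum K d n g"
  unfolding path_sum_def using assms
  by (intro sum_mono mult_left_mono mult_nonneg_nonneg path_weight_nonneg K_nonneg tail_mass_nonneg)
     (auto intro: finite_subset)

lemma renewal_mass_le_1: "renewal_mass K t \<le> 1"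
proof (cases "t = 0")
  case False
  have "renewal_mass K t * path_sum K t t (\<lambda>_. 1) = path_sum K 0 t (\<lambda>B. if t \<in> B then 1 else 0)"
    using path_sum_markov[of 0 t t K "\<lambda>_. 1"] False by simp
  also have "\<dots> \<le> path_sum K 0 t (\<lambda>_. 1)" by (intro path_sum_mono) auto
  finally show ?thesis by (simp add: path_sum_one)
qed (simp add: renewal_mass_def)

end

subsection \<open>The law of the contact set\<close>

context renewal_process
begin

definition incr :: "nat \<Rightarrow> 'r \<Rightarrow> nat" where
  "incr j x = \<tau> (Suc j) x - \<tau> j x"

text \<open>The renewal at \<open>0\<close> is left out: no disorder variable sits there, and the
  set matches the range \<open>{0<..n}\<close> of \<open>path_sum K 0 n\<close>.\<close>

definition contacts :: "nat \<Rightarrow> 'r \<Rightarrow> nat set" where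
  "contacts n x = range (\<lambda>j. \<tau> j x) \<inter> {1..n}"

lemma strict_mono_tau: "x \<in> space P \<Longrightarrow> strict_mono (\<lambda>j. \<tau> j x)"
  using increasing by (simp add: strict_mono_Suc_iff)

lemma tau_Suc: "x \<in> space P \<Longrightarrow> \<tau> (Suc j) x = \<tau> j x + incr j x"
  using increasing[of x j] by (simp add: incr_def)

lemma incr_pos: "x \<in> space P \<Longrightarrow> incr j x \<ge> 1"
  using increasing[of x j] by (simp add: incr_def)

lemma measurable_incr [measurable]: "incr j \<in> measurable P (count_space UNIV)"
  using indep_increments unfolding indep_vars_def incr_def[abs_def] by auto

lemma measurable_tau: "\<tau> j \<in> measurable P (count_space UNIV)"
proof (induction j)
  case 0
  have "(\<lambda>_. 0::nat) \<in> measurable P (count_space UNIV)" by simp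
  then show ?case by (rule measurable_cong[THEN iffD1, rotated]) (simp add: start)
next
  case (Suc j)
  note [measurable] = Suc
  have "(\<lambda>x. \<tau> j x + incr j x) \<in> measurable P (count_space UNIV)" by measurable
  then show ?case by (rule measurable_cong[THEN iffD1, rotated]) (simp add: tau_Suc)
qed

lemma last_pt_tau_image:
  assumes "x \<in> space P" shows "last_pt 0 ((\<lambda>j. \<tau> j x) ` {1..l}) = \<tau> l x"
proof -
  have "insert 0 ((\<lambda>j. \<tau> j x) ` {1..l}) = (\<lambda>j. \<tau> j x) ` {0..l}"
    using start[OF assms] by (force simp: image_iff Suc_le_eq atLeastAtMost_insertL[symmetric])
  moreover have "Max ((\<lambda>j. \<tau> j x) ` {0..l}) = \<tau> l x"
    using strict_mono_less_eq[OF strict_mono_tau[OF assms]] by (intro Max_eqI) auto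
  ultimately show ?thesis by (simp add: last_pt_def)
qed

text \<open>The witness \<open>g\<close> lists the gaps of \<open>B\<close>; the induction adds the
  largest point, whose gap is measured from the previous maximum. A prescribed set of first points
  thus becomes a cylinder event of the increments.\<close>

lemma path_event:
  assumes "finite B" "B \<subseteq> {1..}"
  shows "\<exists>g. (\<forall>j<card B. g j \<ge> 1) \<and> (\<Prod>j<card B. K (g j)) = path_weight K 0 B \<and>
    (\<forall>x\<in>space P. (\<lambda>j. \<tau> j x) ` {1..card B} = B \<longleftrightarrow> (\<forall>j<card B. incr j x = g j))"
  using assms
proof (induction B rule: finite_linorder_max_induct)
  case empty
  then show ?case by simp
next
  case (insert b A)
  then obtain g where g: "\<forall>j<card A. g j \<ge> 1" "(\<Prod>j<card A. K (g j)) = path_weight K 0 A"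
    "\<forall>x\<in>space P. (\<lambda>j. \<tau> j x) ` {1..card A} = A \<longleftrightarrow> (\<forall>j<card A. incr j x = g j)" by auto
  define l where "l = card A"
  define g' where "g' = g(l := b - last_pt 0 A)"
  have bA: "b \<notin> A" using insert by auto
  have cb: "card (insert b A) = Suc l" using insert bA by (simp add: l_def)
  have lb: "last_pt 0 A < b" using last_pt_in[of A 0] insert by auto
  have "(\<Prod>j<Suc l. K (g' j)) = path_weight K 0 (insert b A)"
  proof -
    have "(\<Prod>j<l. K (g' j)) = (\<Prod>j<l. K (g j))" by (intro prod.cong) (auto simp: g'_def)
    then show ?thesis using g(2) insert by (simp add: path_weight_insert l_def g'_def)
  qed
  moreover have "\<forall>j<Suc l. g' j \<ge> 1" using g(1) lb by (auto simp: g'_def l_def less_Suc_eq)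
  moreover have "(\<lambda>j. \<tau> j x) ` {1..Suc l} = insert b A \<longleftrightarrow> (\<forall>j<Suc l. incr j x = g' j)"
    if x: "x \<in> space P" for x
  proof -
    have split: "(\<lambda>j. \<tau> j x) ` {1..Suc l} = insert (\<tau> (Suc l) x) ((\<lambda>j. \<tau> j x) ` {1..l})"
      by (simp add: atLeastAtMostSuc_conv)
    have lt: "\<And>y. y \<in> (\<lambda>j. \<tau> j x) ` {1..l} \<Longrightarrow> y < \<tau> (Suc l) x"
      using strict_mono_less[OF strict_mono_tau[OF x]] by auto
    have "(\<lambda>j. \<tau> j x) ` {1..Suc l} = insert b A \<longleftrightarrow>
       (\<lambda>j. \<tau> j x) ` {1..l} = A \<and> \<tau> (Suc l) x = b"
    proof
      assume e: "(\<lambda>j. \<tau> j x) ` {1..Suc l} = insert b A"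
      have "Max (insert b A) = b" using insert by (intro Max_eqI) auto
      moreover have "Max ((\<lambda>j. \<tau> j x) ` {1..Suc l}) = \<tau> (Suc l) x"
        unfolding split using lt by (intro Max_eqI) (auto intro: less_imp_le)
      ultimately have b: "\<tau> (Suc l) x = b" using e by simp
      have "(\<lambda>j. \<tau> j x) ` {1..l} = A"
      proof -
        have "insert b ((\<lambda>j. \<tau> j x) ` {1..l}) = insert b A" using e[unfolded split] b by simp
        moreover have "b \<notin> (\<lambda>j. \<tau> j x) ` {1..l}" using lt b by blast
        ultimately show ?thesis using bA insert_ident by metis
      qed
      then show "(\<lambda>j. \<tau> j x) ` {1..l} = A \<and> \<tau> (Suc l) x = b" using b by simp
    next
      assume "(\<lambda>j. \<tau> j x) ` {1..l} = A \<and> \<tau> (Suc l) x = b"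
      then show "(\<lambda>j. \<tau> j x) ` {1..Suc l} = insert b A" unfolding split by simp
    qed
    also have "\<dots> \<longleftrightarrow> (\<lambda>j. \<tau> j x) ` {1..l} = A \<and> incr l x = b - last_pt 0 A"
    proof (rule conj_cong[OF refl])
      assume "(\<lambda>j. \<tau> j x) ` {1..l} = A"
      then have "last_pt 0 A = \<tau> l x" using last_pt_tau_image[OF x, of l] by simp
      then show "\<tau> (Suc l) x = b \<longleftrightarrow> incr l x = b - last_pt 0 A"
        using tau_Suc[OF x, of l] lb by auto
    qed
    also have "\<dots> \<longleftrightarrow> (\<forall>j<l. incr j x = g j) \<and> incr l x = b - last_pt 0 A"
      using g(3) x by (simp add: l_def)
    also have "\<dots> \<longleftrightarrow> (\<forall>j<Suc l. incr j x = g' j)"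
      by (auto simp: g'_def less_Suc_eq)
    finally show ?thesis .
  qed
  ultimately show ?case unfolding cb by blast
qed

lemma prob_incr_eq:
  assumes "\<forall>j<l. g j \<ge> 1"
  shows "{x \<in> space P. \<forall>j<l. incr j x = g j} \<in> events"
    "prob {x \<in> space P. \<forall>j<l. incr j x = g j} = (\<Prod>j<l. K (g j))"
proof -
  show "{x \<in> space P. \<forall>j<l. incr j x = g j} \<in> events" by measurable
  show "prob {x \<in> space P. \<forall>j<l. incr j x = g j} = (\<Prod>j<l. K (g j))"
  proof (cases "l = 0")
    case True
    then show ?thesis by (simp add: prob_space)
  next
    case False
    have iv: "indep_vars (\<lambda>_. count_space UNIV) incr UNIV"
      using indep_increments by (simp add: incr_def[abs_def])
    have "prob (\<Inter>j\<in>{..<l}. incr j -` {g j} \<inter> space P) = (\<Prod>j\<in>{..<l}. prob (incr j -` {g j} \<inter> space P))"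
      by (rule indep_varsD[OF iv]) (use False in auto)
    moreover have "(\<Inter>j\<in>{..<l}. incr j -` {g j} \<inter> space P) = {x \<in> space P. \<forall>j<l. incr j x = g j}"
      using False by auto
    moreover have "prob (incr j -` {g j} \<inter> space P) = K (g j)" if "j < l" for j
      using increment_law[of "g j" j] assms that
      by (simp add: incr_def vimage_def Int_def conj_commute)
    ultimately show ?thesis by simp
  qed
qed

text \<open>Since \<open>n \<in> B\<close>, the path sits at \<open>n\<close> after
  \<open>card B\<close> steps and monotonicity excludes further points up to \<open>n\<close>. The
  contact set is then decided by finitely many increments.\<close>

lemma contacts_eq_iff:
  assumes x: "x \<in> space P" and B: "B \<subseteq> {1..n}" "n \<in> B"
  shows "contacts n x = B \<longleftrightarrow> (\<lambda>j. \<tau> j x) ` {1..card B} = B"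
proof -
  have sm: "strict_mono (\<lambda>j. \<tau> j x)" by (rule strict_mono_tau[OF x])
  have pos: "1 \<le> \<tau> j x \<longleftrightarrow> 1 \<le> j" for j
    using sm start[OF x] strict_mono_less[OF sm, of 0 j] by auto
  show ?thesis
  proof
    assume c: "contacts n x = B"
    then obtain l where l: "\<tau> l x = n" using B by (auto simp: contacts_def)
    have "contacts n x = (\<lambda>j. \<tau> j x) ` {1..l}"
      unfolding contacts_def using strict_mono_less_eq[OF sm, of _ l] pos l
      by (auto simp: image_iff)
    moreover have "card ((\<lambda>j. \<tau> j x) ` {1..l}) = l"
      using strict_mono_imp_inj_on[OF sm] by (subst card_image) (auto intro: inj_on_subset)
    ultimately show "(\<lambda>j. \<tau> j x) ` {1..card B} = B" using c by simp
  next
    assume c: "(\<lambda>j. \<tau> j x) ` {1..card B} = B"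
    have fB: "finite B" using B finite_subset by blast
    have "n \<in> (\<lambda>j. \<tau> j x) ` {1..card B}" using c B by simp
    then obtain l where l: "l \<in> {1..card B}" "\<tau> l x = n" by auto
    have "\<tau> (card B) x \<in> B" using c l by force
    then have "\<tau> (card B) x \<le> \<tau> l x" using B l by auto
    then have lc: "\<tau> (card B) x = n"
      using l strict_mono_less_eq[OF sm, of "card B" l] by (metis atLeastAtMost_iff le_antisym)
    have "contacts n x = (\<lambda>j. \<tau> j x) ` {1..card B}"
      unfolding contacts_def using strict_mono_less_eq[OF sm, of _ "card B"] pos lc
      by (auto simp: image_iff)
    then show "contacts n x = B" using c by simp
  qed
qed

text \<open>Sets containing the right end are handled by the increments (\<open>full\<close>).
  Otherwise the window is enlarged by one site: not hitting it is the event for \<open>n\<close>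
  minus the event of hitting it, and the tail factor drops by exactly the corresponding
  \<open>K\<close>.\<close>

lemma prob_contacts:
  assumes "B \<subseteq> {0<..n}"
  shows "{x \<in> space P. contacts n x = B} \<in> events \<and>
    prob {x \<in> space P. contacts n x = B} = path_weight K 0 B * tail_mass K (n - last_pt 0 B)"
proof -
  have full: "{x \<in> space P. contacts n x = B} \<in> events \<and>
    prob {x \<in> space P. contacts n x = B} = path_weight K 0 B"
    if B: "B \<subseteq> {0<..n}" "n \<in> B" for n B
  proof -
    have fB: "finite B" "B \<subseteq> {1..}" "B \<subseteq> {1..n}" using B finite_subset by fastforce+
    obtain g where g: "\<forall>j<card B. g j \<ge> 1" "(\<Prod>j<card B. K (g j)) = path_weight K 0 B"
      "\<forall>x\<in>space P. (\<lambda>j. \<tau> j x) ` {1..card B} = B \<longleftrightarrow> (\<forall>j<card B. incr j x = g j)"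
      using path_event[OF fB(1,2)] by blast
    have "{x \<in> space P. contacts n x = B} = {x \<in> space P. \<forall>j<card B. incr j x = g j}"
    proof (intro Collect_cong conj_cong refl)
      fix x assume "x \<in> space P"
      then show "contacts n x = B \<longleftrightarrow> (\<forall>j<card B. incr j x = g j)"
        using g(3) contacts_eq_iff[OF _ fB(3) B(2)] by metis
    qed
    then show ?thesis using prob_incr_eq[OF g(1)] g(2) by simp
  qed
  show ?thesis
    using assms
  proof (induction n)
    case 0
    then have "B = {}" by auto
    moreover have "{x \<in> space P. contacts 0 x = {}} = space P" by (auto simp: contacts_def)
    ultimately show ?case by (simp add: tail_mass_def prob_space)
  next
    case (Suc n)
    show ?case
    proof (cases "Suc n \<in> B")
      case True
      have "finite B" using Suc.prems finite_subset by blast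
      then have "last_pt 0 (insert (Suc n) B) = Suc n"
        using Suc.prems by (intro last_pt_insert) auto
      then have "last_pt 0 B = Suc n" using True by (simp add: insert_absorb)
      then show ?thesis using full[OF Suc.prems True] by (simp add: tail_mass_def)
    next
      case False
      then have B: "B \<subseteq> {0<..n}" using Suc.prems
        by (metis greaterThanAtMost_iff le_Suc_eq subset_iff)
      have fB: "finite B" using B finite_subset by blast
      let ?S = "\<lambda>n B. {x \<in> space P. contacts n x = B}"
      have c: "contacts n x = contacts (Suc n) x - {Suc n}" for x by (auto simp: contacts_def)
      have e: "?S n B = ?S (Suc n) B \<union> ?S (Suc n) (insert (Suc n) B)"
        unfolding c using False by auto
      have d: "?S (Suc n) B \<inter> ?S (Suc n) (insert (Suc n) B) = {}" using False by auto
      have p1: "?S n B \<in> events \<and> prob (?S n B) = path_weight K 0 B * tail_mass K (n - last_pt 0 B)"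
        by (rule Suc.IH[OF B])
      have p2: "?S (Suc n) (insert (Suc n) B) \<in> events \<and>
        prob (?S (Suc n) (insert (Suc n) B)) = path_weight K 0 (insert (Suc n) B)"
        by (rule full) (use B in auto)
      have s: "?S (Suc n) B = ?S n B - ?S (Suc n) (insert (Suc n) B)" using e d by auto
      have m: "?S (Suc n) B \<in> events" unfolding s using p1 p2 by auto
      have "prob (?S n B) = prob (?S (Suc n) B) + prob (?S (Suc n) (insert (Suc n) B))"
        unfolding e using m p2 d by (intro finite_measure_Union) auto
      moreover have "path_weight K 0 (insert (Suc n) B) = path_weight K 0 B * K (Suc n - last_pt 0 B)"
        using B by (intro path_weight_insert fB) auto
      moreover have "last_pt 0 B \<le> n" using B by (intro last_pt_bounds) auto
      ultimately show ?thesis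
        using m p1 p2 by (simp add: tail_mass_def Suc_diff_le algebra_simps)
    qed
  qed
qed

lemma contacts_in_Pow: "contacts n x \<in> Pow {0<..n}"
  by (auto simp: contacts_def)

lemma contacts_expand:
  fixes f :: "nat set \<Rightarrow> real"
  assumes "x \<in> space P"
  shows "f (contacts n x) = (\<Sum>B\<in>Pow {0<..n}. f B * indicator {x \<in> space P. contacts n x = B} x)"
proof -
  have "(\<Sum>B\<in>Pow {0<..n}. f B * indicator {x \<in> space P. contacts n x = B} x) =
    (\<Sum>B\<in>Pow {0<..n}. if B = contacts n x then f B else 0)"
    using assms by (intro sum.cong) (auto simp: indicator_def)
  also have "\<dots> = f (contacts n x)"
    using contacts_in_Pow[of n x] by (simp add: sum.delta)
  finally show ?thesis by simp
qed

lemma expectation_contacts: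
  fixes f :: "nat set \<Rightarrow> real"
  shows "integrable P (\<lambda>x. f (contacts n x))"
    and "expectation (\<lambda>x. f (contacts n x)) = path_sum K 0 n f"
proof -
  have m: "{x \<in> space P. contacts n x = B} \<in> events" if "B \<in> Pow {0<..n}" for B
    using prob_contacts[of B n] that by auto
  have i: "integrable P (\<lambda>x. \<Sum>B\<in>Pow {0<..n}. f B * indicator {x \<in> space P. contacts n x = B} x)"
    using m by (intro Bochner_Integration.integrable_sum integrable_mult_right integrable_real_indicator)
      (auto simp: emeasure_eq_measure)
  show "integrable P (\<lambda>x. f (contacts n x))"
    by (rule Bochner_Integration.integrable_cong[THEN iffD2, OF refl _ i]) (rule contacts_expand)
  have "expectation (\<lambda>x. f (contacts n x)) =
    expectation (\<lambda>x. \<Sum>B\<in>Pow {0<..n}. f B * indicator {x \<in> space P. contacts n x = B} x)"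
    by (rule Bochner_Integration.integral_cong[OF refl]) (rule contacts_expand)
  also have "\<dots> = (\<Sum>B\<in>Pow {0<..n}. f B * prob {x \<in> space P. contacts n x = B})"
    using m by (subst Bochner_Integration.integral_sum)
      (auto intro!: integrable_mult_right integrable_real_indicator sum.cong simp: emeasure_eq_measure)
  also have "\<dots> = path_sum K 0 n f"
    unfolding path_sum_def using prob_contacts[of _ n] by (intro sum.cong) auto
  finally show "expectation (\<lambda>x. f (contacts n x)) = path_sum K 0 n f" .
qed

lemma measurable_contacts [measurable]: "contacts n \<in> measurable P (count_space UNIV)"
proof (rule measurableI)
  fix A :: "nat set set"
  have "contacts n -` A \<inter> space P = (\<Union>B\<in>A \<inter> Pow {0<..n}. {x \<in> space P. contacts n x = B})"
    using contacts_in_Pow[of n] by auto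
  also have "\<dots> \<in> events" using prob_contacts[of _ n] by (intro sets.finite_UN) auto
  finally show "contacts n -` A \<inter> space P \<in> events" .
qed simp

text \<open>Pinning at \<open>N\<close> forces the last point to be \<open>N\<close>, where the tail
  factor is \<open>tail_mass K 0 = 1\<close>.\<close>

lemma path_sum_pinned:
  assumes "N \<ge> 1"
  shows "path_sum K 0 N (\<lambda>B. (\<Prod>a\<in>B. y a) * indicator B N) = chain_sum K y 0 N"
  unfolding path_sum_def chain_sum_def
proof (rule sum.cong[OF refl])
  fix B assume B: "B \<in> Pow {0<..N}"
  then have f: "finite B" using finite_subset by blast
  have "last_pt 0 B = N \<longleftrightarrow> N \<in> B"
    using last_pt_in[OF f, of 0] last_pt_ge[OF f, of N 0] last_pt_bounds(2)[of B 0 N] B assms by auto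
  then show "path_weight K 0 B * tail_mass K (N - last_pt 0 B) * ((\<Prod>a\<in>B. y a) * indicator B N) =
    (if last_pt 0 B = N then path_weight K 0 B * (\<Prod>a\<in>B. y a) else 0)"
    by (auto simp: tail_mass_def)
qed

lemma partition_function_eq:
  assumes "N \<ge> 1"
  shows "partition_function P \<tau> Q \<omega> \<beta> h N w =
    chain_sum K (\<lambda>n. exp (\<beta> * \<omega> n w + h - ln (mgf Q \<omega> \<beta>))) 0 N"
proof -
  let ?c = "\<lambda>n. \<beta> * \<omega> n w + h - ln (mgf Q \<omega> \<beta>)"
  have "partition_function P \<tau> Q \<omega> \<beta> h N w =
      expectation (\<lambda>x. (\<Prod>a\<in>contacts N x. exp (?c a)) * indicator (contacts N x) N)"
    unfolding partition_function_def
  proof (rule Bochner_Integration.integral_cong[OF refl])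
    fix x assume x: "x \<in> space P"
    have d: "\<delta> \<tau> n x = indicator (contacts N x) n" if "n \<in> {1..N}" for n
      using that by (auto simp: \<delta>_def contacts_def indicator_def)
    have "(\<Sum>n=1..N. ?c n * \<delta> \<tau> n x) = (\<Sum>n\<in>{1..N}. ?c n * indicator (contacts N x) n)"
      using d by (intro sum.cong) auto
    also have "\<dots> = (\<Sum>n\<in>contacts N x. ?c n)"
    proof -
      have "(\<Sum>n\<in>{1..N}. ?c n * indicator (contacts N x) n) =
          (\<Sum>n\<in>{1..N}. if n \<in> contacts N x then ?c n else 0)"
        by (intro sum.cong) (auto simp: indicator_def)
      also have "\<dots> = (\<Sum>n\<in>{1..N} \<inter> contacts N x. ?c n)"
        by (rule sum.inter_restrict[symmetric]) simp
      also have "{1..N} \<inter> contacts N x = contacts N x" by (auto simp: contacts_def)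
      finally show ?thesis .
    qed
    finally have s: "(\<Sum>n=1..N. ?c n * \<delta> \<tau> n x) = (\<Sum>n\<in>contacts N x. ?c n)" .
    have "finite (contacts N x)" by (auto simp: contacts_def)
    then show "exp (\<Sum>n=1..N. ?c n * \<delta> \<tau> n x) * \<delta> \<tau> N x =
      (\<Prod>a\<in>contacts N x. exp (?c a)) * indicator (contacts N x) N"
      unfolding s using d[of N] assms by (simp add: exp_sum)
  qed
  also have "\<dots> = chain_sum K (\<lambda>n. exp (?c n)) 0 N"
    using expectation_contacts(2)[of "\<lambda>B. (\<Prod>a\<in>B. exp (?c a)) * indicator B N" N] path_sum_pinned[OF assms]
    by simp
  finally show ?thesis .
qed

end

section \<open>Tail bounds for renewal times\<close>

locale marginal_renewal = renewal_process P \<tau> K + marginal_kernel K v c1 c2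
  for P :: "'r measure" and \<tau> :: "nat \<Rightarrow> 'r \<Rightarrow> nat" and K v c1 c2
begin

text \<open>Truncation at \<open>t\<close>: on the event, either an increment exceeds \<open>t\<close> or the truncated
  increments add up to more than \<open>t\<close>.\<close>

lemma prob_tau_gt:
  assumes t: "t \<ge> 1"
  shows "{x \<in> space P. \<tau> (j + r) x > \<tau> j x + t} \<in> events"
    and "prob {x \<in> space P. \<tau> (j + r) x > \<tau> j x + t} \<le> 8 * c2 * real r / (real t * v t)"
proof -
  \<comment> \<open>\<open>G i\<close> is the minimum of 1 and the increment divided by
    \<open>t\<close>. As a finite combination of indicators it has an expectation given directly by
    the values \<open>K 1, ..., K t\<close>.\<close>
  define G where "G i x = 1 - (\<Sum>n\<in>{1..t}. (1 - real n / real t) * indicator {x\<in>space P. incr i x = n} x)" for i x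
  have Gx: "G i x = (if incr i x \<le> t then real (incr i x) / real t else 1)" if x: "x \<in> space P" for i x
  proof -
    have "(\<Sum>n\<in>{1..t}. (1 - real n / real t) * indicator {x\<in>space P. incr i x = n} x) =
      (\<Sum>n\<in>{1..t}. if n = incr i x then 1 - real n / real t else 0)"
      using x by (intro sum.cong) (auto simp: indicator_def)
    also have "\<dots> = (if incr i x \<le> t then 1 - real (incr i x) / real t else 0)"
      using incr_pos[OF x, of i] by (simp add: sum.delta)
    finally show ?thesis by (simp add: G_def)
  qed
  have Gint: "integrable P (G i)" for i
    unfolding G_def by (intro Bochner_Integration.integrable_diff Bochner_Integration.integrable_sum
        integrable_mult_right integrable_real_indicator) (auto simp: emeasure_eq_measure)
  \<comment> \<open>The mean is the tail at \<open>t\<close> plus the truncated mean divided by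
    \<open>t\<close>; each contributes \<open>4 * c2 / (t * v t)\<close>.\<close>
  have GE: "expectation (G i) \<le> 8 * c2 / (real t * v t)" for i
  proof -
    have p: "prob {x\<in>space P. incr i x = n} = K n" if "n \<ge> 1" for n
      using increment_law[OF that, of i] by (simp add: incr_def)
    have "expectation (G i) = 1 - (\<Sum>n\<in>{1..t}. (1 - real n / real t) * prob {x\<in>space P. incr i x = n})"
    proof -
      have ii: "integrable P (\<lambda>x. (1 - real n / real t) * indicator {x\<in>space P. incr i x = n} x)" for n
        by (intro integrable_mult_right integrable_real_indicator) (auto simp: emeasure_eq_measure)
      have "expectation (G i) = expectation (\<lambda>_. 1) -
          (\<Sum>n\<in>{1..t}. expectation (\<lambda>x. (1 - real n / real t) * indicator {x\<in>space P. incr i x = n} x))"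
        unfolding G_def
        by (subst Bochner_Integration.integral_diff, simp, intro Bochner_Integration.integrable_sum ii,
            subst Bochner_Integration.integral_sum, rule ii, rule refl)
      then show ?thesis by (simp add: prob_space del: sum_mult_indicator)
    qed
    also have "\<dots> = 1 - (\<Sum>n\<in>{1..t}. (1 - real n / real t) * K n)" using p by simp
    also have "\<dots> = tail_mass K t + (\<Sum>n\<in>{1..t}. real n * K n) / real t"
      by (simp add: tail_mass_def sum_subtractf sum_divide_distrib left_diff_distrib)
    also have "\<dots> \<le> 4 * c2 / (real t * v t) + (4 * c2 / v t) / real t"
      using tail_mass_upper[OF t] truncated_mean[OF t] t by (intro add_mono divide_right_mono) auto
    finally show ?thesis by (simp add: field_simps)
  qed
  have [measurable]: "\<tau> i \<in> borel_measurable P" for i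
    by (rule measurable_compose[OF measurable_tau, of "\<lambda>x. x" borel]) simp
  show m: "{x \<in> space P. \<tau> (j + r) x > \<tau> j x + t} \<in> events" by measurable
  have le: "indicator {x \<in> space P. \<tau> (j + r) x > \<tau> j x + t} x \<le> (\<Sum>i<r. G (j + i) x)" if x: "x \<in> space P" for x
  proof (cases "\<tau> (j + r) x > \<tau> j x + t")
    case True
    have G0: "G i x \<ge> 0" for i using Gx[OF x, of i] by auto
    show ?thesis
    proof (cases "\<exists>i<r. incr (j + i) x > t")
      case True
      then obtain i where i: "i < r" "incr (j + i) x > t" by blast
      have "G (j + i) x \<le> (\<Sum>i<r. G (j + i) x)"
        using i G0 by (intro member_le_sum) auto
      then show ?thesis using Gx[OF x, of "j + i"] i by (auto simp: indicator_def)
    next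
      case False
      have "\<tau> (j + r) x = \<tau> j x + (\<Sum>i<r. incr (j + i) x)"
        by (induction r) (simp_all add: tau_Suc[OF x])
      then have "real t < (\<Sum>i<r. real (incr (j + i) x))" using True by (simp flip: of_nat_sum)
      moreover have "(\<Sum>i<r. G (j + i) x) = (\<Sum>i<r. real (incr (j + i) x)) / real t"
        unfolding sum_divide_distrib using False by (intro sum.cong refl) (simp add: Gx[OF x], metis lessThan_iff not_less)
      ultimately have "1 \<le> (\<Sum>i<r. G (j + i) x)" using t by simp
      then show ?thesis by (simp add: indicator_def)
    qed
  next
    case False
    have "0 \<le> (\<Sum>i<r. G (j + i) x)" by (intro sum_nonneg) (auto simp: Gx[OF x])
    then show ?thesis using False by (simp add: indicator_def)
  qed
  have "prob {x \<in> space P. \<tau> (j + r) x > \<tau> j x + t} = expectation (indicator {x \<in> space P. \<tau> (j + r) x > \<tau> j x + t})"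
    using m by simp
  also have "\<dots> \<le> expectation (\<lambda>x. \<Sum>i<r. G (j + i) x)"
    using m le by (intro integral_mono Bochner_Integration.integrable_sum Gint integrable_real_indicator)
      (auto simp: emeasure_eq_measure)
  also have "\<dots> = (\<Sum>i<r. expectation (G (j + i)))" using Gint by (simp add: Bochner_Integration.integral_sum)
  also have "\<dots> \<le> (\<Sum>i<r. 8 * c2 / (real t * v t))" by (intro sum_mono GE)
  finally show "prob {x \<in> space P. \<tau> (j + r) x > \<tau> j x + t} \<le> 8 * c2 * real r / (real t * v t)"
    by (simp add: field_simps)
qed

end

subsection \<open>Elementary symmetric functions\<close>

definition esp :: "nat \<Rightarrow> ('a \<Rightarrow> real) \<Rightarrow> 'a set \<Rightarrow> real" where
  "esp p f S = (\<Sum>R\<in>{R. R \<subseteq> S \<and> card R = p}. \<Prod>a\<in>R. f a)"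

lemma finite_card_subsets [simp]: "finite S \<Longrightarrow> finite {R. R \<subseteq> S \<and> card R = p}"
  by (rule finite_subset[of _ "Pow S"]) auto

lemma card_0_subsets: "finite S \<Longrightarrow> {R. R \<subseteq> S \<and> card R = 0} = {{}}"
proof (intro set_eqI iffI)
  fix R assume "finite S" and R: "R \<in> {R. R \<subseteq> S \<and> card R = 0}"
  then have "finite R" using finite_subset[of R S] by blast
  then show "R \<in> {{}}" using R by simp
qed simp

lemma esp_0 [simp]: "finite S \<Longrightarrow> esp 0 f S = 1"
  by (simp add: esp_def card_0_subsets del: card_0_eq)

lemma esp_nonneg: "(\<And>a. a \<in> S \<Longrightarrow> f a \<ge> 0) \<Longrightarrow> esp p f S \<ge> 0"
  unfolding esp_def by (intro sum_nonneg prod_nonneg) auto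

lemma esp_mono: "(\<And>a. a \<in> S \<Longrightarrow> 0 \<le> f a) \<Longrightarrow> (\<And>a. a \<in> S \<Longrightarrow> f a \<le> g a) \<Longrightarrow> esp p f S \<le> esp p g S"
  unfolding esp_def by (intro sum_mono prod_mono) auto

lemma esp_insert:
  assumes "finite S" "x \<notin> S"
  shows "esp (Suc p) f (insert x S) = esp (Suc p) f S + f x * esp p f S"
proof -
  have "{R. R \<subseteq> insert x S \<and> card R = Suc p} =
    {R. R \<subseteq> S \<and> card R = Suc p} \<union> insert x ` {R. R \<subseteq> S \<and> card R = p}" (is "?L = ?A \<union> ?B")
  proof (intro set_eqI iffI)
    fix R assume R: "R \<in> ?L"
    show "R \<in> ?A \<union> ?B"
    proof (cases "x \<in> R")
      case True
      then have "R = insert x (R - {x})" "R - {x} \<subseteq> S" "card (R - {x}) = p" using R by auto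
      then show ?thesis by blast
    next
      case False
      then show ?thesis using R by auto
    qed
  next
    fix R assume "R \<in> ?A \<union> ?B"
    then show "R \<in> ?L"
    proof
      assume "R \<in> ?B"
      then obtain R' where R': "R' \<subseteq> S" "card R' = p" "R = insert x R'" by auto
      then have "finite R'" "x \<notin> R'" using assms finite_subset by blast+
      then show ?thesis using R' by auto
    qed auto
  qed
  moreover have "?A \<inter> ?B = {}" using assms by auto
  moreover have "inj_on (insert x) {R. R \<subseteq> S \<and> card R = p}"
  proof (rule inj_onI)
    fix R R' assume "R \<in> {R. R \<subseteq> S \<and> card R = p}" "R' \<in> {R. R \<subseteq> S \<and> card R = p}" "insert x R = insert x R'"
    then show "R = R'" using assms(2) insert_ident[of x R R'] by blast
  qed
  moreover have "(\<Prod>a\<in>insert x R. f a) = f x * (\<Prod>a\<in>R. f a)" if "R \<subseteq> S" for R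
    using finite_subset[OF that assms(1)] that assms(2) by (subst prod.insert) auto
  ultimately show ?thesis
    using assms unfolding esp_def
    by (simp add: sum.union_disjoint sum.reindex sum_distrib_left)
qed

text \<open>Singling out the lowest chosen point prepares an application of the Markov property
  there, with a symmetric function of one order less on the points above.\<close>

lemma esp_by_min:
  fixes S :: "nat set"
  assumes "finite S"
  shows "esp (Suc p) f S = (\<Sum>t\<in>S. f t * esp p f (S \<inter> {t<..}))"
  using assms
proof (induction S rule: finite_linorder_min_induct)
  case empty
  have "{R. R \<subseteq> ({}::nat set) \<and> card R = Suc p} = {}" by auto
  then show ?case by (simp add: esp_def)
next
  case (insert b A)
  have b: "b \<notin> A" using insert by auto
  have "esp (Suc p) f (insert b A) = (\<Sum>t\<in>A. f t * esp p f (A \<inter> {t<..})) + f b * esp p f A"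
    using insert b by (simp add: esp_insert)
  moreover have "(\<Sum>t\<in>insert b A. f t * esp p f (insert b A \<inter> {t<..})) =
     f b * esp p f (insert b A \<inter> {b<..}) + (\<Sum>t\<in>A. f t * esp p f (insert b A \<inter> {t<..}))"
    using insert b by simp
  moreover have "insert b A \<inter> {b<..} = A" using insert by auto
  moreover have "insert b A \<inter> {t<..} = A \<inter> {t<..}" if "t \<in> A" for t
    using insert(2) that by (auto dest: less_asym)
  ultimately show ?case by simp
qed

text \<open>Choosing \<open>p\<close> distinct points in order, each earlier choice removes at most
  1 from the total, so every factor is at least the sum minus \<open>p\<close>. The proof is an
  induction on the set that compares the increments of both sides when one point is added.\<close>

lemma esp_lower:
  assumes "finite S" "\<And>a. a \<in> S \<Longrightarrow> 0 \<le> f a" "\<And>a. a \<in> S \<Longrightarrow> f a \<le> 1"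
  shows "(max 0 (sum f S - real p)) ^ p \<le> fact p * esp p f S"
  using assms
proof (induction S arbitrary: p rule: finite_induct)
  case empty
  then show ?case
  proof (cases p)
    case (Suc p')
    have "{R. R \<subseteq> ({}::'a set) \<and> card R = Suc p'} = {}" by auto
    then show ?thesis using Suc by (simp add: esp_def)
  qed simp
next
  case (insert x S)
  show ?case
  proof (cases p)
    case 0
    then show ?thesis using insert by simp
  next
    case (Suc p')
    define s where "s = sum f S"
    have fx: "0 \<le> f x" "f x \<le> 1" using insert.prems by auto
    have I1: "(max 0 (s - real p)) ^ p \<le> fact p * esp p f S"
      and I2: "(max 0 (s - real p')) ^ p' \<le> fact p' * esp p' f S"
      using insert.IH[of p] insert.IH[of p'] insert.prems unfolding s_def by auto
    \<comment> \<open>With \<open>p = Suc p'\<close>, adding \<open>f x \<le> 1\<close> raises a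
      \<open>p\<close>-th power by at most \<open>f x * p\<close> times the \<open>p'\<close>-th
      power of the argument increased by 1, and \<open>s - p' = (s - p) + 1\<close>.\<close>
    have "(max 0 (f x + s - real p)) ^ p \<le> (max 0 (s - real p)) ^ p + f x * real p * (max 0 (s - real p')) ^ p'"
    proof (cases "s - real p \<ge> 0")
      case True
      define a where "a = s - real p"
      have "(a + f x) ^ p - a ^ p = f x * (\<Sum>i<p. a ^ (p - Suc i) * (a + f x) ^ i)"
        by (subst power_diff_sumr2) simp
      also have "\<dots> \<le> f x * (\<Sum>i<p. (a + 1) ^ p')"
      proof (intro mult_left_mono sum_mono fx)
        fix i assume i: "i \<in> {..<p}"
        have "a ^ (p - Suc i) * (a + f x) ^ i \<le> (a + 1) ^ (p - Suc i) * (a + 1) ^ i"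
          using True fx by (intro mult_mono power_mono) (auto simp: a_def)
        also have "\<dots> = (a + 1) ^ p'" using i Suc by (simp add: power_add[symmetric])
        finally show "a ^ (p - Suc i) * (a + f x) ^ i \<le> (a + 1) ^ p'" .
      qed
      finally have le: "(a + f x) ^ p - a ^ p \<le> f x * real p * (a + 1) ^ p'" by simp
      have e: "max 0 (f x + s - real p) = a + f x" "max 0 (s - real p) = a" "max 0 (s - real p') = a + 1"
        using True fx Suc by (auto simp: a_def)
      show ?thesis unfolding e using le by linarith
    next
      case False
      show ?thesis
      proof (cases "f x + s - real p \<ge> 0")
        case True
        have "(f x + s - real p) ^ p = (f x + s - real p) * (f x + s - real p) ^ p'" using Suc by simp
        also have "\<dots> \<le> f x * (s - real p') ^ p'"
          using True False fx Suc by (intro mult_mono power_mono) auto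
        also have "\<dots> \<le> f x * real p * (s - real p') ^ p'"
        proof -
          have "0 \<le> s - real p'" using True fx Suc by auto
          then have "f x * (s - real p') ^ p' * 1 \<le> f x * (s - real p') ^ p' * real p"
            using fx Suc by (intro mult_left_mono) auto
          then show ?thesis by (simp add: mult_ac)
        qed
        finally have le: "(f x + s - real p) ^ p \<le> f x * real p * (s - real p') ^ p'" .
        have e: "max 0 (f x + s - real p) = f x + s - real p" "max 0 (s - real p) = 0"
          "max 0 (s - real p') = s - real p'" "(0::real) ^ p = 0"
          using True False fx Suc by (simp_all add: max_def)
        show ?thesis unfolding e using le by simp
      next
        case False': False
        then have "(max 0 (f x + s - real p)) ^ p = 0" using Suc by simp
        moreover have "0 \<le> (max 0 (s - real p)) ^ p + f x * real p * (max 0 (s - real p')) ^ p'"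
          using fx by simp
        ultimately show ?thesis by linarith
      qed
    qed
    also have "\<dots> \<le> fact p * esp p f S + f x * real p * (fact p' * esp p' f S)"
      using I1 I2 fx by (intro add_mono mult_left_mono) auto
    also have "\<dots> = fact p * esp p f (insert x S)"
    proof -
      have "esp p f (insert x S) = esp p f S + f x * esp p' f S"
        using esp_insert[OF insert.hyps(1,2), of p' f] Suc by simp
      moreover have "fact p = real p * fact p'" using Suc by simp
      ultimately show ?thesis by (simp only: distrib_left mult_ac)
    qed
    finally show ?thesis using insert.hyps by (simp add: s_def)
  qed
qed

context marginal_kernel
begin

subsection \<open>The star weights\<close>

text \<open>Distances are measured from the first point, not between consecutive points: with the first
  point fixed, the sum over the others is an elementary symmetric function.\<close>

definition star :: "nat set \<Rightarrow> real" where
  "star A = (\<Prod>a\<in>A. v (a - Min A))"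

definition star_sum :: "nat \<Rightarrow> nat set \<Rightarrow> real" where
  "star_sum r A = (\<Sum>R\<in>{R. R \<subseteq> A \<and> card R = r}. star R)"

lemma star_pos: "star A > 0"
  unfolding star_def using v_pos by (intro prod_pos) auto

lemma star_insert_min:
  assumes "finite R" "\<And>b. b \<in> R \<Longrightarrow> a < b"
  shows "star (insert a R) = (\<Prod>b\<in>R. v (b - a))"
proof -
  have "Min (insert a R) = a" using assms by (intro Min_eqI) (auto intro: less_imp_le)
  moreover have "a \<notin> R" using assms(2) by auto
  ultimately show ?thesis unfolding star_def using assms(1) by (simp add: v_0)
qed

lemma star_sum_by_min:
  assumes "finite A"
  shows "star_sum (Suc p) A = (\<Sum>a\<in>A. esp p (\<lambda>b. v (b - a)) (A \<inter> {a<..}))"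
proof -
  have "(\<Sum>a\<in>A. esp p (\<lambda>b. v (b - a)) (A \<inter> {a<..})) =
    (\<Sum>(a, R)\<in>Sigma A (\<lambda>a. {R. R \<subseteq> A \<inter> {a<..} \<and> card R = p}). \<Prod>b\<in>R. v (b - a))"
    unfolding esp_def using assms by (subst sum.Sigma) auto
  also have "\<dots> = star_sum (Suc p) A"
    unfolding star_sum_def
  proof (rule sum.reindex_bij_witness[where i = "\<lambda>R. (Min R, R - {Min R})" and j = "\<lambda>(a, R). insert a R"])
    fix x assume "x \<in> Sigma A (\<lambda>a. {R. R \<subseteq> A \<inter> {a<..} \<and> card R = p})"
    then obtain a R where x: "x = (a, R)" and a: "a \<in> A" "R \<subseteq> A \<inter> {a<..}" "card R = p" by auto
    have fR: "finite R" using a assms finite_subset by blast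
    have M: "Min (insert a R) = a" using a fR by (intro Min_eqI) (auto intro: less_imp_le)
    have aR: "a \<notin> R" using a by auto
    show "(\<lambda>R. (Min R, R - {Min R})) ((\<lambda>(a, R). insert a R) x) = x" using M aR x by simp
    show "(\<lambda>(a, R). insert a R) x \<in> {R. R \<subseteq> A \<and> card R = Suc p}" using a fR aR x by auto
    have "star (insert a R) = (\<Prod>b\<in>R. v (b - a))" using a fR by (intro star_insert_min) auto
    then show "star ((\<lambda>(a, R). insert a R) x) = (case x of (a, R) \<Rightarrow> \<Prod>b\<in>R. v (b - a))"
      using x by simp
  next
    fix R assume R: "R \<in> {R. R \<subseteq> A \<and> card R = Suc p}"
    then have f: "finite R" "R \<noteq> {}" using finite_subset[of R A] assms by auto
    then have M: "Min R \<in> R" "\<And>b. b \<in> R \<Longrightarrow> Min R \<le> b" by auto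
    show "(\<lambda>(a, R). insert a R) (Min R, R - {Min R}) = R" using M by auto
    show "(Min R, R - {Min R}) \<in> Sigma A (\<lambda>a. {R. R \<subseteq> A \<inter> {a<..} \<and> card R = p})"
    proof -
      have "R - {Min R} \<subseteq> A \<inter> {Min R<..}" using R M(2) by (auto intro: le_neq_implies_less)
      moreover have "Min R \<in> A" "card (R - {Min R}) = p" using R M(1) by auto
      ultimately show ?thesis by auto
    qed
  qed
  finally show ?thesis by simp
qed

lemma star_sum_shift:
  assumes "finite A" shows "star_sum (Suc p) ((+) s ` A) = star_sum (Suc p) A"
proof -
  have "star_sum (Suc p) ((+) s ` A) =
      (\<Sum>a\<in>A. esp p (\<lambda>b. v (b - (s + a))) ((+) s ` A \<inter> {s + a<..}))"
    using assms by (simp add: star_sum_by_min sum.reindex)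
  also have "\<dots> = (\<Sum>a\<in>A. esp p (\<lambda>b. v (b - a)) (A \<inter> {a<..}))"
  proof (rule sum.cong[OF refl])
    fix a
    have e: "(+) s ` A \<inter> {s + a<..} = (+) s ` (A \<inter> {a<..})" by auto
    have "{R. R \<subseteq> (+) s ` (A \<inter> {a<..}) \<and> card R = p} = (`) ((+) s) ` {R. R \<subseteq> A \<inter> {a<..} \<and> card R = p}"
      (is "?L = _ ` ?R")
    proof (intro set_eqI iffI)
      fix R assume "R \<in> ?L"
      then obtain R' where "R' \<subseteq> A \<inter> {a<..}" "R = (+) s ` R'" "card R = p"
        by (auto simp: subset_image_iff)
      then show "R \<in> (`) ((+) s) ` ?R" by (auto simp: card_image)
    qed (auto simp: card_image)
    moreover have "inj_on ((`) ((+) s)) ?R" by (intro inj_on_subset[OF inj_on_image]) auto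
    ultimately show "esp p (\<lambda>b. v (b - (s + a))) ((+) s ` A \<inter> {s + a<..}) = esp p (\<lambda>b. v (b - a)) (A \<inter> {a<..})"
      unfolding e esp_def by (simp add: sum.reindex prod.reindex)
  qed
  also have "\<dots> = star_sum (Suc p) A" using assms by (simp add: star_sum_by_min)
  finally show ?thesis .
qed

text \<open>With truncated subtraction \<open>(x - m) + (m - x)\<close> is the distance of
  \<open>x\<close> to \<open>m = Min R\<close>. A point above the minimum contributes exactly this
  factor; a point below becomes the new minimum, the old one contributes the factor, and all other
  distances grow while \<open>v\<close> decreases.\<close>

lemma star_insert_le:
  assumes "finite R" "R \<noteq> {}" "x \<notin> R"
  shows "star (insert x R) \<le> v ((x - Min R) + (Min R - x)) * star R"
proof -
  define m where "m = Min R"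
  have m: "m \<in> R" "\<And>b. b \<in> R \<Longrightarrow> m \<le> b" using assms by (auto simp: m_def)
  show ?thesis
  proof (cases "m < x")
    case True
    have "Min (insert x R) = m" using m True assms by (intro Min_eqI) auto
    then have "star (insert x R) = v (x - m) * star R"
      unfolding star_def using assms by (simp add: m_def)
    then show ?thesis using True by (simp add: m_def)
  next
    case False
    then have xm: "x < m" using m(1) assms(3) by (metis linorder_neqE_nat)
    have "star (insert x R) = (\<Prod>b\<in>R. v (b - x))"
    proof (rule star_insert_min[OF assms(1)])
      fix b assume "b \<in> R"
      then show "x < b" using m(2)[of b] xm by simp
    qed
    also have "\<dots> = v (m - x) * (\<Prod>b\<in>R - {m}. v (b - x))" using assms m by (intro prod.remove) auto
    also have "\<dots> \<le> v (m - x) * (\<Prod>b\<in>R - {m}. v (b - m))"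
      using xm v_pos v_decreasing by (intro mult_left_mono prod_mono) (auto simp: less_imp_le)
    also have "(\<Prod>b\<in>R - {m}. v (b - m)) = star R"
    proof -
      have "star R = v (m - m) * (\<Prod>b\<in>R - {m}. v (b - m))"
        unfolding star_def m_def[symmetric] using assms m by (intro prod.remove) auto
      then show ?thesis by (simp add: v_0)
    qed
    finally show ?thesis using xm by (simp add: m_def)
  qed
qed

lemma sum_v_dist:
  assumes "m \<in> {e0<..e0 + k}"
  shows "(\<Sum>x\<in>{e0<..e0 + k} - {m}. (v ((x - m) + (m - x)))\<^sup>2) \<le> 2 * D k"
proof -
  let ?f = "\<lambda>x. (v ((x - m) + (m - x)))\<^sup>2"
  have e: "{e0<..e0 + k} - {m} = {e0<..<m} \<union> {m<..e0 + k}" using assms by auto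
  have "sum ?f ({e0<..<m} \<union> {m<..e0 + k}) = sum ?f {e0<..<m} + sum ?f {m<..e0 + k}"
    by (rule sum.union_disjoint) auto
  moreover have "sum ?f {e0<..<m} = (\<Sum>x\<in>{e0<..<m}. (v (m - x))\<^sup>2)"
    by (rule sum.cong) auto
  moreover have "sum ?f {m<..e0 + k} = (\<Sum>x\<in>{m<..e0 + k}. (v (x - m))\<^sup>2)"
    by (rule sum.cong) auto
  moreover have "(\<Sum>x\<in>{e0<..<m}. (v (m - x))\<^sup>2) \<le> D k"
  proof -
    have "(\<Sum>x\<in>{e0<..<m}. (v (m - x))\<^sup>2) = (\<Sum>t\<in>(\<lambda>x. m - x) ` {e0<..<m}. (v t)\<^sup>2)"
      by (subst sum.reindex) (auto simp: inj_on_def)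
    also have "\<dots> \<le> D k" unfolding D_def using assms by (intro sum_mono2) auto
    finally show ?thesis .
  qed
  moreover have "(\<Sum>x\<in>{m<..e0 + k}. (v (x - m))\<^sup>2) \<le> D k"
  proof -
    have "(\<Sum>x\<in>{m<..e0 + k}. (v (x - m))\<^sup>2) = (\<Sum>t\<in>(\<lambda>x. x - m) ` {m<..e0 + k}. (v t)\<^sup>2)"
      by (subst sum.reindex) (auto simp: inj_on_def)
    also have "\<dots> \<le> D k" unfolding D_def using assms by (intro sum_mono2) auto
    finally show ?thesis .
  qed
  ultimately show ?thesis unfolding e by linarith
qed

text \<open>Every set of size \<open>Suc s\<close> arises from some choice of one of its points;
  counting all choices only enlarges a nonnegative sum.\<close>

lemma sum_card_Suc_le:
  fixes f :: "'a set \<Rightarrow> real"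
  assumes "finite I" "\<And>S. f S \<ge> 0"
  shows "(\<Sum>S\<in>{S. S \<subseteq> I - R \<and> card S = Suc s}. f (S \<union> R)) \<le>
    (\<Sum>x\<in>I - R. \<Sum>S\<in>{S. S \<subseteq> I - insert x R \<and> card S = s}. f (S \<union> insert x R))"
proof -
  have "(\<Sum>S\<in>{S. S \<subseteq> I - R \<and> card S = Suc s}. f (S \<union> R)) \<le>
    (\<Sum>(x, S)\<in>Sigma (I - R) (\<lambda>x. {S. S \<subseteq> I - insert x R \<and> card S = s}). f (S \<union> insert x R))"
  proof (rule sum_le_included[where i = "\<lambda>(x, S). insert x S"])
    show "finite {S. S \<subseteq> I - R \<and> card S = Suc s}" using assms by simp
    show "finite (Sigma (I - R) (\<lambda>x. {S. S \<subseteq> I - insert x R \<and> card S = s}))" using assms by auto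
    show "\<forall>y\<in>Sigma (I - R) (\<lambda>x. {S. S \<subseteq> I - insert x R \<and> card S = s}). 0 \<le> (case y of (x, S) \<Rightarrow> f (S \<union> insert x R))"
      using assms by auto
    show "\<forall>S\<in>{S. S \<subseteq> I - R \<and> card S = Suc s}. \<exists>y\<in>Sigma (I - R) (\<lambda>x. {S. S \<subseteq> I - insert x R \<and> card S = s}).
      (case y of (x, S) \<Rightarrow> insert x S) = S \<and> f (S \<union> R) \<le> (case y of (x, S) \<Rightarrow> f (S \<union> insert x R))"
    proof
      fix S assume S: "S \<in> {S. S \<subseteq> I - R \<and> card S = Suc s}"
      then obtain x where x: "x \<in> S" by fastforce
      have "(x, S - {x}) \<in> Sigma (I - R) (\<lambda>x. {S. S \<subseteq> I - insert x R \<and> card S = s})" using S x by auto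
      moreover have "insert x (S - {x}) = S" "(S - {x}) \<union> insert x R = S \<union> R" using x by auto
      ultimately show "\<exists>y\<in>Sigma (I - R) (\<lambda>x. {S. S \<subseteq> I - insert x R \<and> card S = s}).
      (case y of (x, S) \<Rightarrow> insert x S) = S \<and> f (S \<union> R) \<le> (case y of (x, S) \<Rightarrow> f (S \<union> insert x R))"
        by (intro bexI[of _ "(x, S - {x})"]) auto
    qed
  qed
  then show ?thesis using assms by (subst sum.Sigma) auto
qed

text \<open>The points of \<open>S\<close> are inserted one at a time, each costing the two-sided
  sum \<open>2 * D k\<close> of squared distances to the current minimum. \<open>R\<close> is
  nonempty, so this minimum exists from the start.\<close>

lemma star_insertion_sum:
  assumes I: "I = {e0<..e0 + k}" and R: "R \<subseteq> I" "R \<noteq> {}"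
  shows "(\<Sum>S\<in>{S. S \<subseteq> I - R \<and> card S = s}. (star (S \<union> R))\<^sup>2) \<le> (2 * D k) ^ s * (star R)\<^sup>2"
  using R
proof (induction s arbitrary: R)
  case 0
  have "{S. S \<subseteq> I - R \<and> card S = 0} = {{}}" using I by (intro card_0_subsets) auto
  then show ?case by simp
next
  case (Suc s)
  have fI: "finite I" by (simp add: I)
  have fR: "finite R" using Suc.prems fI finite_subset by blast
  have mR: "Min R \<in> R" using fR Suc.prems by simp
  have Dk: "D k \<ge> 0" unfolding D_def by (intro sum_nonneg) auto
  have "(\<Sum>S\<in>{S. S \<subseteq> I - R \<and> card S = Suc s}. (star (S \<union> R))\<^sup>2) \<le>
    (\<Sum>x\<in>I - R. \<Sum>S\<in>{S. S \<subseteq> I - insert x R \<and> card S = s}. (star (S \<union> insert x R))\<^sup>2)"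
    by (rule sum_card_Suc_le[OF fI]) auto
  also have "\<dots> \<le> (\<Sum>x\<in>I - R. (2 * D k) ^ s * (star (insert x R))\<^sup>2)"
    using Suc.prems by (intro sum_mono Suc.IH) auto
  also have "\<dots> \<le> (\<Sum>x\<in>I - R. (2 * D k) ^ s * ((v ((x - Min R) + (Min R - x)))\<^sup>2 * (star R)\<^sup>2))"
  proof (intro sum_mono mult_left_mono)
    fix x assume x: "x \<in> I - R"
    have "(star (insert x R))\<^sup>2 \<le> (v ((x - Min R) + (Min R - x)) * star R)\<^sup>2"
      using star_insert_le[OF fR Suc.prems(2), of x] x star_pos[of "insert x R"]
      by (intro power_mono) (auto intro: less_imp_le)
    then show "(star (insert x R))\<^sup>2 \<le> (v ((x - Min R) + (Min R - x)))\<^sup>2 * (star R)\<^sup>2"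
      by (simp add: power_mult_distrib)
  qed (use Dk in auto)
  also have "\<dots> = (2 * D k) ^ s * (star R)\<^sup>2 * (\<Sum>x\<in>I - R. (v ((x - Min R) + (Min R - x)))\<^sup>2)"
    by (simp add: sum_distrib_left mult_ac)
  also have "\<dots> \<le> (2 * D k) ^ s * (star R)\<^sup>2 * (2 * D k)"
  proof (intro mult_left_mono)
    have "(\<Sum>x\<in>I - R. (v ((x - Min R) + (Min R - x)))\<^sup>2) \<le>
      (\<Sum>x\<in>{e0<..e0 + k} - {Min R}. (v ((x - Min R) + (Min R - x)))\<^sup>2)"
      using mR I by (intro sum_mono2) auto
    also have "\<dots> \<le> 2 * D k" using mR Suc.prems I by (intro sum_v_dist) auto
    finally show "(\<Sum>x\<in>I - R. (v ((x - Min R) + (Min R - x)))\<^sup>2) \<le> 2 * D k" .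
  qed (use Dk in auto)
  finally show ?case by (simp add: mult_ac)
qed

text \<open>The first point has \<open>k\<close> positions and star weight \<open>v 0 = 1\<close>;
  the other \<open>s\<close> are inserted. This is the variance of the disorder polynomial without
  tilt.\<close>

lemma star_square_sum:
  assumes I: "I = {e0<..e0 + k}"
  shows "(\<Sum>S\<in>{S. S \<subseteq> I \<and> card S = Suc s}. (star S)\<^sup>2) \<le> real k * (2 * D k) ^ s"
proof -
  have "(\<Sum>S\<in>{S. S \<subseteq> I - {} \<and> card S = Suc s}. (star (S \<union> {}))\<^sup>2) \<le>
    (\<Sum>x\<in>I - {}. \<Sum>S\<in>{S. S \<subseteq> I - insert x {} \<and> card S = s}. (star (S \<union> insert x {}))\<^sup>2)"
    by (rule sum_card_Suc_le) (auto simp: I)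
  also have "\<dots> \<le> (\<Sum>x\<in>I - {}. (2 * D k) ^ s * (star {x})\<^sup>2)"
    by (intro sum_mono star_insertion_sum[OF I]) auto
  also have "\<dots> = real k * (2 * D k) ^ s"
    by (simp add: star_def v_0 I)
  finally show ?thesis by simp
qed

subsection \<open>First moments of the star sums\<close>

lemma path_sum_sum:
  "path_sum K d n (\<lambda>B. \<Sum>t\<in>T. f t B) = (\<Sum>t\<in>T. path_sum K d n (f t))"
  unfolding path_sum_def by (simp add: sum_distrib_left, rule sum.swap)

lemma path_sum_add: "path_sum K d n (\<lambda>B. f B + g B) = path_sum K d n f + path_sum K d n g"
  unfolding path_sum_def by (simp add: distrib_left sum.distrib)

lemma path_sum_cmult: "path_sum K d n (\<lambda>B. c * f B) = c * path_sum K d n f"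
  unfolding path_sum_def by (simp add: sum_distrib_left mult_ac)

lemma path_sum_cong:
  "(\<And>B. B \<subseteq> {d<..n} \<Longrightarrow> f B = g B) \<Longrightarrow> path_sum K d n f = path_sum K d n g"
  unfolding path_sum_def by (intro sum.cong) auto

lemma path_sum_over_points:
  assumes "d \<le> n"
  shows "path_sum K d n (\<lambda>B. \<Sum>t\<in>B. g t (B \<inter> {t<..})) =
    (\<Sum>t\<in>{d<..n}. renewal_mass K (t - d) * path_sum K t n (g t))"
proof -
  have "path_sum K d n (\<lambda>B. \<Sum>t\<in>B. g t (B \<inter> {t<..})) =
    path_sum K d n (\<lambda>B. \<Sum>t\<in>{d<..n}. if t \<in> B then g t (B \<inter> {t<..}) else 0)"
  proof (rule path_sum_cong)
    fix B assume "B \<subseteq> {d<..n}"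
    then have "B = {d<..n} \<inter> B" by auto
    then show "(\<Sum>t\<in>B. g t (B \<inter> {t<..})) = (\<Sum>t\<in>{d<..n}. if t \<in> B then g t (B \<inter> {t<..}) else 0)"
      using sum.inter_restrict[of "{d<..n}" "\<lambda>t. g t (B \<inter> {t<..})" B] by simp
  qed
  also have "\<dots> = (\<Sum>t\<in>{d<..n}. renewal_mass K (t - d) * path_sum K t n (g t))"
    unfolding path_sum_sum by (intro sum.cong refl path_sum_markov) auto
  finally show ?thesis .
qed

text \<open>After the Markov property at the lowest chosen point \<open>t\<close>, distances are
  remeasured from \<open>t\<close>. They shrink, so \<open>v\<close> grows and the induction
  hypothesis applies; the sum over \<open>t\<close> is a weighted Green sum.\<close>

lemma path_sum_esp_le:
  assumes "d \<le> n" "n - d \<le> k"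
  shows "path_sum K d n (esp p (\<lambda>t. v (t - d))) \<le> (4 / c1 * D k) ^ p"
  using assms
proof (induction p arbitrary: d)
  case 0
  have "path_sum K d n (esp 0 (\<lambda>t. v (t - d))) = path_sum K d n (\<lambda>_. 1)"
    by (rule path_sum_cong) (meson esp_0 finite_subset finite_greaterThanAtMost)
  then show ?case using 0 by (simp add: path_sum_one)
next
  case (Suc p)
  have Dk: "D k \<ge> 0" unfolding D_def by (intro sum_nonneg) auto
  have "path_sum K d n (esp (Suc p) (\<lambda>t. v (t - d))) =
    path_sum K d n (\<lambda>B. \<Sum>t\<in>B. v (t - d) * esp p (\<lambda>t. v (t - d)) (B \<inter> {t<..}))"
    by (rule path_sum_cong, rule esp_by_min) (meson finite_subset finite_greaterThanAtMost)
  also have "\<dots> = (\<Sum>t\<in>{d<..n}. renewal_mass K (t - d) * path_sum K t n (\<lambda>B. v (t - d) * esp p (\<lambda>t. v (t - d)) B))"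
    by (rule path_sum_over_points[OF Suc.prems(1)])
  also have "\<dots> \<le> (\<Sum>t\<in>{d<..n}. renewal_mass K (t - d) * (v (t - d) * (4 / c1 * D k) ^ p))"
  proof (intro sum_mono mult_left_mono renewal_mass_nonneg)
    fix t assume t: "t \<in> {d<..n}"
    have "path_sum K t n (esp p (\<lambda>t. v (t - d))) \<le> path_sum K t n (esp p (\<lambda>s. v (s - t)))"
      using t v_pos v_decreasing by (intro path_sum_mono esp_mono) (auto intro: less_imp_le)
    also have "\<dots> \<le> (4 / c1 * D k) ^ p" using Suc.prems t by (intro Suc.IH) auto
    finally show "path_sum K t n (\<lambda>B. v (t - d) * esp p (\<lambda>t. v (t - d)) B) \<le> v (t - d) * (4 / c1 * D k) ^ p"
      unfolding path_sum_cmult using v_pos by (intro mult_left_mono) (auto intro: less_imp_le)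
  qed
  also have "\<dots> = (4 / c1 * D k) ^ p * (\<Sum>t\<in>{d<..n}. v (t - d) * renewal_mass K (t - d))"
    by (simp add: sum_distrib_left mult_ac)
  also have "\<dots> \<le> (4 / c1 * D k) ^ p * (4 / c1 * D k)"
  proof (rule mult_left_mono)
    have "(\<Sum>t\<in>{d<..n}. v (t - d) * renewal_mass K (t - d)) = (\<Sum>s\<in>(\<lambda>t. t - d) ` {d<..n}. v s * renewal_mass K s)"
      by (subst sum.reindex) (auto simp: inj_on_def)
    also have "\<dots> \<le> (\<Sum>s\<in>{1..n - d}. v s * renewal_mass K s)"
      using v_pos renewal_mass_nonneg by (intro sum_mono2) (auto intro!: mult_nonneg_nonneg intro: less_imp_le)
    also have "\<dots> \<le> 4 / c1 * D (n - d)"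
    proof (cases "n - d = 0")
      case True then show ?thesis by (simp add: D_def)
    next
      case False then show ?thesis by (intro weighted_green_sum_bound) auto
    qed
    also have "\<dots> \<le> 4 / c1 * D k" using D_mono[OF Suc.prems(2)] c1_pos by (intro mult_left_mono) auto
    finally show "(\<Sum>t\<in>{d<..n}. v (t - d) * renewal_mass K (t - d)) \<le> 4 / c1 * D k" .
  qed (use c1_pos Dk in auto)
  finally show ?case by (simp only: power_Suc2)
qed

text \<open>The base point of a star is the origin or a renewal \<open>t\<close>; the expected
  number of base points is a Green sum of order \<open>k * v k\<close>, and each carries at most
  \<open>D k ^ p\<close> up to constants.\<close>

lemma path_sum_star_sum_le:
  assumes "1 \<le> k" "n \<le> k"
  shows "path_sum K 0 n (\<lambda>B. star_sum (Suc p) (insert 0 B)) \<le> 4 / c1 * (real k * v k) * (4 / c1 * D k) ^ p"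
proof -
  have Dk: "D k \<ge> 0" unfolding D_def by (intro sum_nonneg) auto
  have "path_sum K 0 n (\<lambda>B. star_sum (Suc p) (insert 0 B)) =
    path_sum K 0 n (\<lambda>B. esp p (\<lambda>b. v (b - 0)) B + (\<Sum>t\<in>B. esp p (\<lambda>b. v (b - t)) (B \<inter> {t<..})))"
  proof (rule path_sum_cong)
    fix B assume B: "B \<subseteq> {0<..n}"
    then have f: "finite B" "0 \<notin> B" using finite_subset[of B "{0<..n}"] by auto
    have "insert 0 B \<inter> {0<..} = B" "insert 0 B \<inter> {t<..} = B \<inter> {t<..}" for t using B by auto
    then show "star_sum (Suc p) (insert 0 B) = esp p (\<lambda>b. v (b - 0)) B + (\<Sum>t\<in>B. esp p (\<lambda>b. v (b - t)) (B \<inter> {t<..}))"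
      using f by (subst star_sum_by_min) auto
  qed
  also have "\<dots> = path_sum K 0 n (esp p (\<lambda>b. v (b - 0))) +
      (\<Sum>t\<in>{0<..n}. renewal_mass K (t - 0) * path_sum K t n (esp p (\<lambda>b. v (b - t))))"
    unfolding path_sum_add by (subst path_sum_over_points) auto
  also have "\<dots> \<le> (4 / c1 * D k) ^ p + (\<Sum>t\<in>{0<..n}. renewal_mass K t * (4 / c1 * D k) ^ p)"
  proof (intro add_mono sum_mono)
    show "path_sum K 0 n (esp p (\<lambda>b. v (b - 0))) \<le> (4 / c1 * D k) ^ p"
      using assms by (intro path_sum_esp_le) auto
    fix t assume "t \<in> {0<..n}"
    then have "path_sum K t n (esp p (\<lambda>b. v (b - t))) \<le> (4 / c1 * D k) ^ p"
      using assms by (intro path_sum_esp_le) auto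
    then show "renewal_mass K (t - 0) * path_sum K t n (esp p (\<lambda>b. v (b - t))) \<le>
      renewal_mass K t * (4 / c1 * D k) ^ p"
      using renewal_mass_nonneg by (auto intro: mult_left_mono)
  qed
  also have "\<dots> = (\<Sum>t\<in>{0..n}. renewal_mass K t) * (4 / c1 * D k) ^ p"
  proof -
    have e: "{0..n} = insert 0 {0<..n}" by auto
    show ?thesis unfolding e by (simp add: renewal_mass_def sum_distrib_right distrib_right)
  qed
  also have "\<dots> \<le> (4 / c1 * (real k * v k)) * (4 / c1 * D k) ^ p"
  proof (intro mult_right_mono)
    have "(\<Sum>t\<in>{0..n}. renewal_mass K t) \<le> (\<Sum>t\<in>{0..k}. renewal_mass K t)"
      using assms renewal_mass_nonneg by (intro sum_mono2) auto
    also have "\<dots> \<le> 4 / c1 * (real k * v k)" by (rule green_sum_bound[OF assms(1)])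
    finally show "(\<Sum>t\<in>{0..n}. renewal_mass K t) \<le> 4 / c1 * (real k * v k)" .
  qed (use c1_pos Dk in auto)
  finally show ?thesis .
qed

end

section \<open>Cut-off weights and nice paths\<close>

context marginal_kernel
begin

text \<open>The cut at \<open>n\<close> makes the boundary term vanish in the summations by parts
  over \<open>{1..n}\<close>.\<close>

definition cut_v :: "nat \<Rightarrow> nat \<Rightarrow> real" where
  "cut_v n t = (if t \<le> n then v t else 0)"

lemma cut_v_simps:
  shows cut_v_dec: "\<And>s t. s \<le> t \<Longrightarrow> cut_v n t \<le> cut_v n s"
    and cut_v_nonneg: "\<And>t. cut_v n t \<ge> 0"
    and cut_v_end: "cut_v n (Suc n) = 0"
    and cut_v_sum: "(\<Sum>s\<in>{1..n}. (cut_v n s)\<^sup>2) = D n"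
  using v_decreasing v_pos by (auto simp: cut_v_def D_def less_imp_le intro!: sum.cong)

lemmas cut_v_abel_upper = abel_decreasing_bounds(1)[of "cut_v n" n for n,
    OF cut_v_dec cut_v_nonneg cut_v_end, unfolded cut_v_sum]
lemmas cut_v_abel_lower = abel_decreasing_bounds(2)[of "cut_v n" n for n,
    OF cut_v_dec cut_v_nonneg cut_v_end, unfolded cut_v_sum]

lemma D_le: "D k \<le> real k"
proof -
  have "D k \<le> (\<Sum>t\<in>{1..k}. 1)" unfolding D_def
    using v_le_1 v_pos by (intro sum_mono) (simp add: power_le_one less_imp_le)
  then show ?thesis by simp
qed

text \<open>\<open>(k * v k) * D k ^ r\<close> is the expected order of the star sum of
  \<open>r + 1\<close> points. The lower bound at top order makes the tilted mean of the test large;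
  the upper bounds at all orders control its tilted variance.\<close>

definition nice :: "real \<Rightarrow> real \<Rightarrow> nat \<Rightarrow> nat \<Rightarrow> nat set \<Rightarrow> bool" where
  "nice c C p k A \<longleftrightarrow> c * (real k * v k) * D k ^ p \<le> star_sum (Suc p) A \<and>
     (\<forall>r\<le>p. star_sum (Suc r) A \<le> C * (real k * v k) * D k ^ r)"

end

context marginal_renewal
begin

subsection \<open>Typical paths have large star sums\<close>

text \<open>About \<open>s * v s\<close> renewals typically fall within distance \<open>s\<close>;
  for small \<open>\<eta>\<close> it is unlikely that fewer than this fraction of them do.\<close>

definition rank_at :: "real \<Rightarrow> nat \<Rightarrow> nat \<Rightarrow> nat" where
  "rank_at \<eta> n s = nat \<lfloor>\<eta> * (real s * cut_v n s)\<rfloor>"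

text \<open>The part of the summation by parts that is lost at those scales \<open>s\<close> where
  the renewals after the \<open>j\<close>-th one are too sparse.\<close>

definition deficit :: "real \<Rightarrow> nat \<Rightarrow> nat \<Rightarrow> 'r \<Rightarrow> real" where
  "deficit \<eta> n j x = (\<Sum>s\<in>{1..n}. (cut_v n s - cut_v n (Suc s)) * (\<eta> * (real s * cut_v n s)) *
     indicator {x \<in> space P. \<tau> (j + rank_at \<eta> n s) x > \<tau> j x + s} x)"

lemma deficit_nonneg: "\<eta> \<ge> 0 \<Longrightarrow> deficit \<eta> n j x \<ge> 0"
  unfolding deficit_def using cut_v_dec cut_v_nonneg by (intro sum_nonneg mult_nonneg_nonneg) auto

text \<open>Each scale fails with probability at most \<open>8 * c2 * \<eta>\<close>, so the
  expected loss is quadratic in \<open>\<eta>\<close> while the main term of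
  \<open>local_density\<close> is linear. A small \<open>\<eta>\<close> makes the loss a small
  fraction.\<close>

lemma deficit_expectation:
  assumes "\<eta> > 0"
  shows "integrable P (deficit \<eta> n j)" "expectation (deficit \<eta> n j) \<le> 8 * c2 * \<eta>\<^sup>2 * D n"
proof -
  let ?w = "\<lambda>s. (cut_v n s - cut_v n (Suc s)) * (\<eta> * (real s * cut_v n s))"
  let ?S = "\<lambda>s. {x \<in> space P. \<tau> (j + rank_at \<eta> n s) x > \<tau> j x + s}"
  have m: "?S s \<in> events" if "s \<in> {1..n}" for s using that prob_tau_gt(1)[of s j "rank_at \<eta> n s"] by auto
  have i: "integrable P (\<lambda>x. ?w s * indicator (?S s) x)" if "s \<in> {1..n}" for s
    using m[OF that] by (intro integrable_mult_right integrable_real_indicator) (auto simp: emeasure_eq_measure)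
  show int: "integrable P (deficit \<eta> n j)"
    unfolding deficit_def[abs_def] by (intro Bochner_Integration.integrable_sum i)
  have "expectation (deficit \<eta> n j) = (\<Sum>s\<in>{1..n}. expectation (\<lambda>x. ?w s * indicator (?S s) x))"
    unfolding deficit_def[abs_def] by (intro Bochner_Integration.integral_sum i)
  also have "\<dots> = (\<Sum>s\<in>{1..n}. ?w s * prob (?S s))"
    using m by (intro sum.cong) auto
  also have "\<dots> \<le> (\<Sum>s\<in>{1..n}. ?w s * (8 * c2 * \<eta>))"
  proof (intro sum_mono mult_left_mono)
    fix s assume s: "s \<in> {1..n}"
    have sv: "real s * v s > 0" using s v_pos by simp
    have "real (rank_at \<eta> n s) \<le> \<eta> * (real s * v s)"
      using s sv assms by (simp add: rank_at_def cut_v_def)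
    then have "8 * c2 * real (rank_at \<eta> n s) / (real s * v s) \<le> 8 * c2 * (\<eta> * (real s * v s)) / (real s * v s)"
      using sv c2_pos by (intro divide_right_mono mult_left_mono) auto
    also have "\<dots> = 8 * c2 * \<eta>"
    proof -
      have "8 * c2 * (\<eta> * z) / z = 8 * c2 * \<eta>" if "z > 0" for z :: real using that by simp
      then show ?thesis using sv by blast
    qed
    finally show "prob (?S s) \<le> 8 * c2 * \<eta>"
      using prob_tau_gt(2)[of s j "rank_at \<eta> n s"] s by simp
    show "0 \<le> ?w s" using assms cut_v_dec cut_v_nonneg by (intro mult_nonneg_nonneg) auto
  qed
  also have "\<dots> = 8 * c2 * \<eta>\<^sup>2 * (\<Sum>s\<in>{1..n}. (cut_v n s - cut_v n (Suc s)) * (real s * cut_v n s))"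
    by (simp add: sum_distrib_left power2_eq_square mult_ac)
  also have "\<dots> \<le> 8 * c2 * \<eta>\<^sup>2 * D n"
    using cut_v_abel_upper[of n] c2_pos by (intro mult_left_mono) auto
  finally show "expectation (deficit \<eta> n j) \<le> 8 * c2 * \<eta>\<^sup>2 * D n" .
qed

lemma count_after:
  assumes x: "x \<in> space P" and r: "\<tau> (j + r) x \<le> \<tau> j x + s"
  shows "real r \<le> (\<Sum>t\<in>{1..s}. indicator (range (\<lambda>i. \<tau> i x)) (\<tau> j x + t))"
proof -
  note sm = strict_mono_tau[OF x]
  have "(\<lambda>i. \<tau> (j + i) x - \<tau> j x) ` {1..r} \<subseteq> {t\<in>{1..s}. \<tau> j x + t \<in> range (\<lambda>i. \<tau> i x)}"
  proof
    fix t assume "t \<in> (\<lambda>i. \<tau> (j + i) x - \<tau> j x) ` {1..r}"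
    then obtain i where i: "i \<in> {1..r}" "t = \<tau> (j + i) x - \<tau> j x" by auto
    have "\<tau> j x < \<tau> (j + i) x" using i strict_mono_less[OF sm, of j "j + i"] by auto
    moreover have "\<tau> (j + i) x \<le> \<tau> (j + r) x" using i strict_mono_less_eq[OF sm, of "j + i" "j + r"] by auto
    ultimately show "t \<in> {t\<in>{1..s}. \<tau> j x + t \<in> range (\<lambda>i. \<tau> i x)}" using i r by auto
  qed
  then have "card ((\<lambda>i. \<tau> (j + i) x - \<tau> j x) ` {1..r}) \<le> card {t\<in>{1..s}. \<tau> j x + t \<in> range (\<lambda>i. \<tau> i x)}"
    by (intro card_mono) auto
  moreover have "card ((\<lambda>i. \<tau> (j + i) x - \<tau> j x) ` {1..r}) = r"
  proof -
    have "inj_on (\<lambda>i. \<tau> (j + i) x - \<tau> j x) {1..r}"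
    proof (rule inj_onI)
      fix a b assume ab: "a \<in> {1..r}" "b \<in> {1..r}" "\<tau> (j + a) x - \<tau> j x = \<tau> (j + b) x - \<tau> j x"
      have "\<tau> j x < \<tau> (j + a) x" "\<tau> j x < \<tau> (j + b) x"
        using ab strict_mono_less[OF sm, of j "j + a"] strict_mono_less[OF sm, of j "j + b"] by auto
      then have "\<tau> (j + a) x = \<tau> (j + b) x" using ab by linarith
      then show "a = b" using strict_mono_eq[OF sm, of "j + a" "j + b"] by auto
    qed
    then show ?thesis by (simp add: card_image)
  qed
  moreover have "(\<Sum>t\<in>{1..s}. indicator (range (\<lambda>i. \<tau> i x)) (\<tau> j x + t) :: real) =
      real (card {t\<in>{1..s}. \<tau> j x + t \<in> range (\<lambda>i. \<tau> i x)})"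
    by (simp add: indicator_def sum.If_cases Int_def)
  ultimately show ?thesis by simp
qed

text \<open>By summation by parts the weighted number of renewals after the \<open>j\<close>-th is a
  positive combination of counts up to distance \<open>s\<close>. At good scales such a count is at
  least \<open>\<eta> * s * v s - 1\<close>; the losses from rounding telescope to at most 1, and
  the bad scales make up the deficit.\<close>

lemma local_density:
  assumes x: "x \<in> space P" and "\<eta> > 0"
  shows "\<eta> / 2 * D n - 1 - deficit \<eta> n j x \<le>
    (\<Sum>t\<in>{1..n}. v t * indicator (range (\<lambda>i. \<tau> i x)) (\<tau> j x + t))"
proof -
  let ?f = "cut_v n"
  let ?g = "\<lambda>t. indicator (range (\<lambda>i. \<tau> i x)) (\<tau> j x + t) :: real"
  let ?S = "\<lambda>s. {x \<in> space P. \<tau> (j + rank_at \<eta> n s) x > \<tau> j x + s}"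
  have w: "0 \<le> ?f s - ?f (Suc s)" for s using cut_v_dec[of s "Suc s" n] by simp
  have tel: "(\<Sum>s\<in>{1..n}. ?f s - ?f (Suc s)) \<le> 1"
  proof -
    have "(\<Sum>s\<in>{1..n}. ?f s - ?f (Suc s)) = ?f 1 - ?f (Suc n)"
      using sum_Suc_diff[of 1 n "\<lambda>s. - ?f s"] by simp
    then show ?thesis using v_le_1[of 1] cut_v_end by (simp add: cut_v_def)
  qed
  have "\<eta> / 2 * D n - 1 - deficit \<eta> n j x \<le>
    \<eta> * (\<Sum>s\<in>{1..n}. (?f s - ?f (Suc s)) * (real s * ?f s)) - (\<Sum>s\<in>{1..n}. ?f s - ?f (Suc s)) - deficit \<eta> n j x"
    using cut_v_abel_lower[of n] tel assms(2) by (intro diff_mono) (auto simp: field_simps)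
  also have "\<dots> = (\<Sum>s\<in>{1..n}. (?f s - ?f (Suc s)) *
      (\<eta> * (real s * ?f s) - 1 - \<eta> * (real s * ?f s) * indicator (?S s) x))"
    unfolding deficit_def sum_distrib_left sum_subtractf[symmetric]
    by (intro sum.cong refl) (simp add: algebra_simps)
  also have "\<dots> \<le> (\<Sum>s\<in>{1..n}. (?f s - ?f (Suc s)) * (\<Sum>t\<in>{1..s}. ?g t))"
  proof (intro sum_mono mult_left_mono w)
    fix s
    have g0: "0 \<le> (\<Sum>t\<in>{1..s}. ?g t)" by (intro sum_nonneg) auto
    show "\<eta> * (real s * ?f s) - 1 - \<eta> * (real s * ?f s) * indicator (?S s) x \<le> (\<Sum>t\<in>{1..s}. ?g t)"
    proof (cases "x \<in> ?S s")
      case True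
      then show ?thesis using g0 by simp
    next
      case False
      then have "\<tau> (j + rank_at \<eta> n s) x \<le> \<tau> j x + s" using x by auto
      then have "real (rank_at \<eta> n s) \<le> (\<Sum>t\<in>{1..s}. ?g t)" by (rule count_after[OF x])
      moreover have "\<eta> * (real s * ?f s) - 1 \<le> real (rank_at \<eta> n s)" unfolding rank_at_def by linarith
      ultimately show ?thesis using False by (simp add: indicator_def)
    qed
  qed
  also have "\<dots> = (\<Sum>t\<in>{1..n}. ?f t * ?g t)"
    using abel_summation[of ?f ?g n] cut_v_end[of n] by simp
  also have "\<dots> = (\<Sum>t\<in>{1..n}. v t * ?g t)" by (intro sum.cong) (auto simp: cut_v_def)
  finally show ?thesis .
qed

text \<open>If the deficits sum to less than \<open>m * x0\<close>, at least half of the first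
  \<open>m\<close> renewals have deficit below \<open>2 * x0\<close>. As
  \<open>\<eta> / 2 * D k' = 4 * x0\<close>, their local density is at least \<open>x0\<close>, and
  \<open>x0 - p \<ge> x0 / 2\<close> feeds \<open>esp_lower\<close>. The condition
  \<open>2 * k' \<le> n\<close> keeps all windows of length \<open>k'\<close> inside the observed
  range.\<close>

lemma star_sum_contacts_lower:
  assumes x: "x \<in> space P" and \<eta>: "\<eta> > 0" and x0: "x0 = \<eta> * D k' / 8" "1 \<le> x0" "2 * real p \<le> x0"
    and n: "2 * k' \<le> n" and m: "\<tau> m x \<le> k'" and d: "(\<Sum>j<m. deficit \<eta> k' j x) < real m * x0"
  shows "real m / 2 * ((x0 / 2) ^ p / fact p) \<le> star_sum (Suc p) (insert 0 (contacts n x))"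
proof -
  note sm = strict_mono_tau[OF x]
  define A where "A = insert 0 (contacts n x)"
  define J where "J = {j\<in>{..<m}. deficit \<eta> k' j x < 2 * x0}"
  have fA: "finite A" by (simp add: A_def contacts_def)
  have Aiff: "b \<in> A" if "b \<le> n" "b \<in> range (\<lambda>i. \<tau> i x)" for b
    using that by (auto simp: A_def contacts_def)
  have cardJ: "real m / 2 \<le> real (card J)"
  proof -
    have "real (card ({..<m} - J)) * (2 * x0) = (\<Sum>j\<in>{..<m} - J. 2 * x0)" by simp
    also have "\<dots> \<le> (\<Sum>j\<in>{..<m} - J. deficit \<eta> k' j x)" by (intro sum_mono) (auto simp: J_def)
    also have "\<dots> \<le> (\<Sum>j<m. deficit \<eta> k' j x)" using \<eta> by (intro sum_mono2 deficit_nonneg) auto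
    finally have "(real (card ({..<m} - J)) * 2) * x0 < real m * x0" using d by (simp add: mult.assoc)
    then have "real (card ({..<m} - J)) * 2 < real m" using x0(2) by simp
    moreover have "card ({..<m} - J) = m - card J"
      by (subst card_Diff_subset) (auto simp: J_def)
    moreover have "card J \<le> m" using card_mono[of "{..<m}" J] by (auto simp: J_def)
    ultimately show ?thesis by (simp add: of_nat_diff)
  qed
  have good: "(x0 / 2) ^ p / fact p \<le> esp p (\<lambda>b. v (b - a)) (A \<inter> {a<..})" if "j \<in> J" "a = \<tau> j x" for j a
  proof -
    have "\<tau> j x \<le> \<tau> m x" using that strict_mono_less_eq[OF sm, of j m] by (auto simp: J_def)
    then have a: "a \<le> k'" using m that by simp
    have "x0 \<le> \<eta> / 2 * D k' - 1 - deficit \<eta> k' j x" using that x0 by (auto simp: J_def field_simps)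
    also have "\<dots> \<le> (\<Sum>t\<in>{1..k'}. v t * indicator (range (\<lambda>i. \<tau> i x)) (\<tau> j x + t))"
      by (rule local_density[OF x \<eta>])
    also have "\<dots> = (\<Sum>t\<in>{1..k'}. if a + t \<in> range (\<lambda>i. \<tau> i x) then v t else 0)"
      using that by (intro sum.cong) (auto simp: indicator_def)
    also have "\<dots> = (\<Sum>t\<in>{t\<in>{1..k'}. a + t \<in> range (\<lambda>i. \<tau> i x)}. v t)"
      by (rule sum.inter_filter[symmetric]) simp
    also have "\<dots> = (\<Sum>b\<in>(\<lambda>t. a + t) ` {t\<in>{1..k'}. a + t \<in> range (\<lambda>i. \<tau> i x)}. v (b - a))"
      by (subst sum.reindex) auto
    also have "\<dots> \<le> (\<Sum>b\<in>A \<inter> {a<..}. v (b - a))"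
      using a n Aiff fA v_pos by (intro sum_mono2) (auto simp: less_imp_le)
    finally have s: "x0 \<le> (\<Sum>b\<in>A \<inter> {a<..}. v (b - a))" .
    have "(x0 / 2) ^ p \<le> (max 0 ((\<Sum>b\<in>A \<inter> {a<..}. v (b - a)) - real p)) ^ p"
      using s x0 by (intro power_mono) auto
    also have "\<dots> \<le> fact p * esp p (\<lambda>b. v (b - a)) (A \<inter> {a<..})"
      using fA v_pos v_le_1 by (intro esp_lower) (auto simp: less_imp_le)
    finally show ?thesis by (simp add: field_simps)
  qed
  have "real m / 2 * ((x0 / 2) ^ p / fact p) \<le> real (card J) * ((x0 / 2) ^ p / fact p)"
    using cardJ x0 by (intro mult_right_mono) auto
  also have "\<dots> = (\<Sum>j\<in>J. (x0 / 2) ^ p / fact p)" by simp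
  also have "\<dots> \<le> (\<Sum>j\<in>J. esp p (\<lambda>b. v (b - \<tau> j x)) (A \<inter> {\<tau> j x<..}))"
    using good by (intro sum_mono) auto
  also have "\<dots> = (\<Sum>a\<in>(\<lambda>j. \<tau> j x) ` J. esp p (\<lambda>b. v (b - a)) (A \<inter> {a<..}))"
    using strict_mono_imp_inj_on[OF sm] by (subst sum.reindex) (auto intro: inj_on_subset)
  also have "\<dots> \<le> (\<Sum>a\<in>A. esp p (\<lambda>b. v (b - a)) (A \<inter> {a<..}))"
  proof (intro sum_mono2 fA esp_nonneg)
    show "(\<lambda>j. \<tau> j x) ` J \<subseteq> A"
    proof
      fix a assume "a \<in> (\<lambda>j. \<tau> j x) ` J"
      then obtain j where "j \<in> J" "a = \<tau> j x" by auto
      then show "a \<in> A" using strict_mono_less_eq[OF sm, of j m] m n by (intro Aiff) (auto simp: J_def)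
    qed
  qed (use v_pos in \<open>auto simp: less_imp_le\<close>)
  also have "\<dots> = star_sum (Suc p) A" by (rule star_sum_by_min[OF fA, symmetric])
  finally show ?thesis by (simp add: A_def)
qed

lemma path_sum_of_bool: "path_sum K 0 n (\<lambda>B. of_bool (Q B)) = prob {x \<in> space P. Q (contacts n x)}"
proof -
  have "path_sum K 0 n (\<lambda>B. of_bool (Q B)) = expectation (\<lambda>x. of_bool (Q (contacts n x)))"
    using expectation_contacts(2)[of "\<lambda>B. of_bool (Q B)" n] by simp
  also have "\<dots> = expectation (indicator {x \<in> space P. Q (contacts n x)})"
    by (rule Bochner_Integration.integral_cong) (auto simp: indicator_def)
  also have "\<dots> = prob {x \<in> space P. Q (contacts n x)}"
  proof -
    have "contacts n -` {B. Q B} \<inter> space P \<in> events"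
      by (rule measurable_sets[OF measurable_contacts]) simp
    moreover have "contacts n -` {B. Q B} \<inter> space P = {x \<in> space P. Q (contacts n x)}" by auto
    ultimately have "{x \<in> space P. Q (contacts n x)} \<in> events" by simp
    then show ?thesis by simp
  qed
  finally show ?thesis .
qed

text \<open>Two bad events: too large a total deficit, where Markov's inequality gives
  \<open>8 * c2 * \<eta>^2 * D k' / x0 = 64 * c2 * \<eta>\<close>, and \<open>m\<close> renewals
  that do not fit into \<open>k'\<close>.\<close>

lemma prob_star_sum_small:
  assumes \<eta>: "\<eta> > 0" and x0: "x0 = \<eta> * D k' / 8" "1 \<le> x0" "2 * real p \<le> x0"
    and n: "2 * k' \<le> n" and k': "1 \<le> k'" and m: "1 \<le> m"
  shows "path_sum K 0 n (\<lambda>B. of_bool (star_sum (Suc p) (insert 0 B) < real m / 2 * ((x0 / 2) ^ p / fact p)))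
    \<le> 64 * c2 * \<eta> + 8 * c2 * real m / (real k' * v k')"
proof -
  let ?E1 = "{x \<in> space P. (\<Sum>j<m. deficit \<eta> k' j x) \<ge> real m * x0}"
  let ?E2 = "{x \<in> space P. \<tau> (0 + m) x > \<tau> 0 x + k'}"
  have int: "integrable P (\<lambda>x. \<Sum>j<m. deficit \<eta> k' j x)"
    by (intro Bochner_Integration.integrable_sum deficit_expectation \<eta>)
  have E1: "?E1 \<in> events" using borel_measurable_integrable[OF int] by measurable
  have E2: "?E2 \<in> events" by (rule prob_tau_gt(1)[OF k'])
  have mx: "real m * x0 > 0" using m x0 by simp
  have "prob ?E1 \<le> expectation (\<lambda>x. \<Sum>j<m. deficit \<eta> k' j x) / (real m * x0)"
    by (intro integral_Markov_inequality_measure[where A = "{}"] int mx)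
       (use \<eta> in \<open>auto intro!: sum_nonneg deficit_nonneg AE_I2\<close>)
  also have "\<dots> \<le> (\<Sum>j<m. 8 * c2 * \<eta>\<^sup>2 * D k') / (real m * x0)"
  proof (intro divide_right_mono)
    have "expectation (\<lambda>x. \<Sum>j<m. deficit \<eta> k' j x) = (\<Sum>j<m. expectation (deficit \<eta> k' j))"
      by (intro Bochner_Integration.integral_sum deficit_expectation \<eta>)
    also have "\<dots> \<le> (\<Sum>j<m. 8 * c2 * \<eta>\<^sup>2 * D k')" by (intro sum_mono deficit_expectation \<eta>)
    finally show "expectation (\<lambda>x. \<Sum>j<m. deficit \<eta> k' j x) \<le> (\<Sum>j<m. 8 * c2 * \<eta>\<^sup>2 * D k')" .
  qed (use mx in simp)
  also have "\<dots> = 64 * c2 * \<eta>"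
    using m \<eta> D_pos[OF k'] by (simp add: x0(1) power2_eq_square field_simps)
  finally have p1: "prob ?E1 \<le> 64 * c2 * \<eta>" .
  have p2: "prob ?E2 \<le> 8 * c2 * real m / (real k' * v k')" by (rule prob_tau_gt(2)[OF k'])
  have "{x \<in> space P. star_sum (Suc p) (insert 0 (contacts n x)) < real m / 2 * ((x0 / 2) ^ p / fact p)} \<subseteq> ?E1 \<union> ?E2"
  proof
    fix x assume x: "x \<in> {x \<in> space P. star_sum (Suc p) (insert 0 (contacts n x)) < real m / 2 * ((x0 / 2) ^ p / fact p)}"
    show "x \<in> ?E1 \<union> ?E2"
    proof (rule ccontr)
      assume "x \<notin> ?E1 \<union> ?E2"
      then have "\<tau> m x \<le> k'" "(\<Sum>j<m. deficit \<eta> k' j x) < real m * x0" using x start[of x] by auto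
      then show False using star_sum_contacts_lower[OF _ \<eta> x0 n, of x m] x by auto
    qed
  qed
  then have "prob {x \<in> space P. star_sum (Suc p) (insert 0 (contacts n x)) < real m / 2 * ((x0 / 2) ^ p / fact p)}
    \<le> prob (?E1 \<union> ?E2)"
    using E1 E2 by (intro finite_measure_mono) auto
  also have "\<dots> \<le> prob ?E1 + prob ?E2" using E1 E2 by (intro measure_Un_le) auto
  finally show ?thesis unfolding path_sum_of_bool using p1 p2 by linarith
qed

text \<open>The lower bound fails with probability at most \<open>\<rho> / 2\<close> by
  \<open>prob_star_sum_small\<close>; each of the \<open>p + 1\<close> upper bounds fails with
  probability at most \<open>\<rho> / (4 (p + 1))\<close> by Markov's inequality and the first
  moments. The constants are uniform in all windows of length at least
  \<open>\<epsilon> k\<close>.\<close>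

lemma nice_paths:
  assumes \<rho>: "\<rho> > 0" and \<epsilon>: "0 < \<epsilon>" "\<epsilon> \<le> 1"
  shows "\<exists>c>0. \<exists>C>0. \<exists>A. \<forall>k n. A \<le> D k \<longrightarrow> \<epsilon> * real k \<le> real n \<longrightarrow> n \<le> k \<longrightarrow>
    path_sum K 0 n (\<lambda>B. of_bool (\<not> nice c C p k (insert 0 B))) \<le> \<rho>"
proof -
  \<comment> \<open>\<open>\<eta>\<close> and \<open>\<eta>2\<close> turn the two error terms of
    \<open>prob_star_sum_small\<close> into \<open>\<rho> / 4\<close> each. The factors in
    \<open>c\<close> are what is lost by working on scale \<open>k' \<ge> \<epsilon> k / 4\<close>,
    by rounding, and in \<open>x0 / 2\<close>.\<close>
  define \<eta> where "\<eta> = \<rho> / (256 * c2)"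
  define \<eta>2 where "\<eta>2 = \<rho> / (32 * c2)"
  define c where "c = \<eta>2 * \<epsilon> / 16 * (\<eta> * \<epsilon> / 64) ^ p / fact p"
  define c4 where "c4 = max 1 (4 / c1)"
  define C where "C = 4 * real (Suc p) / \<rho> * c4 ^ Suc p"
  \<comment> \<open>The three terms ensure \<open>\<epsilon> k \<ge> 4\<close>,
    \<open>x0 \<ge> 1 + 2 p\<close> and \<open>m \<ge> 1\<close>. Since \<open>D k \<le> k\<close>,
    the condition \<open>A \<le> D k\<close> also makes \<open>k\<close> itself large.\<close>
  define A where "A = 4 / \<epsilon> + 32 * (1 + 2 * real p) / (\<eta> * \<epsilon>) + 4 / \<epsilon> * (1 / (v 1 * \<eta>2)) ^ 4"
  have pos: "\<eta> > 0" "\<eta>2 > 0" using \<rho> c2_pos by (auto simp: \<eta>_def \<eta>2_def)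
  have cpos: "c > 0" using pos \<epsilon> by (simp add: c_def)
  have Cpos: "C > 0" using \<rho> by (auto simp: C_def c4_def intro!: mult_pos_pos zero_less_power divide_pos_pos)
  have "path_sum K 0 n (\<lambda>B. of_bool (\<not> nice c C p k (insert 0 B))) \<le> \<rho>"
    if Ak: "A \<le> D k" and nk: "\<epsilon> * real k \<le> real n" "n \<le> k" for k n
  proof -
    define k' where "k' = nat \<lfloor>\<epsilon> * real k / 2\<rfloor>"
    define m where "m = nat \<lfloor>\<eta>2 * (real k' * v k')\<rfloor>"
    define x0 where "x0 = \<eta> * D k' / 8"
    have v1: "v 1 > 0" by (rule v_pos)
    have kA: "A \<le> real k" using Ak D_le[of k] by linarith
    have Ap: "4 / \<epsilon> \<le> A" "32 * (1 + 2 * real p) / (\<eta> * \<epsilon>) \<le> A" "4 / \<epsilon> * (1 / (v 1 * \<eta>2)) ^ 4 \<le> A"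
      using pos \<epsilon> v1 by (auto simp: A_def intro!: add_nonneg_nonneg mult_nonneg_nonneg)
    have \<epsilon>k: "4 \<le> \<epsilon> * real k" 
    proof -
      have "4 / \<epsilon> \<le> real k" using Ap(1) kA by linarith
      then show ?thesis using \<epsilon> by (simp add: pos_divide_le_eq mult.commute)
    qed
    have k: "1 \<le> k" using \<epsilon>k by (cases k) auto
    have k'l: "\<epsilon> * real k / 4 \<le> real k'" and k'u: "real k' \<le> \<epsilon> * real k / 2"
      using \<epsilon>k unfolding k'_def by linarith+
    have k'1: "1 \<le> k'" using k'l \<epsilon>k by linarith
    have k'k: "k' \<le> k"
    proof -
      have "\<epsilon> * real k \<le> 1 * real k" using \<epsilon> by (intro mult_right_mono) auto
      then show ?thesis using k'u by linarith
    qed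
    have k'n: "2 * k' \<le> n" using k'u nk by linarith
    have Dk: "D k > 0" by (rule D_pos[OF k])
    have Dk': "\<epsilon> / 4 * D k \<le> D k'"
    proof -
      have "\<epsilon> * real k / 4 * D k \<le> real k' * D k" using k'l Dk by (intro mult_right_mono) auto
      also have "\<dots> \<le> real k * D k'" by (rule D_scale[OF k'1 k'k])
      finally have "real k * (\<epsilon> / 4 * D k) \<le> real k * D k'" by (simp add: mult_ac)
      then show ?thesis using k by simp
    qed
    have x0l: "\<eta> * \<epsilon> / 32 * D k \<le> x0"
    proof -
      have "\<eta> / 8 * (\<epsilon> / 4 * D k) \<le> \<eta> / 8 * D k'" using Dk' pos by (intro mult_left_mono) auto
      then show ?thesis by (simp add: x0_def)
    qed
    have "1 + 2 * real p \<le> \<eta> * \<epsilon> / 32 * D k"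
    proof -
      have "32 * (1 + 2 * real p) / (\<eta> * \<epsilon>) \<le> D k" using Ap Ak by linarith
      then show ?thesis using pos \<epsilon> by (simp add: field_simps)
    qed
    then have x01: "1 \<le> x0" "2 * real p \<le> x0" using x0l by linarith+
    have kv: "\<epsilon> / 4 * (real k * v k) \<le> real k' * v k'"
    proof -
      have "\<epsilon> * real k / 4 * v k \<le> real k' * v k'"
        using k'l v_decreasing[OF k'k] v_pos[of k] by (intro mult_mono) auto
      then show ?thesis by (simp add: mult_ac)
    qed
    have big: "1 \<le> \<eta>2 * (real k' * v k')"
    proof -
      have "4 / \<epsilon> * (1 / (v 1 * \<eta>2)) ^ 4 \<le> real k" using Ap kA by linarith
      then have "\<epsilon> / 4 * (4 / \<epsilon> * (1 / (v 1 * \<eta>2)) ^ 4) \<le> \<epsilon> / 4 * real k"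
        using \<epsilon> by (intro mult_left_mono) auto
      moreover have "\<epsilon> / 4 * (4 / \<epsilon> * z) = z" for z using \<epsilon> by simp
      ultimately have "(1 / (v 1 * \<eta>2)) ^ 4 \<le> \<epsilon> * real k / 4" by simp
      then have "(1 / (v 1 * \<eta>2)) ^ 4 \<le> real k'" using k'l by linarith
      then have "((1 / (v 1 * \<eta>2)) ^ 4) powr (1/4) \<le> real k' powr (1/4)"
        by (intro powr_mono2) auto
      moreover have "((1 / (v 1 * \<eta>2)) ^ 4) powr (1/4) = 1 / (v 1 * \<eta>2)"
      proof -
        have "(y ^ 4) powr (1/4) = y" if "y > 0" for y :: real
        proof -
          have "(y ^ 4) powr (1/4) = (y powr 4) powr (1/4)" using that by simp
          also have "\<dots> = y" using that by (subst powr_powr) simp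
          finally show ?thesis .
        qed
        then show ?thesis using v1 pos by simp
      qed
      ultimately have "1 / (v 1 * \<eta>2) \<le> real k' powr (1/4)" by simp
      then have "1 \<le> \<eta>2 * (real k' powr (1/4) * v 1)" using v1 pos by (simp add: field_simps)
      also have "\<dots> \<le> \<eta>2 * (real k' * v k')" using nv_lower[OF k'1] pos by (intro mult_left_mono) auto
      finally show ?thesis .
    qed
    have m1: "1 \<le> m" using big unfolding m_def by linarith
    have mu: "real m \<le> \<eta>2 * (real k' * v k')" and ml: "\<eta>2 * (real k' * v k') / 2 \<le> real m"
    proof -
      have "1 \<le> \<lfloor>\<eta>2 * (real k' * v k')\<rfloor>" using big by (simp add: le_floor_iff)
      then have "real m = of_int \<lfloor>\<eta>2 * (real k' * v k')\<rfloor>" "1 \<le> real m"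
        unfolding m_def by linarith+
      then show "real m \<le> \<eta>2 * (real k' * v k')" "\<eta>2 * (real k' * v k') / 2 \<le> real m"
        by linarith+
    qed
    have k'v: "real k' * v k' > 0" using k'1 v_pos[of k'] by simp
    have clow: "c * (real k * v k) * D k ^ p \<le> real m / 2 * ((x0 / 2) ^ p / fact p)"
    proof -
      have "c * (real k * v k) * D k ^ p = (\<eta>2 / 4 * (\<epsilon> / 4 * (real k * v k))) * ((\<eta> * \<epsilon> / 64 * D k) ^ p / fact p)"
        unfolding c_def power_mult_distrib[of "\<eta> * \<epsilon> / 64" "D k"] by simp
      also have "\<dots> \<le> (real m / 2) * ((x0 / 2) ^ p / fact p)"
      proof (intro mult_mono divide_right_mono power_mono)
        have "\<eta>2 / 4 * (\<epsilon> / 4 * (real k * v k)) \<le> \<eta>2 / 4 * (real k' * v k')"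
          using kv pos by (intro mult_left_mono) auto
        then show "\<eta>2 / 4 * (\<epsilon> / 4 * (real k * v k)) \<le> real m / 2" using ml by linarith
        show "\<eta> * \<epsilon> / 64 * D k \<le> x0 / 2" using x0l by linarith
      qed (use pos \<epsilon> Dk in auto)
      finally show ?thesis .
    qed
    let ?bad = "\<lambda>B. star_sum (Suc p) (insert 0 B) < real m / 2 * ((x0 / 2) ^ p / fact p)"
    let ?up = "\<lambda>r. C * (real k * v k) * D k ^ r"
    have uppos: "?up r > 0" for r using Cpos k v_pos[of k] Dk by simp
    have ss0: "star_sum r B \<ge> 0" for r B
      unfolding star_sum_def by (intro sum_nonneg) (auto intro: less_imp_le star_pos)
    have "path_sum K 0 n (\<lambda>B. of_bool (\<not> nice c C p k (insert 0 B))) \<le>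
      path_sum K 0 n (\<lambda>B. of_bool (?bad B) + (\<Sum>r\<in>{..p}. (1 / ?up r) * star_sum (Suc r) (insert 0 B)))"
    proof (rule path_sum_mono)
      fix B
      have s0: "0 \<le> (\<Sum>r\<in>{..p}. (1 / ?up r) * star_sum (Suc r) (insert 0 B))"
        using uppos ss0 by (intro sum_nonneg mult_nonneg_nonneg) (auto intro: less_imp_le)
      show "of_bool (\<not> nice c C p k (insert 0 B)) \<le>
        of_bool (?bad B) + (\<Sum>r\<in>{..p}. (1 / ?up r) * star_sum (Suc r) (insert 0 B))"
      proof (cases "nice c C p k (insert 0 B) \<or> ?bad B")
        case True
        then show ?thesis using s0 by auto
      next
        case False
        then obtain r where r: "r \<le> p" "star_sum (Suc r) (insert 0 B) > ?up r"
          using clow by (auto simp: nice_def not_le)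
        have "1 \<le> (1 / ?up r) * star_sum (Suc r) (insert 0 B)" using r uppos[of r] by simp
        also have "\<dots> \<le> (\<Sum>r\<in>{..p}. (1 / ?up r) * star_sum (Suc r) (insert 0 B))"
          using r uppos ss0 by (intro member_le_sum mult_nonneg_nonneg) (auto intro: less_imp_le)
        finally show ?thesis using False by simp
      qed
    qed simp
    also have "\<dots> = path_sum K 0 n (\<lambda>B. of_bool (?bad B)) +
        (\<Sum>r\<in>{..p}. (1 / ?up r) * path_sum K 0 n (\<lambda>B. star_sum (Suc r) (insert 0 B)))"
      unfolding path_sum_add path_sum_sum path_sum_cmult ..
    also have "\<dots> \<le> (\<rho> / 4 + \<rho> / 4) + (\<Sum>r\<in>{..p}. \<rho> / (4 * real (Suc p)))"
    proof (intro add_mono sum_mono)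
      have "path_sum K 0 n (\<lambda>B. of_bool (?bad B)) \<le> 64 * c2 * \<eta> + 8 * c2 * real m / (real k' * v k')"
        by (rule prob_star_sum_small[OF pos(1) x0_def x01 k'n k'1 m1])
      also have "8 * c2 * real m / (real k' * v k') \<le> 8 * c2 * (\<eta>2 * (real k' * v k')) / (real k' * v k')"
        using mu k'v c2_pos by (intro divide_right_mono mult_left_mono) auto
      also have "\<dots> = \<rho> / 4"
      proof -
        have "8 * c2 * (\<eta>2 * z) / z = \<rho> / 4" if "z > 0" for z :: real
          using that c2_pos by (simp add: \<eta>2_def)
        then show ?thesis using k'v by blast
      qed
      also have "64 * c2 * \<eta> = \<rho> / 4" using c2_pos by (simp add: \<eta>_def)
      finally show "path_sum K 0 n (\<lambda>B. of_bool (?bad B)) \<le> \<rho> / 4 + \<rho> / 4" by simp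
      fix r assume r: "r \<in> {..p}"
      have kvp: "real k * v k * D k ^ r > 0" using k v_pos[of k] Dk by simp
      have "path_sum K 0 n (\<lambda>B. star_sum (Suc r) (insert 0 B)) \<le> 4 / c1 * (real k * v k) * (4 / c1 * D k) ^ r"
        by (rule path_sum_star_sum_le[OF k nk(2)])
      also have "\<dots> = (4 / c1) ^ Suc r * (real k * v k * D k ^ r)" by (simp add: power_mult_distrib power_divide)
      also have "\<dots> \<le> c4 ^ Suc p * (real k * v k * D k ^ r)"
      proof (rule mult_right_mono)
        have "(4 / c1) ^ Suc r \<le> c4 ^ Suc r" using c1_pos by (intro power_mono) (auto simp: c4_def)
        also have "\<dots> \<le> c4 ^ Suc p" using r by (intro power_increasing) (auto simp: c4_def)
        finally show "(4 / c1) ^ Suc r \<le> c4 ^ Suc p" .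
      qed (use kvp in simp)
      finally have "(1 / ?up r) * path_sum K 0 n (\<lambda>B. star_sum (Suc r) (insert 0 B)) \<le>
          (1 / ?up r) * (c4 ^ Suc p * (real k * v k * D k ^ r))"
        using uppos[of r] by (intro mult_left_mono) auto
      also have "\<dots> = c4 ^ Suc p / C"
      proof -
        have "1 / (C * z) * (q * z) = q / C" if "z > 0" for z q :: real using that by simp
        from this[OF kvp, of "c4 ^ Suc p"] show ?thesis by (simp only: mult.assoc)
      qed
      also have "\<dots> = \<rho> / (4 * real (Suc p))"
      proof -
        have "c4 > 0" by (simp add: c4_def)
        then show ?thesis using \<rho> unfolding C_def by (simp add: divide_simps)
      qed
      finally show "(1 / ?up r) * path_sum K 0 n (\<lambda>B. star_sum (Suc r) (insert 0 B)) \<le> \<rho> / (4 * real (Suc p))" .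
    qed
    also have "\<dots> \<le> \<rho>"
    proof -
      have "(\<Sum>r\<in>{..p}. \<rho> / (4 * real (Suc p))) = \<rho> / 4" by (simp del: of_nat_Suc)
      then show ?thesis using \<rho> by linarith
    qed
    finally show ?thesis .
  qed
  then show ?thesis using cpos Cpos by blast
qed

end

subsection \<open>A polynomial chaos of the disorder\<close>

text \<open>One disorder variable under its law \<open>\<nu>\<close> and under the law with density
  \<open>e\<close>. The same \<open>s0\<close> bounds the variance in both cases, which is why
  \<open>s0 \<ge> 1\<close>.\<close>

locale tilted_site = prob_space \<nu> for \<nu> :: "real measure" +
  fixes e :: "real \<Rightarrow> real" and \<mu> s0 :: real
  assumes sets_eq [simp]: "sets \<nu> = sets borel"
    and site_integrable: "integrable \<nu> (\<lambda>x. x)" "integrable \<nu> (\<lambda>x. x\<^sup>2)"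
    and site_mean: "(\<integral>x. x \<partial>\<nu>) = 0"
    and site_variance: "(\<integral>x. x\<^sup>2 \<partial>\<nu>) = 1"
    and density_nonneg: "\<And>x. e x \<ge> 0"
    and density_integrable: "integrable \<nu> e" "integrable \<nu> (\<lambda>x. x * e x)" "integrable \<nu> (\<lambda>x. x\<^sup>2 * e x)"
    and density_total: "(\<integral>x. e x \<partial>\<nu>) = 1"
    and tilted_mean: "(\<integral>x. x * e x \<partial>\<nu>) = \<mu>"
    and tilted_variance: "(\<integral>x. (x - \<mu>)\<^sup>2 * e x \<partial>\<nu>) \<le> s0"
    and s0_ge: "s0 \<ge> 1"
    and mean_pos: "\<mu> > 0"
begin

abbreviation PM :: "nat set \<Rightarrow> (nat \<Rightarrow> real) measure" where
  "PM I \<equiv> PiM I (\<lambda>_. \<nu>)"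

lemma prob_space_PM: "prob_space (PM I)"
  by (rule prob_space_PiM) (rule prob_space_axioms)

lemma PM_prod:
  assumes "finite I" "\<And>i. i \<in> I \<Longrightarrow> integrable \<nu> (f i)"
  shows "integrable (PM I) (\<lambda>x. \<Prod>i\<in>I. f i (x i) :: real)"
    "(\<integral>x. (\<Prod>i\<in>I. f i (x i) :: real) \<partial>PM I) = (\<Prod>i\<in>I. \<integral>t. f i t \<partial>\<nu>)"
proof -
  interpret product_prob_space "\<lambda>_::nat. \<nu>" UNIV by unfold_locales
  show "integrable (PM I) (\<lambda>x. \<Prod>i\<in>I. f i (x i) :: real)"
    by (rule product_integrable_prod[OF assms])
  show "(\<integral>x. (\<Prod>i\<in>I. f i (x i) :: real) \<partial>PM I) = (\<Prod>i\<in>I. \<integral>t. f i t \<partial>\<nu>)"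
    by (rule product_integral_prod[OF assms])
qed

definition shift :: "nat set \<Rightarrow> nat \<Rightarrow> real" where
  "shift A a = (if a \<in> A then \<mu> else 0)"

definition tilt :: "nat set \<Rightarrow> (nat \<Rightarrow> real) \<Rightarrow> real" where
  "tilt A x = (\<Prod>a\<in>A. e (x a))"

text \<open>Each variable is centred at its mean under the law tilted along \<open>A\<close>; this
  makes the monomials orthogonal for that law.\<close>

definition monomial :: "nat set \<Rightarrow> nat set \<Rightarrow> (nat \<Rightarrow> real) \<Rightarrow> real" where
  "monomial A S x = (\<Prod>a\<in>S. x a - shift A a)"

definition site_weight :: "nat set \<Rightarrow> nat \<Rightarrow> real \<Rightarrow> real" where
  "site_weight A a t = (if a \<in> A then e t else 1)"

lemma site_moments:
  shows "integrable \<nu> (site_weight A a)" "(\<integral>t. site_weight A a t \<partial>\<nu>) = 1"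
    "integrable \<nu> (\<lambda>t. site_weight A a t * (t - shift A a))"
    "(\<integral>t. site_weight A a t * (t - shift A a) \<partial>\<nu>) = 0"
    "integrable \<nu> (\<lambda>t. site_weight A a t * (t - shift A a)\<^sup>2)"
    "(\<integral>t. site_weight A a t * (t - shift A a)\<^sup>2 \<partial>\<nu>) \<le> s0"
proof -
  have e1: "(\<lambda>t. e t * (t - \<mu>)) = (\<lambda>t. t * e t - \<mu> * e t)" by (auto simp: algebra_simps)
  have e2: "(\<lambda>t. e t * (t - \<mu>)\<^sup>2) = (\<lambda>t. t\<^sup>2 * e t - 2 * \<mu> * (t * e t) + \<mu>\<^sup>2 * e t)"
    by (auto simp: algebra_simps power2_eq_square)
  have i1: "integrable \<nu> (\<lambda>t. e t * (t - \<mu>))" unfolding e1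
    using density_integrable by (intro Bochner_Integration.integrable_diff integrable_mult_right) auto
  have i2: "integrable \<nu> (\<lambda>t. e t * (t - \<mu>)\<^sup>2)" unfolding e2
    using density_integrable
    by (intro Bochner_Integration.integrable_diff Bochner_Integration.integrable_add integrable_mult_right) auto
  have z: "(\<integral>t. e t * (t - \<mu>) \<partial>\<nu>) = 0" unfolding e1
    using density_integrable density_total tilted_mean by (subst Bochner_Integration.integral_diff) auto
  have one: "(\<integral>t. 1 \<partial>\<nu>) = (1::real)" by (simp add: prob_space)
  show "integrable \<nu> (site_weight A a)" "(\<integral>t. site_weight A a t \<partial>\<nu>) = 1"
    using density_integrable density_total one by (cases "a \<in> A"; simp add: site_weight_def[abs_def])+
  show "integrable \<nu> (\<lambda>t. site_weight A a t * (t - shift A a))"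
    "(\<integral>t. site_weight A a t * (t - shift A a) \<partial>\<nu>) = 0"
    using i1 z site_integrable site_mean by (auto simp: site_weight_def shift_def)
  show "integrable \<nu> (\<lambda>t. site_weight A a t * (t - shift A a)\<^sup>2)"
    "(\<integral>t. site_weight A a t * (t - shift A a)\<^sup>2 \<partial>\<nu>) \<le> s0"
    using i2 site_integrable site_variance tilted_variance s0_ge
    by (auto simp: site_weight_def shift_def mult.commute)
qed

text \<open>The integral factorizes over the sites. A site in exactly one of \<open>S\<close>,
  \<open>S'\<close> contributes a centred first moment, that is 0; a common site contributes a
  variance of at most \<open>s0\<close>.\<close>

lemma tilt_monomials:
  assumes "finite I" "A \<subseteq> I" "S \<subseteq> I" "S' \<subseteq> I"
  shows "integrable (PM I) (\<lambda>x. tilt A x * (monomial A S x * monomial A S' x))"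
    and "S \<noteq> S' \<Longrightarrow> (\<integral>x. tilt A x * (monomial A S x * monomial A S' x) \<partial>PM I) = 0"
    and "S = S' \<Longrightarrow> (\<integral>x. tilt A x * (monomial A S x * monomial A S' x) \<partial>PM I) \<le> s0 ^ card S"
proof -
  define f where "f a t = site_weight A a t * ((if a \<in> S then t - shift A a else 1) * (if a \<in> S' then t - shift A a else 1))" for a t
  have fcases: "f a = (if a \<in> S \<and> a \<in> S' then (\<lambda>t. site_weight A a t * (t - shift A a)\<^sup>2)
      else if a \<in> S \<or> a \<in> S' then (\<lambda>t. site_weight A a t * (t - shift A a)) else site_weight A a)" for a
    by (auto simp: f_def fun_eq_iff power2_eq_square)
  have fint: "integrable \<nu> (f a)" for a
    unfolding fcases using site_moments[of A a] by auto
  have ext: "(\<Prod>a\<in>T. g a) = (\<Prod>a\<in>I. if a \<in> T then g a else 1)" if "T \<subseteq> I" for T and g :: "nat \<Rightarrow> real"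
    using that assms(1) by (simp add: prod.inter_restrict[symmetric] Int_absorb1)
  have eq: "tilt A x * (monomial A S x * monomial A S' x) = (\<Prod>a\<in>I. f a (x a))" for x
    unfolding tilt_def monomial_def ext[OF assms(2)] ext[OF assms(3)] ext[OF assms(4)]
      f_def site_weight_def prod.distrib by simp
  show "integrable (PM I) (\<lambda>x. tilt A x * (monomial A S x * monomial A S' x))"
    unfolding eq by (rule PM_prod(1)[OF assms(1) fint])
  have int: "(\<integral>x. tilt A x * (monomial A S x * monomial A S' x) \<partial>PM I) = (\<Prod>a\<in>I. \<integral>t. f a t \<partial>\<nu>)"
    unfolding eq by (rule PM_prod(2)[OF assms(1) fint])
  show "(\<integral>x. tilt A x * (monomial A S x * monomial A S' x) \<partial>PM I) = 0" if "S \<noteq> S'"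
  proof -
    obtain a where "a \<in> (S - S') \<union> (S' - S)" using \<open>S \<noteq> S'\<close> by blast
    then have a: "a \<in> I" "a \<in> S \<union> S'" "\<not> (a \<in> S \<and> a \<in> S')" using assms by auto
    then have "(\<integral>t. f a t \<partial>\<nu>) = 0" unfolding fcases using site_moments(4)[of A a] by auto
    then show ?thesis unfolding int using a assms(1) by (intro prod_zero) auto
  qed
  show "(\<integral>x. tilt A x * (monomial A S x * monomial A S' x) \<partial>PM I) \<le> s0 ^ card S" if "S = S'"
  proof -
    have nn: "0 \<le> (\<integral>t. f a t \<partial>\<nu>)" for a
      using that density_nonneg by (intro integral_nonneg_AE AE_I2) (auto simp: f_def site_weight_def)
    have "(\<Prod>a\<in>I. \<integral>t. f a t \<partial>\<nu>) \<le> (\<Prod>a\<in>I. if a \<in> S then s0 else 1)"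
      using nn that site_moments[of A] by (intro prod_mono) (auto simp: fcases)
    also have "\<dots> = s0 ^ card S" by (subst ext[OF assms(3), symmetric]) simp
    finally show ?thesis unfolding int .
  qed
qed

lemma tilted_second_moment:
  assumes "finite I" "A \<subseteq> I" "finite F" "\<And>S. S \<in> F \<Longrightarrow> S \<subseteq> I"
  shows "integrable (PM I) (\<lambda>x. tilt A x * (\<Sum>S\<in>F. c S * monomial A S x)\<^sup>2)"
    and "(\<integral>x. tilt A x * (\<Sum>S\<in>F. c S * monomial A S x)\<^sup>2 \<partial>PM I) \<le> (\<Sum>S\<in>F. (c S)\<^sup>2 * s0 ^ card S)"
proof -
  let ?m = "\<lambda>S S' x. tilt A x * (monomial A S x * monomial A S' x)"
  have eq: "tilt A x * (\<Sum>S\<in>F. c S * monomial A S x)\<^sup>2 = (\<Sum>S\<in>F. \<Sum>S'\<in>F. c S * c S' * ?m S S' x)" for x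
    by (simp add: power2_eq_square sum_product sum_distrib_left mult_ac)
  have i: "integrable (PM I) (\<lambda>x. c S * c S' * ?m S S' x)" if "S \<in> F" "S' \<in> F" for S S'
    by (intro integrable_mult_right tilt_monomials assms that)
  show "integrable (PM I) (\<lambda>x. tilt A x * (\<Sum>S\<in>F. c S * monomial A S x)\<^sup>2)"
    unfolding eq by (intro Bochner_Integration.integrable_sum i)
  have "(\<integral>x. tilt A x * (\<Sum>S\<in>F. c S * monomial A S x)\<^sup>2 \<partial>PM I) =
    (\<Sum>S\<in>F. \<Sum>S'\<in>F. c S * c S' * (\<integral>x. ?m S S' x \<partial>PM I))"
    unfolding eq
    by (subst Bochner_Integration.integral_sum, intro Bochner_Integration.integrable_sum i, assumption+)
       (intro sum.cong refl, subst Bochner_Integration.integral_sum, rule i, assumption+, simp)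
  also have "\<dots> = (\<Sum>S\<in>F. c S * c S * (\<integral>x. ?m S S x \<partial>PM I))"
  proof (rule sum.cong[OF refl])
    fix S assume S: "S \<in> F"
    have "(\<Sum>S'\<in>F. c S * c S' * (\<integral>x. ?m S S' x \<partial>PM I)) = (\<Sum>S'\<in>F. if S' = S then c S * c S * (\<integral>x. ?m S S x \<partial>PM I) else 0)"
      using S assms tilt_monomials(2)[OF assms(1,2)] by (intro sum.cong) auto
    then show "(\<Sum>S'\<in>F. c S * c S' * (\<integral>x. ?m S S' x \<partial>PM I)) = c S * c S * (\<integral>x. ?m S S x \<partial>PM I)"
      using S assms by simp
  qed
  also have "\<dots> \<le> (\<Sum>S\<in>F. (c S)\<^sup>2 * s0 ^ card S)"
    using assms tilt_monomials(3)[OF assms(1,2)]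
    by (intro sum_mono) (auto simp: power2_eq_square intro!: mult_left_mono)
  finally show "(\<integral>x. tilt A x * (\<Sum>S\<in>F. c S * monomial A S x)\<^sup>2 \<partial>PM I) \<le> (\<Sum>S\<in>F. (c S)\<^sup>2 * s0 ^ card S)" .
qed

lemma tilt_nonneg: "tilt A x \<ge> 0"
  unfolding tilt_def using density_nonneg by (intro prod_nonneg) auto

lemma tilt_integral:
  assumes "finite I" "A \<subseteq> I"
  shows "integrable (PM I) (tilt A)" "(\<integral>x. tilt A x \<partial>PM I) = 1"
proof -
  have eq: "tilt A x = (\<Prod>a\<in>I. site_weight A a (x a))" for x
    unfolding tilt_def site_weight_def
    using assms by (simp add: prod.inter_restrict[symmetric] Int_absorb1)
  show "integrable (PM I) (tilt A)" "(\<integral>x. tilt A x \<partial>PM I) = 1"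
    unfolding eq[abs_def] using PM_prod[OF assms(1), of "\<lambda>a. site_weight A a"] site_moments(1,2) by auto
qed

end

locale tilted_chaos = marginal_kernel K v c1 c2 + tilted_site \<nu> e \<mu> s0
  for K v c1 c2 \<nu> e \<mu> s0
begin

definition chaos :: "nat set \<Rightarrow> nat \<Rightarrow> (nat \<Rightarrow> real) \<Rightarrow> real" where
  "chaos I q x = (\<Sum>R\<in>{R. R \<subseteq> I \<and> card R = q}. star R * (\<Prod>a\<in>R. x a))"

text \<open>The coefficients of the chaos in the basis of monomials centred for the tilt along
  \<open>A\<close>, obtained by expanding each product of
  \<open>(x a - shift A a) + shift A a\<close>. The coefficient of \<open>{}\<close> is the tilted
  mean.\<close>

definition coef :: "nat set \<Rightarrow> nat \<Rightarrow> nat set \<Rightarrow> nat set \<Rightarrow> real" where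
  "coef I q A S = (\<Sum>R\<in>{R. R \<subseteq> I \<and> card R = q}. if S \<subseteq> R then star R * (\<Prod>a\<in>R - S. shift A a) else 0)"

lemma chaos_expand:
  assumes "finite I"
  shows "chaos I q x = (\<Sum>S\<in>Pow I. coef I q A S * monomial A S x)"
proof -
  have "chaos I q x = (\<Sum>R\<in>{R. R \<subseteq> I \<and> card R = q}. \<Sum>S\<in>Pow I.
      (if S \<subseteq> R then star R * (\<Prod>a\<in>R - S. shift A a) else 0) * monomial A S x)"
    unfolding chaos_def
  proof (rule sum.cong[OF refl])
    fix R assume R: "R \<in> {R. R \<subseteq> I \<and> card R = q}"
    then have fR: "finite R" using assms finite_subset by blast
    have "(\<Prod>a\<in>R. x a) = (\<Prod>a\<in>R. (x a - shift A a) + shift A a)" by simp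
    also have "\<dots> = (\<Sum>S\<in>Pow R. monomial A S x * (\<Prod>a\<in>R - S. shift A a))"
      unfolding monomial_def by (rule prod_add[OF fR])
    finally have "star R * (\<Prod>a\<in>R. x a) = (\<Sum>S\<in>Pow R. star R * (\<Prod>a\<in>R - S. shift A a) * monomial A S x)"
      by (simp add: sum_distrib_left mult_ac)
    also have "\<dots> = (\<Sum>S\<in>Pow I. (if S \<subseteq> R then star R * (\<Prod>a\<in>R - S. shift A a) else 0) * monomial A S x)"
      using R assms by (intro sum.mono_neutral_cong_left) auto
    finally show "star R * (\<Prod>a\<in>R. x a) = (\<Sum>S\<in>Pow I. (if S \<subseteq> R then star R * (\<Prod>a\<in>R - S. shift A a) else 0) * monomial A S x)" .
  qed
  also have "\<dots> = (\<Sum>S\<in>Pow I. coef I q A S * monomial A S x)"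
    unfolding coef_def sum_distrib_right by (rule sum.swap)
  finally show ?thesis .
qed

text \<open>The points outside \<open>S\<close> contribute a tilted mean, which vanishes off
  \<open>A\<close>. So only sets made of \<open>S\<close> and path points survive, each path point
  giving a factor \<open>\<mu>\<close>.\<close>

lemma coef_eq:
  assumes "finite I" "A \<subseteq> I" "S \<subseteq> I" "card S \<le> q"
  shows "coef I q A S = \<mu> ^ (q - card S) * (\<Sum>R\<in>{R. R \<subseteq> A - S \<and> card R = q - card S}. star (S \<union> R))"
proof -
  have fS: "finite S" using assms finite_subset by blast
  have "coef I q A S = (\<Sum>R\<in>{R. R \<subseteq> I \<and> card R = q \<and> S \<subseteq> R \<and> R - S \<subseteq> A}. \<mu> ^ (q - card S) * star R)"
    unfolding coef_def
  proof (rule sum.mono_neutral_cong_right)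
    show "\<forall>R\<in>{R. R \<subseteq> I \<and> card R = q} - {R. R \<subseteq> I \<and> card R = q \<and> S \<subseteq> R \<and> R - S \<subseteq> A}.
        (if S \<subseteq> R then star R * (\<Prod>a\<in>R - S. shift A a) else 0) = 0"
    proof
      fix R assume R: "R \<in> {R. R \<subseteq> I \<and> card R = q} - {R. R \<subseteq> I \<and> card R = q \<and> S \<subseteq> R \<and> R - S \<subseteq> A}"
      have fR: "finite (R - S)" using R assms finite_subset[of R I] by auto
      show "(if S \<subseteq> R then star R * (\<Prod>a\<in>R - S. shift A a) else 0) = 0"
      proof (cases "S \<subseteq> R")
        case True
        then obtain a where "a \<in> R - S" "a \<notin> A" using R by blast
        then have "(\<Prod>a\<in>R - S. shift A a) = 0" using fR by (intro prod_zero) (auto simp: shift_def)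
        then show ?thesis by simp
      qed simp
    qed
    fix R assume R: "R \<in> {R. R \<subseteq> I \<and> card R = q \<and> S \<subseteq> R \<and> R - S \<subseteq> A}"
    then have "(\<Prod>a\<in>R - S. shift A a) = (\<Prod>a\<in>R - S. \<mu>)" by (intro prod.cong) (auto simp: shift_def)
    also have "\<dots> = \<mu> ^ (q - card S)" using R fS by (simp add: card_Diff_subset)
    finally show "(if S \<subseteq> R then star R * (\<Prod>a\<in>R - S. shift A a) else 0) = \<mu> ^ (q - card S) * star R"
      using R by simp
  qed (use assms in auto)
  also have "\<dots> = (\<Sum>R\<in>{R. R \<subseteq> A - S \<and> card R = q - card S}. \<mu> ^ (q - card S) * star (S \<union> R))"
  proof (rule sum.reindex_bij_witness[where i = "\<lambda>R. S \<union> R" and j = "\<lambda>R. R - S"])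
    fix R assume R: "R \<in> {R. R \<subseteq> A - S \<and> card R = q - card S}"
    then have fR: "finite R" using assms finite_subset[of R I] by blast
    have "card (S \<union> R) = card S + card R" using R fR fS by (intro card_Un_disjoint) auto
    then show "S \<union> R \<in> {R. R \<subseteq> I \<and> card R = q \<and> S \<subseteq> R \<and> R - S \<subseteq> A}" using R assms by auto
    show "S \<union> R - S = R" using R by auto
  next
    fix R assume R: "R \<in> {R. R \<subseteq> I \<and> card R = q \<and> S \<subseteq> R \<and> R - S \<subseteq> A}"
    then show "R - S \<in> {R. R \<subseteq> A - S \<and> card R = q - card S}" using fS by (auto simp: card_Diff_subset)
    show "S \<union> (R - S) = R" using R by auto
    then show "\<mu> ^ (q - card S) * star (S \<union> (R - S)) = \<mu> ^ (q - card S) * star R" by simp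
  qed
  finally show ?thesis by (simp add: sum_distrib_left)
qed

lemma coef_empty:
  assumes "finite I" "A \<subseteq> I" shows "coef I q A {} = \<mu> ^ q * star_sum q A"
  using coef_eq[OF assms, of "{}" q] by (simp add: star_sum_def)

lemma coef_zero:
  assumes "finite I" "card S > q" shows "coef I q A S = 0"
proof -
  have "\<not> S \<subseteq> R" if "R \<subseteq> I" "card R = q" for R
    using that assms card_mono[of R S] finite_subset[of R I] by fastforce
  then show ?thesis unfolding coef_def by (intro sum.neutral) auto
qed

text \<open>Cauchy--Schwarz with weights \<open>star R\<close> decouples the sum over the inserted points \<open>S\<close> from the sum
  over the points \<open>R\<close> of the path.\<close>

lemma insertion_second_moment:
  assumes I: "I = {e0<..e0 + k}" and A: "A \<subseteq> I" and r: "r \<ge> 1"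
  shows "(\<Sum>S\<in>{S. S \<subseteq> I \<and> card S = s}. (\<Sum>R\<in>{R. R \<subseteq> A - S \<and> card R = r}. star (S \<union> R))\<^sup>2)
    \<le> (2 * D k) ^ s * (star_sum r A)\<^sup>2"
proof -
  have fI: "finite I" by (simp add: I)
  have fA: "finite A" using fI A finite_subset by blast
  let ?RA = "{R. R \<subseteq> A \<and> card R = r}"
  have cs: "(\<Sum>R\<in>{R. R \<subseteq> A - S \<and> card R = r}. star (S \<union> R))\<^sup>2 \<le>
     star_sum r A * (\<Sum>R\<in>{R. R \<subseteq> A - S \<and> card R = r}. (star (S \<union> R))\<^sup>2 / star R)" for S
  proof -
    let ?T = "{R. R \<subseteq> A - S \<and> card R = r}"
    have "(\<Sum>R\<in>?T. star (S \<union> R)) = (\<Sum>R\<in>?T. sqrt (star R) * (star (S \<union> R) / sqrt (star R)))"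
      using star_pos by (intro sum.cong) (auto simp: less_imp_neq[symmetric])
    then have "(\<Sum>R\<in>?T. star (S \<union> R))\<^sup>2 \<le> (\<Sum>R\<in>?T. (sqrt (star R))\<^sup>2) * (\<Sum>R\<in>?T. (star (S \<union> R) / sqrt (star R))\<^sup>2)"
      using Cauchy_Schwarz_ineq_sum[of "\<lambda>R. sqrt (star R)" "\<lambda>R. star (S \<union> R) / sqrt (star R)" ?T] by simp
    also have "\<dots> = (\<Sum>R\<in>?T. star R) * (\<Sum>R\<in>?T. (star (S \<union> R))\<^sup>2 / star R)"
      using star_pos by (simp add: power_divide less_imp_le)
    also have "\<dots> \<le> star_sum r A * (\<Sum>R\<in>?T. (star (S \<union> R))\<^sup>2 / star R)"
      unfolding star_sum_def using fA star_pos
      by (intro mult_right_mono sum_mono2 sum_nonneg) (auto simp: less_imp_le)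
    finally show ?thesis .
  qed
  have ss0: "0 \<le> star_sum r A" unfolding star_sum_def by (intro sum_nonneg) (auto intro: less_imp_le star_pos)
  have "(\<Sum>S\<in>{S. S \<subseteq> I \<and> card S = s}. (\<Sum>R\<in>{R. R \<subseteq> A - S \<and> card R = r}. star (S \<union> R))\<^sup>2) \<le>
    (\<Sum>S\<in>{S. S \<subseteq> I \<and> card S = s}. star_sum r A * (\<Sum>R\<in>{R. R \<subseteq> A - S \<and> card R = r}. (star (S \<union> R))\<^sup>2 / star R))"
    by (intro sum_mono cs)
  also have "\<dots> = star_sum r A * (\<Sum>S\<in>{S. S \<subseteq> I \<and> card S = s}. \<Sum>R\<in>{R\<in>?RA. R \<inter> S = {}}. (star (S \<union> R))\<^sup>2 / star R)"
  proof -
    have "{R. R \<subseteq> A - S \<and> card R = r} = {R\<in>?RA. R \<inter> S = {}}" for S by auto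
    then show ?thesis by (simp add: sum_distrib_left)
  qed
  finally have le: "(\<Sum>S\<in>{S. S \<subseteq> I \<and> card S = s}. (\<Sum>R\<in>{R. R \<subseteq> A - S \<and> card R = r}. star (S \<union> R))\<^sup>2) \<le>
    star_sum r A * (\<Sum>S\<in>{S. S \<subseteq> I \<and> card S = s}. \<Sum>R\<in>{R\<in>?RA. R \<inter> S = {}}. (star (S \<union> R))\<^sup>2 / star R)" .
  have "(\<Sum>S\<in>{S. S \<subseteq> I \<and> card S = s}. \<Sum>R\<in>{R\<in>?RA. R \<inter> S = {}}. (star (S \<union> R))\<^sup>2 / star R) =
    (\<Sum>R\<in>?RA. \<Sum>S\<in>{S\<in>{S. S \<subseteq> I \<and> card S = s}. R \<inter> S = {}}. (star (S \<union> R))\<^sup>2 / star R)"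
    using fI fA by (intro sum.swap_restrict) auto
  also have "\<dots> \<le> (\<Sum>R\<in>?RA. (2 * D k) ^ s * star R)"
  proof (rule sum_mono)
    fix R assume R: "R \<in> ?RA"
    have e: "{S\<in>{S. S \<subseteq> I \<and> card S = s}. R \<inter> S = {}} = {S. S \<subseteq> I - R \<and> card S = s}" by auto
    have "(\<Sum>S\<in>{S. S \<subseteq> I - R \<and> card S = s}. (star (S \<union> R))\<^sup>2) \<le> (2 * D k) ^ s * (star R)\<^sup>2"
      using R A r by (intro star_insertion_sum[OF I]) auto
    then have "(\<Sum>S\<in>{S. S \<subseteq> I - R \<and> card S = s}. (star (S \<union> R))\<^sup>2) / star R \<le> (2 * D k) ^ s * (star R)\<^sup>2 / star R"
      using star_pos[of R] by (intro divide_right_mono) auto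
    then show "(\<Sum>S\<in>{S\<in>{S. S \<subseteq> I \<and> card S = s}. R \<inter> S = {}}. (star (S \<union> R))\<^sup>2 / star R) \<le> (2 * D k) ^ s * star R"
      unfolding e using star_pos[of R] by (simp add: sum_divide_distrib[symmetric] power2_eq_square)
  qed
  also have "\<dots> = (2 * D k) ^ s * star_sum r A" by (simp add: star_sum_def sum_distrib_left)
  finally have "star_sum r A * (\<Sum>S\<in>{S. S \<subseteq> I \<and> card S = s}. \<Sum>R\<in>{R\<in>?RA. R \<inter> S = {}}. (star (S \<union> R))\<^sup>2 / star R) \<le>
    star_sum r A * ((2 * D k) ^ s * star_sum r A)" by (rule mult_left_mono) (rule ss0)
  with le show ?thesis by (simp add: power2_eq_square mult_ac)
qed

text \<open>Dropping the coefficient of \<open>{}\<close> centres the chaos, and orthogonality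
  reduces the variance to squared coefficients. Grouped by \<open>s = card S\<close>, the top term
  \<open>s = Suc p\<close> is pure noise, independent of the path; the others mix \<open>s\<close>
  free points with \<open>Suc p - s\<close> points of \<open>A\<close>.\<close>

lemma chaos_second_moment:
  assumes I: "I = {e0<..e0 + k}" and A: "A \<subseteq> I"
  shows "integrable (PM I) (\<lambda>x. tilt A x * (chaos I (Suc p) x - \<mu> ^ Suc p * star_sum (Suc p) A)\<^sup>2)"
    and "(\<integral>x. tilt A x * (chaos I (Suc p) x - \<mu> ^ Suc p * star_sum (Suc p) A)\<^sup>2 \<partial>PM I) \<le>
      s0 ^ Suc p * (real k * (2 * D k) ^ p +
        (\<Sum>s\<in>{1..p}. \<mu> ^ (2 * (Suc p - s)) * ((2 * D k) ^ s * (star_sum (Suc p - s) A)\<^sup>2)))"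
proof -
  define q where "q = Suc p"
  have fI: "finite I" by (simp add: I)
  let ?F = "Pow I - {{}}"
  have eq: "chaos I q x - \<mu> ^ q * star_sum q A = (\<Sum>S\<in>?F. coef I q A S * monomial A S x)" for x
  proof -
    have "chaos I q x = coef I q A {} * monomial A {} x + (\<Sum>S\<in>?F. coef I q A S * monomial A S x)"
      unfolding chaos_expand[OF fI, of q x A] using fI by (intro sum.remove) auto
    then show ?thesis using coef_empty[OF fI A] by (simp add: monomial_def)
  qed
  show "integrable (PM I) (\<lambda>x. tilt A x * (chaos I (Suc p) x - \<mu> ^ Suc p * star_sum (Suc p) A)\<^sup>2)"
    unfolding q_def[symmetric] eq by (rule tilted_second_moment[OF fI A]) (use fI in auto)
  have "(\<integral>x. tilt A x * (chaos I q x - \<mu> ^ q * star_sum q A)\<^sup>2 \<partial>PM I) \<le> (\<Sum>S\<in>?F. (coef I q A S)\<^sup>2 * s0 ^ card S)"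
    unfolding eq by (rule tilted_second_moment[OF fI A]) (use fI in auto)
  also have "\<dots> \<le> (\<Sum>S\<in>?F. s0 ^ q * (coef I q A S)\<^sup>2)"
  proof (rule sum_mono)
    fix S
    show "(coef I q A S)\<^sup>2 * s0 ^ card S \<le> s0 ^ q * (coef I q A S)\<^sup>2"
    proof (cases "card S \<le> q")
      case True
      then have "s0 ^ card S \<le> s0 ^ q" using s0_ge by (intro power_increasing) auto
      then have "s0 ^ card S * (coef I q A S)\<^sup>2 \<le> s0 ^ q * (coef I q A S)\<^sup>2"
        by (rule mult_right_mono) simp
      then show ?thesis by (simp add: mult.commute)
    qed (use coef_zero[OF fI] in auto)
  qed
  also have "\<dots> = s0 ^ q * (\<Sum>S\<in>?F. (coef I q A S)\<^sup>2)" by (simp add: sum_distrib_left)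
  finally have le: "(\<integral>x. tilt A x * (chaos I q x - \<mu> ^ q * star_sum q A)\<^sup>2 \<partial>PM I) \<le> s0 ^ q * (\<Sum>S\<in>?F. (coef I q A S)\<^sup>2)" .
  have "(\<Sum>S\<in>?F. (coef I q A S)\<^sup>2) = (\<Sum>S\<in>{S. S \<subseteq> I \<and> 1 \<le> card S \<and> card S \<le> q}. (coef I q A S)\<^sup>2)"
  proof (rule sum.mono_neutral_right)
    show "\<forall>S\<in>?F - {S. S \<subseteq> I \<and> 1 \<le> card S \<and> card S \<le> q}. (coef I q A S)\<^sup>2 = 0"
    proof
      fix S assume S: "S \<in> ?F - {S. S \<subseteq> I \<and> 1 \<le> card S \<and> card S \<le> q}"
      then have "finite S" "S \<noteq> {}" using fI finite_subset[of S I] by auto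
      then have "1 \<le> card S" by (simp add: Suc_le_eq card_gt_0_iff)
      then have "card S > q" using S by auto
      then show "(coef I q A S)\<^sup>2 = 0" using coef_zero[OF fI] by simp
    qed
  qed (use fI in auto)
  also have "\<dots> = (\<Sum>s\<in>{1..q}. \<Sum>S\<in>{S. S \<subseteq> I \<and> card S = s}. (coef I q A S)\<^sup>2)"
  proof -
    have "(\<Sum>s\<in>{1..q}. \<Sum>S\<in>{S\<in>{S. S \<subseteq> I \<and> 1 \<le> card S \<and> card S \<le> q}. card S = s}. (coef I q A S)\<^sup>2) =
      (\<Sum>S\<in>{S. S \<subseteq> I \<and> 1 \<le> card S \<and> card S \<le> q}. (coef I q A S)\<^sup>2)"
      using fI by (intro sum.group) auto
    moreover have "{S\<in>{S. S \<subseteq> I \<and> 1 \<le> card S \<and> card S \<le> q}. card S = s} = {S. S \<subseteq> I \<and> card S = s}" if "s \<in> {1..q}" for s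
      using that by auto
    ultimately show ?thesis by simp
  qed
  also have "\<dots> = (\<Sum>S\<in>{S. S \<subseteq> I \<and> card S = q}. (coef I q A S)\<^sup>2) +
      (\<Sum>s\<in>{1..p}. \<Sum>S\<in>{S. S \<subseteq> I \<and> card S = s}. (coef I q A S)\<^sup>2)"
    by (simp add: q_def)
  also have "\<dots> \<le> real k * (2 * D k) ^ p +
        (\<Sum>s\<in>{1..p}. \<mu> ^ (2 * (q - s)) * ((2 * D k) ^ s * (star_sum (q - s) A)\<^sup>2))"
  proof (intro add_mono sum_mono)
    have "(\<Sum>S\<in>{S. S \<subseteq> I \<and> card S = q}. (coef I q A S)\<^sup>2) = (\<Sum>S\<in>{S. S \<subseteq> I \<and> card S = q}. (star S)\<^sup>2)"
    proof (rule sum.cong[OF refl])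
      fix S assume S: "S \<in> {S. S \<subseteq> I \<and> card S = q}"
      have "finite (A - S)" using A fI finite_subset by blast
      then have "{R. R \<subseteq> A - S \<and> card R = 0} = {{}}" by (rule card_0_subsets)
      then show "(coef I q A S)\<^sup>2 = (star S)\<^sup>2" using coef_eq[OF fI A, of S q] S by (simp del: card_0_eq)
    qed
    also have "\<dots> \<le> real k * (2 * D k) ^ p" unfolding q_def by (rule star_square_sum[OF I])
    finally show "(\<Sum>S\<in>{S. S \<subseteq> I \<and> card S = q}. (coef I q A S)\<^sup>2) \<le> real k * (2 * D k) ^ p" .
    fix s assume s: "s \<in> {1..p}"
    have "(\<Sum>S\<in>{S. S \<subseteq> I \<and> card S = s}. (coef I q A S)\<^sup>2) =
      (\<Sum>S\<in>{S. S \<subseteq> I \<and> card S = s}. \<mu> ^ (2 * (q - s)) * (\<Sum>R\<in>{R. R \<subseteq> A - S \<and> card R = q - s}. star (S \<union> R))\<^sup>2)"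
      using s coef_eq[OF fI A, of _ q] by (intro sum.cong) (auto simp: power_mult_distrib power_mult[symmetric] mult.commute q_def)
    also have "\<dots> = \<mu> ^ (2 * (q - s)) * (\<Sum>S\<in>{S. S \<subseteq> I \<and> card S = s}. (\<Sum>R\<in>{R. R \<subseteq> A - S \<and> card R = q - s}. star (S \<union> R))\<^sup>2)"
      by (simp add: sum_distrib_left)
    also have "\<dots> \<le> \<mu> ^ (2 * (q - s)) * ((2 * D k) ^ s * (star_sum (q - s) A)\<^sup>2)"
      using s mean_pos by (intro mult_left_mono insertion_second_moment[OF I A]) (auto simp: q_def)
    finally show "(\<Sum>S\<in>{S. S \<subseteq> I \<and> card S = s}. (coef I q A S)\<^sup>2) \<le>
        \<mu> ^ (2 * (q - s)) * ((2 * D k) ^ s * (star_sum (q - s) A)\<^sup>2)" .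
  qed
  finally have "s0 ^ q * (\<Sum>S\<in>?F. (coef I q A S)\<^sup>2) \<le> s0 ^ q * (real k * (2 * D k) ^ p +
        (\<Sum>s\<in>{1..p}. \<mu> ^ (2 * (q - s)) * ((2 * D k) ^ s * (star_sum (q - s) A)\<^sup>2)))"
    using s0_ge by (intro mult_left_mono) auto
  with le show "(\<integral>x. tilt A x * (chaos I (Suc p) x - \<mu> ^ Suc p * star_sum (Suc p) A)\<^sup>2 \<partial>PM I) \<le>
      s0 ^ Suc p * (real k * (2 * D k) ^ p +
        (\<Sum>s\<in>{1..p}. \<mu> ^ (2 * (Suc p - s)) * ((2 * D k) ^ s * (star_sum (Suc p - s) A)\<^sup>2)))"
    unfolding q_def by linarith
qed

text \<open>The event is \<open>{chaos \<ge> \<theta>}\<close> with \<open>\<theta>\<close> chosen by Chebyshev; the tilt along a nice path moves the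
  mean of the chaos above \<open>2 \<theta>\<close>.\<close>

lemma chaos_test:
  assumes k: "1 \<le> k" and I: "I = {e0<..e0 + k}" and pos: "c > 0" "C > 0" "\<rho> > 0" "\<pi> > 0"
    and A1: "1 \<le> B" "4 * s0 ^ Suc p * 2 ^ p * (1 + real p * C\<^sup>2) \<le> \<rho> * c\<^sup>2 * B"
      "4 * s0 ^ Suc p * 2 ^ p \<le> \<pi> * c\<^sup>2 * B"
    and c1: "B \<le> \<mu>\<^sup>2 * D k"
    and c2: "B \<le> \<mu> ^ (2 * Suc p) * (real k * (v k)\<^sup>2 * D k ^ p)"
  shows "\<exists>E\<in>sets (PM I). measure (PM I) E \<le> \<pi> \<and> (\<forall>A\<subseteq>I. nice c C p k A \<longrightarrow>
    (\<integral>x. tilt A x * indicator (space (PM I) - E) x \<partial>PM I) \<le> \<rho>)"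
proof -
  interpret PMI: prob_space "PM I" by (rule prob_space_PM)
  have fI: "finite I" by (simp add: I)
  have Dk: "D k > 0" by (rule D_pos[OF k])
  have vk: "v k > 0" by (rule v_pos)
  have s0p: "s0 > 0" using s0_ge by simp
  define W where "W = s0 ^ Suc p * (real k * (2 * D k) ^ p)"
  \<comment> \<open>\<open>W\<close> bounds the variance of the chaos without tilt, so Chebyshev at
    level \<open>\<theta>\<close> gives probability at most \<open>\<pi>\<close>.\<close>
  define \<theta> where "\<theta> = sqrt (W / \<pi>)"
  have Wp: "W > 0" using s0p k Dk by (simp add: W_def)
  have \<theta>: "\<theta> > 0" "\<theta>\<^sup>2 = W / \<pi>" using Wp pos by (auto simp: \<theta>_def)
  have meas: "chaos I (Suc p) \<in> borel_measurable (PM I)"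
  proof -
    have "(\<lambda>x. x a) \<in> borel_measurable (PM I)" if "a \<in> I" for a
    proof -
      have "(\<lambda>x. x a) \<in> measurable (PM I) \<nu>" using that by measurable
      then show ?thesis by (simp add: measurable_cong_sets[OF refl sets_eq])
    qed
    then show ?thesis unfolding chaos_def[abs_def]
      by (intro borel_measurable_sum borel_measurable_times borel_measurable_const borel_measurable_prod) auto
  qed
  define E where "E = {x \<in> space (PM I). chaos I (Suc p) x \<ge> \<theta>}"
  have E: "E \<in> sets (PM I)" unfolding E_def using meas by measurable
  have ss: "star_sum (Suc n) {} = 0" for n
  proof -
    have "{R. R \<subseteq> ({}::nat set) \<and> card R = Suc n} = {}" by auto
    then show ?thesis unfolding star_sum_def by (metis sum.empty)
  qed
  have "measure (PM I) E \<le> \<pi>"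
  proof -
    \<comment> \<open>The law without tilt is the case \<open>A = {}\<close>: the tilt is 1, and the
      mean and all mixed terms vanish because the star sums of the empty path do.\<close>
    have int: "integrable (PM I) (\<lambda>x. (chaos I (Suc p) x)\<^sup>2)"
      using chaos_second_moment(1)[OF I, of "{}" p] by (simp add: ss tilt_def)
    have le: "(\<integral>x. (chaos I (Suc p) x)\<^sup>2 \<partial>PM I) \<le> W"
    proof -
      have "star_sum (Suc p - s) {} = 0" if "s \<in> {1..p}" for s
        using ss[of "p - s"] that by (simp add: Suc_diff_le)
      then have "(\<Sum>s\<in>{1..p}. \<mu> ^ (2 * (Suc p - s)) * ((2 * D k) ^ s * (star_sum (Suc p - s) {})\<^sup>2)) = 0"
        by (intro sum.neutral) auto
      then show ?thesis using chaos_second_moment(2)[OF I, of "{}" p] by (simp add: ss tilt_def W_def)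
    qed
    have "measure (PM I) E \<le> measure (PM I) {x \<in> space (PM I). (chaos I (Suc p) x)\<^sup>2 \<ge> \<theta>\<^sup>2}"
    proof (rule PMI.finite_measure_mono)
      show "E \<subseteq> {x \<in> space (PM I). (chaos I (Suc p) x)\<^sup>2 \<ge> \<theta>\<^sup>2}"
        using \<theta>(1) by (auto simp: E_def intro!: power_mono)
      show "{x \<in> space (PM I). (chaos I (Suc p) x)\<^sup>2 \<ge> \<theta>\<^sup>2} \<in> sets (PM I)" using meas by measurable
    qed
    also have "\<dots> \<le> (\<integral>x. (chaos I (Suc p) x)\<^sup>2 \<partial>PM I) / \<theta>\<^sup>2"
      using \<theta>(1) by (intro integral_Markov_inequality_measure[where A = "{}"] int) auto
    also have "\<dots> \<le> W / \<theta>\<^sup>2" using le by (intro divide_right_mono) auto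
    also have "\<dots> = \<pi>" unfolding \<theta>(2) using Wp pos by simp
    finally show ?thesis .
  qed
  moreover have "(\<integral>x. tilt A x * indicator (space (PM I) - E) x \<partial>PM I) \<le> \<rho>"
    if A: "A \<subseteq> I" and nice: "nice c C p k A" for A
  proof -
    define m where "m = \<mu> ^ Suc p * star_sum (Suc p) A"
    define m0 where "m0 = \<mu> ^ Suc p * (c * (real k * v k) * D k ^ p)"
    define V where "V = s0 ^ Suc p * (real k * (2 * D k) ^ p +
        (\<Sum>s\<in>{1..p}. \<mu> ^ (2 * (Suc p - s)) * ((2 * D k) ^ s * (star_sum (Suc p - s) A)\<^sup>2)))"
    \<comment> \<open>The ratio of squared mean to noise: \<open>m0^2\<close> equals
      \<open>c^2 * z\<close> times the noise level \<open>k * D k ^ p\<close>. Both requirements, on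
      the threshold and on the tilted variance, reduce to \<open>z\<close> being large.\<close>
    define z where "z = \<mu> ^ (2 * Suc p) * (real k * (v k)\<^sup>2 * D k ^ p)"
    have m0p: "m0 > 0" using mean_pos pos k vk Dk by (simp add: m0_def)
    have mm: "m0 \<le> m" unfolding m_def m0_def using nice mean_pos by (intro mult_left_mono) (auto simp: nice_def)
    have zp: "z > 0" using mean_pos k vk Dk by (simp add: z_def)
    have zB: "B \<le> z" using c2 by (simp add: z_def)
    have m0z: "m0\<^sup>2 = c\<^sup>2 * z * (real k * D k ^ p)"
      unfolding m0_def z_def power_even_eq by (simp add: power2_eq_square mult_ac)
    have kD: "real k * D k ^ p > 0" using k Dk by simp
    have th: "2 * \<theta> \<le> m0"
    proof -
      have "4 * s0 ^ Suc p * 2 ^ p \<le> \<pi> * c\<^sup>2 * z"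
        using A1(3) zB pos by (meson mult_left_mono order_trans mult_nonneg_nonneg less_imp_le zero_le_power2)
      then have "4 * s0 ^ Suc p * 2 ^ p * (real k * D k ^ p) \<le> \<pi> * c\<^sup>2 * z * (real k * D k ^ p)"
        using kD by (intro mult_right_mono) auto
      then have "4 * W \<le> \<pi> * m0\<^sup>2" unfolding m0z W_def by (simp add: power_mult_distrib mult_ac)
      then have "(2 * \<theta>)\<^sup>2 \<le> m0\<^sup>2" using pos by (simp add: power_mult_distrib \<theta>(2) field_simps)
      then show ?thesis by (rule power2_le_imp_le) (use m0p in simp)
    qed
    have Vb: "4 * V \<le> \<rho> * m0\<^sup>2"
    proof -
      have tm: "\<mu> ^ (2 * (Suc p - s)) * ((2 * D k) ^ s * (star_sum (Suc p - s) A)\<^sup>2) \<le>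
        2 ^ p * C\<^sup>2 * (z / B) * (real k * D k ^ p)" if s: "s \<in> {1..p}" for s
      proof -
        have nn: "0 \<le> star_sum (Suc p - s) A"
          unfolding star_sum_def by (intro sum_nonneg) (auto intro: less_imp_le star_pos)
        have "star_sum (Suc (p - s)) A \<le> C * (real k * v k) * D k ^ (p - s)"
          using nice s by (auto simp: nice_def)
        then have "(star_sum (Suc p - s) A)\<^sup>2 \<le> (C * (real k * v k) * D k ^ (p - s))\<^sup>2"
          using nn s by (intro power_mono) (auto simp: Suc_diff_le)
        then have "\<mu> ^ (2 * (Suc p - s)) * ((2 * D k) ^ s * (star_sum (Suc p - s) A)\<^sup>2) \<le>
          \<mu> ^ (2 * (Suc p - s)) * ((2 * D k) ^ s * (C * (real k * v k) * D k ^ (p - s))\<^sup>2)"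
          using mean_pos Dk by (intro mult_left_mono) auto
        also have "\<dots> = 2 ^ s * C\<^sup>2 * (\<mu> ^ (2 * (Suc p - s)) * (real k * (v k)\<^sup>2 * D k ^ (p - s))) * (real k * (D k ^ s * D k ^ (p - s)))"
          by (simp add: power_mult_distrib power2_eq_square mult_ac)
        also have "D k ^ s * D k ^ (p - s) = D k ^ p" using s by (simp add: power_add[symmetric])
        also have "2 ^ s * C\<^sup>2 * (\<mu> ^ (2 * (Suc p - s)) * (real k * (v k)\<^sup>2 * D k ^ (p - s))) * (real k * D k ^ p) \<le>
          2 ^ p * C\<^sup>2 * (z / B) * (real k * D k ^ p)"
        proof (intro mult_right_mono mult_mono)
          \<comment> \<open>Replacing \<open>s\<close> path points by free points costs a factor
            \<open>(\<mu>^2 * D k) ^ s\<close> compared with \<open>z\<close>; as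
            \<open>s \<ge> 1\<close> and \<open>\<mu>^2 * D k \<ge> B \<ge> 1\<close>, every mixed
            term gains the factor \<open>1 / B\<close>.\<close>
          have "B \<le> (\<mu>\<^sup>2 * D k) ^ s"
          proof -
            have "(\<mu>\<^sup>2 * D k) ^ 1 \<le> (\<mu>\<^sup>2 * D k) ^ s" using s A1 c1 by (intro power_increasing) auto
            then show ?thesis using c1 by simp
          qed
          moreover have "z = (\<mu> ^ (2 * (Suc p - s)) * (real k * (v k)\<^sup>2 * D k ^ (p - s))) * (\<mu>\<^sup>2 * D k) ^ s"
          proof -
            have "2 * Suc p = 2 * (Suc p - s) + 2 * s" "p = (p - s) + s" using s by auto
            then have e: "\<mu> ^ (2 * Suc p) = \<mu> ^ (2 * (Suc p - s)) * \<mu> ^ (2 * s)" "D k ^ p = D k ^ (p - s) * D k ^ s"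
              by (metis power_add)+
            have e': "(\<mu>\<^sup>2 * D k) ^ s = \<mu> ^ (2 * s) * D k ^ s"
              by (simp add: power_mult_distrib power_mult)
            show ?thesis unfolding z_def e e' by (simp only: mult_ac)
          qed
          moreover have "0 \<le> \<mu> ^ (2 * (Suc p - s)) * (real k * (v k)\<^sup>2 * D k ^ (p - s))"
            using mean_pos Dk by simp
          ultimately have "(\<mu> ^ (2 * (Suc p - s)) * (real k * (v k)\<^sup>2 * D k ^ (p - s))) * B \<le> z"
            by (metis mult_left_mono)
          then show "\<mu> ^ (2 * (Suc p - s)) * (real k * (v k)\<^sup>2 * D k ^ (p - s)) \<le> z / B"
            using A1 by (simp add: pos_le_divide_eq)
        qed (use s kD mean_pos Dk in \<open>auto intro: power_increasing\<close>)
        finally show ?thesis .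
      qed
      have "real k * (2 * D k) ^ p + (\<Sum>s\<in>{1..p}. \<mu> ^ (2 * (Suc p - s)) * ((2 * D k) ^ s * (star_sum (Suc p - s) A)\<^sup>2))
        \<le> 2 ^ p * (z / B) * (real k * D k ^ p) + (\<Sum>s\<in>{1..p}. 2 ^ p * C\<^sup>2 * (z / B) * (real k * D k ^ p))"
      proof (intro add_mono sum_mono tm)
        have "1 \<le> z / B" using zB A1 by simp
        then have "2 ^ p * 1 * (real k * D k ^ p) \<le> 2 ^ p * (z / B) * (real k * D k ^ p)"
          using kD by (intro mult_right_mono mult_left_mono) auto
        then show "real k * (2 * D k) ^ p \<le> 2 ^ p * (z / B) * (real k * D k ^ p)"
          by (simp add: power_mult_distrib mult_ac)
      qed
      also have "\<dots> = 2 ^ p * (1 + real p * C\<^sup>2) * (z / B) * (real k * D k ^ p)"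
        by (simp add: algebra_simps)
      finally have "V \<le> s0 ^ Suc p * (2 ^ p * (1 + real p * C\<^sup>2) * (z / B) * (real k * D k ^ p))"
        unfolding V_def using s0p by (intro mult_left_mono) auto
      then have "4 * V \<le> 4 * (s0 ^ Suc p * (2 ^ p * (1 + real p * C\<^sup>2) * (z / B) * (real k * D k ^ p)))"
        by linarith
      also have "\<dots> = 4 * s0 ^ Suc p * 2 ^ p * (1 + real p * C\<^sup>2) * ((z / B) * (real k * D k ^ p))"
        by (simp only: mult_ac)
      also have "\<dots> \<le> \<rho> * c\<^sup>2 * B * ((z / B) * (real k * D k ^ p))"
        using A1 zp kD by (intro mult_right_mono) auto
      also have "\<dots> = \<rho> * m0\<^sup>2" using A1 by (simp add: m0z)
      finally show ?thesis .
    qed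
    have int1: "integrable (PM I) (\<lambda>x. tilt A x * indicator (space (PM I) - E) x)"
      using E by (intro integrable_real_mult_indicator tilt_integral fI A) auto
    have int2: "integrable (PM I) (\<lambda>x. tilt A x * (chaos I (Suc p) x - m)\<^sup>2)"
      unfolding m_def by (rule chaos_second_moment(1)[OF I A])
    have "(m0 / 2)\<^sup>2 * (\<integral>x. tilt A x * indicator (space (PM I) - E) x \<partial>PM I) =
      (\<integral>x. (m0 / 2)\<^sup>2 * (tilt A x * indicator (space (PM I) - E) x) \<partial>PM I)" by simp
    also have "\<dots> \<le> (\<integral>x. tilt A x * (chaos I (Suc p) x - m)\<^sup>2 \<partial>PM I)"
    proof (intro integral_mono int2 integrable_mult_right int1)
      fix x assume x: "x \<in> space (PM I)"
      show "(m0 / 2)\<^sup>2 * (tilt A x * indicator (space (PM I) - E) x) \<le> tilt A x * (chaos I (Suc p) x - m)\<^sup>2"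
      proof (cases "x \<in> E")
        case True
        then show ?thesis using tilt_nonneg[of A x] by simp
      next
        case False
        \<comment> \<open>Off \<open>E\<close> the chaos stays below
          \<open>\<theta> \<le> m0 / 2\<close>, at least \<open>m0 / 2\<close> under its tilted mean
          \<open>m\<close>; Chebyshev for the tilted law follows.\<close>
        then have "m0 / 2 \<le> m - chaos I (Suc p) x" using x th mm by (auto simp: E_def)
        then have "(m0 / 2)\<^sup>2 \<le> (m - chaos I (Suc p) x)\<^sup>2" using m0p by (intro power_mono) auto
        then have "(m0 / 2)\<^sup>2 * tilt A x \<le> (m - chaos I (Suc p) x)\<^sup>2 * tilt A x"
          using tilt_nonneg[of A x] by (intro mult_right_mono) auto
        then show ?thesis using False x by (simp add: power2_commute mult.commute)
      qed
    qed
    also have "\<dots> \<le> V" unfolding m_def V_def by (rule chaos_second_moment(2)[OF I A])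
    also have "\<dots> \<le> (m0 / 2)\<^sup>2 * \<rho>" using Vb by (simp add: power_divide mult.commute)
    finally show ?thesis using m0p by simp
  qed
  ultimately show ?thesis using E by blast
qed

end

subsection \<open>Fractional moments\<close>

lemma powr_add_le:
  fixes x y g :: real
  assumes "0 \<le> x" "0 \<le> y" "0 < g" "g \<le> 1"
  shows "(x + y) powr g \<le> x powr g + y powr g"
proof (cases "x + y = 0")
  case False
  have le: "t \<le> t powr g" if "0 \<le> t" "t \<le> 1" for t :: real
  proof (cases "t = 0")
    case False
    have "t powr 1 \<le> t powr g" using that False assms by (intro powr_mono') auto
    then show ?thesis using that by simp
  qed simp
  have s: "x + y > 0" using False assms by auto
  have "(x + y) powr g = (x + y) powr g * (x / (x + y) + y / (x + y))"
    using s by (simp add: add_divide_distrib[symmetric])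
  also have "\<dots> \<le> (x + y) powr g * ((x / (x + y)) powr g + (y / (x + y)) powr g)"
    using s assms by (intro mult_left_mono add_mono le) auto
  also have "\<dots> = x powr g + y powr g"
    using s assms by (simp add: powr_divide distrib_left)
  finally show ?thesis .
qed simp

lemma powr_sum_le:
  fixes f :: "'a \<Rightarrow> real" and g :: real
  assumes "finite S" "\<And>a. a \<in> S \<Longrightarrow> 0 \<le> f a" "0 < g" "g \<le> 1"
  shows "(\<Sum>a\<in>S. f a) powr g \<le> (\<Sum>a\<in>S. f a powr g)"
  using assms(1,2)
proof (induction S rule: finite_induct)
  case (insert a S)
  have "(\<Sum>a\<in>insert a S. f a) powr g \<le> f a powr g + (\<Sum>a\<in>S. f a) powr g"
    using insert assms by (simp add: powr_add_le sum_nonneg)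
  then show ?case using insert by simp
qed simp

text \<open>This is Hoelder's inequality for \<open>Y^g\<close> times an indicator. The concave
  function \<open>y^g\<close> is bounded by its tangent at \<open>t\<close>, and the tangent is
  integrated over \<open>A\<close>.\<close>

lemma (in prob_space) fractional_moment_on_event:
  fixes Y :: "'a \<Rightarrow> real"
  assumes int: "integrable M Y" and nn: "\<And>x. x \<in> space M \<Longrightarrow> Y x \<ge> 0" and A: "A \<in> events"
    and p: "prob A \<le> p" "p > 0" and g: "0 < g" "g < 1"
  shows "(\<integral>\<^sup>+x. ennreal (Y x powr g * indicator A x) \<partial>M) \<le>
    ennreal (p powr (1 - g) * expectation (\<lambda>x. Y x * indicator A x) powr g)"
proof -
  define J where "J = expectation (\<lambda>x. Y x * indicator A x)"
  have intA: "integrable M (\<lambda>x. Y x * indicator A x)"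
    using A by (intro integrable_real_mult_indicator int)
  have J0: "J \<ge> 0" unfolding J_def using nn by (intro integral_nonneg_AE AE_I2) (auto simp: indicator_def)
  show ?thesis
  \<comment> \<open>The tangent point chosen below is positive only for \<open>J > 0\<close>; for
    \<open>J = 0\<close> the integrand vanishes almost everywhere.\<close>
  proof (cases "J = 0")
    case True
    have "AE x in M. Y x * indicator A x = 0"
      using integral_nonneg_eq_0_iff_AE[OF intA] nn True by (auto simp: J_def indicator_def)
    then have "AE x in M. ennreal (Y x powr g * indicator A x) = 0"
      by eventually_elim (auto simp: indicator_def)
    then have "(\<integral>\<^sup>+x. ennreal (Y x powr g * indicator A x) \<partial>M) = (\<integral>\<^sup>+x. 0 \<partial>M)"
      by (rule nn_integral_cong_AE)
    then show ?thesis by simp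
  next
    case False
    then have Jp: "J > 0" using J0 by simp
    \<comment> \<open>The minimizer of \<open>g * t^(g - 1) * J + (1 - g) * t^g * p\<close>; at this
      point both terms are multiples of \<open>p^(1 - g) * J^g\<close> with weights \<open>g\<close>
      and \<open>1 - g\<close>.\<close>
    define t where "t = J / p"
    have tp: "t > 0" using Jp p by (simp add: t_def)
    have young: "y powr g \<le> g * t powr (g - 1) * y + (1 - g) * t powr g" if "y \<ge> 0" for y
    proof (cases "y = 0")
      case False
      then have "y powr g * t powr (1 - g) \<le> g * y + (1 - g) * t"
        using Youngs_inequality_0[of g "1 - g" y t] that g tp by simp
      then have "y powr g * t powr (1 - g) * t powr (g - 1) \<le> (g * y + (1 - g) * t) * t powr (g - 1)"
        by (intro mult_right_mono) auto
      moreover have "t powr (1 - g) * t powr (g - 1) = 1" using tp by (simp add: powr_add[symmetric])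
      moreover have "t * t powr (g - 1) = t powr g" using tp by (simp add: powr_mult_base)
      ultimately show ?thesis by (simp add: algebra_simps mult.assoc)
    qed (use g in simp)
    have int2: "integrable M (\<lambda>x. g * t powr (g - 1) * (Y x * indicator A x) + (1 - g) * t powr g * indicator A x)"
      using A by (intro Bochner_Integration.integrable_add integrable_mult_right intA integrable_real_indicator)
        (auto simp: emeasure_eq_measure)
    have "(\<integral>\<^sup>+x. ennreal (Y x powr g * indicator A x) \<partial>M) \<le>
      (\<integral>\<^sup>+x. ennreal (g * t powr (g - 1) * (Y x * indicator A x) + (1 - g) * t powr g * indicator A x) \<partial>M)"
      using young nn by (intro nn_integral_mono ennreal_leI) (auto simp: indicator_def)
    also have "\<dots> = ennreal (expectation (\<lambda>x. g * t powr (g - 1) * (Y x * indicator A x) + (1 - g) * t powr g * indicator A x))"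
      using nn g by (intro nn_integral_eq_integral int2 AE_I2) (auto simp: indicator_def)
    also have "expectation (\<lambda>x. g * t powr (g - 1) * (Y x * indicator A x) + (1 - g) * t powr g * indicator A x) =
       g * t powr (g - 1) * J + (1 - g) * t powr g * prob A"
      unfolding J_def using A intA
      by (subst Bochner_Integration.integral_add)
         (auto intro!: integrable_mult_right integrable_real_indicator simp: emeasure_eq_measure)
    also have "ennreal \<dots> \<le> ennreal (p powr (1 - g) * J powr g)"
    proof (rule ennreal_leI)
      have "(1 - g) * t powr g * prob A \<le> (1 - g) * t powr g * p"
        using g p by (intro mult_left_mono) auto
      moreover have "t powr (g - 1) * J = p powr (1 - g) * J powr g"
      proof -
        have "t powr (g - 1) * J = J powr (g - 1) * J powr 1 / p powr (g - 1)"
          using Jp p by (simp add: t_def powr_divide)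
        also have "\<dots> = J powr g * p powr (1 - g)"
        proof -
          have "J powr (g - 1) * J powr 1 = J powr g" by (simp only: powr_add[symmetric]) simp
          moreover have "p powr (1 - g) = 1 / p powr (g - 1)" using powr_minus_divide[of p "g - 1"] by simp
          ultimately show ?thesis by simp
        qed
        finally show ?thesis by simp
      qed
      moreover have "t powr g * p = p powr (1 - g) * J powr g"
      proof -
        have "t powr g * p = J powr g * (p powr 1 / p powr g)" using Jp p by (simp add: t_def powr_divide)
        also have "p powr 1 / p powr g = p powr (1 - g)" by (simp only: powr_diff)
        finally show ?thesis by simp
      qed
      ultimately have "g * t powr (g - 1) * J + (1 - g) * t powr g * prob A \<le>
        g * (p powr (1 - g) * J powr g) + (1 - g) * (p powr (1 - g) * J powr g)"
        by (simp add: mult.assoc)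
      also have "\<dots> = p powr (1 - g) * J powr g" by (simp add: algebra_simps)
      finally show "g * t powr (g - 1) * J + (1 - g) * t powr g * prob A \<le> p powr (1 - g) * J powr g" .
    qed
    finally show ?thesis unfolding J_def .
  qed
qed

lemma (in prob_space) fractional_moment_jensen:
  fixes Y :: "'a \<Rightarrow> real"
  assumes int: "integrable M Y" and nn: "\<And>x. x \<in> space M \<Longrightarrow> Y x \<ge> 0" and g: "0 < g" "g < 1"
  shows "(\<integral>\<^sup>+x. ennreal (Y x powr g) \<partial>M) \<le> ennreal (expectation Y powr g)"
proof -
  have "(\<integral>\<^sup>+x. ennreal (Y x powr g * indicator (space M) x) \<partial>M) \<le>
    ennreal (1 powr (1 - g) * expectation (\<lambda>x. Y x * indicator (space M) x) powr g)"
    by (rule fractional_moment_on_event) (use assms in auto)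
  moreover have "(\<integral>\<^sup>+x. ennreal (Y x powr g * indicator (space M) x) \<partial>M) = (\<integral>\<^sup>+x. ennreal (Y x powr g) \<partial>M)"
    by (intro nn_integral_cong) auto
  moreover have "expectation (\<lambda>x. Y x * indicator (space M) x) = expectation Y"
    by (intro Bochner_Integration.integral_cong) auto
  ultimately show ?thesis by simp
qed

text \<open>Change of measure by truncation: on \<open>E\<close> only its small probability is used.\<close>

lemma (in prob_space) fractional_moment_split:
  fixes Y :: "'a \<Rightarrow> real"
  assumes int: "integrable M Y" and nn: "\<And>x. x \<in> space M \<Longrightarrow> Y x \<ge> 0" and E: "E \<in> events"
    and p: "prob E \<le> p" "p > 0" and g: "0 < g" "g < 1"
  shows "(\<integral>\<^sup>+x. ennreal (Y x powr g) \<partial>M) \<le>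
    ennreal (expectation (\<lambda>x. Y x * indicator (space M - E) x) powr g + p powr (1 - g) * expectation Y powr g)"
proof -
  have Ym [measurable]: "Y \<in> borel_measurable M" using int by auto
  have Ec [measurable]: "space M - E \<in> events" using E by auto
  note [measurable] = E
  have "(\<integral>\<^sup>+x. ennreal (Y x powr g) \<partial>M) =
    (\<integral>\<^sup>+x. ennreal (Y x powr g * indicator (space M - E) x) + ennreal (Y x powr g * indicator E x) \<partial>M)"
    by (intro nn_integral_cong) (auto simp: indicator_def)
  also have "\<dots> = (\<integral>\<^sup>+x. ennreal (Y x powr g * indicator (space M - E) x) \<partial>M) + (\<integral>\<^sup>+x. ennreal (Y x powr g * indicator E x) \<partial>M)"
    by (intro nn_integral_add) measurable
  also have "\<dots> \<le> ennreal (1 powr (1 - g) * expectation (\<lambda>x. Y x * indicator (space M - E) x) powr g) +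
    ennreal (p powr (1 - g) * expectation (\<lambda>x. Y x * indicator E x) powr g)"
    by (intro add_mono fractional_moment_on_event int nn Ec E p g) auto
  also have "\<dots> \<le> ennreal (expectation (\<lambda>x. Y x * indicator (space M - E) x) powr g) +
    ennreal (p powr (1 - g) * expectation Y powr g)"
  proof (intro add_mono ennreal_leI mult_left_mono powr_mono2)
    show "expectation (\<lambda>x. Y x * indicator E x) \<le> expectation Y"
      using nn E by (intro integral_mono integrable_real_mult_indicator int) (auto simp: indicator_def)
    show "0 \<le> expectation (\<lambda>x. Y x * indicator E x)"
      using nn by (intro integral_nonneg_AE AE_I2) (auto simp: indicator_def)
  qed (use g in auto)
  finally show ?thesis by (simp add: ennreal_plus)
qed

section \<open>Jump weights between blocks\<close>

context marginal_kernel
begin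

text \<open>Bounds the weight of a transition to the \<open>n\<close>-th next block; the factor 3 absorbs the reward
  \<open>H\<^sup>k \<le> 3\<close> collected inside one block, and \<open>5/4 * 9/10 > 1\<close> keeps the fractional moments summable.\<close>

definition hop :: "nat \<Rightarrow> real" where
  "hop n = 3 * max 1 (16 * c2 / c1) * real n powr (-5/4)"

lemma hop_nonneg: "hop n \<ge> 0"
  by (auto simp: hop_def)

text \<open>For jumps of length at least \<open>k\<close>, \<open>K_le_54\<close> on scale
  \<open>k\<close> gives the decay in \<open>n\<close>. A shorter jump forces \<open>n = 1\<close>
  and has length at least \<open>k / 2\<close>, where monotonicity of \<open>v\<close>
  suffices.\<close>

lemma K_far:
  assumes "1 \<le> n" "1 \<le> k" "n * k \<le> 2 * i"
  shows "K i \<le> 4 * c2 * real n powr (-5/4) / (real k ^ 2 * v k)"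
proof -
  have i: "1 \<le> i" using assms by (cases i) auto
  have vk: "v k > 0" by (rule v_pos)
  show ?thesis
  proof (cases "k \<le> i")
    case True
    have "real (n * k) \<le> real (2 * i)" using assms(3) by (rule of_nat_mono)
    then have h: "real n * real k / 2 \<le> real i" by simp
    have "real i powr (-5/4) \<le> (real n * real k / 2) powr (-5/4)"
      using h assms by (intro powr_mono2') auto
    also have "\<dots> = real n powr (-5/4) * real k powr (-5/4) * 2 powr (5/4)"
      using assms by (simp add: powr_mult powr_divide powr_minus_divide)
    also have "\<dots> \<le> real n powr (-5/4) * real k powr (-5/4) * 4"
    proof (intro mult_left_mono)
      have "(2::real) powr (5/4) \<le> 2 powr 2" by (intro powr_mono) auto
      then show "(2::real) powr (5/4) \<le> 4" by simp
    qed auto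
    finally have pi: "real i powr (-5/4) \<le> real n powr (-5/4) * real k powr (-5/4) * 4" .
    have "K i \<le> c2 * real k powr (-3/4) / v k * real i powr (-5/4)"
      by (rule K_le_54[OF assms(2) True])
    also have "\<dots> \<le> c2 * real k powr (-3/4) / v k * (real n powr (-5/4) * real k powr (-5/4) * 4)"
      using pi c2_pos vk by (intro mult_left_mono) auto
    also have "\<dots> = 4 * c2 * real n powr (-5/4) / v k * (real k powr (-3/4) * real k powr (-5/4))"
      by simp
    also have "real k powr (-3/4) * real k powr (-5/4) = 1 / real k ^ 2"
      using assms by (simp add: powr_add[symmetric] powr_minus_divide)
    finally show ?thesis by (simp add: mult.commute)
  next
    case False
    have "n * k < 2 * k" using False assms by linarith
    then have n1: "n = 1" using assms by auto
    have h: "real k \<le> 2 * real i" using assms n1 by (simp flip: of_nat_mult)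
    have "real k ^ 2 \<le> (2 * real i) ^ 2" using h by (intro power_mono) auto
    then have "real k ^ 2 * v k \<le> (4 * real i ^ 2) * v i"
      using v_decreasing[of i k] False vk by (intro mult_mono) (auto simp: power_mult_distrib)
    then have "4 * c2 / ((4 * real i ^ 2) * v i) \<le> 4 * c2 / (real k ^ 2 * v k)"
      using c2_pos vk assms i by (intro divide_left_mono mult_pos_pos v_pos) auto
    then have "c2 / (real i ^ 2 * v i) \<le> 4 * c2 / (real k ^ 2 * v k)" by simp
    then show ?thesis using K_upper[OF i] n1 by simp
  qed
qed

text \<open>For \<open>d \<le> e < t\<close>, the probability that the renewal started at
  \<open>d\<close> has \<open>t\<close> as its first point after \<open>e\<close>.\<close>

definition jump :: "nat \<Rightarrow> nat \<Rightarrow> nat \<Rightarrow> real" where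
  "jump d e t = (\<Sum>B\<in>Pow {d<..e}. path_weight K d B * K (t - last_pt d B))"

lemma path_weight_nonneg': "B \<in> Pow {d<..e} \<Longrightarrow> 0 \<le> path_weight K d B"
  by (rule path_weight_nonneg[OF K_nonneg]) (auto intro: finite_subset[of _ "{d<..e}"])

lemma sum_K_after:
  assumes "B \<in> Pow {d<..e}" "d \<le> e" "T \<subseteq> {e<..}" "finite T"
  shows "(\<Sum>t\<in>T. K (t - last_pt d B)) \<le> tail_mass K (e - last_pt d B)"
proof -
  have l: "last_pt d B \<le> e" using last_pt_bounds[of B d e] assms by auto
  have "(\<Sum>t\<in>T. K (t - last_pt d B)) = (\<Sum>i\<in>(\<lambda>t. t - last_pt d B) ` T. K i)"
    using assms l by (subst sum.reindex) (auto simp: inj_on_def)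
  also have "\<dots> \<le> (\<Sum>i\<in>{e - last_pt d B<..Max (insert e T) - last_pt d B}. K i)"
  proof (rule sum_mono2)
    show "(\<lambda>t. t - last_pt d B) ` T \<subseteq> {e - last_pt d B<..Max (insert e T) - last_pt d B}"
    proof
      fix i assume "i \<in> (\<lambda>t. t - last_pt d B) ` T"
      then obtain t where t: "t \<in> T" "i = t - last_pt d B" by auto
      have "t \<le> Max (insert e T)" using t assms by (intro Max_ge) auto
      then show "i \<in> {e - last_pt d B<..Max (insert e T) - last_pt d B}"
        using t assms l by (auto intro: diff_less_mono diff_le_mono)
    qed
    show "\<And>b. b \<in> {e - last_pt d B<..Max (insert e T) - last_pt d B} - (\<lambda>t. t - last_pt d B) ` T \<Longrightarrow> 0 \<le> K b"
      by (intro K_nonneg) auto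
  qed simp
  also have "\<dots> \<le> tail_mass K (e - last_pt d B)" by (rule sum_K_le_tail_mass)
  finally show ?thesis .
qed

lemma jump_sum_le_1:
  assumes "d \<le> e" "T \<subseteq> {e<..}" "finite T"
  shows "(\<Sum>t\<in>T. jump d e t) \<le> 1"
proof -
  have "(\<Sum>t\<in>T. jump d e t) = (\<Sum>B\<in>Pow {d<..e}. path_weight K d B * (\<Sum>t\<in>T. K (t - last_pt d B)))"
    unfolding jump_def by (subst sum.swap) (simp add: sum_distrib_left)
  also have "\<dots> \<le> (\<Sum>B\<in>Pow {d<..e}. path_weight K d B * tail_mass K (e - last_pt d B))"
    using assms by (intro sum_mono mult_left_mono sum_K_after path_weight_nonneg')
  also have "\<dots> = path_sum K d e (\<lambda>_. 1)" by (simp add: path_sum_def)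
  also have "\<dots> = 1" by (rule path_sum_one[OF assms(1)])
  finally show ?thesis .
qed

text \<open>Decomposing at the last point before the jump, the Green sum \<open>k * v k\<close>
  meets the uniform jump bound of order \<open>1 / (k^2 * v k)\<close>. The slowly varying parts
  cancel, leaving \<open>1 / k\<close> per target.\<close>

lemma jump_sum_far:
  assumes de: "d \<le> e" "e \<le> d + k" and k: "1 \<le> k" and n: "1 \<le> n"
    and T: "finite T" "real (card T) \<le> M" "\<And>t. t \<in> T \<Longrightarrow> e < t" "\<And>t. t \<in> T \<Longrightarrow> n * k \<le> 2 * (t - e)"
  shows "(\<Sum>t\<in>T. jump d e t) \<le> 16 * c2 / c1 * (M / real k) * real n powr (-5/4)"
proof -
  define b where "b = 4 * c2 * real n powr (-5/4) / (real k ^ 2 * v k)"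
  have vk: "v k > 0" by (rule v_pos)
  have b0: "b \<ge> 0" unfolding b_def using c2_pos vk by auto
  have "jump d e t \<le> 4 / c1 * (real k * v k) * b" if t: "t \<in> T" for t
  proof -
    have "jump d e t = (\<Sum>g\<in>{d..e}. renewal_mass K (g - d) * K (t - g))"
      unfolding jump_def by (rule sum_path_weight_last[OF de(1)])
    also have "\<dots> \<le> (\<Sum>g\<in>{d..e}. renewal_mass K (g - d) * b)"
    proof (intro sum_mono mult_left_mono renewal_mass_nonneg, unfold b_def, intro K_far n k)
      fix g assume "g \<in> {d..e}"
      then show "n * k \<le> 2 * (t - g)" using T(4)[OF t] by auto
    qed
    also have "\<dots> = (\<Sum>g\<in>(\<lambda>g. g - d) ` {d..e}. renewal_mass K g) * b"
      by (subst sum.reindex) (auto simp: inj_on_def sum_distrib_right)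
    also have "\<dots> \<le> (\<Sum>g\<in>{0..k}. renewal_mass K g) * b"
      using de b0 renewal_mass_nonneg by (intro mult_right_mono sum_mono2) auto
    also have "\<dots> \<le> 4 / c1 * (real k * v k) * b"
      using b0 by (intro mult_right_mono green_sum_bound k)
    finally show ?thesis .
  qed
  then have "(\<Sum>t\<in>T. jump d e t) \<le> (\<Sum>t\<in>T. 4 / c1 * (real k * v k) * b)" by (rule sum_mono)
  also have "\<dots> = real (card T) * (4 / c1 * (real k * v k) * b)" by simp
  also have "\<dots> \<le> M * (4 / c1 * (real k * v k) * b)"
    using T(2) c1_pos vk b0 by (intro mult_right_mono) auto
  also have "\<dots> = 16 * c2 / c1 * (M / real k) * real n powr (-5/4)"
    unfolding b_def using k vk c1_pos by (simp add: power2_eq_square field_simps)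
  finally show ?thesis .
qed

end

subsection \<open>Coarse graining\<close>

lemma borel_measurable_ennreal_powr:
  fixes f :: "'a \<Rightarrow> real"
  assumes [measurable]: "f \<in> borel_measurable M"
  shows "(\<lambda>x. ennreal (f x powr g)) \<in> borel_measurable M"
  by measurable

text \<open>All choices are collected here: \<open>w\<close> is the length of the end piece of a
  block, \<open>H\<close> the homogeneous reward, \<open>\<pi>\<close> the probability allowed to
  the test event, \<open>\<eta>\<close> the mass that escapes the test from a start outside the end
  piece, \<open>\<Lambda>\<close> the penalty for starts in it. \<open>good_row\<close> and
  \<open>bad_row\<close> say that \<open>(1, \<Lambda>)\<close> is a supersolution for the
  fractional moments of the two kinds of transitions; the factor in \<open>3 * \<eta>\<close> comes
  from \<open>H ^ k \<le> 3\<close>.\<close>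

locale block_model = tilted_chaos K v c1 c2 \<nu> e \<mu> s0
  for K v c1 c2 \<nu> e \<mu> s0 +
  fixes k w :: nat and H \<eta> \<pi> \<Lambda> \<epsilon> :: real
  assumes k1: "1 \<le> k" and w2: "2 * w \<le> k" and w\<epsilon>: "real w \<le> \<epsilon> * real k"
    and H1: "1 \<le> H" and Hk: "H ^ k \<le> 3" and \<pi>_pos: "0 < \<pi>" and \<Lambda>1: "1 \<le> \<Lambda>" and \<epsilon>0: "0 \<le> \<epsilon>" and \<eta>0: "0 \<le> \<eta>"
    and test: "\<And>s. \<exists>E\<in>sets (PiM {s<..s + k} (\<lambda>_. \<nu>)). measure (PiM {s<..s + k} (\<lambda>_. \<nu>)) E \<le> \<pi> \<and>
      (\<forall>d\<in>{s<..s + k - w}. path_sum K d (s + k) (\<lambda>B. \<integral>x. tilt (insert d B) x *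
        indicator (space (PiM {s<..s + k} (\<lambda>_. \<nu>)) - E) x \<partial>PiM {s<..s + k} (\<lambda>_. \<nu>)) \<le> \<eta>)"
    and good_row: "\<And>M. (\<Sum>n\<in>{1..M}. min (3 * \<eta>) (hop n) powr (9/10) + \<Lambda> * (\<epsilon> * hop n) powr (9/10) +
      \<pi> powr (1/10) * (hop n powr (9/10) + \<Lambda> * (\<epsilon> * hop n) powr (9/10))) \<le> 1"
    and bad_row: "\<And>M. (\<Sum>n\<in>{1..M}. (1 + \<pi> powr (1/10)) * (hop n powr (9/10) + \<Lambda> * (\<epsilon> * hop n) powr (9/10))) \<le> \<Lambda>"
begin

text \<open>Unlike in \<open>chain_sum\<close>, the reward of the starting point is included. A step
  out of a block then involves only disorder of that block, and the factor \<open>Z\<close> at the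
  target only disorder beyond it.\<close>

definition Z :: "nat \<Rightarrow> nat \<Rightarrow> (nat \<Rightarrow> real) \<Rightarrow> real" where
  "Z N d x = H * e (x d) * chain_sum K (\<lambda>a. H * e (x a)) d N"

text \<open>The weight of going from \<open>d\<close> to the first point \<open>t\<close> after
  \<open>f\<close>, with the rewards of \<open>d\<close> and of all points up to \<open>f\<close>
  but not of \<open>t\<close>.\<close>

definition tilt_step :: "nat \<Rightarrow> nat \<Rightarrow> nat \<Rightarrow> (nat \<Rightarrow> real) \<Rightarrow> real" where
  "tilt_step d f t x =
     (\<Sum>B\<in>Pow {d<..f}. path_weight K d B * K (t - last_pt d B) * (H ^ card (insert d B) * tilt (insert d B) x))"

definition block :: "nat \<Rightarrow> nat set" where "block i = {i * k<..Suc i * k}"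
text \<open>From a point of the good part at least \<open>w\<close> further sites of the block are
  ahead, enough for a path to be nice with high probability.\<close>

definition good :: "nat \<Rightarrow> nat set" where "good i = {i * k<..Suc i * k - w}"
definition bad :: "nat \<Rightarrow> nat set" where "bad i = {Suc i * k - w<..Suc i * k}"

lemma block_split: "block i = good i \<union> bad i" "good i \<inter> bad i = {}"
  and finite_block [simp]: "finite (block i)" "finite (good i)" "finite (bad i)"
  using w2 by (auto simp: block_def good_def bad_def)

lemma sum_block: "sum g (block i) = sum g (good i) + sum g (bad i)"
  unfolding block_split(1) using block_split(2) by (intro sum.union_disjoint) auto

lemma Z_nonneg: "Z N d x \<ge> 0"
  unfolding Z_def using H1 density_nonneg
  by (intro mult_nonneg_nonneg chain_sum_nonneg K_nonneg) auto

lemma prod_tilt: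
  assumes "B \<subseteq> {d<..f}"
  shows "H * e (x d) * (\<Prod>a\<in>B. H * e (x a)) = H ^ card (insert d B) * tilt (insert d B) x"
proof -
  have f: "finite B" "d \<notin> B" using assms finite_subset[of B "{d<..f}"] by auto
  have "H * e (x d) * (\<Prod>a\<in>B. H * e (x a)) = (\<Prod>a\<in>insert d B. H * e (x a))" using f by simp
  also have "\<dots> = H ^ card (insert d B) * tilt (insert d B) x"
    unfolding tilt_def prod.distrib by simp
  finally show ?thesis .
qed

lemma Z_block:
  assumes "d \<le> f" "f < N"
  shows "Z N d x = (\<Sum>t\<in>{f<..N}. tilt_step d f t x * Z N t x)"
proof -
  have "Z N d x = (\<Sum>B\<in>Pow {d<..f}. \<Sum>t\<in>{f<..N}.
      path_weight K d B * K (t - last_pt d B) * (H * e (x d) * (\<Prod>a\<in>B. H * e (x a))) * Z N t x)"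
    unfolding Z_def chain_sum_block[OF assms] by (simp add: sum_distrib_left mult_ac)
  also have "\<dots> = (\<Sum>B\<in>Pow {d<..f}. \<Sum>t\<in>{f<..N}.
      path_weight K d B * K (t - last_pt d B) * (H ^ card (insert d B) * tilt (insert d B) x) * Z N t x)"
    by (intro sum.cong refl) (simp add: prod_tilt)
  also have "\<dots> = (\<Sum>t\<in>{f<..N}. tilt_step d f t x * Z N t x)"
    unfolding tilt_step_def sum_distrib_right by (rule sum.swap)
  finally show ?thesis .
qed

lemma Z_cong: "(\<And>a. d \<le> a \<Longrightarrow> a \<le> N \<Longrightarrow> x a = y a) \<Longrightarrow> d \<le> N \<Longrightarrow> Z N d x = Z N d y"
  unfolding Z_def by (intro arg_cong2[of _ _ _ _ "(*)"] chain_sum_cong) auto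

lemma tilt_step_cong: "(\<And>a. d \<le> a \<Longrightarrow> a \<le> f \<Longrightarrow> x a = y a) \<Longrightarrow> d \<le> f \<Longrightarrow> tilt_step d f t x = tilt_step d f t y"
  unfolding tilt_step_def tilt_def by (intro sum.cong refl arg_cong2[of _ _ _ _ "(*)"] prod.cong) (auto simp: subset_eq)

lemma measurable_site:
  assumes "a \<in> J" shows "(\<lambda>x. e (x a)) \<in> borel_measurable (PM J)"
proof -
  have "e \<in> borel_measurable \<nu>" using density_integrable(1) by auto
  then show ?thesis
    by (rule measurable_compose[OF measurable_component_singleton[OF assms], of e])
qed

lemma measurable_Z:
  assumes "{d..N} \<subseteq> J" "d \<le> N" shows "Z N d \<in> borel_measurable (PM J)"
proof -
  have p: "(\<lambda>x. \<Prod>a\<in>B. H * e (x a)) \<in> borel_measurable (PM J)" if "B \<in> Pow {d<..N}" for B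
  proof (intro borel_measurable_prod borel_measurable_times borel_measurable_const measurable_site)
    fix a assume "a \<in> B"
    then have "a \<in> {d..N}" using that by auto
    then show "a \<in> J" using assms by blast
  qed
  have "(\<lambda>x. if last_pt d B = N then path_weight K d B * (\<Prod>a\<in>B. H * e (x a)) else 0) \<in> borel_measurable (PM J)"
    if "B \<in> Pow {d<..N}" for B
    using p[OF that] by (cases "last_pt d B = N") auto
  then show ?thesis
    unfolding Z_def[abs_def] chain_sum_def using assms
    by (intro borel_measurable_times borel_measurable_const measurable_site borel_measurable_sum) auto
qed

lemma H_power_le: "j \<le> k \<Longrightarrow> H ^ j \<le> 3"
  using power_increasing[of j k H] H1 Hk by linarith

lemma insert_subset_block:
  assumes "d \<in> block i" "B \<in> Pow {d<..Suc i * k}"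
  shows "insert d B \<subseteq> block i" "card (insert d B) \<le> k"
proof -
  show s: "insert d B \<subseteq> block i" using assms by (auto simp: block_def)
  have "card (insert d B) \<le> card (block i)" by (intro card_mono s) simp
  then show "card (insert d B) \<le> k" by (simp add: block_def)
qed

section \<open>Transition weights averaged over one block\<close>

lemma tilt_step_nonneg:
  assumes "d \<le> f" "f < t" shows "tilt_step d f t x \<ge> 0"
  unfolding tilt_step_def
proof (intro sum_nonneg mult_nonneg_nonneg path_weight_nonneg' K_nonneg tilt_nonneg)
  fix B assume "B \<in> Pow {d<..f}"
  then have "last_pt d B \<le> f" using last_pt_bounds[of B d f] assms by auto
  then show "1 \<le> t - last_pt d B" using assms by simp
qed (use H1 in auto)

text \<open>The transition weight averaged over the disorder of the block outside the test event
  \<open>E\<close>. The full average \<open>total\<close> enters only with the small prefactor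
  coming from the probability of \<open>E\<close>.\<close>

definition kept :: "nat \<Rightarrow> (nat \<Rightarrow> real) set \<Rightarrow> nat \<Rightarrow> nat \<Rightarrow> real" where
  "kept i E d t = (\<integral>x. tilt_step d (Suc i * k) t x * indicator (space (PM (block i)) - E) x \<partial>PM (block i))"

definition total :: "nat \<Rightarrow> nat \<Rightarrow> nat \<Rightarrow> real" where
  "total i d t = (\<integral>x. tilt_step d (Suc i * k) t x \<partial>PM (block i))"

lemma tilt_step_integrals:
  assumes d: "d \<in> block i" and E: "E \<in> sets (PM (block i))"
  shows "integrable (PM (block i)) (tilt_step d (Suc i * k) t)"
    and "integrable (PM (block i)) (\<lambda>x. tilt_step d (Suc i * k) t x * indicator (space (PM (block i)) - E) x)"
    and "total i d t = (\<Sum>B\<in>Pow {d<..Suc i * k}. path_weight K d B * K (t - last_pt d B) * H ^ card (insert d B))"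
    and "kept i E d t = (\<Sum>B\<in>Pow {d<..Suc i * k}. path_weight K d B * K (t - last_pt d B) *
      (H ^ card (insert d B) * (\<integral>x. tilt (insert d B) x * indicator (space (PM (block i)) - E) x \<partial>PM (block i))))"
proof -
  let ?I = "block i" and ?f = "Suc i * k"
  let ?ind = "indicator (space (PM ?I) - E) :: _ \<Rightarrow> real"
  have ti: "integrable (PM ?I) (tilt (insert d B))" "(\<integral>x. tilt (insert d B) x \<partial>PM ?I) = 1"
    if "B \<in> Pow {d<..?f}" for B
    using tilt_integral[of ?I "insert d B"] insert_subset_block[OF d that] by auto
  have ti2: "integrable (PM ?I) (\<lambda>x. tilt (insert d B) x * ?ind x)" if "B \<in> Pow {d<..?f}" for B
    using E by (intro integrable_real_mult_indicator ti that) auto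
  show i1: "integrable (PM ?I) (tilt_step d ?f t)"
    unfolding tilt_step_def[abs_def]
    by (intro Bochner_Integration.integrable_sum integrable_mult_right ti)
  show "integrable (PM ?I) (\<lambda>x. tilt_step d ?f t x * ?ind x)"
    using E by (intro integrable_real_mult_indicator i1) auto
  have "total i d t = (\<Sum>B\<in>Pow {d<..?f}. \<integral>x. path_weight K d B * K (t - last_pt d B) * (H ^ card (insert d B) * tilt (insert d B) x) \<partial>PM ?I)"
    unfolding total_def tilt_step_def
    by (intro Bochner_Integration.integral_sum integrable_mult_right ti)
  then show "total i d t = (\<Sum>B\<in>Pow {d<..?f}. path_weight K d B * K (t - last_pt d B) * H ^ card (insert d B))"
    using ti(2) by simp
  have "kept i E d t = (\<integral>x. (\<Sum>B\<in>Pow {d<..?f}. path_weight K d B * K (t - last_pt d B) * (H ^ card (insert d B) * (tilt (insert d B) x * ?ind x))) \<partial>PM ?I)"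
    unfolding kept_def tilt_step_def sum_distrib_right by (simp only: mult.assoc)
  also have "\<dots> = (\<Sum>B\<in>Pow {d<..?f}. \<integral>x. path_weight K d B * K (t - last_pt d B) * (H ^ card (insert d B) * (tilt (insert d B) x * ?ind x)) \<partial>PM ?I)"
    by (intro Bochner_Integration.integral_sum integrable_mult_right ti2)
  finally show "kept i E d t = (\<Sum>B\<in>Pow {d<..?f}. path_weight K d B * K (t - last_pt d B) *
      (H ^ card (insert d B) * (\<integral>x. tilt (insert d B) x * ?ind x \<partial>PM ?I)))"
    by simp
qed

lemma total_le_jump:
  assumes d: "d \<in> block i" and t: "Suc i * k < t"
  shows "0 \<le> total i d t" "total i d t \<le> 3 * jump d (Suc i * k) t"
proof -
  have df: "d \<le> Suc i * k" using d by (auto simp: block_def)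
  have K0: "0 \<le> path_weight K d B * K (t - last_pt d B)" if B: "B \<in> Pow {d<..Suc i * k}" for B
  proof -
    have "last_pt d B \<le> Suc i * k" using last_pt_bounds[of B d] B df by auto
    then show ?thesis using t by (intro mult_nonneg_nonneg path_weight_nonneg'[OF B] K_nonneg) auto
  qed
  have eq: "total i d t = (\<Sum>B\<in>Pow {d<..Suc i * k}. path_weight K d B * K (t - last_pt d B) * H ^ card (insert d B))"
    by (rule tilt_step_integrals(3)[OF d sets.empty_sets])
  show "0 \<le> total i d t" unfolding eq
    by (intro sum_nonneg mult_nonneg_nonneg[OF K0]) (use H1 in auto)
  have "total i d t \<le> (\<Sum>B\<in>Pow {d<..Suc i * k}. path_weight K d B * K (t - last_pt d B) * 3)"
    unfolding eq by (intro sum_mono mult_left_mono K0 H_power_le insert_subset_block[OF d])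
  then show "total i d t \<le> 3 * jump d (Suc i * k) t"
    by (simp add: jump_def sum_distrib_left mult_ac)
qed

lemma kept_bounds:
  assumes d: "d \<in> block i" and t: "Suc i * k < t" and E: "E \<in> sets (PM (block i))"
  shows "0 \<le> kept i E d t" "kept i E d t \<le> total i d t"
proof -
  have nn: "0 \<le> tilt_step d (Suc i * k) t x" for x
    using d t by (intro tilt_step_nonneg) (auto simp: block_def)
  show "0 \<le> kept i E d t" unfolding kept_def
    using nn by (intro integral_nonneg_AE AE_I2 mult_nonneg_nonneg) auto
  show "kept i E d t \<le> total i d t" unfolding kept_def total_def
    using nn by (intro integral_mono tilt_step_integrals[OF d E]) (auto simp: indicator_def)
qed

text \<open>Summing over targets turns the exit probabilities into the tail factor of
  \<open>path_sum\<close>, so all transitions together are controlled by the tilted probability of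
  the complement of \<open>E\<close>, averaged over paths.\<close>

lemma kept_sum_le:
  assumes d: "d \<in> block i" and E: "E \<in> sets (PM (block i))" and T: "finite T" "T \<subseteq> {Suc i * k<..}"
  shows "(\<Sum>t\<in>T. kept i E d t) \<le> 3 * path_sum K d (Suc i * k) (\<lambda>B. \<integral>x. tilt (insert d B) x *
        indicator (space (PM (block i)) - E) x \<partial>PM (block i))"
proof -
  let ?f = "Suc i * k"
  let ?G = "\<lambda>B. \<integral>x. tilt (insert d B) x * indicator (space (PM (block i)) - E) x \<partial>PM (block i)"
  have df: "d \<le> ?f" using d by (auto simp: block_def)
  have G0: "0 \<le> ?G B" for B
    using tilt_nonneg by (intro integral_nonneg_AE AE_I2 mult_nonneg_nonneg) auto
  have "(\<Sum>t\<in>T. kept i E d t) = (\<Sum>B\<in>Pow {d<..?f}. path_weight K d B * (\<Sum>t\<in>T. K (t - last_pt d B)) * (H ^ card (insert d B) * ?G B))"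
    unfolding tilt_step_integrals(4)[OF d E]
    by (subst sum.swap) (simp add: sum_distrib_left sum_distrib_right)
  also have "\<dots> \<le> (\<Sum>B\<in>Pow {d<..?f}. path_weight K d B * tail_mass K (?f - last_pt d B) * (3 * ?G B))"
  proof (intro sum_mono mult_mono)
    fix B assume B: "B \<in> Pow {d<..?f}"
    show "path_weight K d B \<le> path_weight K d B" "0 \<le> path_weight K d B" by (simp_all add: path_weight_nonneg'[OF B])
    show "(\<Sum>t\<in>T. K (t - last_pt d B)) \<le> tail_mass K (?f - last_pt d B)"
      by (rule sum_K_after[OF B df T(2,1)])
    show "0 \<le> (\<Sum>t\<in>T. K (t - last_pt d B))"
      using T last_pt_bounds[of B d ?f] B df by (intro sum_nonneg K_nonneg) (auto simp: Suc_le_eq dest!: subsetD intro: le_less_trans)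
    show "H ^ card (insert d B) \<le> 3" by (intro H_power_le insert_subset_block[OF d B])
    show "0 \<le> path_weight K d B * tail_mass K (?f - last_pt d B)"
      by (intro mult_nonneg_nonneg path_weight_nonneg'[OF B] tail_mass_nonneg)
    show "0 \<le> H ^ card (insert d B) * ?G B" using H1 G0 by (intro mult_nonneg_nonneg) auto
  qed (use G0 in auto)
  also have "\<dots> = 3 * path_sum K d ?f ?G" by (simp add: path_sum_def sum_distrib_left mult_ac)
  finally show ?thesis .
qed

lemma measurable_tilt_step:
  assumes "d \<in> block i" "Suc i * k \<le> N"
  shows "tilt_step d (Suc i * k) t \<in> borel_measurable (PM {1..N})"
proof -
  have "tilt (insert d B) \<in> borel_measurable (PM {1..N})" if "B \<in> Pow {d<..Suc i * k}" for B
    unfolding tilt_def[abs_def]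
  proof (intro borel_measurable_prod measurable_site)
    fix a assume "a \<in> insert d B"
    then have "a \<in> block i" using insert_subset_block(1)[OF assms(1) that] by blast
    then show "a \<in> {1..N}" using assms(2) by (auto simp: block_def)
  qed
  then show ?thesis unfolding tilt_step_def[abs_def]
    by (intro borel_measurable_sum borel_measurable_times borel_measurable_const)
qed

text \<open>The factors \<open>Z N t\<close> with \<open>t\<close> beyond the block do not depend on
  its disorder. By Fubini that disorder is integrated first with everything else fixed, where
  \<open>fractional_moment_split\<close> applies; the result no longer depends on the block and
  extends back to the full product.\<close>

lemma block_transfer:
  assumes i: "Suc i * k \<le> N" and T: "T \<subseteq> {Suc i * k<..N}" and wt: "\<And>d. d \<in> block i \<Longrightarrow> wt d \<ge> 0"
    and E: "E \<in> sets (PM (block i))" "measure (PM (block i)) E \<le> \<pi>"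
  shows "(\<integral>\<^sup>+x. ennreal ((\<Sum>t\<in>T. (\<Sum>d\<in>block i. wt d * tilt_step d (Suc i * k) t x) * Z N t x) powr (9/10)) \<partial>PM {1..N}) \<le>
    (\<integral>\<^sup>+x. ennreal ((\<Sum>t\<in>T. (\<Sum>d\<in>block i. wt d * kept i E d t) * Z N t x) powr (9/10)) \<partial>PM {1..N}) +
    ennreal (\<pi> powr (1/10)) *
    (\<integral>\<^sup>+x. ennreal ((\<Sum>t\<in>T. (\<Sum>d\<in>block i. wt d * total i d t) * Z N t x) powr (9/10)) \<partial>PM {1..N})"
proof -
  let ?I = "block i" and ?f = "Suc i * k"
  define Oc where "Oc = {1..N} - ?I"
  have ON: "{1..N} = Oc \<union> ?I" "Oc \<inter> ?I = {}" "finite Oc" "finite ?I"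
    using i by (auto simp: block_def Oc_def)
  have TO: "{t..N} \<subseteq> Oc" "{t..N} \<subseteq> {1..N}" "t \<le> N" if "t \<in> T" for t
    using that T by (auto simp: block_def Oc_def)
  have fT: "finite T" using T finite_subset by blast
  interpret PP: product_prob_space "\<lambda>_::nat. \<nu>" UNIV by unfold_locales
  interpret PI: prob_space "PM ?I" by (rule prob_space_PM)
  have Zm: "Z N t \<in> borel_measurable (PM {1..N})" "Z N t \<in> borel_measurable (PM Oc)" if "t \<in> T" for t
    using TO[OF that] by (auto intro: measurable_Z)
  have Sm: "tilt_step d ?f t \<in> borel_measurable (PM {1..N})" if "d \<in> ?I" for d t
    by (rule measurable_tilt_step[OF that i])
  define q where "q t = (\<Sum>d\<in>?I. wt d * kept i E d t)" for t
  define r where "r t = (\<Sum>d\<in>?I. wt d * total i d t)" for t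
  define S where "S t x = (\<Sum>d\<in>?I. wt d * tilt_step d ?f t x)" for t x
  have Zmerge: "Z N t (merge Oc ?I (x, y)) = Z N t x" if "t \<in> T" for t x y
    using TO[OF that] ON by (intro Z_cong) (auto simp: merge_def)
  have Smerge: "S t (merge Oc ?I (x, y)) = S t y" for t x y
    unfolding S_def
    by (intro sum.cong refl arg_cong2[of _ _ _ _ "(*)"] tilt_step_cong) (auto simp: merge_def block_def Oc_def)
  have fold: "(\<integral>\<^sup>+x. ennreal ((\<Sum>t\<in>T. F t x * Z N t x) powr (9/10)) \<partial>PM {1..N}) =
     (\<integral>\<^sup>+x. \<integral>\<^sup>+y. ennreal ((\<Sum>t\<in>T. F t (merge Oc ?I (x, y)) * Z N t x) powr (9/10)) \<partial>PM ?I \<partial>PM Oc)"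
    if F: "\<And>t. F t \<in> borel_measurable (PM {1..N})" for F
  proof -
    have m: "(\<lambda>x. ennreal ((\<Sum>t\<in>T. F t x * Z N t x) powr (9/10))) \<in> borel_measurable (PM (Oc \<union> ?I))"
      unfolding ON(1)[symmetric] using F Zm
      by (intro borel_measurable_ennreal_powr borel_measurable_sum borel_measurable_times borel_measurable_const)
    have "(\<integral>\<^sup>+x. ennreal ((\<Sum>t\<in>T. F t x * Z N t x) powr (9/10)) \<partial>PM {1..N}) =
      (\<integral>\<^sup>+x. ennreal ((\<Sum>t\<in>T. F t x * Z N t x) powr (9/10)) \<partial>PM (Oc \<union> ?I))"
      by (simp only: ON(1)[symmetric])
    also have "(\<integral>\<^sup>+x. ennreal ((\<Sum>t\<in>T. F t x * Z N t x) powr (9/10)) \<partial>PM (Oc \<union> ?I)) = (\<integral>\<^sup>+x. \<integral>\<^sup>+y. ennreal ((\<Sum>t\<in>T. F t (merge Oc ?I (x, y)) * Z N t (merge Oc ?I (x, y))) powr (9/10)) \<partial>PM ?I \<partial>PM Oc)"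
      by (rule PP.product_nn_integral_fold[OF ON(2-4) m])
    finally have "(\<integral>\<^sup>+x. ennreal ((\<Sum>t\<in>T. F t x * Z N t x) powr (9/10)) \<partial>PM {1..N}) =
      (\<integral>\<^sup>+x. \<integral>\<^sup>+y. ennreal ((\<Sum>t\<in>T. F t (merge Oc ?I (x, y)) * Z N t (merge Oc ?I (x, y))) powr (9/10)) \<partial>PM ?I \<partial>PM Oc)" .
    moreover have "(\<Sum>t\<in>T. F t (merge Oc ?I (x, y)) * Z N t (merge Oc ?I (x, y))) =
        (\<Sum>t\<in>T. F t (merge Oc ?I (x, y)) * Z N t x)" for x y
      by (intro sum.cong refl) (simp only: Zmerge)
    ultimately show ?thesis by (simp only:)
  qed
  have const: "(\<integral>\<^sup>+x. ennreal ((\<Sum>t\<in>T. c t * Z N t x) powr (9/10)) \<partial>PM {1..N}) =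
     (\<integral>\<^sup>+x. ennreal ((\<Sum>t\<in>T. c t * Z N t x) powr (9/10)) \<partial>PM Oc)" for c
    using fold[of "\<lambda>t _. c t"] by (simp add: PI.emeasure_space_1)
  have inner: "(\<integral>\<^sup>+y. ennreal ((\<Sum>t\<in>T. S t y * Z N t x) powr (9/10)) \<partial>PM ?I) \<le>
    ennreal ((\<Sum>t\<in>T. q t * Z N t x) powr (9/10)) + ennreal (\<pi> powr (1/10)) * ennreal ((\<Sum>t\<in>T. r t * Z N t x) powr (9/10))" for x
  proof -
    let ?ind = "indicator (space (PM ?I) - E) :: _ \<Rightarrow> real"
    let ?Y = "\<lambda>y. \<Sum>t\<in>T. S t y * Z N t x"
    have Si: "integrable (PM ?I) (S t)" for t
      unfolding S_def[abs_def]
      by (intro Bochner_Integration.integrable_sum integrable_mult_right tilt_step_integrals(1)[OF _ E(1)])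
    have Sint: "(\<integral>y. S t y \<partial>PM ?I) = r t" for t
    proof -
      have "(\<integral>y. S t y \<partial>PM ?I) = (\<Sum>d\<in>?I. \<integral>y. wt d * tilt_step d ?f t y \<partial>PM ?I)"
        unfolding S_def
        by (intro Bochner_Integration.integral_sum integrable_mult_right tilt_step_integrals(1)[OF _ E(1)])
      then show ?thesis by (simp add: r_def total_def)
    qed
    have Si2: "integrable (PM ?I) (\<lambda>y. S t y * ?ind y)" for t
      using E by (intro integrable_real_mult_indicator Si) auto
    have Sint2: "(\<integral>y. S t y * ?ind y \<partial>PM ?I) = q t" for t
    proof -
      have "(\<integral>y. S t y * ?ind y \<partial>PM ?I) = (\<integral>y. (\<Sum>d\<in>?I. wt d * (tilt_step d ?f t y * ?ind y)) \<partial>PM ?I)"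
        unfolding S_def sum_distrib_right by (simp only: mult.assoc)
      also have "\<dots> = (\<Sum>d\<in>?I. \<integral>y. wt d * (tilt_step d ?f t y * ?ind y) \<partial>PM ?I)"
        by (intro Bochner_Integration.integral_sum integrable_mult_right tilt_step_integrals(2)[OF _ E(1)])
      finally show ?thesis by (simp add: q_def kept_def)
    qed
    have Yi: "integrable (PM ?I) ?Y"
      by (intro Bochner_Integration.integrable_sum integrable_mult_left Si)
    have Y0: "0 \<le> ?Y y" for y
      unfolding S_def using wt Z_nonneg T
      by (intro sum_nonneg mult_nonneg_nonneg tilt_step_nonneg) (auto simp: block_def)
    have e1: "(\<integral>y. ?Y y \<partial>PM ?I) = (\<Sum>t\<in>T. r t * Z N t x)"
    proof -
      have "(\<integral>y. ?Y y \<partial>PM ?I) = (\<Sum>t\<in>T. \<integral>y. S t y * Z N t x \<partial>PM ?I)"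
        by (intro Bochner_Integration.integral_sum integrable_mult_left Si)
      then show ?thesis by (simp add: Sint)
    qed
    have e2: "(\<integral>y. ?Y y * ?ind y \<partial>PM ?I) = (\<Sum>t\<in>T. q t * Z N t x)"
    proof -
      have "(\<integral>y. ?Y y * ?ind y \<partial>PM ?I) = (\<integral>y. (\<Sum>t\<in>T. S t y * ?ind y * Z N t x) \<partial>PM ?I)"
        unfolding sum_distrib_right by (simp only: mult_ac)
      also have "\<dots> = (\<Sum>t\<in>T. \<integral>y. S t y * ?ind y * Z N t x \<partial>PM ?I)"
        by (intro Bochner_Integration.integral_sum integrable_mult_left Si2)
      also have "\<dots> = (\<Sum>t\<in>T. q t * Z N t x)" by (simp add: Sint2)
      finally show ?thesis .
    qed
    have "(\<integral>\<^sup>+y. ennreal (?Y y powr (9/10)) \<partial>PM ?I) \<le>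
      ennreal ((\<Sum>t\<in>T. q t * Z N t x) powr (9/10) + \<pi> powr (1 - 9/10) * (\<Sum>t\<in>T. r t * Z N t x) powr (9/10))"
      unfolding e1[symmetric] e2[symmetric]
      by (rule PI.fractional_moment_split[OF Yi _ E(1) E(2) \<pi>_pos]) (use Y0 in auto)
    also have "\<dots> = ennreal ((\<Sum>t\<in>T. q t * Z N t x) powr (9/10)) + ennreal (\<pi> powr (1/10)) * ennreal ((\<Sum>t\<in>T. r t * Z N t x) powr (9/10))"
      by (simp add: ennreal_plus ennreal_mult')
    finally show ?thesis .
  qed
  have mO: "(\<lambda>x. ennreal ((\<Sum>t\<in>T. c t * Z N t x) powr (9/10))) \<in> borel_measurable (PM Oc)" for c
    using Zm by (intro borel_measurable_ennreal_powr borel_measurable_sum borel_measurable_times borel_measurable_const)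
  have "(\<integral>\<^sup>+x. ennreal ((\<Sum>t\<in>T. S t x * Z N t x) powr (9/10)) \<partial>PM {1..N}) =
    (\<integral>\<^sup>+x. \<integral>\<^sup>+y. ennreal ((\<Sum>t\<in>T. S t y * Z N t x) powr (9/10)) \<partial>PM ?I \<partial>PM Oc)"
  proof -
    have "S t \<in> borel_measurable (PM {1..N})" for t
      unfolding S_def[abs_def] by (intro borel_measurable_sum borel_measurable_times borel_measurable_const Sm)
    then show ?thesis by (simp only: fold Smerge)
  qed
  also have "\<dots> \<le> (\<integral>\<^sup>+x. ennreal ((\<Sum>t\<in>T. q t * Z N t x) powr (9/10)) +
      ennreal (\<pi> powr (1/10)) * ennreal ((\<Sum>t\<in>T. r t * Z N t x) powr (9/10)) \<partial>PM Oc)"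
    by (intro nn_integral_mono inner)
  also have "\<dots> = (\<integral>\<^sup>+x. ennreal ((\<Sum>t\<in>T. q t * Z N t x) powr (9/10)) \<partial>PM Oc) +
      ennreal (\<pi> powr (1/10)) * (\<integral>\<^sup>+x. ennreal ((\<Sum>t\<in>T. r t * Z N t x) powr (9/10)) \<partial>PM Oc)"
    using mO[of q] mO[of r] by (subst nn_integral_add) (auto simp: nn_integral_cmult)
  finally show ?thesis unfolding const S_def q_def r_def .
qed

text \<open>Entering block \<open>j\<close> costs the jump weight \<open>hop\<close>; the bad part
  holds only a fraction \<open>\<epsilon>\<close> of its sites, and the bound is proportional to the
  number of targets.\<close>

lemma total_mass:
  assumes d: "d \<in> block i" and ij: "i < j"
  shows "(\<Sum>t\<in>good j. total i d t) \<le> hop (j - i)" "(\<Sum>t\<in>bad j. total i d t) \<le> \<epsilon> * hop (j - i)"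
proof -
  let ?f = "Suc i * k"
  have df: "d \<le> ?f" "?f \<le> d + k" using d by (auto simp: block_def)
  have fj: "?f \<le> j * k" using ij by (intro mult_right_mono) auto
  have n: "1 \<le> j - i" using ij by simp
  have dist: "?f + (j - i - 1) * k = j * k"
  proof -
    have "Suc i + (j - i - 1) = j" using ij by simp
    then show ?thesis by (metis add_mult_distrib)
  qed
  have nk: "(j - i) * k = (j - i - 1) * k + k" using n by (metis add_mult_distrib le_add_diff_inverse2 mult_1)
  have gf: "?f < t" if "t \<in> good j" for t using that fj by (auto simp: good_def)
  have bf: "?f < t" if "t \<in> bad j" for t
    using that fj w2 k1 by (auto simp: bad_def)
  have cg: "real (card (good j)) \<le> real k" by (simp add: good_def)
  have cb: "real (card (bad j)) \<le> \<epsilon> * real k" using w\<epsilon> w2 by (simp add: bad_def)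
  have le3: "(\<Sum>t\<in>T. total i d t) \<le> 3 * (\<Sum>t\<in>T. jump d ?f t)" if "\<And>t. t \<in> T \<Longrightarrow> ?f < t" for T
    unfolding sum_distrib_left using total_le_jump(2)[OF d] that by (intro sum_mono) auto
  have leg: "(\<Sum>t\<in>good j. total i d t) \<le> 3 * (\<Sum>t\<in>good j. jump d ?f t)" by (rule le3, rule gf)
  have leb: "(\<Sum>t\<in>bad j. total i d t) \<le> 3 * (\<Sum>t\<in>bad j. jump d ?f t)" by (rule le3, rule bf)
  have h: "3 * (16 * c2 / c1 * real n powr (-5/4)) \<le> hop n" for n
  proof -
    have "16 * c2 / c1 * real n powr (-5/4) \<le> max 1 (16 * c2 / c1) * real n powr (-5/4)"
      by (intro mult_right_mono) auto
    then show ?thesis by (simp add: hop_def)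
  qed
  show "(\<Sum>t\<in>good j. total i d t) \<le> hop (j - i)"
  \<comment> \<open>Targets in the next block can be adjacent to the end of block \<open>i\<close>,
    where no decay is available; total probability at most 1 is used instead.\<close>
  proof (cases "j - i = 1")
    case True
    have "(\<Sum>t\<in>good j. jump d ?f t) \<le> 1"
      using gf df by (intro jump_sum_le_1) auto
    then have "(\<Sum>t\<in>good j. total i d t) \<le> 3 * 1" using leg by linarith
    also have "\<dots> \<le> hop (j - i)" unfolding True by (simp add: hop_def)
    finally show ?thesis .
  next
    case False
    have "(\<Sum>t\<in>good j. jump d ?f t) \<le> 16 * c2 / c1 * (real k / real k) * real (j - i) powr (-5/4)"
    proof (intro jump_sum_far df k1 n cg gf)
      fix t assume "t \<in> good j"
      then have "j * k < t" by (auto simp: good_def)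
      then have "(j - i - 1) * k \<le> t - ?f" using dist by linarith
      moreover have "1 * k \<le> (j - i - 1) * k" using False n by (intro mult_right_mono) linarith+
      ultimately show "(j - i) * k \<le> 2 * (t - ?f)" using nk by linarith
    qed auto
    then have "3 * (\<Sum>t\<in>good j. jump d ?f t) \<le> 3 * (16 * c2 / c1 * real (j - i) powr (-5/4))" using k1 by simp
    then show ?thesis using leg h[of "j - i"] by linarith
  qed
  \<comment> \<open>Since \<open>2 * w \<le> k\<close>, even the bad part of the next block is at
    distance more than \<open>k / 2\<close>, so the bound for far targets covers all
    \<open>j\<close>.\<close>
  have "(\<Sum>t\<in>bad j. jump d ?f t) \<le> 16 * c2 / c1 * (\<epsilon> * real k / real k) * real (j - i) powr (-5/4)"
  proof (intro jump_sum_far df k1 n cb bf)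
    fix t assume "t \<in> bad j"
    then have "Suc j * k - w < t" by (auto simp: bad_def)
    then have "j * k + k < t + w" by simp
    then have "(j - i - 1) * k + k < (t - ?f) + w" using dist fj bf[OF \<open>t \<in> bad j\<close>] by linarith
    then show "(j - i) * k \<le> 2 * (t - ?f)" using nk w2 by linarith
  qed auto
  note far = this
  have e: "16 * c2 / c1 * (\<epsilon> * real k / real k) * y = \<epsilon> * (16 * c2 / c1 * y)" for y using k1 by simp
  have "3 * (\<Sum>t\<in>bad j. jump d ?f t) \<le> 3 * (\<epsilon> * (16 * c2 / c1 * real (j - i) powr (-5/4)))"
    using far unfolding e by linarith
  also have "\<dots> = \<epsilon> * (3 * (16 * c2 / c1 * real (j - i) powr (-5/4)))" by (simp only: mult_ac)
  also have "\<dots> \<le> \<epsilon> * hop (j - i)" using h \<epsilon>0 by (intro mult_left_mono) auto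
  finally show "(\<Sum>t\<in>bad j. total i d t) \<le> \<epsilon> * hop (j - i)" using leb by linarith
qed

text \<open>The bound is required for arbitrary nonnegative starting weights, because the induction
  feeds the averaged transition weights of the preceding block into it.\<close>

definition block_moment :: "nat \<Rightarrow> nat \<Rightarrow> bool" where
  "block_moment N i \<longleftrightarrow> (\<forall>wt. (\<forall>d\<in>block i. wt d \<ge> 0) \<longrightarrow>
     (\<integral>\<^sup>+x. ennreal ((\<Sum>d\<in>block i. wt d * Z N d x) powr (9/10)) \<partial>PM {1..N}) \<le>
     ennreal (3 * ((\<Sum>d\<in>good i. wt d) powr (9/10) + \<Lambda> * (\<Sum>d\<in>bad i. wt d) powr (9/10))))"

text \<open>Inside the last block neither test nor decay is used: by Jensen's inequality it is
  enough that the mean of \<open>Z\<close> is at most \<open>H ^ k \<le> 3\<close>.\<close>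

lemma block_moment_last:
  assumes N: "N = Suc i * k" shows "block_moment N i"
  unfolding block_moment_def
proof (intro allI impI)
  fix wt :: "nat \<Rightarrow> real" assume wt: "\<forall>d\<in>block i. wt d \<ge> 0"
  interpret PN: prob_space "PM {1..N}" by (rule prob_space_PM)
  have Zi: "integrable (PM {1..N}) (Z N d) \<and> (\<integral>x. Z N d x \<partial>PM {1..N}) \<le> 3" if d: "d \<in> block i" for d
  proof -
    have eq: "Z N d x = (\<Sum>B\<in>Pow {d<..N}. (if last_pt d B = N then path_weight K d B else 0) * (H ^ card (insert d B) * tilt (insert d B) x))" for x
      unfolding Z_def chain_sum_def sum_distrib_left
    proof (intro sum.cong refl)
      fix B assume "B \<in> Pow {d<..N}"
      then have "B \<subseteq> {d<..N}" by simp
      note pt = prod_tilt[OF this, of x, symmetric]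
      show "H * e (x d) * (if last_pt d B = N then path_weight K d B * (\<Prod>a\<in>B. H * e (x a)) else 0) =
        (if last_pt d B = N then path_weight K d B else 0) * (H ^ card (insert d B) * tilt (insert d B) x)"
        by (simp only: pt) (simp add: mult_ac)
    qed
    have sub: "insert d B \<subseteq> {1..N}" "card (insert d B) \<le> k" if "B \<in> Pow {d<..N}" for B
      using insert_subset_block[OF d, of B] that by (auto simp: N block_def)
    have ti: "integrable (PM {1..N}) (tilt (insert d B))" "(\<integral>x. tilt (insert d B) x \<partial>PM {1..N}) = 1"
      if "B \<in> Pow {d<..N}" for B using tilt_integral[OF _ sub(1)[OF that]] by auto
    have i: "integrable (PM {1..N}) (Z N d)"
      unfolding eq[abs_def] by (intro Bochner_Integration.integrable_sum integrable_mult_right ti)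
    have "(\<integral>x. Z N d x \<partial>PM {1..N}) = (\<Sum>B\<in>Pow {d<..N}. \<integral>x. (if last_pt d B = N then path_weight K d B else 0) * (H ^ card (insert d B) * tilt (insert d B) x) \<partial>PM {1..N})"
      unfolding eq by (intro Bochner_Integration.integral_sum integrable_mult_right ti)
    also have "\<dots> = (\<Sum>B\<in>Pow {d<..N}. (if last_pt d B = N then path_weight K d B else 0) * H ^ card (insert d B))"
      by (intro sum.cong refl) (simp only: integral_mult_right_zero ti(2) mult_1_right)
    also have "\<dots> \<le> (\<Sum>B\<in>Pow {d<..N}. (if last_pt d B = N then path_weight K d B else 0) * 3)"
      using path_weight_nonneg' by (intro sum_mono mult_left_mono H_power_le sub) auto
    also have "\<dots> = 3 * chain_sum K (\<lambda>_. 1) d N"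
      unfolding chain_sum_def sum_distrib_left by (intro sum.cong) auto
    also have "\<dots> \<le> 3"
      using renewal_mass_le_1 chain_sum_one_shift[of d N K] d by (auto simp: N block_def)
    finally show ?thesis using i by simp
  qed
  define G where "G = (\<Sum>d\<in>good i. wt d)"
  define B where "B = (\<Sum>d\<in>bad i. wt d)"
  have GB: "0 \<le> G" "0 \<le> B" unfolding G_def B_def using wt block_split(1)[of i] by (auto intro!: sum_nonneg)
  have "(\<integral>\<^sup>+x. ennreal ((\<Sum>d\<in>block i. wt d * Z N d x) powr (9/10)) \<partial>PM {1..N}) \<le>
    ennreal ((\<integral>x. (\<Sum>d\<in>block i. wt d * Z N d x) \<partial>PM {1..N}) powr (9/10))"
    using Zi wt Z_nonneg
    by (intro PN.fractional_moment_jensen Bochner_Integration.integrable_sum integrable_mult_right) (auto intro!: sum_nonneg)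
  also have "\<dots> \<le> ennreal ((3 * (G + B)) powr (9/10))"
  proof (intro ennreal_leI powr_mono2)
    have "(\<integral>x. (\<Sum>d\<in>block i. wt d * Z N d x) \<partial>PM {1..N}) = (\<Sum>d\<in>block i. \<integral>x. wt d * Z N d x \<partial>PM {1..N})"
      using Zi by (intro Bochner_Integration.integral_sum integrable_mult_right) auto
    also have "\<dots> = (\<Sum>d\<in>block i. wt d * (\<integral>x. Z N d x \<partial>PM {1..N}))" by simp
    also have "\<dots> \<le> (\<Sum>d\<in>block i. wt d * 3)" using Zi wt by (intro sum_mono mult_left_mono) auto
    also have "\<dots> = 3 * (G + B)" by (simp add: sum_distrib_right[symmetric] sum_block G_def B_def)
    finally show "(\<integral>x. (\<Sum>d\<in>block i. wt d * Z N d x) \<partial>PM {1..N}) \<le> 3 * (G + B)" .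
    show "0 \<le> (\<integral>x. (\<Sum>d\<in>block i. wt d * Z N d x) \<partial>PM {1..N})"
      using wt Z_nonneg by (intro integral_nonneg_AE AE_I2 sum_nonneg mult_nonneg_nonneg) auto
  qed simp
  also have "\<dots> \<le> ennreal (3 * (G powr (9/10) + \<Lambda> * B powr (9/10)))"
  proof (rule ennreal_leI)
    have "(3 * (G + B)) powr (9/10) = 3 powr (9/10) * (G + B) powr (9/10)"
      using powr_mult[of 3 "G + B" "9/10"] GB by (simp del: distrib_left_numeral distrib_right_numeral)
    also have "\<dots> \<le> 3 powr 1 * (G powr (9/10) + B powr (9/10))"
      using GB by (intro mult_mono powr_mono powr_add_le) auto
    also have "\<dots> \<le> 3 * (G powr (9/10) + \<Lambda> * B powr (9/10))"
      using mult_right_mono[OF \<Lambda>1, of "B powr (9/10)"] by simp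
    finally show "(3 * (G + B)) powr (9/10) \<le> 3 * (G powr (9/10) + \<Lambda> * B powr (9/10))" .
  qed
  finally show "(\<integral>\<^sup>+x. ennreal ((\<Sum>d\<in>block i. wt d * Z N d x) powr (9/10)) \<partial>PM {1..N}) \<le>
     ennreal (3 * ((\<Sum>d\<in>good i. wt d) powr (9/10) + \<Lambda> * (\<Sum>d\<in>bad i. wt d) powr (9/10)))"
    unfolding G_def B_def .
qed

lemma sum_over_blocks:
  fixes g :: "nat \<Rightarrow> 'b::comm_monoid_add"
  assumes "i \<le> m" shows "(\<Sum>t\<in>{i * k<..m * k}. g t) = (\<Sum>j\<in>{i..<m}. \<Sum>t\<in>block j. g t)"
  using assms
proof (induction m rule: dec_induct)
  case (step m)
  have "{i * k<..Suc m * k} = {i * k<..m * k} \<union> block m"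
  proof -
    have le: "i * k \<le> m * k" using step by (intro mult_right_mono) auto
    have "i * k < x" if "m * k < x" for x using le that by (rule le_less_trans)
    then show ?thesis using step by (auto simp: block_def)
  qed
  moreover have "{i * k<..m * k} \<inter> block m = {}" by (auto simp: block_def)
  ultimately have "(\<Sum>t\<in>{i * k<..Suc m * k}. g t) = (\<Sum>t\<in>{i * k<..m * k}. g t) + (\<Sum>t\<in>block m. g t)"
    by (simp add: sum.union_disjoint)
  then show ?case using step by simp
qed simp

lemma powr_linear_le:
  fixes V a b G B g :: real
  assumes "0 \<le> V" "V \<le> a * G + b * B" "0 \<le> a" "0 \<le> b" "0 \<le> G" "0 \<le> B" "0 < g" "g \<le> 1"
  shows "V powr g \<le> a powr g * G powr g + b powr g * B powr g"
proof -
  have "V powr g \<le> (a * G + b * B) powr g" using assms by (intro powr_mono2) auto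
  also have "\<dots> \<le> (a * G) powr g + (b * B) powr g" using assms by (intro powr_add_le) auto
  finally show ?thesis using assms by (simp add: powr_mult)
qed

text \<open>The sum is split according to the next visited block \<open>j\<close>, with
  subadditivity of the power \<open>9/10\<close>. Averaging over block \<open>i\<close> gives
  starting weights for block \<open>j\<close>, to which the hypothesis for \<open>j\<close> applies;
  the two row conditions then sum the contributions over \<open>j\<close>.\<close>

lemma block_moment_step:
  assumes N: "N = m * k" and im: "Suc i < m" and IH: "\<And>j. i < j \<Longrightarrow> j < m \<Longrightarrow> block_moment N j"
  shows "block_moment N i"
  unfolding block_moment_def
proof (intro allI impI)
  fix wt :: "nat \<Rightarrow> real" assume wt: "\<forall>d\<in>block i. wt d \<ge> 0"
  let ?f = "Suc i * k"
  have fN: "?f < N" unfolding N using im k1 by (intro mult_strict_right_mono) auto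
  have bi: "{i * k<..i * k + k} = block i" "{i * k<..i * k + k - w} = good i"
    by (simp_all add: block_def good_def add.commute)
  obtain E where E: "E \<in> sets (PM (block i))" "measure (PM (block i)) E \<le> \<pi>"
    and En: "\<And>d. d \<in> good i \<Longrightarrow> path_sum K d ?f (\<lambda>B. \<integral>x. tilt (insert d B) x *
        indicator (space (PM (block i)) - E) x \<partial>PM (block i)) \<le> \<eta>"
    using test[of "i * k"] unfolding bi by (auto simp: add.commute)
  define G where "G = (\<Sum>d\<in>good i. wt d)"
  define B where "B = (\<Sum>d\<in>bad i. wt d)"
  have GB: "0 \<le> G" "0 \<le> B" unfolding G_def B_def using wt block_split(1)[of i] by (auto intro!: sum_nonneg)
  define q where "q t = (\<Sum>d\<in>block i. wt d * kept i E d t)" for t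
  define r where "r t = (\<Sum>d\<in>block i. wt d * total i d t)" for t
  define Y where "Y j x = (\<Sum>t\<in>block j. (\<Sum>d\<in>block i. wt d * tilt_step d ?f t x) * Z N t x)" for j x
  define p where "p = \<pi> powr (1/10)"
  have p0: "p \<ge> 0" by (simp add: p_def)
  \<comment> \<open>The rows of the transition matrix at block distance \<open>n\<close>, with the
    target weights 1 and \<open>\<Lambda>\<close> built in. Only the transition from good to good,
    off the test event, profits from the truncation at \<open>3 * \<eta>\<close>.\<close>
  define cg where "cg n = min (3 * \<eta>) (hop n) powr (9/10) + \<Lambda> * (\<epsilon> * hop n) powr (9/10) +
      p * (hop n powr (9/10) + \<Lambda> * (\<epsilon> * hop n) powr (9/10))" for n
  define cb where "cb n = (1 + p) * (hop n powr (9/10) + \<Lambda> * (\<epsilon> * hop n) powr (9/10))" for n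
  have blk: "?f < t" "t \<le> N" if "t \<in> block j" "j \<in> {i<..<m}" for t j
  proof -
    have "?f \<le> j * k" "Suc j * k \<le> m * k" using that by (auto intro!: mult_right_mono simp del: mult_Suc)
    then show "?f < t" "t \<le> N" using that by (auto simp: block_def N)
  qed
  have decomp: "(\<Sum>d\<in>block i. wt d * Z N d x) = (\<Sum>j\<in>{i<..<m}. Y j x)" for x
  proof -
    have "(\<Sum>d\<in>block i. wt d * Z N d x) = (\<Sum>d\<in>block i. \<Sum>t\<in>{?f<..N}. wt d * tilt_step d ?f t x * Z N t x)"
    proof (rule sum.cong[OF refl])
      fix d assume "d \<in> block i"
      then have "d \<le> ?f" by (auto simp: block_def)
      then show "wt d * Z N d x = (\<Sum>t\<in>{?f<..N}. wt d * tilt_step d ?f t x * Z N t x)"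
        by (subst Z_block[OF _ fN]) (simp_all add: sum_distrib_left mult_ac del: mult_Suc)
    qed
    also have "\<dots> = (\<Sum>t\<in>{?f<..N}. (\<Sum>d\<in>block i. wt d * tilt_step d ?f t x) * Z N t x)"
      by (subst sum.swap) (simp add: sum_distrib_right)
    also have "\<dots> = (\<Sum>j\<in>{Suc i..<m}. Y j x)"
      unfolding Y_def N using im by (intro sum_over_blocks) auto
    also have "{Suc i..<m} = {i<..<m}" by auto
    finally show ?thesis .
  qed
  have Y0: "0 \<le> Y j x" if "j \<in> {i<..<m}" for j x
    unfolding Y_def
  proof (intro sum_nonneg mult_nonneg_nonneg Z_nonneg)
    fix t d assume t: "t \<in> block j" and d: "d \<in> block i"
    show "0 \<le> wt d" using wt d by blast
    show "0 \<le> tilt_step d ?f t x" using d blk[OF t that] by (intro tilt_step_nonneg) (auto simp: block_def)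
  qed
  have Ym: "Y j \<in> borel_measurable (PM {1..N})" if "j \<in> {i<..<m}" for j
    unfolding Y_def[abs_def] using fN blk(2)[OF _ that]
    by (intro borel_measurable_sum borel_measurable_times borel_measurable_const measurable_tilt_step measurable_Z)
       (auto simp: block_def)
  have each: "(\<integral>\<^sup>+x. ennreal (Y j x powr (9/10)) \<partial>PM {1..N}) \<le>
    ennreal (3 * (cg (j - i) * G powr (9/10) + cb (j - i) * B powr (9/10)))" if j: "j \<in> {i<..<m}" for j
  proof -
    define a where "a = hop (j - i)"
    have a0: "a \<ge> 0" by (simp add: a_def hop_nonneg)
    have ij: "i < j" using j by simp
    have sub: "good j \<subseteq> block j" "bad j \<subseteq> block j" using block_split(1) by auto
    have q0: "0 \<le> q t" "q t \<le> r t" "0 \<le> r t" if "t \<in> block j" for t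
      unfolding q_def r_def using wt kept_bounds[OF _ blk(1)[OF that j] E(1)] total_le_jump(1)[OF _ blk(1)[OF that j]]
      by (auto intro!: sum_nonneg sum_mono mult_left_mono)
    have swap: "(\<Sum>t\<in>T. \<Sum>d\<in>block i. wt d * g d t) = (\<Sum>d\<in>good i. wt d * (\<Sum>t\<in>T. g d t)) + (\<Sum>d\<in>bad i. wt d * (\<Sum>t\<in>T. g d t))"
      for T and g :: "nat \<Rightarrow> nat \<Rightarrow> real"
      by (subst sum.swap) (simp add: sum_block sum_distrib_left)
    have lin: "(\<Sum>t\<in>T. \<Sum>d\<in>block i. wt d * g d t) \<le> \<alpha> * G + \<beta> * B"
      if "\<And>d. d \<in> good i \<Longrightarrow> (\<Sum>t\<in>T. g d t) \<le> \<alpha>" "\<And>d. d \<in> bad i \<Longrightarrow> (\<Sum>t\<in>T. g d t) \<le> \<beta>"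
      for T \<alpha> \<beta> and g :: "nat \<Rightarrow> nat \<Rightarrow> real"
    proof -
      have "(\<Sum>d\<in>good i. wt d * (\<Sum>t\<in>T. g d t)) \<le> (\<Sum>d\<in>good i. wt d * \<alpha>)"
        using wt that block_split(1)[of i] by (intro sum_mono mult_left_mono) auto
      moreover have "(\<Sum>d\<in>bad i. wt d * (\<Sum>t\<in>T. g d t)) \<le> (\<Sum>d\<in>bad i. wt d * \<beta>)"
        using wt that block_split(1)[of i] by (intro sum_mono mult_left_mono) auto
      ultimately show ?thesis unfolding swap G_def B_def by (simp add: sum_distrib_left mult.commute)
    qed
    have dgb: "d \<in> block i" if "d \<in> good i \<or> d \<in> bad i" for d using that block_split(1)[of i] by auto
    have rg: "(\<Sum>t\<in>good j. r t) \<le> a * G + a * B"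
      unfolding r_def a_def by (intro lin total_mass(1) ij dgb) auto
    have rb: "(\<Sum>t\<in>bad j. r t) \<le> (\<epsilon> * a) * G + (\<epsilon> * a) * B"
      unfolding r_def a_def by (intro lin total_mass(2) ij dgb) auto
    have qb: "(\<Sum>t\<in>bad j. q t) \<le> (\<epsilon> * a) * G + (\<epsilon> * a) * B"
      by (rule order_trans[OF sum_mono rb]) (use q0 sub in auto)
    have kept_a: "(\<Sum>t\<in>good j. kept i E d t) \<le> a" if d: "d \<in> good i \<or> d \<in> bad i" for d
    proof -
      have "(\<Sum>t\<in>good j. kept i E d t) \<le> (\<Sum>t\<in>good j. total i d t)"
        using sub blk(1)[OF _ j] by (intro sum_mono kept_bounds[OF dgb[OF d] _ E(1)]) auto
      also have "\<dots> \<le> a" unfolding a_def by (rule total_mass(1)[OF dgb[OF d] ij])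
      finally show ?thesis .
    qed
    have kept_min: "(\<Sum>t\<in>good j. kept i E d t) \<le> min (3 * \<eta>) a" if d: "d \<in> good i" for d
    proof -
      have "(\<Sum>t\<in>good j. kept i E d t) \<le> 3 * path_sum K d ?f (\<lambda>B. \<integral>x. tilt (insert d B) x *
          indicator (space (PM (block i)) - E) x \<partial>PM (block i))"
        using sub blk(1)[OF _ j] d by (intro kept_sum_le E dgb) auto
      then have "(\<Sum>t\<in>good j. kept i E d t) \<le> 3 * \<eta>" using En[OF d] by linarith
      then show ?thesis using kept_a[of d] d by simp
    qed
    have qg: "(\<Sum>t\<in>good j. q t) \<le> min (3 * \<eta>) a * G + a * B"
      unfolding q_def by (intro lin kept_min kept_a) auto
    have "block_moment N j" using j by (intro IH) auto
    then have cl: "(\<integral>\<^sup>+x. ennreal ((\<Sum>t\<in>block j. c t * Z N t x) powr (9/10)) \<partial>PM {1..N}) \<le>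
       ennreal (3 * ((\<Sum>t\<in>good j. c t) powr (9/10) + \<Lambda> * (\<Sum>t\<in>bad j. c t) powr (9/10)))"
      if "\<And>t. t \<in> block j \<Longrightarrow> 0 \<le> c t" for c using that unfolding block_moment_def by blast
    have nn: "0 \<le> (\<Sum>t\<in>good j. q t)" "0 \<le> (\<Sum>t\<in>bad j. q t)" "0 \<le> (\<Sum>t\<in>good j. r t)" "0 \<le> (\<Sum>t\<in>bad j. r t)"
      using q0 sub by (auto intro!: sum_nonneg)
    have "(\<integral>\<^sup>+x. ennreal (Y j x powr (9/10)) \<partial>PM {1..N}) \<le>
      (\<integral>\<^sup>+x. ennreal ((\<Sum>t\<in>block j. q t * Z N t x) powr (9/10)) \<partial>PM {1..N}) +
      ennreal p * (\<integral>\<^sup>+x. ennreal ((\<Sum>t\<in>block j. r t * Z N t x) powr (9/10)) \<partial>PM {1..N})"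
      unfolding Y_def q_def r_def p_def
    proof (rule block_transfer)
      show "block j \<subseteq> {?f<..N}" using blk[OF _ j] by auto
    qed (use fN wt E in auto)
    also have "\<dots> \<le> ennreal (3 * ((\<Sum>t\<in>good j. q t) powr (9/10) + \<Lambda> * (\<Sum>t\<in>bad j. q t) powr (9/10))) +
      ennreal p * ennreal (3 * ((\<Sum>t\<in>good j. r t) powr (9/10) + \<Lambda> * (\<Sum>t\<in>bad j. r t) powr (9/10)))"
      using q0 by (intro add_mono mult_left_mono cl) auto
    also have "\<dots> = ennreal (3 * ((\<Sum>t\<in>good j. q t) powr (9/10) + \<Lambda> * (\<Sum>t\<in>bad j. q t) powr (9/10)) +
      p * (3 * ((\<Sum>t\<in>good j. r t) powr (9/10) + \<Lambda> * (\<Sum>t\<in>bad j. r t) powr (9/10))))"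
      using p0 \<Lambda>1 by (simp add: ennreal_plus ennreal_mult')
    also have "\<dots> \<le> ennreal (3 * (cg (j - i) * G powr (9/10) + cb (j - i) * B powr (9/10)))"
    proof (rule ennreal_leI)
      let ?g = "9/10 :: real"
      have b1: "(\<Sum>t\<in>good j. q t) powr ?g \<le> min (3 * \<eta>) a powr ?g * G powr ?g + a powr ?g * B powr ?g"
        using nn qg GB a0 \<eta>0 by (intro powr_linear_le) auto
      have b2: "(\<Sum>t\<in>bad j. q t) powr ?g \<le> (\<epsilon> * a) powr ?g * G powr ?g + (\<epsilon> * a) powr ?g * B powr ?g"
        using nn qb GB a0 \<epsilon>0 by (intro powr_linear_le) auto
      have b3: "(\<Sum>t\<in>good j. r t) powr ?g \<le> a powr ?g * G powr ?g + a powr ?g * B powr ?g"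
        using nn rg GB a0 by (intro powr_linear_le) auto
      have b4: "(\<Sum>t\<in>bad j. r t) powr ?g \<le> (\<epsilon> * a) powr ?g * G powr ?g + (\<epsilon> * a) powr ?g * B powr ?g"
        using nn rb GB a0 \<epsilon>0 by (intro powr_linear_le) auto
      have "3 * ((\<Sum>t\<in>good j. q t) powr ?g + \<Lambda> * (\<Sum>t\<in>bad j. q t) powr ?g) +
        p * (3 * ((\<Sum>t\<in>good j. r t) powr ?g + \<Lambda> * (\<Sum>t\<in>bad j. r t) powr ?g)) \<le>
        3 * ((min (3 * \<eta>) a powr ?g * G powr ?g + a powr ?g * B powr ?g) + \<Lambda> * ((\<epsilon> * a) powr ?g * G powr ?g + (\<epsilon> * a) powr ?g * B powr ?g)) +
        p * (3 * ((a powr ?g * G powr ?g + a powr ?g * B powr ?g) + \<Lambda> * ((\<epsilon> * a) powr ?g * G powr ?g + (\<epsilon> * a) powr ?g * B powr ?g)))"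
        using b1 b2 b3 b4 p0 \<Lambda>1 by (intro add_mono mult_left_mono) auto
      also have "\<dots> = 3 * (cg (j - i) * G powr ?g + cb (j - i) * B powr ?g)"
        unfolding cg_def cb_def a_def by (simp only: distrib_left distrib_right mult_ac add_ac mult_1_left mult_1_right)
      finally show "3 * ((\<Sum>t\<in>good j. q t) powr ?g + \<Lambda> * (\<Sum>t\<in>bad j. q t) powr ?g) +
        p * (3 * ((\<Sum>t\<in>good j. r t) powr ?g + \<Lambda> * (\<Sum>t\<in>bad j. r t) powr ?g)) \<le>
        3 * (cg (j - i) * G powr ?g + cb (j - i) * B powr ?g)" .
    qed
    finally show ?thesis .
  qed
  have "(\<integral>\<^sup>+x. ennreal ((\<Sum>d\<in>block i. wt d * Z N d x) powr (9/10)) \<partial>PM {1..N}) \<le>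
    (\<integral>\<^sup>+x. (\<Sum>j\<in>{i<..<m}. ennreal (Y j x powr (9/10))) \<partial>PM {1..N})"
  proof (rule nn_integral_mono)
    fix x
    have "ennreal ((\<Sum>j\<in>{i<..<m}. Y j x) powr (9/10)) \<le> ennreal (\<Sum>j\<in>{i<..<m}. Y j x powr (9/10))"
      using Y0 by (intro ennreal_leI powr_sum_le) auto
    also have "\<dots> = (\<Sum>j\<in>{i<..<m}. ennreal (Y j x powr (9/10)))" by (simp add: sum_ennreal)
    finally show "ennreal ((\<Sum>d\<in>block i. wt d * Z N d x) powr (9/10)) \<le> (\<Sum>j\<in>{i<..<m}. ennreal (Y j x powr (9/10)))"
      unfolding decomp .
  qed
  also have "\<dots> = (\<Sum>j\<in>{i<..<m}. \<integral>\<^sup>+x. ennreal (Y j x powr (9/10)) \<partial>PM {1..N})"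
    using Ym by (intro nn_integral_sum borel_measurable_ennreal_powr) auto
  also have "\<dots> \<le> (\<Sum>j\<in>{i<..<m}. ennreal (3 * (cg (j - i) * G powr (9/10) + cb (j - i) * B powr (9/10))))"
    by (intro sum_mono each)
  also have "\<dots> = ennreal (\<Sum>j\<in>{i<..<m}. 3 * (cg (j - i) * G powr (9/10) + cb (j - i) * B powr (9/10)))"
    using p0 \<Lambda>1 by (intro sum_ennreal) (auto simp: cg_def cb_def intro!: add_nonneg_nonneg mult_nonneg_nonneg)
  also have "\<dots> \<le> ennreal (3 * (G powr (9/10) + \<Lambda> * B powr (9/10)))"
  proof (rule ennreal_leI)
    have re: "(\<Sum>j\<in>{i<..<m}. c (j - i)) = (\<Sum>n\<in>{1..m - 1 - i}. c n)" for c :: "nat \<Rightarrow> real"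
      by (rule sum.reindex_bij_witness[of _ "\<lambda>n. n + i" "\<lambda>j. j - i"]) auto
    have "(\<Sum>j\<in>{i<..<m}. 3 * (cg (j - i) * G powr (9/10) + cb (j - i) * B powr (9/10))) =
      3 * ((\<Sum>n\<in>{1..m - 1 - i}. cg n) * G powr (9/10) + (\<Sum>n\<in>{1..m - 1 - i}. cb n) * B powr (9/10))"
      unfolding re[of "\<lambda>n. 3 * (cg n * G powr (9/10) + cb n * B powr (9/10))"]
      by (simp add: sum_distrib_left sum_distrib_right sum.distrib distrib_left mult_ac)
    also have "\<dots> \<le> 3 * (1 * G powr (9/10) + \<Lambda> * B powr (9/10))"
      using good_row[of "m - 1 - i"] bad_row[of "m - 1 - i"]
      unfolding cg_def cb_def p_def by (intro mult_left_mono add_mono mult_right_mono) auto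
    finally show "(\<Sum>j\<in>{i<..<m}. 3 * (cg (j - i) * G powr (9/10) + cb (j - i) * B powr (9/10))) \<le>
      3 * (G powr (9/10) + \<Lambda> * B powr (9/10))" by simp
  qed
  finally show "(\<integral>\<^sup>+x. ennreal ((\<Sum>d\<in>block i. wt d * Z N d x) powr (9/10)) \<partial>PM {1..N}) \<le>
     ennreal (3 * ((\<Sum>d\<in>good i. wt d) powr (9/10) + \<Lambda> * (\<Sum>d\<in>bad i. wt d) powr (9/10)))"
    unfolding G_def B_def .
qed

lemma block_moment_all:
  assumes "N = m * k" "i < m" shows "block_moment N i"
  using assms(2)
proof (induction "m - i" arbitrary: i rule: less_induct)
  case less
  show ?case
  proof (cases "Suc i = m")
    case True
    then show ?thesis using assms(1) by (intro block_moment_last) simp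
  next
    case False
    show ?thesis
    proof (rule block_moment_step[OF assms(1)])
      show "Suc i < m" using less.prems False by simp
      fix j assume "i < j" "j < m"
      then show "block_moment N j" by (intro less.hyps) auto
    qed
  qed
qed

text \<open>The first contact lies in one of the \<open>m\<close> blocks. Its weights
  \<open>K t\<close> have total mass at most 1 in each block, so every block contributes a constant
  and the bound is linear in \<open>m\<close>.\<close>

lemma fractional_moment_bound:
  assumes m: "1 \<le> m"
  shows "(\<integral>\<^sup>+x. ennreal (chain_sum K (\<lambda>a. H * e (x a)) 0 (m * k) powr (9/10)) \<partial>PM {1..m * k}) \<le> ennreal (3 * (1 + \<Lambda>) * real m)"
proof -
  define N where "N = m * k"
  have N0: "0 < N" using m k1 by (simp add: N_def)
  have eq: "chain_sum K (\<lambda>a. H * e (x a)) 0 N = (\<Sum>j\<in>{0..<m}. \<Sum>t\<in>block j. K t * Z N t x)" for x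
  proof -
    have "chain_sum K (\<lambda>a. H * e (x a)) 0 N = (\<Sum>t\<in>{0<..N}. K t * Z N t x)"
      by (subst chain_sum_block[of 0 0]) (use N0 in \<open>auto simp: Z_def mult_ac\<close>)
    also have "\<dots> = (\<Sum>t\<in>{0 * k<..m * k}. K t * Z N t x)" by (simp add: N_def)
    also have "\<dots> = (\<Sum>j\<in>{0..<m}. \<Sum>t\<in>block j. K t * Z N t x)" by (rule sum_over_blocks) simp
    finally show ?thesis .
  qed
  have tb: "0 < t" "t \<le> N" if "t \<in> block j" "j \<in> {0..<m}" for t j
  proof -
    have "Suc j * k \<le> m * k" using that by (intro mult_right_mono) auto
    then show "0 < t" "t \<le> N" using that by (auto simp: block_def N_def)
  qed
  have S0: "0 \<le> (\<Sum>t\<in>block j. K t * Z N t x)" if "j \<in> {0..<m}" for j x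
    using tb[OF _ that] by (intro sum_nonneg mult_nonneg_nonneg Z_nonneg K_nonneg) (auto simp: Suc_le_eq)
  have Sm: "(\<lambda>x. \<Sum>t\<in>block j. K t * Z N t x) \<in> borel_measurable (PM {1..N})" if "j \<in> {0..<m}" for j
    using tb[OF _ that] by (intro borel_measurable_sum borel_measurable_times borel_measurable_const measurable_Z) (auto simp: Suc_le_eq)
  have "(\<integral>\<^sup>+x. ennreal (chain_sum K (\<lambda>a. H * e (x a)) 0 N powr (9/10)) \<partial>PM {1..N}) \<le>
    (\<integral>\<^sup>+x. (\<Sum>j\<in>{0..<m}. ennreal ((\<Sum>t\<in>block j. K t * Z N t x) powr (9/10))) \<partial>PM {1..N})"
  proof (rule nn_integral_mono)
    fix x
    have "ennreal ((\<Sum>j\<in>{0..<m}. \<Sum>t\<in>block j. K t * Z N t x) powr (9/10)) \<le>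
        ennreal (\<Sum>j\<in>{0..<m}. (\<Sum>t\<in>block j. K t * Z N t x) powr (9/10))"
      using S0 by (intro ennreal_leI powr_sum_le) auto
    then show "ennreal (chain_sum K (\<lambda>a. H * e (x a)) 0 N powr (9/10)) \<le>
       (\<Sum>j\<in>{0..<m}. ennreal ((\<Sum>t\<in>block j. K t * Z N t x) powr (9/10)))"
      unfolding eq by (simp add: sum_ennreal)
  qed
  also have "\<dots> = (\<Sum>j\<in>{0..<m}. \<integral>\<^sup>+x. ennreal ((\<Sum>t\<in>block j. K t * Z N t x) powr (9/10)) \<partial>PM {1..N})"
    using Sm by (intro nn_integral_sum borel_measurable_ennreal_powr) auto
  also have "\<dots> \<le> (\<Sum>j\<in>{0..<m}. ennreal (3 * (1 + \<Lambda>)))"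
  proof (rule sum_mono)
    fix j assume j: "j \<in> {0..<m}"
    have Kt: "0 \<le> K t" if "t \<in> block j" for t using tb[OF that j] by (intro K_nonneg) auto
    have le1: "(\<Sum>t\<in>S. K t) powr (9/10) \<le> 1" if "S \<subseteq> block j" for S
    proof -
      have fS: "finite S" by (rule finite_subset[OF that]) simp
      have "(\<Sum>t\<in>S. K t) \<le> (\<Sum>t\<in>{0<..N}. K t)"
        using that tb[OF _ j] K_nonneg by (intro sum_mono2) auto
      also have "\<dots> \<le> 1" using sum_K_le_tail_mass[of 0 N] by (simp add: tail_mass_def)
      finally have "(\<Sum>t\<in>S. K t) \<le> 1" .
      moreover have "0 \<le> (\<Sum>t\<in>S. K t)" using that Kt by (intro sum_nonneg) auto
      ultimately have "(\<Sum>t\<in>S. K t) powr (9/10) \<le> 1 powr (9/10)" by (intro powr_mono2) auto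
      then show ?thesis by simp
    qed
    have "(\<integral>\<^sup>+x. ennreal ((\<Sum>t\<in>block j. K t * Z N t x) powr (9/10)) \<partial>PM {1..N}) \<le>
      ennreal (3 * ((\<Sum>d\<in>good j. K d) powr (9/10) + \<Lambda> * (\<Sum>d\<in>bad j. K d) powr (9/10)))"
      using block_moment_all[OF N_def, of j] j Kt unfolding block_moment_def by auto
    also have "\<dots> \<le> ennreal (3 * (1 + \<Lambda> * 1))"
      using le1 block_split(1)[of j] \<Lambda>1 by (intro ennreal_leI mult_left_mono add_mono) auto
    finally show "(\<integral>\<^sup>+x. ennreal ((\<Sum>t\<in>block j. K t * Z N t x) powr (9/10)) \<partial>PM {1..N}) \<le> ennreal (3 * (1 + \<Lambda>))" by simp
  qed
  also have "\<dots> = ennreal (3 * (1 + \<Lambda>) * real m)"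
    using \<Lambda>1 by (subst sum_ennreal) (auto simp: mult.commute)
  finally show ?thesis unfolding N_def .
qed

end

subsection \<open>Choice of the parameters\<close>

context marginal_kernel
begin

lemma hop_powr_summable: "summable (\<lambda>n. hop n powr (9/10))"
proof -
  have "hop n powr (9/10) = (3 * max 1 (16 * c2 / c1)) powr (9/10) * real n powr (-9/8)" for n
    unfolding hop_def by (subst powr_mult) (auto simp: powr_powr)
  then show ?thesis
    using summable_real_powr_iff[of "-9/8"] by (simp add: summable_mult)
qed

lemma hop_powr_bound: "\<exists>S\<ge>1. \<forall>M. (\<Sum>n\<in>{1..M}. hop n powr (9/10)) \<le> S"
proof -
  have "(\<Sum>n\<in>{1..M}. hop n powr (9/10)) \<le> (\<Sum>n. hop n powr (9/10))" for M
    by (rule sum_le_suminf[OF hop_powr_summable]) auto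
  then show ?thesis by (intro exI[of _ "max 1 (\<Sum>n. hop n powr (9/10))"]) (auto intro: max.coboundedI2)
qed

text \<open>Dominated convergence for a convergent series: the tail is small without truncation, the
  finitely many remaining terms by taking \<open>\<eta>\<close> small.\<close>

lemma hop_powr_truncated:
  assumes "r > 0"
  shows "\<exists>\<eta>>0. \<forall>M. (\<Sum>n\<in>{1..M}. min (3 * \<eta>) (hop n) powr (9/10)) \<le> r"
proof -
  obtain N where N: "norm (\<Sum>i. hop (i + N) powr (9/10)) < r / 2"
    using suminf_exist_split[OF _ hop_powr_summable, of "r / 2"] assms by auto
  \<comment> \<open>Solves \<open>(3 * \<eta>)^(9/10) = r / (2 (N + 1))\<close>, so the first
    \<open>N\<close> terms add up to at most \<open>r / 2\<close>.\<close>
  define \<eta> where "\<eta> = (r / (2 * (real N + 1))) powr (10/9) / 3"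
  have \<eta>: "\<eta> > 0" using assms by (simp add: \<eta>_def)
  have e: "(3 * \<eta>) powr (9/10) = r / (2 * (real N + 1))"
    using assms by (simp add: \<eta>_def powr_powr)
  have sN: "summable (\<lambda>i. hop (i + N) powr (9/10))"
    using summable_iff_shift[of "\<lambda>n. hop n powr (9/10)" N] hop_powr_summable by simp
  have "(\<Sum>n\<in>{1..M}. min (3 * \<eta>) (hop n) powr (9/10)) \<le> r" for M
  proof -
    have "(\<Sum>n\<in>{1..M}. min (3 * \<eta>) (hop n) powr (9/10)) \<le> (\<Sum>n\<in>{..<N} \<union> {N..N + M}. min (3 * \<eta>) (hop n) powr (9/10))"
      by (intro sum_mono2) auto
    also have "\<dots> = (\<Sum>n\<in>{..<N}. min (3 * \<eta>) (hop n) powr (9/10)) + (\<Sum>n\<in>{N..N + M}. min (3 * \<eta>) (hop n) powr (9/10))"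
      by (rule sum.union_disjoint) auto
    also have "\<dots> \<le> (\<Sum>n\<in>{..<N}. (3 * \<eta>) powr (9/10)) + (\<Sum>n\<in>{N..N + M}. hop n powr (9/10))"
      using \<eta> hop_nonneg by (intro add_mono sum_mono powr_mono2) auto
    also have "(\<Sum>n\<in>{N..N + M}. hop n powr (9/10)) = (\<Sum>i\<in>{0..M}. hop (i + N) powr (9/10))"
      using sum.shift_bounds_cl_nat_ivl[of "\<lambda>n. hop n powr (9/10)" 0 N M] by (simp add: add.commute)
    also have "\<dots> \<le> (\<Sum>i. hop (i + N) powr (9/10))" by (rule sum_le_suminf[OF sN]) auto
    also have "(\<Sum>n\<in>{..<N}. (3 * \<eta>) powr (9/10)) \<le> r / 2"
    proof -
      have "(\<Sum>n\<in>{..<N}. (3 * \<eta>) powr (9/10)) = real N * (r / (2 * (real N + 1)))" by (simp add: e)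
      also have "\<dots> = r / 2 * (real N / (real N + 1))" by simp
      also have "\<dots> \<le> r / 2 * 1" using assms by (intro mult_left_mono) auto
      finally show ?thesis by simp
    qed
    finally show ?thesis using N by simp
  qed
  then show ?thesis using \<eta> by blast
qed

lemma nice_shift:
  assumes "finite A" shows "nice c C p k ((+) s ` A) \<longleftrightarrow> nice c C p k A"
  unfolding nice_def using star_sum_shift[OF assms] by simp

end

context marginal_renewal
begin

text \<open>The order of choices matters: \<open>\<Lambda>\<close>, \<open>\<epsilon>\<close>,
  \<open>\<pi>\<close>, \<open>\<eta>\<close> depend only on the kernel; then the constants of
  \<open>nice\<close>; last the threshold \<open>A\<close>, which depends also on \<open>s0\<close>
  and \<open>p\<close>. Nothing depends on the block length, the site law or its mean, so
  \<open>k\<close> may be tuned to \<open>\<beta>\<close> afterwards.\<close>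

lemma block_model_exists:
  assumes s0: "s0 \<ge> 1"
  shows "\<exists>w \<eta> \<pi> \<Lambda> \<epsilon> A. \<forall>k \<nu> e \<mu> H. tilted_site \<nu> e \<mu> s0 \<longrightarrow> A \<le> D k \<longrightarrow> A \<le> \<mu>\<^sup>2 * D k \<longrightarrow>
    A \<le> \<mu> ^ (2 * Suc p) * (real k * (v k)\<^sup>2 * D k ^ p) \<longrightarrow> 1 \<le> H \<longrightarrow> H ^ k \<le> 3 \<longrightarrow>
    block_model K v c1 c2 \<nu> e \<mu> s0 k (w k) H \<eta> \<pi> \<Lambda> \<epsilon>"
proof -
  obtain S where S: "S \<ge> 1" "\<And>M. (\<Sum>n\<in>{1..M}. hop n powr (9/10)) \<le> S"
    using hop_powr_bound by blast
  \<comment> \<open>With \<open>\<epsilon>^(9/10) = 1 / (16 S^2)\<close> the bad targets sum to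
    \<open>\<Lambda> * \<epsilon>^(9/10) * S = 1/4\<close>, and
    \<open>\<pi>^(1/10) = 1 / (8 S)\<close> makes the contribution of the test event
    \<open>1/4\<close>; with \<open>1/4\<close> from \<open>\<eta>\<close> the good row is at most
    \<open>3/4\<close>. The bad row is at most \<open>2 * (2 * S) = \<Lambda>\<close>.\<close>
  define \<Lambda> where "\<Lambda> = 4 * S"
  define \<epsilon> where "\<epsilon> = (1 / (16 * S\<^sup>2)) powr (10/9)"
  define \<pi> where "\<pi> = (1 / (8 * S)) ^ 10"
  obtain \<eta> where \<eta>: "\<eta> > 0" "\<And>M. (\<Sum>n\<in>{1..M}. min (3 * \<eta>) (hop n) powr (9/10)) \<le> 1/4"
    using hop_powr_truncated[of "1/4"] by auto
  have S2: "1 \<le> S\<^sup>2" using S by simp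
  have \<epsilon>: "0 < \<epsilon>" "\<epsilon> \<le> 1/2"
  proof -
    show "0 < \<epsilon>" using S by (simp add: \<epsilon>_def)
    have "\<epsilon> \<le> (1 / (16 * S\<^sup>2)) powr 1"
      unfolding \<epsilon>_def using S2 by (intro powr_mono') (auto simp: divide_simps)
    also have "\<dots> \<le> 1/2" using S2 by (simp add: divide_simps)
    finally show "\<epsilon> \<le> 1/2" .
  qed
  have \<epsilon>g: "\<epsilon> powr (9/10) = 1 / (16 * S\<^sup>2)" using S by (simp add: \<epsilon>_def powr_powr)
  have \<pi>: "0 < \<pi>" using S by (simp add: \<pi>_def)
  have \<pi>g: "\<pi> powr (1/10) = 1 / (8 * S)"
  proof -
    have "(y ^ 10) powr (1/10) = y" if "y > 0" for y :: real
    proof -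
      have "(y ^ 10) powr (1/10) = (y powr 10) powr (1/10)" using that by simp
      also have "\<dots> = y" using that by (subst powr_powr) simp
      finally show ?thesis .
    qed
    from this[of "1 / (8 * S)"] show ?thesis using S by (simp only: \<pi>_def) simp
  qed
  have bad_sum: "(\<Sum>n\<in>{1..M}. \<Lambda> * (\<epsilon> * hop n) powr (9/10)) \<le> 1/4" for M
  proof -
    have "(\<Sum>n\<in>{1..M}. \<Lambda> * (\<epsilon> * hop n) powr (9/10)) = \<Lambda> * \<epsilon> powr (9/10) * (\<Sum>n\<in>{1..M}. hop n powr (9/10))"
      using \<epsilon> hop_nonneg by (simp add: powr_mult sum_distrib_left mult_ac)
    also have "\<dots> \<le> \<Lambda> * \<epsilon> powr (9/10) * S" using S by (intro mult_left_mono) (auto simp: \<Lambda>_def)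
    also have "\<dots> = 1/4" unfolding \<epsilon>g \<Lambda>_def using S by (simp add: power2_eq_square)
    finally show ?thesis .
  qed
  have row: "(\<Sum>n\<in>{1..M}. hop n powr (9/10) + \<Lambda> * (\<epsilon> * hop n) powr (9/10)) \<le> 2 * S" for M
    unfolding sum.distrib using S(1) S(2)[of M] bad_sum[of M] by linarith
  have good_row: "(\<Sum>n\<in>{1..M}. min (3 * \<eta>) (hop n) powr (9/10) + \<Lambda> * (\<epsilon> * hop n) powr (9/10) +
      \<pi> powr (1/10) * (hop n powr (9/10) + \<Lambda> * (\<epsilon> * hop n) powr (9/10))) \<le> 1" for M
  proof -
    have "\<pi> powr (1/10) * (\<Sum>n\<in>{1..M}. hop n powr (9/10) + \<Lambda> * (\<epsilon> * hop n) powr (9/10)) \<le> \<pi> powr (1/10) * (2 * S)"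
      by (intro mult_left_mono row) auto
    also have "\<dots> = 1/4" unfolding \<pi>g using S by simp
    finally have "(\<Sum>n\<in>{1..M}. \<pi> powr (1/10) * (hop n powr (9/10) + \<Lambda> * (\<epsilon> * hop n) powr (9/10))) \<le> 1/4"
      by (simp only: sum_distrib_left)
    then show ?thesis unfolding sum.distrib using \<eta>(2)[of M] bad_sum[of M] by (simp add: sum.distrib)
  qed
  have bad_row: "(\<Sum>n\<in>{1..M}. (1 + \<pi> powr (1/10)) * (hop n powr (9/10) + \<Lambda> * (\<epsilon> * hop n) powr (9/10))) \<le> \<Lambda>" for M
  proof -
    have "(\<Sum>n\<in>{1..M}. (1 + \<pi> powr (1/10)) * (hop n powr (9/10) + \<Lambda> * (\<epsilon> * hop n) powr (9/10))) =
      (1 + \<pi> powr (1/10)) * (\<Sum>n\<in>{1..M}. hop n powr (9/10) + \<Lambda> * (\<epsilon> * hop n) powr (9/10))"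
      by (simp only: sum_distrib_left)
    also have "\<dots> \<le> 2 * (2 * S)"
    proof (intro mult_mono row)
      show "1 + \<pi> powr (1/10) \<le> 2" unfolding \<pi>g using S by (simp add: divide_simps)
      show "0 \<le> (\<Sum>n\<in>{1..M}. hop n powr (9/10) + \<Lambda> * (\<epsilon> * hop n) powr (9/10))"
        using S by (intro sum_nonneg add_nonneg_nonneg mult_nonneg_nonneg) (auto simp: \<Lambda>_def)
    qed auto
    finally show ?thesis by (simp add: \<Lambda>_def)
  qed
  \<comment> \<open>A good start leaves a window of at least
    \<open>w k \<ge> \<epsilon> / 2 * k\<close> sites, hence the fraction
    \<open>\<epsilon> / 2\<close>. The budget \<open>\<eta>\<close> is shared equally between paths
    that are not nice and the failure of the test on nice ones.\<close>
  have "\<exists>c>0. \<exists>C>0. \<exists>A. \<forall>k n. A \<le> D k \<longrightarrow> \<epsilon> / 2 * real k \<le> real n \<longrightarrow> n \<le> k \<longrightarrow>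
    path_sum K 0 n (\<lambda>B. of_bool (\<not> nice c C p k (insert 0 B))) \<le> \<eta> / 2"
    by (rule nice_paths) (use \<eta>(1) \<epsilon> in auto)
  then obtain c C A1 where cC: "c > 0" "C > 0" and nice: "\<And>k n. A1 \<le> D k \<Longrightarrow> \<epsilon> / 2 * real k \<le> real n \<Longrightarrow> n \<le> k \<Longrightarrow>
      path_sum K 0 n (\<lambda>B. of_bool (\<not> nice c C p k (insert 0 B))) \<le> \<eta> / 2"
    by blast
  define B where "B = max 1 (max (4 * s0 ^ Suc p * 2 ^ p * (1 + real p * C\<^sup>2) / (\<eta> / 2 * c\<^sup>2)) (4 * s0 ^ Suc p * 2 ^ p / (\<pi> * c\<^sup>2)))"
  have B: "1 \<le> B" "4 * s0 ^ Suc p * 2 ^ p * (1 + real p * C\<^sup>2) \<le> \<eta> / 2 * c\<^sup>2 * B"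
      "4 * s0 ^ Suc p * 2 ^ p \<le> \<pi> * c\<^sup>2 * B"
  proof -
    show "1 \<le> B" by (simp add: B_def)
    have div: "x \<le> y * B" if "x / y \<le> B" "y > 0" for x y :: real
      using that by (simp add: pos_divide_le_eq mult.commute)
    show "4 * s0 ^ Suc p * 2 ^ p * (1 + real p * C\<^sup>2) \<le> \<eta> / 2 * c\<^sup>2 * B"
      by (rule div) (use \<eta>(1) cC in \<open>auto simp: B_def\<close>)
    show "4 * s0 ^ Suc p * 2 ^ p \<le> \<pi> * c\<^sup>2 * B"
      by (rule div) (use \<pi> cC in \<open>auto simp: B_def\<close>)
  qed
  \<comment> \<open>The term \<open>2 / \<epsilon>\<close> forces
    \<open>\<epsilon> k \<ge> 2\<close> through \<open>D k \<le> k\<close>, so rounding down in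
    \<open>w\<close> loses at most a factor 2.\<close>
  define A where "A = max (max A1 B) (2 / \<epsilon>)"
  define w where "w k = nat \<lfloor>\<epsilon> * real k\<rfloor>" for k :: nat
  have "block_model K v c1 c2 \<nu> e \<mu> s0 k (w k) H \<eta> \<pi> \<Lambda> \<epsilon>"
    if site: "tilted_site \<nu> e \<mu> s0" and A: "A \<le> D k" "A \<le> \<mu>\<^sup>2 * D k"
      "A \<le> \<mu> ^ (2 * Suc p) * (real k * (v k)\<^sup>2 * D k ^ p)" and H: "1 \<le> H" "H ^ k \<le> 3" for k \<nu> e \<mu> H
  proof -
    interpret site: tilted_site \<nu> e \<mu> s0 by (rule site)
    interpret T: tilted_chaos K v c1 c2 \<nu> e \<mu> s0 by unfold_locales
    have A': "A1 \<le> D k" "B \<le> \<mu>\<^sup>2 * D k" "B \<le> \<mu> ^ (2 * Suc p) * (real k * (v k)\<^sup>2 * D k ^ p)" "2 / \<epsilon> \<le> D k"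
      using A by (auto simp: A_def)
    have \<epsilon>k: "2 \<le> \<epsilon> * real k"
    proof -
      have "2 / \<epsilon> \<le> real k" using A'(4) D_le[of k] by linarith
      then show ?thesis using \<epsilon> by (simp add: pos_divide_le_eq mult.commute)
    qed
    have k1: "1 \<le> k" using \<epsilon>k by (cases k) auto
    have w: "real (w k) \<le> \<epsilon> * real k" "\<epsilon> / 2 * real k \<le> real (w k)"
      using \<epsilon>k unfolding w_def by linarith+
    have w2: "2 * w k \<le> k"
    proof -
      have "\<epsilon> * real k \<le> 1/2 * real k" using \<epsilon> by (intro mult_right_mono) auto
      then have "real (2 * w k) \<le> real k" using w by simp
      then show ?thesis by linarith
    qed
    show ?thesis
    proof (unfold_locales)
      fix s
      let ?I = "{s<..s + k}"
      let ?M = "PiM ?I (\<lambda>_. \<nu>)"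
      obtain E where E: "E \<in> sets ?M" "measure ?M E \<le> \<pi>" and En: "\<And>A. A \<subseteq> ?I \<Longrightarrow> nice c C p k A \<Longrightarrow>
          (\<integral>x. site.tilt A x * indicator (space ?M - E) x \<partial>?M) \<le> \<eta> / 2"
        using T.chaos_test[OF k1 refl cC _ \<pi> B A'(2,3), of s] \<eta>(1) by auto
      have "path_sum K d (s + k) (\<lambda>B. \<integral>x. site.tilt (insert d B) x * indicator (space ?M - E) x \<partial>?M) \<le> \<eta>"
        if d: "d \<in> {s<..s + k - w k}" for d
      proof -
        let ?n = "s + k - d"
        have n: "d + ?n = s + k" "?n \<le> k" "w k \<le> ?n" using d w2 by auto
        have "path_sum K d (s + k) (\<lambda>B. \<integral>x. site.tilt (insert d B) x * indicator (space ?M - E) x \<partial>?M) \<le>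
          path_sum K d (s + k) (\<lambda>B. \<eta> / 2 * 1 + of_bool (\<not> nice c C p k (insert d B)))"
        proof (rule path_sum_mono)
          fix B assume B: "B \<subseteq> {d<..s + k}"
          have sub: "insert d B \<subseteq> ?I" using B d by auto
          show "(\<integral>x. site.tilt (insert d B) x * indicator (space ?M - E) x \<partial>?M) \<le> \<eta> / 2 * 1 + of_bool (\<not> nice c C p k (insert d B))"
          proof (cases "nice c C p k (insert d B)")
            case True
            then show ?thesis using En[OF sub] by simp
          next
            case False
            have int: "integrable ?M (site.tilt (insert d B))" "(\<integral>x. site.tilt (insert d B) x \<partial>?M) = 1"
              using site.tilt_integral[OF _ sub] by auto
            have "(\<integral>x. site.tilt (insert d B) x * indicator (space ?M - E) x \<partial>?M) \<le> (\<integral>x. site.tilt (insert d B) x \<partial>?M)"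
              using E(1) site.tilt_nonneg int(1)
              by (intro integral_mono integrable_real_mult_indicator) (auto simp: indicator_def)
            then show ?thesis using False int(2) \<eta>(1) by simp
          qed
        qed (use d in auto)
        also have "\<dots> = \<eta> / 2 * path_sum K d (s + k) (\<lambda>_. 1) + path_sum K d (s + k) (\<lambda>B. of_bool (\<not> nice c C p k (insert d B)))"
          unfolding path_sum_add path_sum_cmult ..
        also have "path_sum K d (s + k) (\<lambda>_. 1) = 1" using d by (intro path_sum_one) auto
        also have "path_sum K d (s + k) (\<lambda>B. of_bool (\<not> nice c C p k (insert d B))) =
            path_sum K 0 ?n (\<lambda>B. of_bool (\<not> nice c C p k (insert d ((+) d ` B))))"
          using path_sum_shift[of K d 0 ?n "\<lambda>B. of_bool (\<not> nice c C p k (insert d B))"] n(1) by simp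
        also have "\<dots> = path_sum K 0 ?n (\<lambda>B. of_bool (\<not> nice c C p k (insert 0 B)))"
        proof (rule path_sum_cong)
          fix B assume "B \<subseteq> {0<..?n}"
          then have fB: "finite (insert 0 B)" using finite_subset by blast
          have "insert d ((+) d ` B) = (+) d ` insert 0 B" by simp
          then show "of_bool (\<not> nice c C p k (insert d ((+) d ` B))) = of_bool (\<not> nice c C p k (insert 0 B))"
            using nice_shift[OF fB, of c C p k d] by simp
        qed
        also have "\<dots> \<le> \<eta> / 2"
          using w n by (intro nice A'(1)) linarith+
        finally show ?thesis by simp
      qed
      then show "\<exists>E\<in>sets ?M. measure ?M E \<le> \<pi> \<and> (\<forall>d\<in>{s<..s + k - w k}.
          path_sum K d (s + k) (\<lambda>B. \<integral>x. site.tilt (insert d B) x * indicator (space ?M - E) x \<partial>?M) \<le> \<eta>)"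
        using E by blast
    next
      fix M
      show "(\<Sum>n\<in>{1..M}. min (3 * \<eta>) (hop n) powr (9/10) + \<Lambda> * (\<epsilon> * hop n) powr (9/10) +
        \<pi> powr (1/10) * (hop n powr (9/10) + \<Lambda> * (\<epsilon> * hop n) powr (9/10))) \<le> 1" by (rule good_row)
      show "(\<Sum>n\<in>{1..M}. (1 + \<pi> powr (1/10)) * (hop n powr (9/10) + \<Lambda> * (\<epsilon> * hop n) powr (9/10))) \<le> \<Lambda>"
        by (rule bad_row)
    qed (use k1 w w2 H \<pi> \<epsilon> \<eta>(1) S in \<open>auto simp: \<Lambda>_def\<close>)
  qed
  then show ?thesis by blast
qed

end

subsection \<open>Kernels of logarithmic type\<close>

text \<open>The offset \<open>4\<bar>b\<bar> + 1\<close> makes the power bounds of the locale \<open>marginal_kernel\<close> hold from \<open>n = 1\<close> on.\<close>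

definition log_profile :: "real \<Rightarrow> nat \<Rightarrow> real" where
  "log_profile b n = ((4 * \<bar>b\<bar> + 1 + ln (real n)) / (4 * \<bar>b\<bar> + 1)) powr b"

text \<open>Solving \<open>K n = 1 / (n^2 * v n)\<close> for \<open>K n = n^(-3/2)\<close> times the
  profile gives this \<open>v\<close>; the value at 0 is the normalization of
  \<open>marginal_kernel\<close>.\<close>

definition log_weight :: "real \<Rightarrow> nat \<Rightarrow> real" where
  "log_weight b n = (if n = 0 then 1 else real n powr (-1/2) / log_profile b n)"

lemma log_profile_pos: "n \<ge> 1 \<Longrightarrow> log_profile b n > 0"
proof -
  assume "n \<ge> 1"
  then have "0 \<le> ln (real n)" by simp
  then have "0 < 4 * \<bar>b\<bar> + 1 + ln (real n)" "0 < 4 * \<bar>b\<bar> + 1" by linarith+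
  then show ?thesis by (simp add: log_profile_def)
qed

text \<open>With \<open>M \<ge> 4 * \<bar>b\<bar>\<close> the inequality
  \<open>ln (y / x) \<le> (y - x) / M\<close> bounds the ratio of the logarithmic factors by the
  power \<open>1/4\<close> of \<open>n / m\<close>, whatever the sign of \<open>b\<close>.\<close>

lemma log_profile_ratio:
  assumes "1 \<le> m" "m \<le> n"
  shows "log_profile b n \<le> (real n / real m) powr (1/4) * log_profile b m"
    and "log_profile b m \<le> (real n / real m) powr (1/4) * log_profile b n"
proof -
  define M where "M = 4 * \<bar>b\<bar> + 1"
  define x where "x = M + ln (real m)"
  define y where "y = M + ln (real n)"
  have M: "M \<ge> 1" "4 * \<bar>b\<bar> \<le> M" by (auto simp: M_def)
  have xy: "M \<le> x" "x \<le> y" "y - x = ln (real n / real m)"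
    using assms by (auto simp: x_def y_def ln_div)
  have x0: "x > 0" "y > 0" using M xy by auto
  have "(y / x) powr \<bar>b\<bar> \<le> (real n / real m) powr (1/4)"
  proof -
    have "ln (y / x) \<le> y / x - 1" using x0 by (intro ln_le_minus_one) auto
    also have "\<dots> = (y - x) / x" using x0 by (simp add: field_simps)
    also have "\<dots> \<le> (y - x) / M" using xy M by (intro divide_left_mono mult_pos_pos) auto
    finally have "\<bar>b\<bar> * ln (y / x) \<le> \<bar>b\<bar> * ((y - x) / M)" by (intro mult_left_mono) auto
    also have "\<dots> = \<bar>b\<bar> / M * (y - x)" by simp
    also have "\<dots> \<le> 1/4 * (y - x)" using M xy by (intro mult_right_mono) (auto simp: divide_simps)
    finally have "\<bar>b\<bar> * ln (y / x) \<le> 1/4 * ln (real n / real m)" using xy by simp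
    then show ?thesis using x0 assms by (simp add: powr_def)
  qed
  moreover have "(y / x) powr b \<le> (y / x) powr \<bar>b\<bar>" "(y / x) powr (- b) \<le> (y / x) powr \<bar>b\<bar>"
    using xy x0 by (intro powr_mono; simp)+
  moreover have "log_profile b n = (y / x) powr b * log_profile b m"
    "log_profile b m = (y / x) powr (- b) * log_profile b n"
  proof -
    have l: "log_profile b n = y powr b / M powr b" "log_profile b m = x powr b / M powr b"
      unfolding log_profile_def M_def[symmetric] x_def[symmetric] y_def[symmetric]
      using x0 M by (simp_all add: powr_divide)
    show "log_profile b n = (y / x) powr b * log_profile b m"
      unfolding l using x0 by (simp add: powr_divide)
    show "log_profile b m = (y / x) powr (- b) * log_profile b n"
      unfolding l using x0 by (simp add: powr_minus_divide powr_divide)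
  qed
  moreover have "0 \<le> log_profile b m" "0 \<le> log_profile b n" by (simp_all add: log_profile_def)
  ultimately show "log_profile b n \<le> (real n / real m) powr (1/4) * log_profile b m"
    "log_profile b m \<le> (real n / real m) powr (1/4) * log_profile b n"
    by (metis mult_right_mono order_trans)+
qed

lemma log_weight_1: "log_weight b 1 = 1"
  by (simp add: log_weight_def log_profile_def)

lemma log_weight_pos: "log_weight b n > 0"
  using log_profile_pos[of n b] by (auto simp: log_weight_def)

lemma log_weight_regular:
  assumes "1 \<le> m" "m \<le> n"
  shows "(real m / real n) powr (3/4) * log_weight b m \<le> log_weight b n"
    and "(real n / real m) powr (1/4) * log_weight b n \<le> log_weight b m"
proof -
  define t where "t = real n / real m"
  have mn: "real m > 0" "real n > 0" and t: "t > 0" using assms by (auto simp: t_def)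
  note pm = log_profile_pos[OF assms(1), of b]
  have pn: "log_profile b n > 0" using assms by (intro log_profile_pos) auto
  have nt: "real n = t * real m" using mn by (simp add: t_def)
  have wn: "log_weight b n = t powr (-1/2) * real m powr (-1/2) / log_profile b n"
    using assms mn t by (simp add: log_weight_def nt powr_mult)
  have wm: "log_weight b m = real m powr (-1/2) / log_profile b m"
    using assms by (simp add: log_weight_def)
  have inv1: "1 / log_profile b m \<le> t powr (1/4) / log_profile b n"
    using log_profile_ratio(1)[OF assms, of b] pm pn by (simp add: t_def field_simps)
  have inv2: "1 / log_profile b n \<le> t powr (1/4) / log_profile b m"
    using log_profile_ratio(2)[OF assms, of b] pm pn by (simp add: t_def field_simps)
  have mnt: "(real m / real n) powr (3/4) = t powr (-3/4)"
    using mn by (simp add: t_def powr_divide powr_minus_divide)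
  have "t powr (-3/4) * log_weight b m = t powr (-3/4) * real m powr (-1/2) * (1 / log_profile b m)"
    by (simp add: wm)
  also have "\<dots> \<le> t powr (-3/4) * real m powr (-1/2) * (t powr (1/4) / log_profile b n)"
    using inv1 by (intro mult_left_mono) auto
  also have "\<dots> = (t powr (-3/4) * t powr (1/4)) * real m powr (-1/2) / log_profile b n" by simp
  also have "t powr (-3/4) * t powr (1/4) = t powr (-1/2)" by (simp add: powr_add[symmetric])
  finally show "(real m / real n) powr (3/4) * log_weight b m \<le> log_weight b n"
    unfolding mnt wn .
  have "t powr (1/4) * log_weight b n = t powr (1/4) * t powr (-1/2) * real m powr (-1/2) * (1 / log_profile b n)"
    by (simp add: wn)
  also have "\<dots> \<le> t powr (1/4) * t powr (-1/2) * real m powr (-1/2) * (t powr (1/4) / log_profile b m)"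
    using inv2 by (intro mult_left_mono) auto
  also have "\<dots> = (t powr (1/4) * t powr (-1/2) * t powr (1/4)) * real m powr (-1/2) / log_profile b m" by simp
  also have "t powr (1/4) * t powr (-1/2) * t powr (1/4) = 1" using t by (simp add: powr_add[symmetric])
  finally show "(real n / real m) powr (1/4) * log_weight b n \<le> log_weight b m"
    by (simp add: wm t_def)
qed

lemma log_weight_decreasing:
  assumes "m \<le> n" shows "log_weight b n \<le> log_weight b m"
proof -
  have dec: "log_weight b n \<le> log_weight b m" if "1 \<le> m" "m \<le> n" for m n
  proof -
    have "1 powr (1/4) \<le> (real n / real m) powr (1/4)" using that by (intro powr_mono2) auto
    then have "1 * log_weight b n \<le> (real n / real m) powr (1/4) * log_weight b n"
      using log_weight_pos[of b n] by (intro mult_right_mono) auto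
    then show ?thesis using log_weight_regular(2)[OF that, of b] by simp
  qed
  show ?thesis
  proof (cases "m = 0")
    case True
    show ?thesis
    proof (cases "n = 0")
      case False
      then show ?thesis using True dec[of 1 n] log_weight_1[of b] by (simp add: log_weight_def)
    qed (simp add: True)
  qed (use dec assms in auto)
qed

text \<open>The ratio of \<open>L\<close> to the profile converges to a nonzero limit; it and its
  inverse are then bounded sequences, and positivity turns this into two-sided bounds from
  \<open>n = 1\<close> on.\<close>

lemma logarithmic_type_bounds:
  assumes L: "\<And>x. x > 0 \<Longrightarrow> L x > 0" and lt: "logarithmic_type L b"
  shows "\<exists>c1>0. \<exists>c2. \<forall>n\<ge>1. c1 * log_profile b n \<le> L (real n) \<and> L (real n) \<le> c2 * log_profile b n"
proof -
  define M where "M = 4 * \<bar>b\<bar> + 1"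
  have M: "M \<ge> 1" by (simp add: M_def)
  obtain a where a: "a > 0" "L \<sim>[at_top] (\<lambda>x. a * ln x powr b)" using lt by (auto simp: logarithmic_type_def)
  define f where "f n = L (real n) / log_profile b n" for n
  have fpos: "f n > 0" if "n \<ge> 1" for n
    using L[of "real n"] log_profile_pos[OF that, of b] that by (simp add: f_def)
  have "(\<lambda>n. L (real n)) \<sim>[sequentially] (\<lambda>n. a * ln (real n) powr b)"
    using asymp_equiv_compose'[OF a(2) filterlim_real_sequentially] .
  then have lim1: "(\<lambda>n. L (real n) / (a * ln (real n) powr b)) \<longlonglongrightarrow> 1"
    by (rule asymp_equivD_strong) (use a in \<open>auto intro!: eventually_sequentiallyI[of 3]\<close>)
  have lim2: "(\<lambda>n. ((M + ln (real n)) / M / ln (real n)) powr b) \<longlonglongrightarrow> (1 / M) powr b"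
  proof (intro tendsto_powr tendsto_const)
    have lnlim: "filterlim (\<lambda>n. ln (real n)) at_top sequentially"
      by (rule filterlim_compose[OF ln_at_top filterlim_real_sequentially])
    have "(\<lambda>n. inverse (ln (real n)) + 1 / M) \<longlonglongrightarrow> 0 + 1 / M"
      by (intro tendsto_intros tendsto_inverse_0_at_top lnlim)
    moreover have "eventually (\<lambda>n. inverse (ln (real n)) + 1 / M = (M + ln (real n)) / M / ln (real n)) sequentially"
      using M by (intro eventually_sequentiallyI[of 3]) (auto simp: field_simps)
    ultimately show "(\<lambda>n. (M + ln (real n)) / M / ln (real n)) \<longlonglongrightarrow> 1 / M"
      using tendsto_cong[THEN iffD1] by fastforce
  qed (use M in auto)
  have "(\<lambda>n. L (real n) / (a * ln (real n) powr b) * a / ((M + ln (real n)) / M / ln (real n)) powr b) \<longlonglongrightarrow> 1 * a / (1 / M) powr b"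
    using M by (intro tendsto_intros lim1 lim2) auto
  moreover have "eventually (\<lambda>n. L (real n) / (a * ln (real n) powr b) * a / ((M + ln (real n)) / M / ln (real n)) powr b = f n) sequentially"
  proof (rule eventually_sequentiallyI[of 3])
    fix n :: nat assume "3 \<le> n"
    then have l: "ln (real n) > 0" by simp
    have "((M + ln (real n)) / M / ln (real n)) powr b = log_profile b n / ln (real n) powr b"
      unfolding log_profile_def M_def by (rule powr_divide)
    with l show "L (real n) / (a * ln (real n) powr b) * a / ((M + ln (real n)) / M / ln (real n)) powr b = f n"
      using a l by (simp add: f_def)
  qed
  ultimately have flim: "f \<longlonglongrightarrow> 1 * a / (1 / M) powr b"
    by (rule Lim_transform_eventually)
  have lpos: "1 * a / (1 / M) powr b \<noteq> 0" using a M by simp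
  obtain c2 where c2: "\<And>n. norm (f n) \<le> c2"
    using convergent_imp_Bseq[OF convergentI[OF flim]] by (auto simp: Bseq_def)
  obtain c where c: "c > 0" "\<And>n. norm (inverse (f n)) \<le> c"
    using convergent_imp_Bseq[OF convergentI[OF tendsto_inverse[OF flim lpos]]] by (auto simp: Bseq_def)
  have "1 / c * log_profile b n \<le> L (real n) \<and> L (real n) \<le> c2 * log_profile b n" if n: "n \<ge> 1" for n
  proof
    have p: "log_profile b n > 0" by (rule log_profile_pos[OF n])
    have "inverse (f n) \<le> c" using c(2)[of n] fpos[OF n] by simp
    then have "1 / c \<le> f n" using c(1) fpos[OF n] by (simp add: field_simps)
    then show "1 / c * log_profile b n \<le> L (real n)" using p by (simp add: f_def pos_le_divide_eq)
    have "f n \<le> c2" using c2[of n] by simp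
    then show "L (real n) \<le> c2 * log_profile b n" using p by (simp add: f_def pos_divide_le_eq)
  qed
  then show ?thesis using c(1) by (intro exI[of _ "1 / c"] conjI exI[of _ c2]) auto
qed

lemma marginal_kernel_logarithmic:
  assumes L: "\<And>x. x > 0 \<Longrightarrow> L x > 0" and lt: "logarithmic_type L b"
    and sums: "(\<lambda>n. inter_arrival_law L (1/2) (Suc n)) sums 1"
  shows "\<exists>c1 c2. marginal_kernel (inter_arrival_law L (1/2)) (log_weight b) c1 c2"
proof -
  obtain c1 c2 where c: "c1 > 0" "\<And>n. n \<ge> 1 \<Longrightarrow> c1 * log_profile b n \<le> L (real n) \<and> L (real n) \<le> c2 * log_profile b n"
    using logarithmic_type_bounds[OF L lt] by blast
  have w: "c / (real n ^ 2 * log_weight b n) = c * log_profile b n / real n powr (1 + 1/2)" if n: "n \<ge> 1" for n c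
  proof -
    have "real n ^ 2 * log_weight b n = real n powr 2 * real n powr (-1/2) / log_profile b n"
      using n by (simp add: log_weight_def)
    also have "real n powr 2 * real n powr (-1/2) = real n powr (1 + 1/2)"
      by (subst powr_add[symmetric]) simp
    finally show ?thesis using n log_profile_pos[OF n, of b] by simp
  qed
  have "marginal_kernel (inter_arrival_law L (1/2)) (log_weight b) c1 c2"
  proof
    fix n :: nat assume n: "n \<ge> 1"
    show "c1 / (real n ^ 2 * log_weight b n) \<le> inter_arrival_law L (1/2) n"
      unfolding w[OF n] inter_arrival_law_def using c(2)[OF n] n by (intro divide_right_mono) auto
    show "inter_arrival_law L (1/2) n \<le> c2 / (real n ^ 2 * log_weight b n)"
      unfolding w[OF n] inter_arrival_law_def using c(2)[OF n] n by (intro divide_right_mono) auto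
  qed (use c sums log_weight_pos log_weight_decreasing log_weight_regular in \<open>auto simp: log_weight_def[of b 0]\<close>)
  then show ?thesis by blast
qed

lemma log_weight_square:
  assumes "n \<ge> 1"
  shows "real n * (log_weight b n)\<^sup>2 = ((4 * \<bar>b\<bar> + 1 + ln (real n)) / (4 * \<bar>b\<bar> + 1)) powr (- 2 * b)"
proof -
  have "(real n powr (-1/2))\<^sup>2 = 1 / real n"
    using assms by (simp add: power2_eq_square powr_add[symmetric] powr_minus_divide)
  moreover have "(log_profile b n)\<^sup>2 = ((4 * \<bar>b\<bar> + 1 + ln (real n)) / (4 * \<bar>b\<bar> + 1)) powr (2 * b)"
    by (simp add: log_profile_def power2_eq_square powr_add[symmetric])
  moreover have "log_weight b n = real n powr (-1/2) / log_profile b n" using assms by (simp add: log_weight_def)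
  ultimately have "(log_weight b n)\<^sup>2 = 1 / real n / ((4 * \<bar>b\<bar> + 1 + ln (real n)) / (4 * \<bar>b\<bar> + 1)) powr (2 * b)"
    by (simp only: power_divide)
  then show ?thesis
    using assms powr_minus_divide[of "(4 * \<bar>b\<bar> + 1 + ln (real n)) / (4 * \<bar>b\<bar> + 1)" "2 * b"] by simp
qed

text \<open>A form that covers both signs of \<open>s\<close>, since the exponent
  \<open>- 2 * b\<close> can have either sign.\<close>

lemma powr_comparable:
  fixes x y r s :: real
  assumes "0 < x" "x \<le> y" "y \<le> r * x"
  shows "r powr (- \<bar>s\<bar>) * y powr s \<le> x powr s" "r powr (- \<bar>s\<bar>) * x powr s \<le> y powr s"
proof -
  have r: "1 \<le> r"
  proof -
    have "x * 1 \<le> x * r" using assms by (simp add: mult.commute order_trans)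
    then show ?thesis by (simp only: mult_le_cancel_left_pos[OF assms(1)])
  qed
  define t where "t = y / x"
  have t: "1 \<le> t" "t \<le> r" and y: "y = t * x" using assms by (auto simp: t_def field_simps)
  have b: "r powr (- \<bar>s\<bar>) \<le> t powr (- \<bar>s\<bar>)" using t by (intro powr_mono2') auto
  have ts: "t powr (- \<bar>s\<bar>) \<le> t powr s" "t powr (- \<bar>s\<bar>) \<le> t powr (- s)"
    using t by (intro powr_mono; simp)+
  have ys: "y powr s = t powr s * x powr s" using t assms y by (simp add: powr_mult)
  have "r powr (- \<bar>s\<bar>) * x powr s \<le> t powr s * x powr s"
    using b ts by (intro mult_right_mono) auto
  then show "r powr (- \<bar>s\<bar>) * x powr s \<le> y powr s" by (simp add: ys)
  have "r powr (- \<bar>s\<bar>) * (t powr s * x powr s) \<le> t powr (- s) * (t powr s * x powr s)"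
    using b ts by (intro mult_right_mono) auto
  also have "\<dots> = x powr s" using t by (simp add: powr_minus)
  finally show "r powr (- \<bar>s\<bar>) * y powr s \<le> x powr s" by (simp add: ys)
qed

lemma harmonic_lower:
  assumes "m \<le> n" "1 \<le> m" shows "ln (real n / real m) - ln 2 \<le> (\<Sum>t\<in>{m<..n}. 1 / real t)"
proof -
  have "ln ((real n + 1) / (real m + 1)) \<le> (\<Sum>t\<in>{m<..n}. 1 / real t)"
    using assms(1)
  proof (induction n rule: dec_induct)
    case base
    then show ?case by simp
  next
    case (step n)
    have e: "{m<..Suc n} = insert (Suc n) {m<..n}" using step by auto
    have "ln ((real (Suc n) + 1) / (real m + 1)) = ln ((real n + 1) / (real m + 1)) + ln (1 + 1 / (real n + 1))"
    proof -
      have g: "(A + 1) / B = A / B * (1 + 1 / A)" if "A > 0" "B > 0" for A B :: real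
        using that by (simp add: field_simps)
      have lnm: "ln (x * y) = ln x + ln y" if "x > 0" "y > 0" for x y :: real
        using that by (simp add: ln_mult)
      have "(real (Suc n) + 1) / (real m + 1) = (real n + 1) / (real m + 1) * (1 + 1 / (real n + 1))"
        using g[of "real n + 1" "real m + 1"] by (simp add: add.commute)
      moreover have "ln ((real n + 1) / (real m + 1) * (1 + 1 / (real n + 1))) =
          ln ((real n + 1) / (real m + 1)) + ln (1 + 1 / (real n + 1))"
        by (rule lnm) (auto intro: add_pos_nonneg)
      ultimately show ?thesis by (simp only:)
    qed
    also have "ln (1 + 1 / (real n + 1)) \<le> 1 / (real n + 1)" by (rule ln_add_one_self_le_self) simp
    finally show ?case unfolding e using step by (simp add: add.commute)
  qed
  moreover have "ln (real n / real m) - ln 2 \<le> ln ((real n + 1) / (real m + 1))"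
  proof -
    have "ln (real n / real m / 2) \<le> ln ((real n + 1) / (real m + 1))"
    proof (rule ln_mono)
      have h: "x / y / 2 \<le> (x + 1) / (y + 1)" if "0 \<le> x" "1 \<le> y" for x y :: real
      proof -
        have "x * 1 \<le> x * y" using that by (intro mult_left_mono) auto
        then have "x * (y + 1) \<le> (x + 1) * (y * 2)" using that by (simp add: algebra_simps)
        then show ?thesis using that by (simp add: pos_divide_le_eq pos_le_divide_eq)
      qed
      show "real n / real m / 2 \<le> (real n + 1) / (real m + 1)" by (rule h) (use assms in auto)
    qed (use assms in auto)
    then show ?thesis using assms by (simp add: ln_div ln_mult)
  qed
  ultimately show ?thesis by linarith
qed

text \<open>Only \<open>t\<close> between \<open>sqrt k\<close> and \<open>k\<close> are used: there
  \<open>ln t\<close> is comparable to \<open>ln k\<close>, so each term is of order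
  \<open>ln k ^ (- 2 b) / t\<close>, and the harmonic sum supplies one more factor
  \<open>ln k\<close>.\<close>

lemma log_weight_growth:
  shows "\<exists>c>0. \<exists>k0. \<forall>k\<ge>k0. c * ln (real k) powr (1 - 2 * b) \<le> (\<Sum>t\<in>{1..k}. (log_weight b t)\<^sup>2) \<and>
    c * ln (real k) powr (- 2 * b) \<le> real k * (log_weight b k)\<^sup>2"
proof -
  define M where "M = 4 * \<bar>b\<bar> + 1"
  have M: "M \<ge> 1" by (simp add: M_def)
  define s where "s = - 2 * b"
  define R where "R = 2 * (M + 1)"
  define c0 where "c0 = R powr (- \<bar>s\<bar>) * (1 / M) powr s"
  have R: "R > 0" and c0: "c0 > 0" using M by (auto simp: R_def c0_def)
  have sq: "c0 * ln (real k) powr s \<le> real n * (log_weight b n)\<^sup>2"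
    if n: "1 \<le> n" and x: "ln (real k) > 0" and le: "ln (real k) \<le> 2 * ln (real n)" "ln (real n) \<le> ln (real k)" "1 \<le> ln (real k)" for n k
  proof -
    let ?x = "ln (real k)" and ?y = "M + ln (real n)"
    have y0: "?y > 0" using M le x by linarith
    have key: "R powr (- \<bar>s\<bar>) * ?x powr s \<le> ?y powr s"
    proof (cases "?x \<le> ?y")
      case True
      have "M + ln (real n) \<le> M * ?x + ?x" using M le by (intro add_mono) (auto simp: mult_le_cancel_left1)
      also have "\<dots> \<le> R * ?x" using M le unfolding R_def by (simp add: algebra_simps)
      finally show ?thesis using True x by (intro powr_comparable(2)) auto
    next
      case False
      have "2 * ln (real n) \<le> 2 * ?y" using M by simp
      then have "?x \<le> 2 * ?y" by (rule order_trans[OF le(1)])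
      also have "\<dots> \<le> R * ?y" using y0 M by (intro mult_right_mono) (auto simp: R_def)
      finally show ?thesis using False y0 by (intro powr_comparable(1)) auto
    qed
    have "c0 * ?x powr s = (1 / M) powr s * (R powr (- \<bar>s\<bar>) * ?x powr s)" by (simp add: c0_def)
    also have "\<dots> \<le> (1 / M) powr s * ?y powr s" using key by (intro mult_left_mono) auto
    also have "\<dots> = (?y / M) powr s" using M y0 by (simp add: powr_divide)
    also have "\<dots> = real n * (log_weight b n)\<^sup>2" unfolding log_weight_square[OF n] M_def s_def by simp
    finally show ?thesis .
  qed
  have ineq: "c0 / 4 * ln (real k) powr (1 - 2 * b) \<le> (\<Sum>t\<in>{1..k}. (log_weight b t)\<^sup>2) \<and>
    c0 / 4 * ln (real k) powr (- 2 * b) \<le> real k * (log_weight b k)\<^sup>2"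
    if k: "256 \<le> k" for k :: nat
  proof
    let ?x = "ln (real k)"
    \<comment> \<open>The threshold \<open>256 = 2^8\<close> makes a quarter of \<open>ln k\<close>
      absorb the two losses of \<open>ln 2\<close>, from rounding \<open>sqrt k\<close> up and from
      \<open>harmonic_lower\<close>.\<close>
    have l4: "4 * (2 * ln 2) \<le> ?x"
    proof -
      have "ln ((2::real) ^ 8) \<le> ln (real k)" using k by (intro ln_mono) auto
      moreover have "ln ((2::real) ^ 8) = real 8 * ln 2" by (rule ln_realpow)
      ultimately show ?thesis by simp
    qed
    have x1: "1 \<le> ?x" using l4 ln2_ge_two_thirds by linarith
    have x0: "0 < ?x" using x1 by linarith
    show "c0 / 4 * ln (real k) powr (- 2 * b) \<le> real k * (log_weight b k)\<^sup>2"
    proof -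
      have "c0 * ?x powr s \<le> real k * (log_weight b k)\<^sup>2" using k x0 x1 by (intro sq) auto
      moreover have "c0 / 4 * ?x powr s \<le> c0 * ?x powr s" using c0 by (intro mult_right_mono) auto
      ultimately show ?thesis by (simp add: s_def)
    qed
    define m where "m = nat \<lceil>sqrt (real k)\<rceil>"
    have sk: "sqrt (real k) \<ge> 1" using k by simp
    have m: "sqrt (real k) \<le> real m" "real m \<le> 2 * sqrt (real k)" "1 \<le> m"
      using sk unfolding m_def by linarith+
    have lm: "?x \<le> 2 * ln (real m)"
    proof -
      have "ln (sqrt (real k)) \<le> ln (real m)" using m sk by (intro ln_mono) auto
      then show ?thesis using k by (simp add: ln_sqrt)
    qed
    have mk: "m \<le> k"
    proof -
      have "2 * sqrt (real k) \<le> sqrt (real k) * sqrt (real k)"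
        using real_le_rsqrt[of 2 "real k"] k by (intro mult_right_mono) auto
      then show ?thesis using m k by simp
    qed
    have "?x / 4 \<le> ln (real k / real m) - ln 2"
    proof -
      have "ln (real m) \<le> ln (2 * sqrt (real k))" using m by (intro ln_mono) auto
      also have "\<dots> = ln 2 + ?x / 2" using k by (simp add: ln_mult ln_sqrt)
      finally show ?thesis using m k l4 by (simp add: ln_div)
    qed
    also have "\<dots> \<le> (\<Sum>t\<in>{m<..k}. 1 / real t)" by (rule harmonic_lower[OF mk m(3)])
    finally have h: "?x / 4 \<le> (\<Sum>t\<in>{m<..k}. 1 / real t)" .
    have "c0 / 4 * ?x powr (1 - 2 * b) = c0 * ?x powr s * (?x / 4)"
      using x0 by (simp add: s_def powr_diff powr_minus field_simps)
    also have "\<dots> \<le> c0 * ?x powr s * (\<Sum>t\<in>{m<..k}. 1 / real t)"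
      using h c0 by (intro mult_left_mono) auto
    also have "\<dots> \<le> (\<Sum>t\<in>{m<..k}. (log_weight b t)\<^sup>2)"
      unfolding sum_distrib_left
    proof (rule sum_mono)
      fix t assume t: "t \<in> {m<..k}"
      have "ln (real m) \<le> ln (real t)" "ln (real t) \<le> ?x" using t m by (auto intro!: ln_mono)
      then have "?x \<le> 2 * ln (real t)" "ln (real t) \<le> ?x" using lm by linarith+
      moreover have "t \<ge> 1" using t by simp
      ultimately have "c0 * ?x powr s \<le> real t * (log_weight b t)\<^sup>2"
        using x0 x1 by (intro sq)
      then show "c0 * ?x powr s * (1 / real t) \<le> (log_weight b t)\<^sup>2"
        using t by (simp add: pos_divide_le_eq mult.commute)
    qed
    also have "\<dots> \<le> (\<Sum>t\<in>{1..k}. (log_weight b t)\<^sup>2)" by (intro sum_mono2) auto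
    finally show "c0 / 4 * ?x powr (1 - 2 * b) \<le> (\<Sum>t\<in>{1..k}. (log_weight b t)\<^sup>2)" .
  qed
  then show ?thesis using c0 by (intro exI[of _ "c0 / 4"] conjI exI[of _ 256]) auto
qed

subsection \<open>The free energy\<close>

text \<open>Fekete's lemma. The limit is the supremum, so every finite-volume value is a lower bound
  for the free energy.\<close>

lemma superadditive_limit:
  fixes a :: "nat \<Rightarrow> real"
  assumes super: "\<And>m n. m \<ge> 1 \<Longrightarrow> n \<ge> 1 \<Longrightarrow> a m + a n \<le> a (m + n)"
    and bound: "\<And>n. n \<ge> 1 \<Longrightarrow> a n \<le> C * real n"
  shows "\<exists>l. (\<lambda>n. a n / real n) \<longlonglongrightarrow> l \<and> (\<forall>n\<ge>1. a n / real n \<le> l)"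
proof -
  define S where "S = (\<lambda>n. a n / real n) ` {1..}"
  define l where "l = Sup S"
  have bdd: "bdd_above S"
    using bound by (intro bdd_aboveI[of _ C]) (auto simp: S_def pos_divide_le_eq)
  have up: "a n / real n \<le> l" if "n \<ge> 1" for n
    unfolding l_def using that by (intro cSup_upper bdd) (auto simp: S_def)
  have mult: "real q * a m + a r \<le> a (q * m + r)" if "m \<ge> 1" "r \<ge> 1" for q m r
  proof (induction q)
    case (Suc q)
    have "a m + a (q * m + r) \<le> a (m + (q * m + r))" using that by (intro super) auto
    then show ?case using Suc by (simp add: algebra_simps)
  qed simp
  have "(\<lambda>n. a n / real n) \<longlonglongrightarrow> l"
  proof (rule LIMSEQ_I)
    fix \<epsilon> :: real assume \<epsilon>: "0 < \<epsilon>"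
    have "S \<noteq> {}" by (auto simp: S_def)
    then obtain s where "s \<in> S" "l - \<epsilon> / 2 < s"
      using less_cSup_iff[of S "l - \<epsilon> / 2"] bdd \<epsilon> by (auto simp: l_def)
    then obtain m where m: "m \<ge> 1" "l - \<epsilon> / 2 < a m / real m" by (auto simp: S_def)
    define \<theta> where "\<theta> = a m / real m"
    define B where "B = (\<Sum>r\<in>{1..m}. \<bar>a r\<bar>) + real m * \<bar>\<theta>\<bar>"
    have B0: "B \<ge> 0" by (auto simp: B_def intro!: add_nonneg_nonneg sum_nonneg)
    have lower: "\<theta> - B / real n \<le> a n / real n" if n: "n \<ge> 1" for n
    proof -
      define q where "q = (n - 1) div m"
      \<comment> \<open>The remainder is taken in \<open>{1..m}\<close> because superadditivity is
        given for positive arguments.\<close>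
      define r where "r = (n - 1) mod m + 1"
      have nq: "n = q * m + r" using n by (simp add: q_def r_def)
      have r: "1 \<le> r" "r \<le> m" using m by (auto simp: r_def Suc_le_eq)
      have "\<bar>a r\<bar> \<le> (\<Sum>r\<in>{1..m}. \<bar>a r\<bar>)" using r by (intro member_le_sum) auto
      moreover have "real q * a m = (real n - real r) * \<theta>"
        using m by (simp add: nq \<theta>_def)
      moreover have "real r * \<theta> \<le> real m * \<bar>\<theta>\<bar>"
      proof -
        have "real r * \<theta> \<le> real r * \<bar>\<theta>\<bar>" by (intro mult_left_mono abs_ge_self) simp
        also have "\<dots> \<le> real m * \<bar>\<theta>\<bar>" using r by (intro mult_right_mono) auto
        finally show ?thesis .
      qed
      moreover have "real q * a m + a r \<le> a n" unfolding nq by (rule mult[OF m(1) r(1)])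
      ultimately have "real n * \<theta> - B \<le> a n" by (simp add: B_def algebra_simps)
      then have "(real n * \<theta> - B) / real n \<le> a n / real n" by (intro divide_right_mono) auto
      then show ?thesis using n by (simp add: diff_divide_distrib)
    qed
    obtain N where N: "real N > 2 * B / \<epsilon>" "N \<ge> 1"
      using reals_Archimedean2[of "max (2 * B / \<epsilon>) 1"] by (metis max_less_iff_conj of_nat_1 of_nat_less_iff less_imp_le)
    show "\<exists>no. \<forall>n\<ge>no. norm (a n / real n - l) < \<epsilon>"
    proof (intro exI[of _ N] allI impI)
      fix n assume n: "N \<le> n"
      then have n1: "n \<ge> 1" using N by simp
      have "2 * B / \<epsilon> < real n" using N n by (meson less_le_trans of_nat_le_iff)
      then have "B / real n < \<epsilon> / 2" using \<epsilon> n1 by (simp add: divide_simps mult.commute)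
      then have "l - \<epsilon> < a n / real n" using lower[OF n1] m by (simp add: \<theta>_def)
      then show "norm (a n / real n - l) < \<epsilon>" using up[OF n1] by simp
    qed
  qed
  then show ?thesis using up by blast
qed

text \<open>Jensen's inequality through the tangent of the logarithm at \<open>c\<close>.\<close>

lemma (in prob_space) expectation_ln_le:
  fixes Y :: "'a \<Rightarrow> real"
  assumes "integrable M Y" "integrable M (\<lambda>x. ln (Y x))" "\<And>x. x \<in> space M \<Longrightarrow> Y x > 0"
    and c: "expectation Y \<le> c" "c > 0"
  shows "expectation (\<lambda>x. ln (Y x)) \<le> ln c"
proof -
  have "expectation (\<lambda>x. ln (Y x)) \<le> expectation (\<lambda>x. Y x / c + (ln c - 1))"
  proof (intro integral_mono assms Bochner_Integration.integrable_add)
    fix x assume x: "x \<in> space M"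
    have "ln (Y x / c) \<le> Y x / c - 1" using assms(3)[OF x] c by (intro ln_le_minus_one) auto
    then show "ln (Y x) \<le> Y x / c + (ln c - 1)" using assms(3)[OF x] c by (simp add: ln_div)
  qed (use assms in auto)
  also have "\<dots> = expectation Y / c + (ln c - 1)"
    using assms(1) by (subst Bochner_Integration.integral_add) (auto simp: prob_space)
  also have "\<dots> \<le> ln c" using c by simp
  finally show ?thesis .
qed

section \<open>The quenched free energy for a general positive site density\<close>

locale quenched = marginal_kernel K v c1 c2 for K v c1 c2 +
  fixes \<nu> :: "real measure" and e :: "real \<Rightarrow> real" and H :: real
  assumes site_prob: "prob_space \<nu>" and site_sets: "sets \<nu> = sets borel"
    and e_pos: "\<And>x. e x > 0" and e_int: "integrable \<nu> e" "(\<integral>x. e x \<partial>\<nu>) = 1"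
    and ln_e_int: "integrable \<nu> (\<lambda>x. ln (e x))" and H_pos: "H > 0"
begin

abbreviation PM :: "nat set \<Rightarrow> (nat \<Rightarrow> real) measure" where
  "PM I \<equiv> PiM I (\<lambda>_. \<nu>)"

definition Zq :: "nat \<Rightarrow> (nat \<Rightarrow> real) \<Rightarrow> real" where
  "Zq N x = chain_sum K (\<lambda>a. H * e (x a)) 0 N"

definition logZ :: "nat \<Rightarrow> real" where
  "logZ N = (\<integral>x. ln (Zq N x) \<partial>PM {1..N})"

lemma prob_PM: "prob_space (PM I)"
  by (rule prob_space_PiM) (rule site_prob)

lemma PM_component:
  assumes "a \<in> J" "integrable \<nu> f"
  shows "integrable (PM J) (\<lambda>x. f (x a) :: real)" "(\<integral>x. f (x a) \<partial>PM J) = (\<integral>t. f t \<partial>\<nu>)"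
proof -
  have d: "distr (PM J) \<nu> (\<lambda>x. x a) = \<nu>"
    using distr_PiM_component[of J "\<lambda>_. \<nu>" a] site_prob assms by auto
  have m: "(\<lambda>x. x a) \<in> measurable (PM J) \<nu>" using assms by (intro measurable_component_singleton)
  have f: "f \<in> borel_measurable \<nu>" using assms by auto
  show "integrable (PM J) (\<lambda>x. f (x a) :: real)"
    using integrable_distr_eq[OF m f] assms d by simp
  show "(\<integral>x. f (x a) \<partial>PM J) = (\<integral>t. f t \<partial>\<nu>)"
    using integral_distr[OF m f] d by simp
qed

lemma chain_integral:
  assumes J: "{d<..N} \<subseteq> J" "finite J"
  shows "integrable (PM J) (\<lambda>x. chain_sum K (\<lambda>a. H * e (x a)) d N)"
    and "(\<integral>x. chain_sum K (\<lambda>a. H * e (x a)) d N \<partial>PM J) = chain_sum K (\<lambda>_. H) d N"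
proof -
  interpret PP: product_prob_space "\<lambda>_::nat. \<nu>" UNIV
    by (intro product_prob_space.intro product_sigma_finite.intro product_prob_space_axioms.intro site_prob prob_space_imp_sigma_finite)
  have pr: "integrable (PM J) (\<lambda>x. \<Prod>a\<in>B. H * e (x a))" "(\<integral>x. (\<Prod>a\<in>B. H * e (x a)) \<partial>PM J) = (\<Prod>a\<in>B. H)"
    if "B \<in> Pow {d<..N}" for B
  proof -
    have sub: "B \<subseteq> J" using that J by auto
    define f where "f a t = (if a \<in> B then H * e t else 1)" for a t
    have eq: "(\<Prod>a\<in>B. H * e (x a)) = (\<Prod>a\<in>J. f a (x a))" for x
      using sub J by (simp add: f_def prod.inter_restrict[symmetric] Int_absorb1)
    have fi: "integrable \<nu> (f a)" "(\<integral>t. f a t \<partial>\<nu>) = (if a \<in> B then H else 1)" for a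
      using e_int prob_space.prob_space[OF site_prob] site_prob
      by (cases "a \<in> B"; simp add: f_def[abs_def] prob_space.finite_measure finite_measure.integrable_const)+
    show "integrable (PM J) (\<lambda>x. \<Prod>a\<in>B. H * e (x a))"
      unfolding eq by (rule PP.product_integrable_prod[OF J(2) fi(1)])
    have "(\<integral>x. (\<Prod>a\<in>B. H * e (x a)) \<partial>PM J) = (\<Prod>a\<in>J. \<integral>t. f a t \<partial>\<nu>)"
      unfolding eq by (rule PP.product_integral_prod[OF J(2) fi(1)])
    then show "(\<integral>x. (\<Prod>a\<in>B. H * e (x a)) \<partial>PM J) = (\<Prod>a\<in>B. H)"
      using sub J by (simp add: fi prod.inter_restrict[symmetric] Int_absorb1)
  qed
  have eq: "chain_sum K (\<lambda>a. H * e (x a)) d N =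
     (\<Sum>B\<in>Pow {d<..N}. (if last_pt d B = N then path_weight K d B else 0) * (\<Prod>a\<in>B. H * e (x a)))" for x
    unfolding chain_sum_def by (intro sum.cong) auto
  show "integrable (PM J) (\<lambda>x. chain_sum K (\<lambda>a. H * e (x a)) d N)"
    unfolding eq by (intro Bochner_Integration.integrable_sum integrable_mult_right pr)
  have "(\<integral>x. chain_sum K (\<lambda>a. H * e (x a)) d N \<partial>PM J) =
    (\<Sum>B\<in>Pow {d<..N}. \<integral>x. (if last_pt d B = N then path_weight K d B else 0) * (\<Prod>a\<in>B. H * e (x a)) \<partial>PM J)"
    unfolding eq by (intro Bochner_Integration.integral_sum integrable_mult_right pr)
  also have "\<dots> = chain_sum K (\<lambda>_. H) d N"
    unfolding chain_sum_def using pr(2) by (intro sum.cong refl) simp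
  finally show "(\<integral>x. chain_sum K (\<lambda>a. H * e (x a)) d N \<partial>PM J) = chain_sum K (\<lambda>_. H) d N" .
qed

lemma chain_lower:
  assumes "d < N" "\<And>a. y a > 0" shows "K (N - d) * y N \<le> chain_sum K y d N"
proof -
  have "path_weight K d {N} * (\<Prod>a\<in>{N}. y a) \<le> chain_sum K y d N"
    unfolding chain_sum_alt[OF assms(1)]
  proof (rule order_trans[OF _ member_le_sum[of "{}"]])
    fix B assume "B \<in> Pow {d<..<N} - {{}}"
    then have "B \<subseteq> {d<..<N}" "finite (insert N B)" by (auto dest: finite_subset)
    then show "0 \<le> path_weight K d (insert N B) * prod y (insert N B)"
      using assms by (intro mult_nonneg_nonneg path_weight_nonneg K_nonneg prod_nonneg)
        (auto intro: less_imp_le)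
  qed auto
  then show ?thesis using path_weight_insert[of "{}" N K d] by simp
qed

text \<open>The single jump from \<open>d\<close> to \<open>N\<close> bounds the logarithm below by
  a function of one disorder variable; above, the logarithm is at most the integrable partition
  function itself.\<close>

lemma ln_chain_integrable:
  assumes "d < N" "{d<..N} \<subseteq> J" "finite J"
  shows "integrable (PM J) (\<lambda>x. ln (chain_sum K (\<lambda>a. H * e (x a)) d N))"
    and "ln (K (N - d)) + ln H + (\<integral>x. ln (e x) \<partial>\<nu>) \<le> (\<integral>x. ln (chain_sum K (\<lambda>a. H * e (x a)) d N) \<partial>PM J)"
    and "\<And>x. chain_sum K (\<lambda>a. H * e (x a)) d N > 0"
proof -
  interpret PJ: prob_space "PM J" by (rule prob_PM)
  let ?Z = "\<lambda>x. chain_sum K (\<lambda>a. H * e (x a)) d N"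
  have Kp: "K (N - d) > 0" using assms by (intro K_pos) auto
  have low: "K (N - d) * (H * e (x N)) \<le> ?Z x" for x
    using assms H_pos e_pos by (intro chain_lower) auto
  have lp: "0 < K (N - d) * (H * e (x N))" for x :: "nat \<Rightarrow> real" using Kp H_pos e_pos by simp
  show Zp: "?Z x > 0" for x using low[of x] lp[of x] by linarith
  let ?l = "\<lambda>x. ln (K (N - d)) + ln H + ln (e (x N))"
  have ll: "?l x \<le> ln (?Z x)" for x
  proof -
    have "?l x = ln (K (N - d) * (H * e (x N)))" using Kp H_pos e_pos[of "x N"] by (simp add: ln_mult)
    also have "\<dots> \<le> ln (?Z x)" using low[of x] lp[of x] by (intro ln_mono) auto
    finally show ?thesis .
  qed
  have NJ: "N \<in> J" using assms by auto
  have li: "integrable (PM J) ?l"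
    using PM_component(1)[OF NJ ln_e_int] by (intro Bochner_Integration.integrable_add) auto
  have Zi: "integrable (PM J) ?Z" by (rule chain_integral[OF assms(2,3)])
  show int: "integrable (PM J) (\<lambda>x. ln (?Z x))"
  proof (rule Bochner_Integration.integrable_bound[of "PM J" "\<lambda>x. \<bar>?l x\<bar> + ?Z x"])
    show "integrable (PM J) (\<lambda>x. \<bar>?l x\<bar> + ?Z x)"
      by (rule Bochner_Integration.integrable_add[OF integrable_abs[OF li] Zi])
    show "(\<lambda>x. ln (?Z x)) \<in> borel_measurable (PM J)"
      using Zi by (intro borel_measurable_ln) auto
    show "AE x in PM J. norm (ln (?Z x)) \<le> norm (\<bar>?l x\<bar> + ?Z x)"
    proof (rule AE_I2)
      fix x
      have "ln (?Z x) \<le> ?Z x" using ln_le_minus_one[OF Zp[of x]] by linarith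
      then show "norm (ln (?Z x)) \<le> norm (\<bar>?l x\<bar> + ?Z x)" using ll[of x] Zp[of x] by auto
    qed
  qed
  have "(\<integral>x. ?l x \<partial>PM J) = ln (K (N - d)) + ln H + (\<integral>x. ln (e x) \<partial>\<nu>)"
    using PM_component[OF NJ ln_e_int] by (simp add: PJ.prob_space)
  then show "ln (K (N - d)) + ln H + (\<integral>x. ln (e x) \<partial>\<nu>) \<le> (\<integral>x. ln (?Z x) \<partial>PM J)"
    using integral_mono[OF li int] ll by simp
qed

lemma PM_reindex:
  assumes "inj_on f I" "f \<in> I \<rightarrow> J" "I \<noteq> {}" "F \<in> borel_measurable (PM I)"
  shows "(\<integral>x. F (\<lambda>i\<in>I. x (f i)) \<partial>PM J) = (\<integral>x. F x \<partial>PM I :: real)"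
proof -
  have d: "distr (PM J) (PM I) (\<lambda>x. \<lambda>i\<in>I. x (f i)) = PM I"
    using distr_PiM_reindex[of J "\<lambda>_. \<nu>" f I] site_prob assms by auto
  have m: "(\<lambda>x. \<lambda>i\<in>I. x (f i)) \<in> measurable (PM J) (PM I)"
    using assms by (intro measurable_restrict measurable_component_singleton) auto
  show ?thesis using integral_distr[OF m assms(4)] d by simp
qed

lemma ln_Zq_measurable: "1 \<le> N \<Longrightarrow> (\<lambda>x. ln (Zq N x)) \<in> borel_measurable (PM {1..N})"
  unfolding Zq_def using ln_chain_integrable(1)[of 0 N "{1..N}"]
  by (intro borel_measurable_integrable) (auto simp: subset_eq)

lemma logZ_shift:
  assumes "1 \<le> N" "{s + 1..s + N} \<subseteq> J"
  shows "(\<integral>x. ln (chain_sum K (\<lambda>a. H * e (x a)) s (s + N)) \<partial>PM J) = logZ N"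
proof -
  have "chain_sum K (\<lambda>a. H * e (x a)) s (s + N) = Zq N (\<lambda>i\<in>{1..N}. x (s + i))" for x
    using chain_sum_shift[of K "\<lambda>a. H * e (x a)" s 0 N] unfolding Zq_def
    by (auto intro!: chain_sum_cong)
  then show ?thesis
    using PM_reindex[of "(+) s" "{1..N}" J "\<lambda>x. ln (Zq N x)", OF _ _ _ ln_Zq_measurable[OF assms(1)]] assms
    by (auto simp: logZ_def subset_eq)
qed

lemma logZ_super:
  assumes "1 \<le> m" "1 \<le> n" shows "logZ m + logZ n \<le> logZ (m + n)"
proof -
  let ?J = "{1..m + n}"
  let ?C = "\<lambda>d N x. chain_sum K (\<lambda>a. H * e (x a)) d N"
  have i: "integrable (PM ?J) (\<lambda>x. ln (?C 0 m x))" "integrable (PM ?J) (\<lambda>x. ln (?C m (m + n) x))"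
    "integrable (PM ?J) (\<lambda>x. ln (?C 0 (m + n) x))"
    using assms by (auto intro!: ln_chain_integrable(1))
  have "logZ m + logZ n = (\<integral>x. ln (?C 0 m x) \<partial>PM ?J) + (\<integral>x. ln (?C m (m + n) x) \<partial>PM ?J)"
    using logZ_shift[of m 0 ?J] logZ_shift[of n m ?J] assms by simp
  also have "\<dots> = (\<integral>x. ln (?C 0 m x) + ln (?C m (m + n) x) \<partial>PM ?J)" using i by simp
  also have "\<dots> \<le> (\<integral>x. ln (?C 0 (m + n) x) \<partial>PM ?J)"
  proof (intro integral_mono i Bochner_Integration.integrable_add)
    fix x
    have p: "?C 0 m x > 0" "?C m (m + n) x > 0"
      using assms by (auto intro!: ln_chain_integrable(3)[of _ _ "{1..m + n}"])
    have "ln (?C 0 m x) + ln (?C m (m + n) x) = ln (?C 0 m x * ?C m (m + n) x)" using p by (simp add: ln_mult)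
    also have "\<dots> \<le> ln (?C 0 (m + n) x)"
      using p assms H_pos e_pos K_nonneg
      by (intro ln_mono chain_sum_super) (auto intro: less_imp_le mult_nonneg_nonneg)
    finally show "ln (?C 0 m x) + ln (?C m (m + n) x) \<le> ln (?C 0 (m + n) x)" .
  qed
  also have "\<dots> = logZ (m + n)" using logZ_shift[of "m + n" 0 ?J] assms by simp
  finally show ?thesis .
qed

lemma logZ_upper:
  assumes "1 \<le> N" shows "logZ N \<le> ln (max 1 H) * real N"
proof -
  interpret PN: prob_space "PM {1..N}" by (rule prob_PM)
  have "chain_sum K (\<lambda>_. H) 0 N \<le> max 1 H ^ N * chain_sum K (\<lambda>_. 1) 0 N"
    unfolding chain_sum_def sum_distrib_left
  proof (rule sum_mono)
    fix B assume B: "B \<in> Pow {0<..N}"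
    have "card B \<le> card {0<..N}" using B by (intro card_mono) auto
    then have le: "H ^ card B \<le> max 1 H ^ N"
      using H_pos power_mono[of H "max 1 H" "card B"] power_increasing[of "card B" N "max 1 H"] by auto
    show "(if last_pt 0 B = N then path_weight K 0 B * (\<Prod>a\<in>B. H) else 0) \<le>
        max 1 H ^ N * (if last_pt 0 B = N then path_weight K 0 B * (\<Prod>a\<in>B. 1) else 0)"
      using mult_left_mono[OF le path_weight_nonneg'[OF B]] by (simp add: mult.commute)
  qed
  also have "\<dots> \<le> max 1 H ^ N * 1"
    using renewal_mass_le_1[of N] by (intro mult_left_mono) (auto simp: renewal_mass_def)
  finally have le: "(\<integral>x. chain_sum K (\<lambda>a. H * e (x a)) 0 N \<partial>PM {1..N}) \<le> max 1 H ^ N"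
    using chain_integral(2)[of 0 N "{1..N}"] by (auto simp: subset_eq)
  have "logZ N \<le> ln (max 1 H ^ N)"
    unfolding logZ_def Zq_def
    by (rule PN.expectation_ln_le[OF _ _ _ le])
       (use assms in \<open>auto intro!: chain_integral(1) ln_chain_integrable(1) ln_chain_integrable(3)[of _ _ "{1..N}"]\<close>)
  then show ?thesis by (simp add: ln_realpow mult.commute)
qed

lemma logZ_lower:
  assumes "1 \<le> N" shows "ln (K N) + ln H + (\<integral>x. ln (e x) \<partial>\<nu>) \<le> logZ N"
  using ln_chain_integrable(2)[of 0 N "{1..N}"] assms by (auto simp: logZ_def Zq_def subset_eq)

text \<open>Existence is superadditivity; the limit is nonnegative because the path with a single
  jump to \<open>n\<close> costs only a logarithm of \<open>n\<close>.\<close>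

lemma logZ_limit:
  "\<exists>l\<ge>0. (\<lambda>n. logZ n / real n) \<longlonglongrightarrow> l \<and> (\<forall>n\<ge>1. logZ n / real n \<le> l)"
proof -
  obtain l where l: "(\<lambda>n. logZ n / real n) \<longlonglongrightarrow> l" "\<forall>n\<ge>1. logZ n / real n \<le> l"
    using superadditive_limit[of logZ "ln (max 1 H)"] logZ_super logZ_upper by blast
  define c where "c = ln c1 + ln H + (\<integral>x. ln (e x) \<partial>\<nu>)"
  have "c / real n - 2 * (ln (real n) / real n) \<le> l" if n: "n \<ge> 1" for n
  proof -
    have "c1 / real n ^ 2 \<le> c1 / (real n ^ 2 * v n)"
      using c1_pos v_pos[of n] v_le_1[of n] n by (intro divide_left_mono mult_pos_pos) (auto simp: mult_le_cancel_left1)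
    then have "c1 / real n ^ 2 \<le> K n" using K_lower[OF n] by linarith
    then have "ln (c1 / real n ^ 2) \<le> ln (K n)" using c1_pos n K_pos[OF n] by (intro ln_mono) auto
    moreover have "ln (c1 / real n ^ 2) = ln c1 - 2 * ln (real n)" using c1_pos n by (simp add: ln_div ln_realpow)
    ultimately have "c - 2 * ln (real n) \<le> logZ n" using logZ_lower[OF n] by (simp add: c_def)
    then have "(c - 2 * ln (real n)) / real n \<le> logZ n / real n" by (intro divide_right_mono) auto
    then show ?thesis using l(2) n by (simp add: diff_divide_distrib order_trans)
  qed
  then have "eventually (\<lambda>n. c / real n - 2 * (ln (real n) / real n) \<le> l) sequentially"
    using eventually_sequentially by blast
  moreover have "(\<lambda>n. c / real n - 2 * (ln (real n) / real n)) \<longlonglongrightarrow> 0 - 2 * 0"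
  proof (intro tendsto_diff tendsto_mult tendsto_const)
    show "(\<lambda>n. c / real n) \<longlonglongrightarrow> 0" by (rule lim_const_over_n)
    show "(\<lambda>n. ln (real n) / real n) \<longlonglongrightarrow> 0" by (rule lim_ln_over_n)
  qed
  ultimately have "0 \<le> l" using tendsto_upperbound[of _ "0 - 2 * 0" sequentially l] by simp
  then show ?thesis using l by blast
qed

text \<open>Writing \<open>ln Z\<close> as \<open>10/9\<close> times the logarithm of
  \<open>Z^(9/10)\<close>, Jensen's inequality leaves a term of order \<open>ln m\<close>, which
  vanishes after division by the volume \<open>m * k\<close>.\<close>

lemma logZ_nonpos_limit:
  assumes k: "1 \<le> k" and C: "1 \<le> C"
    and bound: "\<And>m. 1 \<le> m \<Longrightarrow> (\<integral>\<^sup>+x. ennreal (Zq (m * k) x powr (9/10)) \<partial>PM {1..m * k}) \<le> ennreal (C * real m)"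
    and lim: "(\<lambda>n. logZ n / real n) \<longlonglongrightarrow> l"
  shows "l \<le> 0"
proof -
  have le: "logZ (m * k) \<le> 10/9 * ln (C * real m)" if m: "1 \<le> m" for m
  proof -
    let ?N = "m * k"
    interpret PN: prob_space "PM {1..?N}" by (rule prob_PM)
    have N: "1 \<le> ?N" using m k by simp
    have Zp: "Zq ?N x > 0" for x
      unfolding Zq_def using N by (intro ln_chain_integrable(3)[of _ _ "{1..?N}"]) auto
    have Zi: "integrable (PM {1..?N}) (Zq ?N)"
      unfolding Zq_def[abs_def] by (intro chain_integral) auto
    have li: "integrable (PM {1..?N}) (\<lambda>x. ln (Zq ?N x))"
      unfolding Zq_def using N by (intro ln_chain_integrable) auto
    have 1: "integrable (PM {1..?N}) (\<lambda>x. 1 + Zq ?N x)"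
      by (intro Bochner_Integration.integrable_add PN.integrable_const Zi)
    have pi: "integrable (PM {1..?N}) (\<lambda>x. Zq ?N x powr (9/10))"
    proof (rule Bochner_Integration.integrable_bound[of _ "\<lambda>x. 1 + Zq ?N x"])
      show "AE x in PM {1..?N}. norm (Zq ?N x powr (9/10)) \<le> norm (1 + Zq ?N x)"
      proof (rule AE_I2)
        fix x
        have "Zq ?N x powr (9/10) \<le> 1 + Zq ?N x"
        proof (cases "Zq ?N x \<le> 1")
          case True
          then have "Zq ?N x powr (9/10) \<le> 1 powr (9/10)" using Zp[of x] by (intro powr_mono2) auto
          then show ?thesis using Zp[of x] by simp
        next
          case False
          then have "Zq ?N x powr (9/10) \<le> Zq ?N x powr 1" by (intro powr_mono) auto
          then show ?thesis using Zp[of x] by simp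
        qed
        then show "norm (Zq ?N x powr (9/10)) \<le> norm (1 + Zq ?N x)" using Zp[of x] by simp
      qed
    qed (use Zi 1 in auto)
    have "ennreal (\<integral>x. Zq ?N x powr (9/10) \<partial>PM {1..?N}) \<le> ennreal (C * real m)"
      using bound[OF m] nn_integral_eq_integral[OF pi] by simp
    then have e: "(\<integral>x. Zq ?N x powr (9/10) \<partial>PM {1..?N}) \<le> C * real m"
      using C by (subst (asm) ennreal_le_iff) auto
    have lp: "ln (Zq ?N x powr (9/10)) = 9/10 * ln (Zq ?N x)" for x using Zp[of x] by (simp add: ln_powr)
    have "(\<integral>x. ln (Zq ?N x powr (9/10)) \<partial>PM {1..?N}) \<le> ln (C * real m)"
      using Zp C m li by (intro PN.expectation_ln_le pi e) (auto simp: lp less_imp_neq[symmetric])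
    then have "9/10 * logZ ?N \<le> ln (C * real m)" by (simp add: lp logZ_def)
    then show ?thesis by simp
  qed
  \<comment> \<open>The full sequence converges, so the multiples of \<open>k\<close> already
    determine the limit.\<close>
  have "(\<lambda>m. logZ (m * k) / real (m * k)) \<longlonglongrightarrow> l"
    using LIMSEQ_subseq_LIMSEQ[OF lim, of "\<lambda>m. m * k"] k by (auto simp: strict_mono_def o_def)
  moreover have "(\<lambda>m. 10/9 / real k * (ln C / real m + ln (real m) / real m)) \<longlonglongrightarrow> 10/9 / real k * (0 + 0)"
    by (intro tendsto_mult tendsto_add tendsto_const lim_const_over_n lim_ln_over_n)
  moreover have "eventually (\<lambda>m. logZ (m * k) / real (m * k) \<le> 10/9 / real k * (ln C / real m + ln (real m) / real m)) sequentially"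
  proof (rule eventually_sequentiallyI[of 1])
    fix m :: nat assume m: "1 \<le> m"
    have "logZ (m * k) / real (m * k) \<le> (10/9 * ln (C * real m)) / real (m * k)"
      by (intro divide_right_mono le m) simp
    also have "\<dots> = 10/9 / real k * (ln C / real m + ln (real m) / real m)"
      using C m k by (simp add: ln_mult field_simps)
    finally show "logZ (m * k) / real (m * k) \<le> 10/9 / real k * (ln C / real m + ln (real m) / real m)" .
  qed
  ultimately have "l \<le> 10/9 / real k * (0 + 0)"
    by (intro tendsto_le[OF sequentially_bot]) auto
  then show ?thesis by simp
qed

end

section \<open>Growth of the homogeneous model\<close>

context marginal_kernel
begin

text \<open>Without disorder every \<open>H > 1\<close> localizes: once the first \<open>n\<close> terms of \<open>H K\<close> have mass larger
  than one, the renewal equation makes the partition function grow geometrically.\<close>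

lemma pure_growth:
  assumes H: "H > 1"
  shows "\<exists>N\<ge>1. chain_sum K (\<lambda>_. H) 0 N > 1"
proof -
  define z where "z = chain_sum K (\<lambda>_. H) 0"
  have rec: "z N = (\<Sum>t\<in>{0<..N}. H * K t * z (N - t))" if "N \<ge> 1" for N
  proof -
    have "z N = (\<Sum>t\<in>{0<..N}. K t * H * chain_sum K (\<lambda>_. H) t N)"
      unfolding z_def by (subst chain_sum_block[of 0 0]) (use that in auto)
    also have "\<dots> = (\<Sum>t\<in>{0<..N}. H * K t * z (N - t))"
    proof (rule sum.cong[OF refl])
      fix t assume "t \<in> {0<..N}"
      then have "chain_sum K (\<lambda>_. H) t N = z (N - t)"
        unfolding z_def using chain_sum_shift[of K "\<lambda>_. H" t 0 "N - t"] by simp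
      then show "K t * H * chain_sum K (\<lambda>_. H) t N = H * K t * z (N - t)" by simp
    qed
    finally show ?thesis .
  qed
  have z0: "z 0 = 1" by (simp add: z_def)
  have zpos: "z N > 0" for N
  proof (induction N rule: less_induct)
    case (less N)
    show ?case
    proof (cases "N = 0")
      case False
      then have "z N = (\<Sum>t\<in>{0<..N}. H * K t * z (N - t))" by (intro rec) simp
      also have "\<dots> > 0" using False less H K_pos by (intro sum_pos mult_pos_pos) auto
      finally show ?thesis .
    qed (simp add: z0)
  qed
  have "(\<lambda>n. H * (1 - tail_mass K n)) \<longlonglongrightarrow> H * (1 - 0)"
    by (intro tendsto_intros tail_mass_tendsto)
  then have "eventually (\<lambda>n. H * (1 - tail_mass K n) > 1) sequentially"
    using H by (intro order_tendstoD) auto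
  then obtain n where n: "H * (1 - tail_mass K n) > 1" by (auto simp: eventually_sequentially)
  define \<theta> where "\<theta> = H * (1 - tail_mass K n)"
  have \<theta>: "\<theta> > 1" "\<theta> = (\<Sum>t\<in>{0<..n}. H * K t)"
    using n by (auto simp: \<theta>_def tail_mass_def sum_distrib_left atLeastSucAtMost_greaterThanAtMost)
  have n1: "n \<ge> 1" using \<theta> by (cases n) auto
  define m where "m = Min (z ` {..<n})"
  have "m \<in> z ` {..<n}" unfolding m_def using n1 by (intro Min_in) (auto simp: lessThan_empty_iff)
  then have m: "m > 0" "\<And>j. j < n \<Longrightarrow> m \<le> z j" using zpos by (auto simp: m_def)
  have step: "\<theta> * c \<le> z N" if "N \<ge> n" "c \<ge> 0" "\<And>j. N - n \<le> j \<Longrightarrow> j < N \<Longrightarrow> c \<le> z j" for N c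
  proof -
    have "\<theta> * c = (\<Sum>t\<in>{0<..n}. H * K t * c)" unfolding \<theta>(2) by (simp add: sum_distrib_right)
    also have "\<dots> \<le> (\<Sum>t\<in>{0<..n}. H * K t * z (N - t))"
      using that H K_nonneg by (intro sum_mono mult_left_mono that(3)) auto
    also have "\<dots> \<le> (\<Sum>t\<in>{0<..N}. H * K t * z (N - t))"
      using that H K_nonneg zpos by (intro sum_mono2) (auto intro!: mult_nonneg_nonneg intro: less_imp_le)
    also have "\<dots> = z N" using that n1 by (intro rec[symmetric]) auto
    finally show ?thesis .
  qed
  \<comment> \<open>\<open>m\<close> bounds the first \<open>n\<close> values below; each further
    stretch of \<open>n\<close> sites multiplies the lower bound by
    \<open>\<theta> > 1\<close>.\<close>
  have grow: "\<theta> ^ i * m \<le> z j" if "i * n \<le> j" for i j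
    using that
  proof (induction i arbitrary: j)
    case 0
    show ?case
    proof (induction j rule: less_induct)
      case (less j)
      show ?case
      proof (cases "j < n")
        case False
        then have "\<theta> * m \<le> z j" using less m by (intro step) auto
        moreover have "1 * m \<le> \<theta> * m" using \<theta> m by (intro mult_right_mono) auto
        ultimately show ?thesis by simp
      qed (use m in auto)
    qed
  next
    case (Suc i)
    have "\<theta> * (\<theta> ^ i * m) \<le> z j"
    proof (rule step)
      show "n \<le> j" using Suc.prems by simp
      show "0 \<le> \<theta> ^ i * m" using \<theta> m by simp
      fix j' assume "j - n \<le> j'"
      then show "\<theta> ^ i * m \<le> z j'" using Suc.prems by (intro Suc.IH) auto
    qed
    then show ?case by simp
  qed
  obtain i where i: "1 / m < \<theta> ^ i" using real_arch_pow[OF \<theta>(1)] by blast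
  have "1 < \<theta> ^ i * m" using i m by (simp add: divide_simps mult.commute)
  also have "\<dots> \<le> z (i * n + 1)" by (rule grow) simp
  finally show ?thesis unfolding z_def by (intro exI[of _ "i * n + 1"]) auto
qed

end

subsection \<open>Exponential tilting of the site law\<close>

locale exponential_site = prob_space \<nu> for \<nu> :: "real measure" +
  assumes sets_eq [simp]: "sets \<nu> = sets borel"
    and exp_moments: "\<And>t. integrable \<nu> (\<lambda>x. exp (t * x))"
    and mean: "(\<integral>x. x \<partial>\<nu>) = 0" and variance_1: "(\<integral>x. x\<^sup>2 \<partial>\<nu>) = 1"
begin

definition laplace :: "real \<Rightarrow> real" where
  "laplace t = (\<integral>x. exp (t * x) \<partial>\<nu>)"

definition density :: "real \<Rightarrow> real \<Rightarrow> real" where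
  "density t x = exp (t * x - ln (laplace t))"

text \<open>Polynomial factors are dominated by \<open>exp x + exp (- x)\<close>, which only shifts
  \<open>t\<close> by one in either direction.\<close>

lemma moment_integrable:
  "integrable \<nu> (\<lambda>x. x * exp (t * x))" "integrable \<nu> (\<lambda>x. x\<^sup>2 * exp (t * x))"
proof -
  have i: "integrable \<nu> (\<lambda>x. 2 * (exp ((t + 1) * x) + exp ((t - 1) * x)))"
    by (intro integrable_mult_right Bochner_Integration.integrable_add exp_moments)
  have b: "\<bar>x\<bar> \<le> 2 * (exp x + exp (- x)) \<and> x\<^sup>2 \<le> 2 * (exp x + exp (- x))" for x :: real
  proof -
    have "B \<le> 2 * E \<and> q \<le> 2 * E" if "1 + B + q / 2 \<le> E" "0 \<le> B" "0 \<le> q" for B q E :: real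
      using that by auto
    moreover have "1 + \<bar>x\<bar> + \<bar>x\<bar>\<^sup>2 / 2 \<le> exp \<bar>x\<bar>" by (rule exp_lower_Taylor_quadratic) simp
    moreover have "exp \<bar>x\<bar> \<le> exp x + exp (- x)" by (cases "x \<ge> 0") auto
    ultimately show ?thesis unfolding power2_abs by (meson abs_ge_zero order_trans zero_le_power2)
  qed
  have e: "2 * (exp ((t + 1) * x) + exp ((t - 1) * x)) = 2 * (exp x + exp (- x)) * exp (t * x)" for x
    by (simp add: algebra_simps exp_add[symmetric])
  show "integrable \<nu> (\<lambda>x. x * exp (t * x))"
  proof (rule Bochner_Integration.integrable_bound[OF i])
    show "AE x in \<nu>. norm (x * exp (t * x)) \<le> norm (2 * (exp ((t + 1) * x) + exp ((t - 1) * x)))"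
    proof (rule AE_I2)
      fix x
      have "\<bar>x\<bar> * exp (t * x) \<le> 2 * (exp x + exp (- x)) * exp (t * x)" by (intro mult_right_mono) (use b in auto)
      then show "norm (x * exp (t * x)) \<le> norm (2 * (exp ((t + 1) * x) + exp ((t - 1) * x)))"
        unfolding e by (simp add: abs_mult)
    qed
  qed (simp add: measurable_cong_sets[OF sets_eq refl])
  show "integrable \<nu> (\<lambda>x. x\<^sup>2 * exp (t * x))"
  proof (rule Bochner_Integration.integrable_bound[OF i])
    show "AE x in \<nu>. norm (x\<^sup>2 * exp (t * x)) \<le> norm (2 * (exp ((t + 1) * x) + exp ((t - 1) * x)))"
    proof (rule AE_I2)
      fix x
      have "x\<^sup>2 * exp (t * x) \<le> 2 * (exp x + exp (- x)) * exp (t * x)" by (intro mult_right_mono) (use b in auto)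
      then show "norm (x\<^sup>2 * exp (t * x)) \<le> norm (2 * (exp ((t + 1) * x) + exp ((t - 1) * x)))"
        unfolding e by (simp add: abs_mult)
    qed
  qed (simp add: measurable_cong_sets[OF sets_eq refl])
qed

lemma moments_0: "integrable \<nu> (\<lambda>x. x)" "integrable \<nu> (\<lambda>x. x\<^sup>2)"
  using moment_integrable[of 0] by auto

lemma laplace_ge_1: "1 \<le> laplace t"
proof -
  have "(\<integral>x. 1 + t * x \<partial>\<nu>) \<le> laplace t"
    unfolding laplace_def using moments_0 exp_moments by (intro integral_mono) auto
  then show ?thesis using moments_0 mean prob_space by simp
qed

lemma laplace_le:
  assumes "0 \<le> t" "t \<le> T" shows "laplace t \<le> 1 + laplace T"
proof -
  have "laplace t \<le> (\<integral>x. 1 + exp (T * x) \<partial>\<nu>)"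
    unfolding laplace_def
  proof (intro integral_mono)
    fix x :: real
    show "exp (t * x) \<le> 1 + exp (T * x)"
    proof (cases "x \<ge> 0")
      case True
      then have "t * x \<le> T * x" using assms by (intro mult_right_mono) auto
      then have "exp (t * x) \<le> exp (T * x)" by simp
      then show ?thesis by linarith
    next
      case False
      then have "t * x \<le> 0" using assms by (intro mult_nonneg_nonpos) auto
      then have "exp (t * x) \<le> 1" by simp
      moreover have "exp (T * x) > 0" by simp
      ultimately show ?thesis by linarith
    qed
  qed (use exp_moments in auto)
  then show ?thesis using exp_moments[of T] prob_space by (simp add: laplace_def)
qed

lemma density_eq: "density t x = exp (t * x) / laplace t"
  using laplace_ge_1[of t] by (simp add: density_def exp_diff)

lemma density_moments:
  "integrable \<nu> (density t)" "integrable \<nu> (\<lambda>x. x * density t x)" "integrable \<nu> (\<lambda>x. x\<^sup>2 * density t x)"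
  "(\<integral>x. density t x \<partial>\<nu>) = 1"
  using exp_moments[of t] moment_integrable[of t] laplace_ge_1[of t]
  by (auto simp: density_eq[abs_def] laplace_def)

text \<open>If the positive part vanished, mean zero would force the variable to be zero almost
  surely, against unit variance.\<close>

lemma positive_part_variance: "(\<integral>x. x\<^sup>2 * indicator {0<..} x \<partial>\<nu>) > 0"
proof (rule ccontr)
  let ?f = "\<lambda>x::real. x\<^sup>2 * indicator {0<..} x"
  assume "\<not> (\<integral>x. ?f x \<partial>\<nu>) > 0"
  moreover have i: "integrable \<nu> ?f" by (rule integrable_real_mult_indicator[OF _ moments_0(2)]) simp
  moreover have "(\<integral>x. ?f x \<partial>\<nu>) \<ge> 0" by (intro integral_nonneg_AE) auto
  ultimately have "AE x in \<nu>. ?f x = 0" by (subst integral_nonneg_eq_0_iff_AE[symmetric]) auto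
  then have np: "AE x in \<nu>. x \<le> 0" by (rule AE_mp) (auto intro!: AE_I2 simp: indicator_def split: if_splits)
  have "(\<integral>x. - x \<partial>\<nu>) = 0" using mean by simp
  then have "AE x in \<nu>. - x = 0"
    using np moments_0 by (subst integral_nonneg_eq_0_iff_AE[symmetric]) auto
  then have "(\<integral>x. x\<^sup>2 \<partial>\<nu>) = (\<integral>x. 0 \<partial>\<nu>)" by (intro integral_cong_AE) (auto simp: measurable_cong_sets[OF sets_eq refl])
  then show False using variance_1 by simp
qed

text \<open>The tilted mean is bounded below linearly in \<open>t\<close>, and the tilted variance
  above, uniformly for \<open>t\<close> in \<open>(0, T]\<close>. Fixed constants then serve all
  small \<open>\<beta>\<close>.\<close>

lemma tilted_site_density:
  assumes T: "T > 0"
  shows "\<exists>c>0. \<exists>s0\<ge>1. \<forall>t. 0 < t \<longrightarrow> t \<le> T \<longrightarrow> (\<exists>\<mu>\<ge>c * t. tilted_site \<nu> (density t) \<mu> s0)"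
proof -
  define V where "V = (\<integral>x. x\<^sup>2 * indicator {0<..} x \<partial>\<nu>)"
  define c where "c = V / (1 + laplace T)"
  define s0 where "s0 = max 1 (\<integral>x. x\<^sup>2 + x\<^sup>2 * exp (T * x) \<partial>\<nu>)"
  have V: "V > 0" using positive_part_variance by (simp add: V_def)
  have c: "c > 0" using V laplace_ge_1[of T] by (simp add: c_def)
  have "\<exists>\<mu>\<ge>c * t. tilted_site \<nu> (density t) \<mu> s0" if t: "0 < t" "t \<le> T" for t
  proof (intro exI conjI)
    let ?\<mu> = "\<integral>x. x * density t x \<partial>\<nu>"
    \<comment> \<open>As \<open>\<nu>\<close> has mean zero, \<open>x\<close> may be subtracted;
      \<open>x * exp (t * x) - x\<close> is at least \<open>t * x^2\<close> for positive
      \<open>x\<close> and nonnegative otherwise.\<close>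
    have "t * V = (\<integral>x. t * (x\<^sup>2 * indicator {0<..} x) \<partial>\<nu>)" by (simp add: V_def)
    also have "\<dots> \<le> (\<integral>x. x * exp (t * x) - x \<partial>\<nu>)"
    proof (intro integral_mono)
      show "integrable \<nu> (\<lambda>x. t * (x\<^sup>2 * indicator {0<..} x))"
        by (intro integrable_mult_right integrable_real_mult_indicator moments_0) simp
      show "integrable \<nu> (\<lambda>x. x * exp (t * x) - x)"
        by (intro Bochner_Integration.integrable_diff moment_integrable moments_0)
      fix x :: real
      show "t * (x\<^sup>2 * indicator {0<..} x) \<le> x * exp (t * x) - x"
      proof (cases "x > 0")
        case True
        then have "x * (1 + t * x) \<le> x * exp (t * x)" by (intro mult_left_mono exp_ge_add_one_self) auto
        then show ?thesis using True by (simp add: algebra_simps power2_eq_square)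
      next
        case False
        then have "exp (t * x) \<le> 1" using t by (simp add: mult_nonneg_nonpos)
        then have "x * 1 \<le> x * exp (t * x)" using False by (intro mult_left_mono_neg) auto
        then show ?thesis using False by simp
      qed
    qed
    also have "\<dots> = (\<integral>x. x * exp (t * x) \<partial>\<nu>)" using moment_integrable moments_0 mean by simp
    finally have tV: "t * V \<le> (\<integral>x. x * exp (t * x) \<partial>\<nu>)" .
    have "c * t = t * V / (1 + laplace T)" by (simp add: c_def)
    also have "\<dots> \<le> t * V / laplace t"
      using laplace_le[of t T] laplace_ge_1[of t] t V by (intro divide_left_mono) auto
    also have "\<dots> \<le> (\<integral>x. x * exp (t * x) \<partial>\<nu>) / laplace t"
      using tV laplace_ge_1[of t] by (intro divide_right_mono) auto
    also have "\<dots> = ?\<mu>" by (simp add: density_eq)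
    finally show le: "c * t \<le> ?\<mu>" .
    have "(\<integral>x. (x - ?\<mu>)\<^sup>2 * density t x \<partial>\<nu>) =
      (\<integral>x. x\<^sup>2 * density t x - 2 * ?\<mu> * (x * density t x) + ?\<mu>\<^sup>2 * density t x \<partial>\<nu>)"
      by (intro Bochner_Integration.integral_cong refl) (simp add: power2_eq_square algebra_simps)
    also have "\<dots> = (\<integral>x. x\<^sup>2 * density t x \<partial>\<nu>) - 2 * ?\<mu> * ?\<mu> + ?\<mu>\<^sup>2"
      using density_moments by simp
    also have "\<dots> \<le> (\<integral>x. x\<^sup>2 * density t x \<partial>\<nu>)" by (simp add: power2_eq_square)
    also have "\<dots> \<le> (\<integral>x. x\<^sup>2 + x\<^sup>2 * exp (T * x) \<partial>\<nu>)"
    proof (intro integral_mono density_moments Bochner_Integration.integrable_add moments_0 moment_integrable)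
      fix x :: real
      have "density t x \<le> exp (t * x)"
        using laplace_ge_1[of t] by (simp add: density_eq divide_le_eq mult_le_cancel_left1)
      also have "\<dots> \<le> 1 + exp (T * x)"
      proof (cases "x \<ge> 0")
        case True
        then have "t * x \<le> T * x" using t by (intro mult_right_mono) auto
        then have "exp (t * x) \<le> exp (T * x)" by simp
        then show ?thesis by linarith
      next
        case False
        then have "exp (t * x) \<le> 1" using t by (simp add: mult_nonneg_nonpos)
        moreover have "exp (T * x) > 0" by simp
        ultimately show ?thesis by linarith
      qed
      finally have "x\<^sup>2 * density t x \<le> x\<^sup>2 * (1 + exp (T * x))" by (intro mult_left_mono) auto
      then show "x\<^sup>2 * density t x \<le> x\<^sup>2 + x\<^sup>2 * exp (T * x)" by (simp add: algebra_simps)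
    qed
    also have "\<dots> \<le> s0" by (simp add: s0_def)
    finally have var: "(\<integral>x. (x - ?\<mu>)\<^sup>2 * density t x \<partial>\<nu>) \<le> s0" .
    have mp: "?\<mu> > 0" using le c t mult_pos_pos[of c t] by linarith
    show "tilted_site \<nu> (density t) ?\<mu> s0"
      by unfold_locales (use moments_0 mean variance_1 density_moments var mp in \<open>auto simp: density_def s0_def\<close>)
  qed
  then show ?thesis using c by (intro exI[of _ c] conjI exI[of _ s0]) (auto simp: s0_def)
qed

lemma quenched_density:
  assumes "marginal_kernel K v c1 c2" shows "quenched K v c1 c2 \<nu> (density t) (exp h)"
proof -
  interpret marginal_kernel K v c1 c2 by fact
  show ?thesis
    using moments_0 density_moments
    by unfold_locales (auto simp: density_def[abs_def] prob_space_axioms)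
qed

end

subsection \<open>The critical point\<close>

locale pinning = marginal_renewal P \<tau> K v c1 c2 + disorder: disorder Q \<omega>
  for P :: "'r measure" and \<tau> :: "nat \<Rightarrow> 'r \<Rightarrow> nat" and K v c1 c2
    and Q :: "'w measure" and \<omega> :: "nat \<Rightarrow> 'w \<Rightarrow> real"
begin

definition \<nu> :: "real measure" where "\<nu> = distr Q borel (\<omega> 1)"

lemma \<omega>_measurable: "n \<ge> 1 \<Longrightarrow> \<omega> n \<in> borel_measurable Q"
  using disorder.indep by (auto simp: disorder.indep_vars_def)

lemma exponential_site_\<nu>: "exponential_site \<nu>"
proof -
  have m: "\<omega> 1 \<in> measurable Q borel" by (rule \<omega>_measurable) simp
  have e: "integrable \<nu> f \<longleftrightarrow> integrable Q (\<lambda>v. f (\<omega> 1 v))" "(\<integral>x. f x \<partial>\<nu>) = (\<integral>v. f (\<omega> 1 v) \<partial>Q)"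
    if "f \<in> borel_measurable borel" for f :: "real \<Rightarrow> real"
    unfolding \<nu>_def by (rule integrable_distr_eq[OF m that], rule integral_distr[OF m that])
  interpret N: prob_space \<nu> unfolding \<nu>_def by (rule disorder.prob_space_distr[OF m])
  show ?thesis
  proof
    show "sets \<nu> = sets borel" by (simp add: \<nu>_def)
    show "integrable \<nu> (\<lambda>x. exp (t * x))" for t
      by (subst e(1)) (simp_all only: disorder.exponential_moments, simp)
    show "(\<integral>x. x \<partial>\<nu>) = 0"
      by (subst e(2)) (simp_all only: disorder.mean_zero, simp)
    show "(\<integral>x. x\<^sup>2 \<partial>\<nu>) = 1"
      using disorder.unit_variance by (subst e(2)) (simp_all only: disorder.mean_zero diff_zero, simp)
  qed
qed

sublocale site: exponential_site \<nu> by (rule exponential_site_\<nu>)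

lemma laplace_eq: "site.laplace \<beta> = mgf Q \<omega> \<beta>"
  unfolding site.laplace_def mgf_def unfolding \<nu>_def by (rule integral_distr[OF \<omega>_measurable]) auto

abbreviation logZ :: "real \<Rightarrow> real \<Rightarrow> nat \<Rightarrow> real" where
  "logZ \<beta> h \<equiv> quenched.logZ K \<nu> (site.density \<beta>) (exp h)"

abbreviation F :: "real \<Rightarrow> real \<Rightarrow> real" where
  "F \<beta> h \<equiv> free_energy P \<tau> Q \<omega> \<beta> h"

lemma quenched: "quenched K v c1 c2 \<nu> (site.density \<beta>) (exp h)"
  by (rule site.quenched_density) (rule marginal_kernel_axioms)

lemma disorder_law:
  assumes "N \<ge> 1"
  shows "distr Q (PiM {1..N} (\<lambda>_. borel)) (\<lambda>v. \<lambda>i\<in>{1..N}. \<omega> i v) = PiM {1..N} (\<lambda>_. \<nu>)"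
proof -
  have "disorder.indep_vars (\<lambda>_. borel) \<omega> {1..N}"
    by (rule disorder.indep_vars_subset[OF disorder.indep]) auto
  then have "distr Q (PiM {1..N} (\<lambda>_. borel)) (\<lambda>v. \<lambda>i\<in>{1..N}. \<omega> i v) =
      PiM {1..N} (\<lambda>i. distr Q borel (\<omega> i))"
    using assms \<omega>_measurable by (subst (asm) disorder.indep_vars_iff_distr_eq_PiM') auto
  also have "\<dots> = PiM {1..N} (\<lambda>_. \<nu>)"
    unfolding \<nu>_def by (intro PiM_cong refl disorder.identically_distributed) auto
  finally show ?thesis .
qed

lemma expectation_ln_partition_function:
  assumes "N \<ge> 1"
  shows "(\<integral>w. ln (partition_function P \<tau> Q \<omega> \<beta> h N w) \<partial>Q) = logZ \<beta> h N"
proof -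
  interpret q: quenched K v c1 c2 \<nu> "site.density \<beta>" "exp h" by (rule quenched)
  have eq: "partition_function P \<tau> Q \<omega> \<beta> h N w = q.Zq N (\<lambda>i\<in>{1..N}. \<omega> i w)" for w
    unfolding partition_function_eq[OF assms] q.Zq_def
    by (intro chain_sum_cong)
       (auto simp: site.density_def laplace_eq[symmetric] exp_add[symmetric] algebra_simps)
  have s: "sets (PiM {1..N} (\<lambda>_. \<nu>)) = sets (PiM {1..N} (\<lambda>_. borel))"
    by (intro sets_PiM_cong) auto
  have m: "(\<lambda>v. \<lambda>i\<in>{1..N}. \<omega> i v) \<in> measurable Q (PiM {1..N} (\<lambda>_. borel))"
    by (intro measurable_restrict \<omega>_measurable) auto
  have f: "(\<lambda>x. ln (q.Zq N x)) \<in> borel_measurable (PiM {1..N} (\<lambda>_. borel))"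
    using q.ln_Zq_measurable[OF assms] measurable_cong_sets[OF s refl] by blast
  show ?thesis
    unfolding eq q.logZ_def disorder_law[OF assms, symmetric] by (rule integral_distr[OF m f, symmetric])
qed

lemma free_energy_limit:
  "(\<lambda>n. logZ \<beta> h n / real n) \<longlonglongrightarrow> F \<beta> h" "0 \<le> F \<beta> h"
  "n \<ge> 1 \<Longrightarrow> logZ \<beta> h n / real n \<le> F \<beta> h"
proof -
  interpret q: quenched K v c1 c2 \<nu> "site.density \<beta>" "exp h" by (rule quenched)
  obtain l where l: "l \<ge> 0" "(\<lambda>n. q.logZ n / real n) \<longlonglongrightarrow> l" "\<forall>n\<ge>1. q.logZ n / real n \<le> l"
    using q.logZ_limit by blast
  have "(\<lambda>N. 1 / real N * (\<integral>w. ln (partition_function P \<tau> Q \<omega> \<beta> h N w) \<partial>Q)) \<longlonglongrightarrow> l"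
    by (rule Lim_transform_eventually[OF l(2)])
       (auto intro!: eventually_sequentiallyI[of 1] simp: expectation_ln_partition_function)
  then have "F \<beta> h = l" unfolding free_energy_def by (rule limI)
  then show "(\<lambda>n. logZ \<beta> h n / real n) \<longlonglongrightarrow> F \<beta> h" "0 \<le> F \<beta> h"
    "n \<ge> 1 \<Longrightarrow> logZ \<beta> h n / real n \<le> F \<beta> h" using l by auto
qed

text \<open>The supremum over the reals is meaningful only for a bounded set; the bound comes from a
  system of size 1, whose expected logarithm increases linearly in \<open>h\<close> and cannot
  exceed the free energy.\<close>

lemma critical_point_ge:
  assumes "F \<beta> h = 0" shows "h \<le> critical_point P \<tau> Q \<omega> \<beta>"
  unfolding critical_point_def
proof (rule cSup_upper)
  show "bdd_above {h. F \<beta> h = 0}"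
  proof (rule bdd_aboveI)
    fix h assume "h \<in> {h. F \<beta> h = 0}"
    interpret q: quenched K v c1 c2 \<nu> "site.density \<beta>" "exp h" by (rule quenched)
    have "ln (K 1) + ln (exp h) + (\<integral>x. ln (site.density \<beta> x) \<partial>\<nu>) \<le> q.logZ 1"
      by (rule q.logZ_lower) simp
    also have "\<dots> \<le> 0" using free_energy_limit(3)[of 1 \<beta> h] \<open>h \<in> _\<close> by simp
    finally show "h \<le> - ln (K 1) - (\<integral>x. ln (site.density \<beta> x) \<partial>\<nu>)" by simp
  qed
qed (use assms in auto)

text \<open>Without disorder and for \<open>h > 0\<close> some finite system has partition function
  above 1, hence positive free energy by superadditivity. With this upper bound, lower bounds on the
  critical point at \<open>\<beta>\<close> become bounds on the difference.\<close>

lemma critical_point_0: "critical_point P \<tau> Q \<omega> 0 \<le> 0"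
  unfolding critical_point_def
proof (rule cSup_least)
  interpret q: quenched K v c1 c2 \<nu> "site.density 0" "exp 0" by (rule quenched)
  have "F 0 0 \<le> 0"
  proof (rule LIMSEQ_le_const2[OF free_energy_limit(1)], intro exI allI impI)
    fix n :: nat assume n: "n \<ge> 1"
    show "logZ 0 0 n / real n \<le> 0" using q.logZ_upper[OF n] n by (simp add: divide_le_0_iff)
  qed
  then show "{h. F 0 h = 0} \<noteq> {}" using free_energy_limit(2)[of 0 0] by force
  fix h assume h: "h \<in> {h. F 0 h = 0}"
  show "h \<le> 0"
  proof (rule ccontr)
    assume "\<not> h \<le> 0"
    then obtain N where N: "N \<ge> 1" "chain_sum K (\<lambda>_. exp h) 0 N > 1" using pure_growth[of "exp h"] by auto
    interpret qh: quenched K v c1 c2 \<nu> "site.density 0" "exp h" by (rule quenched)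
    have d: "site.density 0 x = 1" for x
      by (simp add: site.density_def site.laplace_def site.prob_space)
    interpret PN: prob_space "PiM {1..N} (\<lambda>_. \<nu>)" by (rule qh.prob_PM)
    have "qh.logZ N = ln (chain_sum K (\<lambda>_. exp h) 0 N)"
      by (simp add: qh.logZ_def qh.Zq_def d PN.prob_space[unfolded One_nat_def])
    then have "qh.logZ N / real N > 0" using N by simp
    then show False using free_energy_limit(3)[OF N(1), of 0 h] h by simp
  qed
qed

lemma zero_free_energy:
  assumes "block_model K v c1 c2 \<nu> (site.density \<beta>) \<mu> s0 k w (exp h) \<eta> \<pi> \<Lambda> \<epsilon>"
  shows "F \<beta> h = 0"
proof -
  interpret b: block_model K v c1 c2 \<nu> "site.density \<beta>" \<mu> s0 k w "exp h" \<eta> \<pi> \<Lambda> \<epsilon> by fact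
  interpret q: quenched K v c1 c2 \<nu> "site.density \<beta>" "exp h" by (rule quenched)
  have "F \<beta> h \<le> 0"
  proof (rule q.logZ_nonpos_limit[of k "3 * (1 + \<Lambda>)"])
    show "(\<integral>\<^sup>+x. ennreal (q.Zq (m * k) x powr (9/10)) \<partial>PiM {1..m * k} (\<lambda>_. \<nu>)) \<le> ennreal (3 * (1 + \<Lambda>) * real m)"
      if "1 \<le> m" for m
      unfolding q.Zq_def by (rule b.fractional_moment_bound[OF that])
  qed (use b.k1 b.\<Lambda>1 free_energy_limit(1) in auto)
  then show ?thesis using free_energy_limit(2)[of \<beta> h] by simp
qed

text \<open>The three size conditions of \<open>block_model_exists\<close> are rewritten in the
  variable \<open>y\<close>, of which \<open>ln k\<close> is at least half. The last exponent is
  \<open>(s - 1) + s * p\<close>, from the growth of \<open>k * (v k)^2\<close> and of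
  \<open>D k ^ p\<close>.\<close>

lemma critical_point_lower_bound:
  assumes T: "T > 0" and c: "c > 0" and s: "s > 0" and r: "s * real (Suc p) - 1 \<ge> 0"
    and growth: "\<And>k. k \<ge> k0 \<Longrightarrow> c * ln (real k) powr s \<le> D k \<and> c * ln (real k) powr (s - 1) \<le> real k * (v k)\<^sup>2"
  shows "\<exists>A. \<forall>\<beta> y. 0 < \<beta> \<longrightarrow> \<beta> \<le> T \<longrightarrow> A \<le> y \<longrightarrow> A \<le> y powr s \<longrightarrow> A \<le> \<beta>\<^sup>2 * y powr s \<longrightarrow>
    A \<le> \<beta> ^ (2 * Suc p) * y powr (s * real (Suc p) - 1) \<longrightarrow> exp (- y) \<le> critical_point P \<tau> Q \<omega> \<beta>"
proof -
  define q where "q = Suc p"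
  define r where "r = s * real q - 1"
  obtain c0 s0 where c0: "c0 > 0" and s0: "s0 \<ge> 1"
    and site: "\<And>t. 0 < t \<Longrightarrow> t \<le> T \<Longrightarrow> \<exists>\<mu>\<ge>c0 * t. tilted_site \<nu> (site.density t) \<mu> s0"
    using site.tilted_site_density[OF T] by blast
  obtain w \<eta> \<pi> \<Lambda> \<epsilon> A0 where block: "\<And>k e \<mu> H. tilted_site \<nu> e \<mu> s0 \<Longrightarrow> A0 \<le> D k \<Longrightarrow> A0 \<le> \<mu>\<^sup>2 * D k \<Longrightarrow>
    A0 \<le> \<mu> ^ (2 * q) * (real k * (v k)\<^sup>2 * D k ^ p) \<Longrightarrow> 1 \<le> H \<Longrightarrow> H ^ k \<le> 3 \<Longrightarrow>
    block_model K v c1 c2 \<nu> e \<mu> s0 k (w k) H \<eta> \<pi> \<Lambda> \<epsilon>"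
    using block_model_exists[OF s0, of p] unfolding q_def by blast
  define C1 where "C1 = c / 2 powr s"
  define C2 where "C2 = c0\<^sup>2 * C1"
  define C3 where "C3 = c0 ^ (2 * q) * (c ^ q / 2 powr r)"
  have C: "C1 > 0" "C2 > 0" "C3 > 0" using c c0 by (auto simp: C1_def C2_def C3_def)
  \<comment> \<open>The entry 4 makes rounding harmless, \<open>2 * k0\<close> gives
    \<open>k \<ge> k0\<close> via \<open>exp (y / 2) \<ge> 1 + y / 2\<close>, and the quotients
    absorb the constants in front of the three conditions.\<close>
  define A where "A = Max {4, 2 * real k0, A0 / C1, A0 / C2, A0 / C3}"
  have A: "4 \<le> A" "2 * real k0 \<le> A" "A0 / C1 \<le> A" "A0 / C2 \<le> A" "A0 / C3 \<le> A"
    unfolding A_def by (auto intro!: Max_ge)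
  have "exp (- y) \<le> critical_point P \<tau> Q \<omega> \<beta>"
    if \<beta>: "0 < \<beta>" "\<beta> \<le> T" and y: "A \<le> y" "A \<le> y powr s" "A \<le> \<beta>\<^sup>2 * y powr s" "A \<le> \<beta> ^ (2 * q) * y powr r" for \<beta> y
  proof -
    \<comment> \<open>Rounding down gives \<open>1 / k \<ge> exp (- y)\<close>, the direction needed
      for the bound, and \<open>k \<ge> exp (y / 2)\<close> keeps
      \<open>ln k \<ge> y / 2\<close>.\<close>
    define k where "k = nat \<lfloor>exp y\<rfloor>"
    have y4: "y \<ge> 4" using A y by linarith
    have ku: "real k \<le> exp y" by (simp add: k_def)
    have "exp y - 1 \<le> real k" unfolding k_def by linarith
    moreover have h: "1 + y / 2 \<le> exp (y / 2)" by (rule exp_ge_add_one_self)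
    moreover have "2 \<le> exp (y / 2)" using h y4 by linarith
    then have "2 * exp (y / 2) \<le> exp (y / 2) * exp (y / 2)" by (intro mult_right_mono) auto
    then have "2 * exp (y / 2) \<le> exp y" by (simp add: exp_add[symmetric])
    ultimately have kl: "exp (y / 2) \<le> real k" using y4 by linarith
    have kk: "k \<ge> k0" "k \<ge> 1" using kl h A y y4 by linarith+
    let ?x = "ln (real k)"
    have x: "y / 2 \<le> ?x" using kl kk by (subst ln_ge_iff) auto
    have x0: "?x > 0" using x y4 by linarith
    have xs: "y powr s / 2 powr s \<le> ?x powr s"
      using x y4 s by (subst powr_divide[symmetric]) (auto intro!: powr_mono2)
    have xr: "y powr r / 2 powr r \<le> ?x powr r"
      using x y4 assms(4) by (subst powr_divide[symmetric]) (auto intro!: powr_mono2 simp: r_def q_def)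
    obtain \<mu> where \<mu>: "c0 * \<beta> \<le> \<mu>" "tilted_site \<nu> (site.density \<beta>) \<mu> s0" using site[OF \<beta>] by blast
    have D1: "C1 * y powr s \<le> D k"
    proof -
      have "C1 * y powr s = c * (y powr s / 2 powr s)" by (simp add: C1_def)
      also have "\<dots> \<le> c * ?x powr s" using c by (intro mult_left_mono xs) auto
      also have "\<dots> \<le> D k" using growth[OF kk(1)] by simp
      finally show ?thesis .
    qed
    have "A0 \<le> C1 * A" using A C by (simp add: pos_divide_le_eq mult.commute)
    also have "\<dots> \<le> C1 * y powr s" using y C by (intro mult_left_mono) auto
    finally have b1: "A0 \<le> D k" using D1 by linarith
    have "A0 \<le> C2 * A" using A C by (simp add: pos_divide_le_eq mult.commute)
    also have "\<dots> \<le> C2 * (\<beta>\<^sup>2 * y powr s)" using y C by (intro mult_left_mono) auto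
    also have "\<dots> = (c0 * \<beta>)\<^sup>2 * (C1 * y powr s)" by (simp add: C2_def power_mult_distrib)
    also have "\<dots> \<le> \<mu>\<^sup>2 * D k"
      using \<mu> c0 \<beta> C by (intro mult_mono power_mono D1) auto
    finally have b2: "A0 \<le> \<mu>\<^sup>2 * D k" .
    have "A0 \<le> C3 * A" using A C by (simp add: pos_divide_le_eq mult.commute)
    also have "\<dots> \<le> C3 * (\<beta> ^ (2 * q) * y powr r)" using y C by (intro mult_left_mono) auto
    also have "\<dots> = (c0 * \<beta>) ^ (2 * q) * (c ^ q * (y powr r / 2 powr r))"
      by (simp add: C3_def power_mult_distrib)
    also have "\<dots> \<le> \<mu> ^ (2 * q) * (real k * (v k)\<^sup>2 * D k ^ p)"
    proof (rule mult_mono)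
      show "(c0 * \<beta>) ^ (2 * q) \<le> \<mu> ^ (2 * q)" using \<mu>(1) c0 \<beta> by (intro power_mono) auto
      show "0 \<le> \<mu> ^ (2 * q)" by simp
      show "0 \<le> c ^ q * (y powr r / 2 powr r)" using c by simp
      have "c ^ q * (y powr r / 2 powr r) \<le> c ^ q * ?x powr r" using c by (intro mult_left_mono xr) auto
      also have "\<dots> = (c * ?x powr (s - 1)) * (c * ?x powr s) ^ p"
      proof -
        have "r = (s - 1) + s * real p" by (simp add: r_def q_def algebra_simps)
        then have "?x powr r = ?x powr (s - 1) * (?x powr s) ^ p"
          using x0 by (simp add: powr_add powr_powr[symmetric] powr_realpow)
        then show ?thesis by (simp add: q_def power_mult_distrib)
      qed
      also have "\<dots> \<le> (real k * (v k)\<^sup>2) * D k ^ p"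
        using c
        by (intro mult_mono[OF conjunct2[OF growth[OF kk(1)]] power_mono[OF conjunct1[OF growth[OF kk(1)]]]]) auto
      finally show "c ^ q * (y powr r / 2 powr r) \<le> real k * (v k)\<^sup>2 * D k ^ p" .
    qed
    finally have b3: "A0 \<le> \<mu> ^ (2 * q) * (real k * (v k)\<^sup>2 * D k ^ p)" .
    have "exp (1 / real k) ^ k = exp 1" using kk by (subst exp_of_nat_mult[symmetric]) simp
    then have "exp (1 / real k) ^ k \<le> 3" using exp_le by simp
    then have "F \<beta> (1 / real k) = 0"
      using block[OF \<mu>(2) b1 b2 b3, of "exp (1 / real k)"] by (intro zero_free_energy) auto
    then have "1 / real k \<le> critical_point P \<tau> Q \<omega> \<beta>" by (rule critical_point_ge)
    moreover have "exp (- y) \<le> 1 / real k" using ku kk by (simp add: exp_minus field_simps)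
    ultimately show ?thesis by linarith
  qed
  then show ?thesis unfolding q_def r_def by blast
qed

end

lemma eventually_le_powr_at_top:
  fixes r A :: real assumes "r > 0"
  shows "eventually (\<lambda>y. A \<le> y powr r) at_top"
proof -
  have "filterlim (\<lambda>y::real. exp (r * ln y)) at_top at_top"
    by (intro filterlim_compose[OF exp_at_top] filterlim_tendsto_pos_mult_at_top[OF tendsto_const assms] ln_at_top)
  then have "eventually (\<lambda>y::real. A \<le> exp (r * ln y)) at_top" by (simp add: filterlim_at_top)
  then show ?thesis using eventually_gt_at_top[of 0] by eventually_elim (simp add: powr_def)
qed

theorem corollary1p8:
  fixes L :: "real \<Rightarrow> real" and \<b> :: real
    and P :: "'r measure" and \<tau> :: "nat \<Rightarrow> 'r \<Rightarrow> nat"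
    and Q :: "'w measure" and \<omega> :: "nat \<Rightarrow> 'w \<Rightarrow> real"
  assumes "slowly_varying L"
    and "smooth_on_pos L"
    and "logarithmic_type L \<b>"
    and "\<b> < 1 / 2"
    and "renewal_process P \<tau> (inter_arrival_law L (1 / 2))"
    and "disorder Q \<omega>"
  shows "(\<forall>\<beta>>0. critical_point P \<tau> Q \<omega> \<beta> > critical_point P \<tau> Q \<omega> 0) \<and>
    (\<forall>b > 2 / (1 - 2 * \<b>). \<exists>c>0. \<forall>\<^sub>F \<beta> in at_right 0.
       critical_point P \<tau> Q \<omega> \<beta> - critical_point P \<tau> Q \<omega> 0 \<ge> exp (- c * \<beta> powr (- b)))"
proof -
  define K where "K = inter_arrival_law L (1 / 2)"
  define s where "s = 1 - 2 * \<b>"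
  have s: "s > 0" using assms(4) by (simp add: s_def)
  have Lpos: "L x > 0" if "x > 0" for x using assms(1) that by (auto simp: slowly_varying_def)
  obtain c1 c2 where mk: "marginal_kernel K (log_weight \<b>) c1 c2"
    using marginal_kernel_logarithmic[OF Lpos assms(3) renewal_process.law_sums[OF assms(5)]] unfolding K_def by blast
  interpret R: pinning P \<tau> K "log_weight \<b>" c1 c2 Q \<omega>
    using assms(5) unfolding K_def[symmetric]
    by (intro pinning.intro marginal_renewal.intro mk assms(6))
  obtain c k0 where c: "c > 0" and growth: "\<And>k. k \<ge> k0 \<Longrightarrow>
      c * ln (real k) powr s \<le> R.D k \<and> c * ln (real k) powr (s - 1) \<le> real k * (log_weight \<b> k)\<^sup>2"
    using log_weight_growth[of \<b>] unfolding R.D_def s_def by auto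
  note lower = R.critical_point_lower_bound[OF _ c s _ growth]
  have "critical_point P \<tau> Q \<omega> \<beta> > critical_point P \<tau> Q \<omega> 0" if \<beta>: "\<beta> > 0" for \<beta>
  proof -
    \<comment> \<open>For fixed \<open>\<beta>\<close> all conditions hold for large
      \<open>y\<close> once the exponent \<open>s * (p + 1) - 1\<close> is positive; no rate is
      required here.\<close>
    obtain p :: nat where p: "1 / s < real p" using reals_Archimedean2 by blast
    have r: "s * real (Suc p) - 1 > 0"
    proof -
      have "s * (1 / s) < s * real (Suc p)" using p s by (intro mult_strict_left_mono) auto
      then show ?thesis using s by simp
    qed
    obtain A where A: "\<And>y. A \<le> y \<Longrightarrow> A \<le> y powr s \<Longrightarrow> A \<le> \<beta>\<^sup>2 * y powr s \<Longrightarrow>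
        A \<le> \<beta> ^ (2 * Suc p) * y powr (s * real (Suc p) - 1) \<Longrightarrow> exp (- y) \<le> critical_point P \<tau> Q \<omega> \<beta>"
      using lower[OF \<beta>, of p] r \<beta> by (meson less_imp_le order_refl)
    have "eventually (\<lambda>y. A \<le> y \<and> A \<le> y powr s \<and> A / \<beta>\<^sup>2 \<le> y powr s \<and>
        A / \<beta> ^ (2 * Suc p) \<le> y powr (s * real (Suc p) - 1)) at_top"
      by (intro eventually_conj eventually_ge_at_top eventually_le_powr_at_top s r)
    then obtain y where y: "A \<le> y" "A \<le> y powr s" "A / \<beta>\<^sup>2 \<le> y powr s"
        "A / \<beta> ^ (2 * Suc p) \<le> y powr (s * real (Suc p) - 1)"
      using eventually_happens by fastforce
    have "exp (- y) \<le> critical_point P \<tau> Q \<omega> \<beta>"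
    proof (rule A[OF y(1,2)])
      show "A \<le> \<beta>\<^sup>2 * y powr s" using y(3) \<beta> by (simp add: pos_divide_le_eq mult.commute)
      have "\<beta> ^ (2 * Suc p) > 0" using \<beta> by (rule zero_less_power)
      then show "A \<le> \<beta> ^ (2 * Suc p) * y powr (s * real (Suc p) - 1)"
        using y(4) by (simp only: pos_divide_le_eq mult.commute)
    qed
    then have "0 < critical_point P \<tau> Q \<omega> \<beta>" by (rule less_le_trans[OF exp_gt_zero])
    then show ?thesis using R.critical_point_0 by linarith
  qed
  moreover have "\<exists>c>0. \<forall>\<^sub>F \<beta> in at_right 0.
       critical_point P \<tau> Q \<omega> \<beta> - critical_point P \<tau> Q \<omega> 0 \<ge> exp (- c * \<beta> powr (- b))"
    if b: "b > 2 / (1 - 2 * \<b>)" for b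
  proof -
    have bs: "b * s - 2 > 0" using b s by (simp add: s_def[symmetric] pos_divide_less_eq)
    have b0: "b > 0" using b s by (simp add: s_def[symmetric]) (meson divide_pos_pos less_trans zero_less_numeral)
    \<comment> \<open>With \<open>\<beta> = y^(-1/b)\<close> the last condition has exponent
      \<open>s * q - 1 - 2 * q / b\<close>, which is positive iff
      \<open>q * (b * s - 2) > b\<close>. Such \<open>q\<close> exist exactly because
      \<open>b > 2 / s\<close>.\<close>
    obtain p :: nat where p: "b / (b * s - 2) < real p" using reals_Archimedean2 by blast
    define q where "q = Suc p"
    have q: "b < real q * (b * s - 2)"
    proof -
      have "b / (b * s - 2) < real q" using p by (simp add: q_def)
      then show ?thesis using bs by (simp add: pos_divide_less_eq)
    qed
    have r2: "s * real q - 1 - 2 * real q / b > 0"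
    proof -
      have "0 < (real q * (b * s - 2) - b) / b" using q b0 by simp
      also have "\<dots> = s * real q - 1 - 2 * real q / b" using b0 by (simp add: field_simps)
      finally show ?thesis .
    qed
    have r1: "s - 2 / b > 0"
    proof -
      have "0 < (b * s - 2) / b" using bs b0 by simp
      also have "\<dots> = s - 2 / b" using b0 by (simp add: field_simps)
      finally show ?thesis .
    qed
    have "0 \<le> 2 * real q / b" using b0 by simp
    then have r: "s * real (Suc p) - 1 \<ge> 0" using r2 unfolding q_def by linarith
    obtain A where A: "\<And>\<beta> y. 0 < \<beta> \<Longrightarrow> \<beta> \<le> 1 \<Longrightarrow> A \<le> y \<Longrightarrow> A \<le> y powr s \<Longrightarrow> A \<le> \<beta>\<^sup>2 * y powr s \<Longrightarrow>
        A \<le> \<beta> ^ (2 * q) * y powr (s * real q - 1) \<Longrightarrow> exp (- y) \<le> critical_point P \<tau> Q \<omega> \<beta>"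
      using lower[OF zero_less_one r] unfolding q_def by blast
    have "eventually (\<lambda>y. A \<le> y \<and> A \<le> y powr s \<and> A \<le> y powr (s - 2 / b) \<and>
        A \<le> y powr (s * real q - 1 - 2 * real q / b)) at_top"
      by (intro eventually_conj eventually_ge_at_top eventually_le_powr_at_top s r1 r2)
    then obtain Y where Y: "\<And>y. Y \<le> y \<Longrightarrow> A \<le> y \<and> A \<le> y powr s \<and> A \<le> y powr (s - 2 / b) \<and>
        A \<le> y powr (s * real q - 1 - 2 * real q / b)"
      by (auto simp: eventually_at_top_linorder)
    define Y' where "Y' = max Y 1"
    have Y': "Y' \<ge> 1" "Y' \<ge> Y" by (auto simp: Y'_def)
    \<comment> \<open>Chosen so that \<open>\<beta> < d\<close> gives
      \<open>\<beta>^(-b) \<ge> Y'\<close>; the maximum with 1 in \<open>Y'\<close> also ensures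
      \<open>d \<le> 1\<close>, the range where \<open>A\<close> was obtained.\<close>
    define d where "d = Y' powr (- 1 / b)"
    have "d > 0" using Y' by (simp add: d_def)
    have d1: "d \<le> 1"
    proof -
      have "d \<le> Y' powr 0" unfolding d_def using Y' b0 by (intro powr_mono) auto
      then show ?thesis using Y' by simp
    qed
    have "exp (- 1 * \<beta> powr (- b)) \<le> critical_point P \<tau> Q \<omega> \<beta> - critical_point P \<tau> Q \<omega> 0"
      if \<beta>: "0 < \<beta>" "\<beta> < d" for \<beta>
    proof -
      define y where "y = \<beta> powr (- b)"
      have "d powr (- b) \<le> y" unfolding y_def using \<beta> b0 by (intro powr_mono2') auto
      moreover have "d powr (- b) = Y'" using b0 Y' by (simp add: d_def powr_powr)
      ultimately have "Y \<le> y" using Y' by linarith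
      note Yy = Y[OF this]
      have \<beta>y: "\<beta> = y powr (- 1 / b)" using b0 \<beta> by (simp add: y_def powr_powr)
      have y0: "y > 0" using \<beta> by (simp add: y_def)
      have pw: "\<beta> ^ n = y powr (- (real n / b))" for n
        unfolding \<beta>y using y0 by (simp add: powr_realpow[symmetric] powr_powr del: powr_realpow)
      have "exp (- y) \<le> critical_point P \<tau> Q \<omega> \<beta>"
      proof (rule A)
        show "A \<le> \<beta>\<^sup>2 * y powr s"
          unfolding pw using Yy by (simp add: powr_add[symmetric])
        show "A \<le> \<beta> ^ (2 * q) * y powr (s * real q - 1)"
          unfolding pw using Yy by (simp add: powr_add[symmetric] algebra_simps)
      qed (use \<beta> d1 Yy in auto)
      then show ?thesis using R.critical_point_0 by (simp add: y_def)
    qed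
    \<comment> \<open>The constant 1 suffices: since the exponents of \<open>y\<close> are strictly
      positive, all constants have been absorbed by making \<open>\<beta>\<close> small.\<close>
    then show ?thesis
      using \<open>d > 0\<close> by (intro exI[of _ 1] conjI zero_less_one) (auto simp: eventually_at_right_field)
  qed
  ultimately show ?thesis by blast
qed

end
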